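(* $|\mathrm{Sk}|=\varepsilon_0$.
   Context: $\mathrm{Sk}$ (the Skolem functions) is the smallest set of germs at $+\infty$ of positive real functions containing the constant $1$ and the identity $x$ and closed under addition, multiplication and exponentiation $(f,g)\mapsto f^g$. Germs are compared by eventual order: $f<g$ means $f(x)<g(x)$ for all sufficiently large $x$; functions that agree eventually are identified. It is known that this is a well-order on $\mathrm{Sk}$. $|\mathrm{Sk}|$ denotes the order type (not cardinality) of $\mathrm{Sk}$ under this order. $\varepsilon_0$ is the least ordinal $\alpha$ with $\omega^\alpha=\alpha$. *)

theory Defs
  imports Complex_Main
begin

unbundle cardinal_syntax

section \<open>Germs at $+\infty$\<close>

quotient_type germ = "real \<Rightarrow> real" / "\<lambda>f g. \<forall>\<^sub>F x in at_top. f x = g x"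
proof (rule equivpI)
  show "transp (\<lambda>f g :: real \<Rightarrow> real. \<forall>\<^sub>F x in at_top. f x = g x)"
  proof (rule transpI)
    fix f g h :: "real \<Rightarrow> real"
    assume "\<forall>\<^sub>F x in at_top. f x = g x" "\<forall>\<^sub>F x in at_top. g x = h x"
    then show "\<forall>\<^sub>F x in at_top. f x = h x" by eventually_elim simp
  qed
qed (auto simp: reflp_def symp_def eq_commute)

instantiation germ :: "{zero, one, plus, times, order}"
begin

lift_definition zero_germ :: germ is "\<lambda>_. 0" .
lift_definition one_germ :: germ is "\<lambda>_. 1" .

lift_definition plus_germ :: "germ \<Rightarrow> germ \<Rightarrow> germ" is "\<lambda>f g x. f x + g x"
  by (erule (1) eventually_elim2, simp)

lift_definition times_germ :: "germ \<Rightarrow> germ \<Rightarrow> germ" is "\<lambda>f g x. f x * g x"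
  by (erule (1) eventually_elim2, simp)

lift_definition less_germ :: "germ \<Rightarrow> germ \<Rightarrow> bool"
  is "\<lambda>f g. \<forall>\<^sub>F x in at_top. f x < g x"
proof -
  fix f f' g g' :: "real \<Rightarrow> real"
  assume "\<forall>\<^sub>F x in at_top. f x = f' x" "\<forall>\<^sub>F x in at_top. g x = g' x"
  then have "\<forall>\<^sub>F x in at_top. f x < g x \<longleftrightarrow> f' x < g' x"
    by eventually_elim simp
  then show "(\<forall>\<^sub>F x in at_top. f x < g x) = (\<forall>\<^sub>F x in at_top. f' x < g' x)"
    by (rule eventually_subst)
qed

(* The reflexive closure of the eventual strict order; for arbitrary germs this is
   finer than the eventual inequality of the representatives. *)
definition less_eq_germ :: "germ \<Rightarrow> germ \<Rightarrow> bool" where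
  "less_eq_germ f g \<longleftrightarrow> f < g \<or> f = g"

instance
proof
  have trans: "f < h" if "f < g" "g < h" for f g h :: germ
    using that by transfer (erule (1) eventually_elim2, simp)
  have irrefl: "\<not> f < f" for f :: germ
    by transfer simp
  fix f g h :: germ
  show "f < g \<longleftrightarrow> f \<le> g \<and> \<not> g \<le> f"
    unfolding less_eq_germ_def using trans irrefl by metis
  show "f \<le> f"
    by (simp add: less_eq_germ_def)
  show "f \<le> g \<Longrightarrow> g \<le> h \<Longrightarrow> f \<le> h"
    unfolding less_eq_germ_def using trans by metis
  show "f \<le> g \<Longrightarrow> g \<le> f \<Longrightarrow> f = g"
    unfolding less_eq_germ_def using trans irrefl by metis
qed

end

lift_definition germ_id :: germ is "\<lambda>x. x" .

lift_definition germ_powr :: "germ \<Rightarrow> germ \<Rightarrow> germ" is "\<lambda>f g x. f x powr g x"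
  by (erule (1) eventually_elim2, simp)


section \<open>The Skolem functions\<close>

inductive_set Sk :: "germ set" where
  one: "1 \<in> Sk"
| ident: "germ_id \<in> Sk"
| add: "f \<in> Sk \<Longrightarrow> g \<in> Sk \<Longrightarrow> f + g \<in> Sk"
| mult: "f \<in> Sk \<Longrightarrow> g \<in> Sk \<Longrightarrow> f * g \<in> Sk"
| power: "f \<in> Sk \<Longrightarrow> g \<in> Sk \<Longrightarrow> germ_powr f g \<in> Sk"

(* Positivity is not built into Sk but follows; hence powr is applied to positive bases only. *)
lemma Sk_pos: "f \<in> Sk \<Longrightarrow> 0 < f"
proof (induction rule: Sk.induct)
  case one
  show ?case by transfer simp
next
  case ident
  show ?case by transfer (rule eventually_gt_at_top)
next
  case (add f g)
  from add.IH show ?case by transfer (erule (1) eventually_elim2, simp)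
next
  case (mult f g)
  from mult.IH show ?case by transfer (erule (1) eventually_elim2, simp)
next
  case (power f g)
  from power.IH(1) show ?case by transfer (erule eventually_mono, simp)
qed

definition Sk_order :: "germ rel" where
  "Sk_order = {(f, g). f \<in> Sk \<and> g \<in> Sk \<and> f \<le> g}"


section \<open>The ordinal $\varepsilon_0$\<close>

text \<open>
  Ordinals are represented by (reflexive) well-order relations up to \<^const>\<open>ordIso\<close>.
  If \<open>r\<close> represents \<open>\<alpha>\<close>, then \<open>\<omega>\<^sup>\<alpha>\<close> is represented by the finitely supported functions
  from the field of \<open>r\<close> to the natural numbers, two distinct such functions being compared at
  the largest argument where they differ; this is \<open>\<omega>\<^bsup>a1\<^esup> * n1 + ... + \<omega>\<^bsup>ak\<^esup> * nk\<close> with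
  \<open>a1 > ... > ak\<close> (Cantor normal form) encoded by the function sending each \<open>ai\<close> to \<open>ni\<close>.
\<close>

definition omega_exp :: "'a rel \<Rightarrow> ('a \<Rightarrow> nat) rel" where
  "omega_exp r =
    (let F = {f. finite {a. f a \<noteq> 0} \<and> {a. f a \<noteq> 0} \<subseteq> Field r}
     in {(f, g). f \<in> F \<and> g \<in> F \<and>
          (f = g \<or> (\<exists>a \<in> Field r. f a < g a \<and> (\<forall>b. (a, b) \<in> r \<and> b \<noteq> a \<longrightarrow> f b = g b)))})"

(* Minimality only quantifies over relations on the same type; this is no restriction, since
   every ordinal smaller than that of r is represented by an initial segment of r. *)
definition is_epsilon_0 :: "'a rel \<Rightarrow> bool" where
  "is_epsilon_0 r \<longleftrightarrow>
     Well_order r \<and> omega_exp r =o r \<and>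
     (\<forall>s :: 'a rel. Well_order s \<and> omega_exp s =o s \<longrightarrow> r \<le>o s)"

end

theory Submission
  imports Defs "HOL-Analysis.Analysis" "HOL-Library.Multiset_Order"
begin

text \<open>
  Two facts make the order type of the Skolem functions equal to \<open>\<epsilon>\<^sub>0\<close>:
  it is a fixed point of \<open>\<alpha> \<mapsto> \<omega>\<^sup>\<alpha>\<close>, and it is not
  larger than the least one.

  The fixed point property is elementary. A Skolem function takes positive integer values at
  positive integers, so \<open>a < b\<close> implies \<open>a + 1 \<le> b\<close>. Hence a finitely
  supported function \<open>f\<close> on the Skolem functions can be sent, strictly monotonically,
  to the Skolem function \<open>1 + (\<Sum>a. f a * x\<^sup>a)\<close>; in the other direction
  \<open>a\<close> goes to its indicator function.

  The upper bound needs a strictly increasing map from the Skolem functions to the ordinals below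
  \<open>\<epsilon>\<^sub>0\<close>, which are represented by the hereditary finite multisets of
  type \<open>ord\<close> (natural sums of powers of \<open>\<omega>\<close>). Any \<open>s\<close>
  with \<open>\<omega>\<^sup>s = s\<close> receives a strictly increasing map from
  \<open>ord\<close> by recursion on the normal form (\<open>realize_strict_mono\<close>), so the
  composition shows that the order type is at most \<open>s\<close>. The same map to
  \<open>ord\<close> also yields that the Skolem functions are well-ordered.

  To build it, let \<open>G\<close> be a set of Skolem functions that is closed under multiplication
  and whose order type is already bounded, and let \<open>S\<close> be the closure of \<open>{1,
  x}\<close> under addition, multiplication and powers with exponents in \<open>G\<close>. An
  element of \<open>S\<close> is a finite sum of finite products of factors \<open>p\<^sup>q\<close>
  with \<open>q \<in> G\<close>, and \<open>ln (p\<^sup>q) = q * ln p\<close>. Every \<open>ln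
  f\<close> with \<open>f \<in> S\<close>, \<open>f \<noteq> 1\<close> is bounded above and below by
  constant multiples of some \<open>q\<close> or \<open>q * ln x\<close> with \<open>q \<in>
  G\<close> (\<open>S_has_level\<close>), so the magnitudes of the logarithms have bounded order
  type too. By induction on this magnitude, the logarithms of smaller elements bound the logarithms
  of factors, whose finite sums are the logarithms of products, and products bound sums. Finite sums
  of positive elements are handled by a general theorem on ordered fields
  (\<open>ot_le_sums\<close>).

  The induction has to carry more than an order type, because taking logarithms shrinks differences:
  one bounds the type of \<open>{a. \<bar>a - z\<bar> \<le> e * u\<^sup>n for some n}\<close> when
  differences in \<open>O(e)\<close> are neglected, uniformly in \<open>z\<close> and in the
  quotients \<open>e\<close> of Skolem functions (\<open>locally\<close>). The width
  \<open>u\<close> runs through the tower \<open>ln x\<close>, \<open>x\<close>,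
  \<open>x\<^sup>x\<close>, \<open>\<dots>\<close>: passing to logarithms leads from a window of one
  width to a window of the preceding width, and windows of the first width are harmless because of a
  gap: if \<open>g / f\<close> is at most a power of \<open>ln x\<close>, then it is bounded.
  Starting with the positive integers, \<open>N\<close> closure steps give all Skolem functions
  below the \<open>N\<close>-th tower function, so every initial segment has bounded type.

  This argument takes place in an ordered field that contains the Skolem functions and their
  logarithms. It consists of germs of absolutely convergent series \<open>\<Sum>i. c\<^sub>i * exp
  e\<^sub>i\<close> whose exponents lie in an ordered group generated, level by level, by \<open>ln
  (ln x)\<close> and the purely infinite series over the group constructed before. Convergence turns
  formal computations with such series into statements on germs: a nonzero series is asymptotic to
  its leading term (\<open>leading\<close>), so the germs are totally ordered and have inverses,
  exponentials, and logarithms when they are Skolem functions. Nonzero exponents are at least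
  \<open>ln (ln x)\<close> in absolute value, so a positive series is either bounded or at least a
  constant multiple of \<open>ln x\<close>; applied to \<open>g / f\<close> and to its logarithm,
  this is the gap.
\<close>

section \<open>Ordinals below \<open>\<epsilon>\<^sub>0\<close> as hereditary multisets\<close>

text \<open>
  \<open>Ord {#a\<^sub>1, \<dots>, a\<^sub>n#}\<close> stands for the natural (Hessenberg) sum of
  \<open>\<omega>\<close> to the powers \<open>a\<^sub>i\<close>, that is, for a Cantor normal form
  whose exponents are again such ordinals. Addition of multisets is the natural sum, which, unlike
  the ordinary one, is commutative and strictly monotone in both arguments.
\<close>
datatype ord = Ord "ord multiset"

primrec exponents :: "ord \<Rightarrow> ord multiset" where
  "exponents (Ord M) = M"

lemma Ord_exponents [simp]: "Ord (exponents a) = a"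
  by (cases a) simp

text \<open>
  Comparing normal forms lexicographically from the largest exponent on is the multiset extension of
  the order of the exponents.
\<close>
inductive ord_less :: "ord \<Rightarrow> ord \<Rightarrow> bool" where
  "multp ord_less M N \<Longrightarrow> ord_less (Ord M) (Ord N)"

lemma ord_less_iff: "ord_less a b \<longleftrightarrow> multp ord_less (exponents a) (exponents b)"
  by (metis Ord_exponents exponents.simps ord_less.simps)

lemma exponents_mem_size: "b \<in># exponents a \<Longrightarrow> size b < size a"
  by (cases a) (auto dest!: multi_member_split)

lemma transp_ord_less: "transp ord_less"
proof (rule transpI)
  fix a b c assume "ord_less a b" "ord_less b c"
  then have "multp ord_less (exponents a) (exponents b)" "multp ord_less (exponents b) (exponents c)"
    using ord_less_iff by blast+
  then have "multp ord_less (exponents a) (exponents c)"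
    unfolding multp_def mult_def by (meson trancl_trans)
  then show "ord_less a c" by (simp add: ord_less_iff)
qed

text \<open>
  The multiset extension is known to be total only over a set on which the given relation is total,
  hence the induction on the size.
\<close>
lemma totalp_on_ord_less: "totalp_on {a. size a < n} ord_less"
proof (induction n)
  case 0
  show ?case by (simp add: totalp_on_def)
next
  case (Suc n)
  have "totalp_on {M. set_mset M \<subseteq> {a. size a < n}} (multp ord_less)"
    by (rule totalp_on_multp[OF Suc transp_ord_less]) auto
  moreover have sub: "set_mset (exponents a) \<subseteq> {a. size a < n}" if "size a < Suc n" for a
    using that exponents_mem_size[of _ a] by fastforce
  ultimately have *: "multp ord_less (exponents a) (exponents b) \<or> multp ord_less (exponents b) (exponents a)"
    if "size a < Suc n" "size b < Suc n" "exponents a \<noteq> exponents b" for a b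
    using that by (intro totalp_onD) auto
  show ?case
  proof (rule totalp_onI)
    fix a b :: ord assume "a \<in> {a. size a < Suc n}" "b \<in> {a. size a < Suc n}" "a \<noteq> b"
    moreover from \<open>a \<noteq> b\<close> have "exponents a \<noteq> exponents b" by (metis Ord_exponents)
    ultimately show "ord_less a b \<or> ord_less b a"
      using *[of a b] ord_less_iff[of a b] ord_less_iff[of b a] by simp
  qed
qed

text \<open>
  Restricted to its accessible part \<open>A\<close> the relation is well-founded, and so is the
  multiset extension of this restriction. Descending from a multiset over \<open>A\<close> never
  leaves the multisets over \<open>A\<close>, so \<open>Ord M\<close> is accessible as soon as all
  elements of \<open>M\<close> are, and structural induction makes everything accessible.
\<close>
lemma wfp_ord_less: "wfp ord_less"
proof -
  define r where "r = {(x, y). ord_less x y}"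
  define A where "A = Wellfounded.acc r"
  define r' where "r' = {(x, y) \<in> r. x \<in> A \<and> y \<in> A}"
  have down: "x \<in> A" if "(x, y) \<in> r" "y \<in> A" for x y
    using that unfolding A_def by (meson acc_downward)
  have "wf r'"
  proof (rule wfUNIVI)
    fix P x assume P: "\<forall>x. (\<forall>y. (y, x) \<in> r' \<longrightarrow> P y) \<longrightarrow> P x"
    have "P x" if "x \<in> A" for x
      using that unfolding A_def
    proof (induction rule: acc.induct)
      case (accI x)
      then show ?case using P down unfolding r'_def A_def by blast
    qed
    moreover have "P x" if "x \<notin> A" using P that unfolding r'_def by blast
    ultimately show "P x" by blast
  qed
  then have wf: "wf (mult r')" by (rule wf_mult)
  have mult: "set_mset N \<subseteq> A \<and> (N, M) \<in> mult r'" if "(N, M) \<in> mult r" "set_mset M \<subseteq> A" for M N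
  proof -
    have step0: "set_mset N \<subseteq> A \<and> (N, M) \<in> mult1 r'" if "(N, M) \<in> mult1 r" "set_mset M \<subseteq> A" for M N
    proof -
      from that obtain a M0 K where *: "M = add_mset a M0" "N = M0 + K" "\<forall>b. b \<in># K \<longrightarrow> (b, a) \<in> r"
        unfolding mult1_def by auto
      then have "a \<in> A" "\<forall>b. b \<in># K \<longrightarrow> b \<in> A" using that(2) down by auto
      then have "\<forall>b. b \<in># K \<longrightarrow> (b, a) \<in> r'" using *(3) by (auto simp: r'_def)
      with * \<open>\<forall>b. b \<in># K \<longrightarrow> b \<in> A\<close> that(2) show ?thesis
        unfolding mult1_def by auto
    qed
    from that(1)[unfolded mult_def] that(2) show ?thesis
    proof (induction rule: converse_trancl_induct)
      case (base y)
      then show ?case using step0[of y M] unfolding mult_def by blast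
    next
      case (step y z)
      then have z: "set_mset z \<subseteq> A \<and> (z, M) \<in> mult r'" by blast
      with step0[OF step.hyps(1)] show ?case
        unfolding mult_def by (meson trancl_into_trancl2)
    qed
  qed
  have *: "set_mset M \<subseteq> A \<longrightarrow> Ord M \<in> A" for M
  proof (rule wf_induct[OF wf, of "\<lambda>M. set_mset M \<subseteq> A \<longrightarrow> Ord M \<in> A"], intro impI)
    fix M assume IH: "\<forall>N. (N, M) \<in> mult r' \<longrightarrow> set_mset N \<subseteq> A \<longrightarrow> Ord N \<in> A" and M: "set_mset M \<subseteq> A"
    show "Ord M \<in> A" unfolding A_def
    proof (rule acc.accI)
      fix b assume "(b, Ord M) \<in> r"
      then have "multp ord_less (exponents b) M" using ord_less_iff[of b "Ord M"] by (simp add: r_def)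
      then have "(exponents b, M) \<in> mult r" by (simp add: r_def multp_def)
      from mult[OF this M] IH have "Ord (exponents b) \<in> A" by blast
      then show "b \<in> Wellfounded.acc r" by (simp add: A_def)
    qed
  qed
  have "a \<in> A" for a
    by (induction a) (use * in blast)
  then show ?thesis unfolding A_def r_def wfp_def by (simp add: wf_iff_acc)
qed

instantiation ord :: "{wellorder, ordered_cancel_comm_monoid_add}"
begin

definition "zero_ord = Ord {#}"
definition "plus_ord a b = Ord (exponents a + exponents b)"
definition "minus_ord a b = Ord (exponents a - exponents b)"
definition "less_ord = ord_less"
definition "less_eq_ord a b \<longleftrightarrow> ord_less a b \<or> a = b"

lemma irreflp_ord_less: "\<not> ord_less a a"
  using wfp_ord_less by (simp add: wfp_imp_irreflp irreflpD)

instance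
proof
  fix a b c :: ord
  show "a < b \<longleftrightarrow> a \<le> b \<and> \<not> b \<le> a"
    unfolding less_ord_def less_eq_ord_def
    using irreflp_ord_less transpD[OF transp_ord_less, of a b a] by auto
  show "a \<le> a" by (simp add: less_eq_ord_def)
  show "a \<le> b \<Longrightarrow> b \<le> c \<Longrightarrow> a \<le> c"
    unfolding less_eq_ord_def using transpD[OF transp_ord_less, of a b c] by auto
  show "a \<le> b \<Longrightarrow> b \<le> a \<Longrightarrow> a = b"
    unfolding less_eq_ord_def using irreflp_ord_less transpD[OF transp_ord_less, of a b a] by auto
  show "a \<le> b \<or> b \<le> a"
    using totalp_onD[OF totalp_on_ord_less[of "max (Suc (size a)) (Suc (size b))"], of a b]
    by (auto simp: less_eq_ord_def less_max_iff_disj)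
  show "P a" if "\<And>x. (\<And>y. y < x \<Longrightarrow> P y) \<Longrightarrow> P x" for P
    using wfp_ord_less
  proof (induction a rule: wfp_induct_rule)
    case (less x)
    then show ?case using that[of x] unfolding less_ord_def by blast
  qed
  show "a + b + c = a + (b + c)" by (simp add: plus_ord_def add.assoc)
  show "a + b = b + a" by (simp add: plus_ord_def add.commute)
  show "0 + a = a" by (simp add: plus_ord_def zero_ord_def)
  show "a + b - a = b" by (simp add: plus_ord_def minus_ord_def)
  show "a - b - c = a - (b + c)" by (simp add: plus_ord_def minus_ord_def)
  have irr: "irreflp_on (set_mset M) ord_less" for M
    by (simp add: irreflp_on_def irreflp_ord_less)
  show "c + a \<le> c + b" if "a \<le> b"
    using that multp_cancel[OF transp_ord_less irr, of "exponents a" "exponents c" "exponents b"]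
    ord_less_iff[of a b] ord_less_iff[of "c + a" "c + b"]
    by (auto simp add: less_eq_ord_def plus_ord_def add.commute)
qed

end

definition \<omega> :: "ord \<Rightarrow> ord" where "\<omega> a = Ord {#a#}"

lemma less_ord_iff: "a < b \<longleftrightarrow> exponents a < exponents b"
  using ord_less_iff[of a b] by (simp add: less_ord_def less_multiset_def)

lemma exponents_plus [simp]: "exponents (a + b) = exponents a + exponents b"
  by (simp add: plus_ord_def)

lemma exponents_omega [simp]: "exponents (\<omega> a) = {#a#}"
  by (simp add: \<omega>_def)

lemma omega_less_iff [simp]: "\<omega> a < \<omega> b \<longleftrightarrow> a < b"
  by (simp add: less_ord_iff)

lemma omega_le_iff [simp]: "\<omega> a \<le> \<omega> b \<longleftrightarrow> a \<le> b"
  by (metis linorder_not_less omega_less_iff)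

text \<open>
  Together with \<open>plus_less_omega\<close> this is what makes \<open>\<omega> c\<close> useful
  as a bound: it is closed under natural sums of smaller ordinals.
\<close>
lemma less_omega_iff: "a < \<omega> c \<longleftrightarrow> (\<forall>x\<in>#exponents a. x < c)"
  by (simp add: less_ord_iff)

lemma plus_less_omega: "a < \<omega> c \<Longrightarrow> b < \<omega> c \<Longrightarrow> a + b < \<omega> c"
  by (auto simp: less_omega_iff)

lemma zero_le_ord [simp]: "0 \<le> (a::ord)"
  by (metis Ord_exponents exponents.simps le_multiset_empty_left less_ord_iff nle_le order.strict_iff_order zero_ord_def)

lemma zero_less_omega [simp]: "0 < \<omega> a"
  by (simp add: less_ord_iff zero_ord_def)

lemma le_omega: "a \<le> \<omega> a"
proof (induction a rule: less_induct)
  case (less a)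
  show ?case
  proof (rule ccontr)
    assume "\<not> a \<le> \<omega> a"
    then have *: "\<omega> a < a" by simp
    from less.IH[OF this] show False using * by (metis leD omega_less_iff)
  qed
qed

section \<open>Bounding order types by finite covers of initial segments\<close>

text \<open>
  \<open>ot_le R d A\<close> bounds the order type of \<open>A\<close> by
  \<open>\<omega>\<^sup>d\<close>: what lies below an element must be covered by finitely many sets
  with bounds \<open>d' < d\<close>. Since \<open>\<omega>\<^sup>d\<close> is closed under natural
  sums of smaller ordinals, finite covers cost nothing, and since only initial segments are
  inspected, the notion makes sense for arbitrary relations. \<open>ot_lt R d A\<close> bounds the
  order type strictly below \<open>\<omega>\<^sup>d\<close>.
\<close>
inductive ot_le :: "('a \<Rightarrow> 'a \<Rightarrow> bool) \<Rightarrow> ord \<Rightarrow> 'a set \<Rightarrow> bool" for R where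
  "(\<And>z. z \<in> A \<Longrightarrow> \<exists>\<B>. finite \<B> \<and> {y \<in> A. R y z} \<subseteq> \<Union>\<B> \<and> (\<forall>B\<in>\<B>. \<exists>d'<d. ot_le R d' B))
    \<Longrightarrow> ot_le R d A"

definition ot_lt :: "('a \<Rightarrow> 'a \<Rightarrow> bool) \<Rightarrow> ord \<Rightarrow> 'a set \<Rightarrow> bool" where
  "ot_lt R d A \<longleftrightarrow> (\<exists>\<B>. finite \<B> \<and> A \<subseteq> \<Union>\<B> \<and> (\<forall>B\<in>\<B>. \<exists>d'<d. ot_le R d' B))"

lemma ot_le_iff: "ot_le R d A \<longleftrightarrow> (\<forall>z\<in>A. ot_lt R d {y \<in> A. R y z})"
  by (subst ot_le.simps) (auto simp: ot_lt_def)

lemma ot_leD: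
  "ot_le R d A \<Longrightarrow> z \<in> A \<Longrightarrow>
    \<exists>\<B>. finite \<B> \<and> {y \<in> A. R y z} \<subseteq> \<Union>\<B> \<and> (\<forall>B\<in>\<B>. \<exists>d'<d. ot_le R d' B)"
  by (erule ot_le.cases) auto

lemma ot_lt_subset: "ot_lt R d B \<Longrightarrow> A \<subseteq> B \<Longrightarrow> ot_lt R d A"
  unfolding ot_lt_def by (meson subset_trans)

lemma ot_lt_mono: "ot_lt R d A \<Longrightarrow> d \<le> d' \<Longrightarrow> ot_lt R d' A"
  unfolding ot_lt_def by (meson order_less_le_trans)

lemma ot_le_mono: "ot_le R d A \<Longrightarrow> d \<le> d' \<Longrightarrow> ot_le R d' A"
  using ot_lt_mono unfolding ot_le_iff by blast

lemma ot_lt_empty [simp]: "ot_lt R d {}"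
  unfolding ot_lt_def by (rule exI[of _ "{}"]) simp

lemma ot_lt_Un: "ot_lt R d A \<Longrightarrow> ot_lt R d B \<Longrightarrow> ot_lt R d (A \<union> B)"
proof -
  assume "ot_lt R d A" "ot_lt R d B"
  then obtain \<A> \<B> where "finite \<A>" "A \<subseteq> \<Union>\<A>" "\<forall>B\<in>\<A>. \<exists>d'<d. ot_le R d' B"
    "finite \<B>" "B \<subseteq> \<Union>\<B>" "\<forall>B\<in>\<B>. \<exists>d'<d. ot_le R d' B" unfolding ot_lt_def by blast
  then show ?thesis unfolding ot_lt_def by (intro exI[of _ "\<A> \<union> \<B>"]) auto
qed

lemma ot_lt_UN: "finite I \<Longrightarrow> (\<And>i. i \<in> I \<Longrightarrow> ot_lt R d (A i)) \<Longrightarrow> ot_lt R d (\<Union>i\<in>I. A i)"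
  by (induction I rule: finite_induct) (auto intro: ot_lt_Un)

lemma ot_le_imp_lt: "ot_le R d A \<Longrightarrow> d < d' \<Longrightarrow> ot_lt R d' A"
  unfolding ot_lt_def by (rule exI[of _ "{A}"]) auto

text \<open>
  Every estimate of an order type below consists in mapping a set monotonically into others whose
  types are known; this is the case of one map.
\<close>
lemma ot_le_pullback:
  assumes "ot_le R' d B" "\<And>a. a \<in> A \<Longrightarrow> f a \<in> B"
    and "\<And>a a'. a \<in> A \<Longrightarrow> a' \<in> A \<Longrightarrow> R a' a \<Longrightarrow> R' (f a') (f a)"
  shows "ot_le R d A"
  using assms
proof (induction d arbitrary: A B rule: less_induct)
  case (less d)
  show ?case unfolding ot_le_iff
  proof
    fix z assume z: "z \<in> A"
    with less.prems have "ot_lt R' d {y \<in> B. R' y (f z)}" unfolding ot_le_iff by blast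
    then obtain \<B> where \<B>: "finite \<B>" "{y \<in> B. R' y (f z)} \<subseteq> \<Union>\<B>" "\<forall>C\<in>\<B>. \<exists>d'<d. ot_le R' d' C"
      unfolding ot_lt_def by blast
    have cov: "\<exists>C\<in>\<B>. f y \<in> C" if "y \<in> A" "R y z" for y
      using \<B>(2) less.prems(2)[OF that(1)] less.prems(3)[OF z that] by blast
    show "ot_lt R d {y \<in> A. R y z}" unfolding ot_lt_def
    proof (rule exI[of _ "(\<lambda>C. {a \<in> A. f a \<in> C}) ` \<B>"], intro conjI ballI)
      show "finite ((\<lambda>C. {a \<in> A. f a \<in> C}) ` \<B>)" using \<B>(1) by simp
      show "{y \<in> A. R y z} \<subseteq> \<Union>((\<lambda>C. {a \<in> A. f a \<in> C}) ` \<B>)"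
        using cov by blast
      fix D assume "D \<in> (\<lambda>C. {a \<in> A. f a \<in> C}) ` \<B>"
      then obtain C where C: "C \<in> \<B>" "D = {a \<in> A. f a \<in> C}" by blast
      with \<B>(3) obtain d' where d': "d' < d" "ot_le R' d' C" by blast
      have "ot_le R d' D"
        by (rule less.IH[OF d']) (use C less.prems(3) in auto)
      then show "\<exists>d'<d. ot_le R d' D" using d' by blast
    qed
  qed
qed

lemma ot_le_subset: "ot_le R d B \<Longrightarrow> A \<subseteq> B \<Longrightarrow> ot_le R d A"
  by (erule ot_le_pullback[where f = "\<lambda>x. x"]) auto

lemma ot_lt_imp_le: "ot_lt R d A \<Longrightarrow> ot_le R d A"
  unfolding ot_le_iff by (auto intro: ot_lt_subset)

lemma ot_lt_pullback:
  assumes "ot_lt R' d B" "\<And>a. a \<in> A \<Longrightarrow> f a \<in> B"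
    and "\<And>a a'. a \<in> A \<Longrightarrow> a' \<in> A \<Longrightarrow> R a' a \<Longrightarrow> R' (f a') (f a)"
  shows "ot_lt R d A"
proof -
  from assms(1) obtain \<B> where \<B>: "finite \<B>" "B \<subseteq> \<Union>\<B>" "\<forall>C\<in>\<B>. \<exists>d'<d. ot_le R' d' C"
    unfolding ot_lt_def by blast
  show ?thesis unfolding ot_lt_def
  proof (rule exI[of _ "(\<lambda>C. {a \<in> A. f a \<in> C}) ` \<B>"], intro conjI ballI)
    show "finite ((\<lambda>C. {a \<in> A. f a \<in> C}) ` \<B>)" using \<B>(1) by simp
    show "A \<subseteq> \<Union>((\<lambda>C. {a \<in> A. f a \<in> C}) ` \<B>)" using \<B>(2) assms(2) by blast
    fix D assume "D \<in> (\<lambda>C. {a \<in> A. f a \<in> C}) ` \<B>"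
    then obtain C where C: "C \<in> \<B>" "D = {a \<in> A. f a \<in> C}" by blast
    with \<B>(3) obtain d' where d': "d' < d" "ot_le R' d' C" by blast
    have "ot_le R d' D"
      by (rule ot_le_pullback[OF d'(2), of _ f]) (use C assms(3) in auto)
    then show "\<exists>d'<d. ot_le R d' D" using d' by blast
  qed
qed

text \<open>
  The product bound: if an element is smaller than \<open>z\<close> only by being smaller in one of
  two components, then the initial segment below \<open>z\<close> is covered by two families of sets
  in which one of the components has a smaller bound. This gives the natural sum of the exponents,
  as \<open>\<omega>\<^sup>a * \<omega>\<^sup>b = \<omega>\<^bsup>a + b\<^esup>\<close> for natural
  products.
\<close>
lemma ot_le_inter:
  assumes "ot_le R1 d1 A" "ot_le R2 d2 A"
    and "\<And>y z. y \<in> A \<Longrightarrow> z \<in> A \<Longrightarrow> R y z \<Longrightarrow> R1 y z \<or> R2 y z"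
  shows "ot_le R (d1 + d2) A"
  using assms
proof (induction "d1 + d2" arbitrary: d1 d2 A rule: less_induct)
  case less
  show ?case unfolding ot_le_iff
  proof
    fix z assume z: "z \<in> A"
    obtain \<A> where \<A>: "finite \<A>" "{y \<in> A. R1 y z} \<subseteq> \<Union>\<A>" "\<forall>C\<in>\<A>. \<exists>d'<d1. ot_le R1 d' C"
      using ot_leD[OF less.prems(1) z] by blast
    obtain \<B> where \<B>: "finite \<B>" "{y \<in> A. R2 y z} \<subseteq> \<Union>\<B>" "\<forall>C\<in>\<B>. \<exists>d'<d2. ot_le R2 d' C"
      using ot_leD[OF less.prems(2) z] by blast
    show "ot_lt R (d1 + d2) {y \<in> A. R y z}" unfolding ot_lt_def
    proof (rule exI[of _ "(\<inter>) A ` (\<A> \<union> \<B>)"], intro conjI ballI)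
      show "finite ((\<inter>) A ` (\<A> \<union> \<B>))" using \<A>(1) \<B>(1) by simp
      show "{y \<in> A. R y z} \<subseteq> \<Union>((\<inter>) A ` (\<A> \<union> \<B>))"
        using \<A>(2) \<B>(2) less.prems(3)[OF _ z] by blast
      fix D assume "D \<in> (\<inter>) A ` (\<A> \<union> \<B>)"
      then consider C where "C \<in> \<A>" "D = A \<inter> C" | C where "C \<in> \<B>" "D = A \<inter> C" by blast
      then show "\<exists>d'<d1 + d2. ot_le R d' D"
      proof cases
        case 1
        with \<A>(3) obtain d' where d': "d' < d1" "ot_le R1 d' C" by blast
        have "ot_le R (d' + d2) D"
          by (rule less.hyps) (use d' 1 less.prems in \<open>auto intro: ot_le_subset add_strict_right_mono\<close>)
        then show ?thesis using add_strict_right_mono[OF d'(1)] by blast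
      next
        case 2
        with \<B>(3) obtain d' where d': "d' < d2" "ot_le R2 d' C" by blast
        have "ot_le R (d1 + d') D"
          by (rule less.hyps) (use d' 2 less.prems in \<open>auto intro: ot_le_subset add_strict_left_mono\<close>)
        then show ?thesis using add_strict_left_mono[OF d'(1)] by blast
      qed
    qed
  qed
qed

text \<open>
  For strict bounds no exponent is lost when the bound is itself a power of \<open>\<omega>\<close>:
  finitely many pairs of types below \<open>\<omega>\<^bsup>\<omega> b\<^esup>\<close> have products
  below it. This is why all bounds are kept in the form \<open>\<omega> b\<close>.
\<close>
lemma ot_lt_inter:
  assumes "ot_lt R1 (\<omega> b) A" "ot_lt R2 (\<omega> b) A"
    and R: "\<And>y z. y \<in> A \<Longrightarrow> z \<in> A \<Longrightarrow> R y z \<Longrightarrow> R1 y z \<or> R2 y z"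
  shows "ot_lt R (\<omega> b) A"
proof -
  obtain \<A> where \<A>: "finite \<A>" "A \<subseteq> \<Union>\<A>" "\<forall>C\<in>\<A>. \<exists>d'<\<omega> b. ot_le R1 d' C"
    using assms(1) unfolding ot_lt_def by blast
  obtain \<B> where \<B>: "finite \<B>" "A \<subseteq> \<Union>\<B>" "\<forall>C\<in>\<B>. \<exists>d'<\<omega> b. ot_le R2 d' C"
    using assms(2) unfolding ot_lt_def by blast
  have "ot_lt R (\<omega> b) (A \<inter> C \<inter> D)" if C: "C \<in> \<A>" and D: "D \<in> \<B>" for C D
  proof -
    obtain c where c: "c < \<omega> b" "ot_le R1 c C" using \<A>(3) C by blast
    obtain d where d: "d < \<omega> b" "ot_le R2 d D" using \<B>(3) D by blast
    have "ot_le R (c + d) (A \<inter> C \<inter> D)"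
      by (rule ot_le_inter[where ?R1.0 = R1 and ?R2.0 = R2]) (use c d assms in \<open>auto intro: ot_le_subset\<close>)
    then show ?thesis by (rule ot_le_imp_lt) (use c d plus_less_omega in simp)
  qed
  then have *: "ot_lt R (\<omega> b) (\<Union>C\<in>\<A>. \<Union>D\<in>\<B>. A \<inter> C \<inter> D)" by (intro ot_lt_UN \<A>(1) \<B>(1))
  have "A \<subseteq> (\<Union>C\<in>\<A>. \<Union>D\<in>\<B>. A \<inter> C \<inter> D)"
  proof
    fix a assume "a \<in> A"
    then obtain C D where "C \<in> \<A>" "D \<in> \<B>" "a \<in> C" "a \<in> D" using \<A>(2) \<B>(2) by blast
    with \<open>a \<in> A\<close> show "a \<in> (\<Union>C\<in>\<A>. \<Union>D\<in>\<B>. A \<inter> C \<inter> D)" by blast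
  qed
  with * show ?thesis by (rule ot_lt_subset)
qed

text \<open>
  Refining a coarse relation \<open>R1\<close>: the elements \<open>R1\<close>-below
  \<open>z\<close> have a smaller coarse bound, and those \<open>R1\<close>-incomparable to
  \<open>z\<close> form a fibre. The summand \<open>\<omega> 0 = 1\<close> separates the two.
\<close>
lemma ot_le_lex:
  assumes "ot_le R1 d1 A" "\<And>z. z \<in> A \<Longrightarrow> ot_le R d2 {y \<in> A. \<not> R1 y z \<and> \<not> R1 z y}"
    and "\<And>y z. y \<in> A \<Longrightarrow> z \<in> A \<Longrightarrow> R y z \<Longrightarrow> \<not> R1 z y"
  shows "ot_le R (d2 + \<omega> 0 + d1) A"
  using assms
proof (induction d1 arbitrary: A rule: less_induct)
  case (less d1)
  show ?case unfolding ot_le_iff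
  proof
    fix z assume z: "z \<in> A"
    obtain \<A> where \<A>: "finite \<A>" "{y \<in> A. R1 y z} \<subseteq> \<Union>\<A>" "\<forall>C\<in>\<A>. \<exists>d'<d1. ot_le R1 d' C"
      using ot_leD[OF less.prems(1) z] by blast
    have "ot_lt R (d2 + \<omega> 0 + d1) (A \<inter> C)" if C: "C \<in> \<A>" for C
    proof -
      obtain d' where d': "d' < d1" "ot_le R1 d' C" using \<A>(3) C by blast
      have "ot_le R (d2 + \<omega> 0 + d') (A \<inter> C)"
      proof (rule less.IH[OF d'(1)])
        show "ot_le R1 d' (A \<inter> C)" by (rule ot_le_subset[OF d'(2)]) auto
        show "ot_le R d2 {y \<in> A \<inter> C. \<not> R1 y z \<and> \<not> R1 z y}" if "z \<in> A \<inter> C" for z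
          by (rule ot_le_subset[OF less.prems(2)[of z]]) (use that in auto)
      qed (use less.prems in auto)
      then show ?thesis by (rule ot_le_imp_lt) (use d' in \<open>simp add: add_strict_left_mono\<close>)
    qed
    then have 1: "ot_lt R (d2 + \<omega> 0 + d1) (\<Union>C\<in>\<A>. A \<inter> C)" by (intro ot_lt_UN \<A>(1))
    have "d2 + 0 < d2 + \<omega> 0" by (rule add_strict_left_mono) simp
    then have "d2 < d2 + \<omega> 0 + d1" by (metis add.right_neutral add_less_le_mono zero_le_ord)
    then have 2: "ot_lt R (d2 + \<omega> 0 + d1) {y \<in> A. \<not> R1 y z \<and> \<not> R1 z y}"
      using less.prems(2)[OF z] ot_le_imp_lt by blast
    show "ot_lt R (d2 + \<omega> 0 + d1) {y \<in> A. R y z}"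
      by (rule ot_lt_subset[OF ot_lt_Un[OF 1 2]]) (use \<A>(2) less.prems(3) z in blast)
  qed
qed

definition ranked :: "('a \<Rightarrow> 'a \<Rightarrow> bool) \<Rightarrow> ord \<Rightarrow> 'a set \<Rightarrow> bool" where
  "ranked R \<theta> A \<longleftrightarrow> (\<exists>\<rho>. (\<forall>a\<in>A. \<rho> a < \<theta>) \<and> (\<forall>a\<in>A. \<forall>b\<in>A. R a b \<longrightarrow> \<rho> a < \<rho> b))"

lemma ranked_subset: "ranked R \<theta> B \<Longrightarrow> A \<subseteq> B \<Longrightarrow> ranked R \<theta> A"
  unfolding ranked_def by (elim exE) (rule exI, auto)

text \<open>
  An element \<open>z\<close> of the union is ranked by the natural sum of its residual ranks, the
  least bounds for the ranks of the elements of \<open>A\<close>, and of \<open>B\<close>, that lie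
  below \<open>z\<close>.
\<close>
lemma ranked_Un:
  assumes "transp R" "ranked R \<alpha> A" "ranked R \<beta> B"
  shows "ranked R (\<alpha> + \<beta>) (A \<union> B)"
proof -
  define rk where "rk \<rho> A z = (LEAST \<gamma>. \<forall>a\<in>A. R a z \<longrightarrow> \<rho> a < (\<gamma>::ord))" for \<rho> A z
  have key: "rk \<rho> A z \<le> \<theta>" "z \<in> A \<Longrightarrow> rk \<rho> A z < \<theta>"
       "R z z' \<Longrightarrow> rk \<rho> A z \<le> rk \<rho> A z'" "R z z' \<Longrightarrow> z \<in> A \<Longrightarrow> rk \<rho> A z < rk \<rho> A z'"
    if \<rho>: "\<forall>a\<in>A. \<rho> a < \<theta>" "\<forall>a\<in>A. \<forall>b\<in>A. R a b \<longrightarrow> \<rho> a < \<rho> b" for A \<rho> \<theta> z z'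
  proof -
    have ex: "\<forall>a\<in>A. R a z \<longrightarrow> \<rho> a < rk \<rho> A z" for z
      unfolding rk_def by (rule LeastI[of _ \<theta>]) (use \<rho> in auto)
    show "rk \<rho> A z \<le> \<theta>" unfolding rk_def by (rule Least_le) (use \<rho> in auto)
    have le: "rk \<rho> A z \<le> \<rho> z" if "z \<in> A" unfolding rk_def by (rule Least_le) (use \<rho> that in auto)
    then show "rk \<rho> A z < \<theta>" if "z \<in> A" using \<rho>(1) that by force
    show "rk \<rho> A z \<le> rk \<rho> A z'" if "R z z'"
      unfolding rk_def[of _ _ z] by (rule Least_le) (use ex[of z'] transpD[OF assms(1) _ that] in blast)
    show "rk \<rho> A z < rk \<rho> A z'" if "R z z'" "z \<in> A" using le[OF that(2)] ex that by force
  qed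
  from assms obtain f g where f: "\<forall>a\<in>A. f a < \<alpha>" "\<forall>a\<in>A. \<forall>b\<in>A. R a b \<longrightarrow> f a < f b"
    and g: "\<forall>a\<in>B. g a < \<beta>" "\<forall>a\<in>B. \<forall>b\<in>B. R a b \<longrightarrow> g a < g b"
    unfolding ranked_def by blast
  show ?thesis unfolding ranked_def
  proof (intro exI conjI ballI impI)
    let ?h = "\<lambda>z. rk f A z + rk g B z"
    show "?h a < \<alpha> + \<beta>" if "a \<in> A \<union> B" for a
      using key(1,2)[OF f, of a] key(1,2)[OF g, of a] that
      by (auto intro: add_less_le_mono add_le_less_mono)
    show "?h a < ?h b" if "a \<in> A \<union> B" "b \<in> A \<union> B" "R a b" for a b
      using key(3,4)[OF f that(3)] key(3,4)[OF g that(3)] that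
      by (auto intro: add_less_le_mono add_le_less_mono)
  qed
qed

text \<open>
  If all initial segments can be ranked, then the least possible bound for the segment below
  \<open>z\<close> is a rank of \<open>z\<close>. This rank depends only on the initial segment,
  which is the last claim. The predicate \<open>Q\<close> transports bounds on the ranks.
\<close>
lemma ranked_residual:
  assumes "transp R" "\<And>z. z \<in> A \<Longrightarrow> \<exists>\<theta>. Q \<theta> \<and> ranked R \<theta> {y \<in> A. R y z}"
    and "\<And>\<theta> \<theta>'. Q \<theta> \<Longrightarrow> \<theta>' \<le> \<theta> \<Longrightarrow> Q \<theta>'"
  shows "\<exists>\<rho>. (\<forall>a\<in>A. Q (\<rho> a)) \<and> (\<forall>a\<in>A. \<forall>b\<in>A. R a b \<longrightarrow> \<rho> a < \<rho> b)
     \<and> (\<forall>a\<in>A. \<forall>b\<in>A. {y \<in> A. R y a} \<subseteq> {y \<in> A. R y b} \<longrightarrow> \<rho> a \<le> \<rho> b)"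
proof -
  define \<rho> where "\<rho> z = (LEAST \<theta>. ranked R \<theta> {y \<in> A. R y z})" for z
  have ex: "ranked R (\<rho> z) {y \<in> A. R y z}" if "z \<in> A" for z
    unfolding \<rho>_def using assms(2)[OF that] by (meson LeastI)
  have le: "\<rho> z \<le> \<theta>'" if "ranked R \<theta>' {y \<in> A. R y z}" for z \<theta>'
    unfolding \<rho>_def using that by (rule Least_le)
  have 1: "\<forall>a\<in>A. Q (\<rho> a)" using assms(2,3) le by meson
  have 2: "\<forall>a\<in>A. \<forall>b\<in>A. R a b \<longrightarrow> \<rho> a < \<rho> b"
  proof (intro ballI impI)
    fix a b assume ab: "a \<in> A" "b \<in> A" "R a b"
    obtain f where f: "\<forall>y\<in>{y \<in> A. R y b}. f y < \<rho> b"
      "\<forall>y\<in>{y \<in> A. R y b}. \<forall>z\<in>{y \<in> A. R y b}. R y z \<longrightarrow> f y < f z"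
      using ex[OF ab(2)] unfolding ranked_def by blast
    have tr: "R y b" if "R y a" for y using transpD[OF assms(1) that ab(3)] .
    have "ranked R (f a) {y \<in> A. R y a}"
      unfolding ranked_def by (rule exI[of _ f]) (use f ab tr in auto)
    from le[OF this] f ab show "\<rho> a < \<rho> b" by fastforce
  qed
  have 3: "\<forall>a\<in>A. \<forall>b\<in>A. {y \<in> A. R y a} \<subseteq> {y \<in> A. R y b} \<longrightarrow> \<rho> a \<le> \<rho> b"
    using ex le ranked_subset by meson
  show ?thesis using 1 2 3 by blast
qed

lemma ot_le_rank:
  assumes "transp R" "ot_le R d A"
  shows "\<exists>\<rho>. (\<forall>a\<in>A. \<rho> a < \<omega> d) \<and> (\<forall>a\<in>A. \<forall>b\<in>A. R a b \<longrightarrow> \<rho> a < \<rho> b)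
     \<and> (\<forall>a\<in>A. \<forall>b\<in>A. {y \<in> A. R y a} \<subseteq> {y \<in> A. R y b} \<longrightarrow> \<rho> a \<le> \<rho> b)"
  using assms(2)
proof (induction d arbitrary: A rule: less_induct)
  case (less d)
  show ?case
  proof (rule ranked_residual[OF assms(1), where Q = "\<lambda>\<theta>. \<theta> < \<omega> d"])
    fix z assume z: "z \<in> A"
    obtain \<A> where \<A>: "finite \<A>" "{y \<in> A. R y z} \<subseteq> \<Union>\<A>" "\<forall>C\<in>\<A>. \<exists>d'<d. ot_le R d' C"
      using ot_leD[OF less.prems(1) z] by blast
    from \<A>(1,3) have "\<exists>\<theta><\<omega> d. ranked R \<theta> (\<Union>\<A>)"
    proof (induction \<A> rule: finite_induct)
      case empty
      show ?case by (rule exI[of _ 0]) (simp add: ranked_def)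
    next
      case (insert C \<A>)
      then obtain \<theta> where \<theta>: "\<theta> < \<omega> d" "ranked R \<theta> (\<Union>\<A>)" by auto
      from insert.prems obtain d' where d': "d' < d" "ot_le R d' C" by auto
      from less.IH[OF this] have "ranked R (\<omega> d') C" unfolding ranked_def by blast
      from ranked_Un[OF assms(1) this \<theta>(2)] have "ranked R (\<omega> d' + \<theta>) (\<Union>(insert C \<A>))" by simp
      moreover have "\<omega> d' + \<theta> < \<omega> d" by (rule plus_less_omega) (use d' \<theta> in auto)
      ultimately show ?case by blast
    qed
    then obtain \<theta> where \<theta>: "\<theta> < \<omega> d" "ranked R \<theta> (\<Union>\<A>)" by (elim exE conjE)
    show "\<exists>\<theta><\<omega> d. ranked R \<theta> {y \<in> A. R y z}"
      by (intro exI[of _ \<theta>] conjI \<theta>(1) ranked_subset[OF \<theta>(2) \<A>(2)])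
  qed (rule order_le_less_trans)
qed

text \<open>
  Dickson's lemma in the form of finite bases: adding a component in a well-order preserves the
  property that every set has a finite subset of elements below all others. Take a finite basis for
  \<open>le\<close>; it settles all elements whose value is at least the largest value on the basis,
  and the remaining ones have values below that bound, to which well-founded induction applies.
\<close>
lemma dickson:
  fixes f :: "'p \<Rightarrow> 'u::wellorder"
  assumes "\<And>T'. T' \<subseteq> T \<Longrightarrow> \<exists>F\<subseteq>T'. finite F \<and> (\<forall>p\<in>T'. \<exists>q\<in>F. le q p)"
  shows "\<exists>F\<subseteq>T. finite F \<and> (\<forall>p\<in>T. \<exists>q\<in>F. f q \<le> f p \<and> le q p)"
proof -
  have step: "\<exists>b. (\<exists>F\<subseteq>T'. finite F \<and> (\<forall>p\<in>T'. b \<le> f p \<longrightarrow> (\<exists>q\<in>F. f q \<le> f p \<and> le q p)))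
      \<and> b \<in> f ` T'" if ne: "T' \<noteq> {}" and T': "T' \<subseteq> T" for T'
  proof -
    obtain F where F: "F \<subseteq> T'" "finite F" "\<forall>p\<in>T'. \<exists>q\<in>F. le q p" using assms[OF T'] by blast
    then have Fne: "F \<noteq> {}" using ne by blast
    let ?b = "Max (f ` F)"
    have "?b \<in> f ` F" using F(2) Fne by simp
    moreover have "f q \<le> ?b" if "q \<in> F" for q using F(2) that by simp
    moreover have "\<exists>q\<in>F. f q \<le> f p \<and> le q p" if "p \<in> T'" "?b \<le> f p" for p
      using F(3) that \<open>\<And>q. q \<in> F \<Longrightarrow> f q \<le> ?b\<close> by (meson order_trans)
    ultimately show ?thesis using F by (intro exI[of _ ?b] conjI exI[of _ F]) auto
  qed
  have main: "\<exists>F\<subseteq>T'. finite F \<and> (\<forall>p\<in>T'. \<exists>q\<in>F. f q \<le> f p \<and> le q p)"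
    if "T' \<subseteq> T" "\<forall>p\<in>T'. f p < b" for T' b
    using that
  proof (induction b arbitrary: T' rule: less_induct)
    case (less b)
    show ?case
    proof (cases "T' = {}")
      case False
      from step[OF this less.prems(1)] obtain b' F where b': "b' \<in> f ` T'"
        "F \<subseteq> T'" "finite F" "\<forall>p\<in>T'. b' \<le> f p \<longrightarrow> (\<exists>q\<in>F. f q \<le> f p \<and> le q p)" by blast
      from b'(1) less.prems(2) have "b' < b" by blast
      have "{p \<in> T'. f p < b'} \<subseteq> T" "\<forall>p\<in>{p \<in> T'. f p < b'}. f p < b'" using less.prems(1) by auto
      from less.IH[OF \<open>b' < b\<close> this] obtain F' where
        F': "F' \<subseteq> {p \<in> T'. f p < b'}" "finite F'" "\<forall>p\<in>{p \<in> T'. f p < b'}. \<exists>q\<in>F'. f q \<le> f p \<and> le q p"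
        by blast
      show ?thesis
      proof (intro exI[of _ "F \<union> F'"] conjI ballI)
        fix p assume "p \<in> T'"
        then show "\<exists>q\<in>F \<union> F'. f q \<le> f p \<and> le q p"
          using b'(4) F'(3) by (cases "b' \<le> f p") (blast, metis (lifting) UnI2 mem_Collect_eq not_le)
      next
        show "F \<union> F' \<subseteq> T'" using b'(2) F'(1) by blast
        show "finite (F \<union> F')" using b'(3) F'(2) by blast
      qed
    qed auto
  qed
  show ?thesis
  proof (cases "T = {}")
    case False
    from step[OF this order_refl] obtain b' F where b': "b' \<in> f ` T"
      "F \<subseteq> T" "finite F" "\<forall>p\<in>T. b' \<le> f p \<longrightarrow> (\<exists>q\<in>F. f q \<le> f p \<and> le q p)" by blast
    have "{p \<in> T. f p < b'} \<subseteq> T" "\<forall>p\<in>{p \<in> T. f p < b'}. f p < b'" by auto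
    from main[OF this] obtain F' where
      F': "F' \<subseteq> {p \<in> T. f p < b'}" "finite F'" "\<forall>p\<in>{p \<in> T. f p < b'}. \<exists>q\<in>F'. f q \<le> f p \<and> le q p"
      by blast
    show ?thesis
    proof (intro exI[of _ "F \<union> F'"] conjI ballI)
      fix p assume "p \<in> T"
      then show "\<exists>q\<in>F \<union> F'. f q \<le> f p \<and> le q p"
        using b'(4) F'(3) by (cases "b' \<le> f p") (blast, metis (lifting) UnI2 mem_Collect_eq not_le)
    next
      show "F \<union> F' \<subseteq> T" using b'(2) F'(1) by blast
      show "finite (F \<union> F')" using b'(3) F'(2) by blast
    qed
  qed auto
qed

lemma dickson_pair:
  fixes f :: "'p \<Rightarrow> 'u::wellorder" and g :: "'p \<Rightarrow> 'v::wellorder"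
  shows "\<exists>F\<subseteq>T. finite F \<and> (\<forall>p\<in>T. \<exists>q\<in>F. f q \<le> f p \<and> g q \<le> g p)"
proof (rule dickson)
  fix T' :: "'p set"
  show "\<exists>F\<subseteq>T'. finite F \<and> (\<forall>p\<in>T'. \<exists>q\<in>F. g q \<le> g p)"
  proof (cases "T' = {}")
    case False
    define m where "m = (LEAST y. y \<in> g ` T')"
    have "m \<in> g ` T'" unfolding m_def using False by (metis LeastI ex_in_conv imageI)
    then obtain q where "q \<in> T'" "m = g q" by blast
    moreover have "m \<le> g p" if "p \<in> T'" for p unfolding m_def by (rule Least_le) (use that in auto)
    ultimately show ?thesis by (intro exI[of _ "{q}"]) auto
  qed auto
qed

section \<open>Finite sums in an ordered field at a given precision\<close>

definition convex_subgroup :: "'a::linordered_field set \<Rightarrow> bool" where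
  "convex_subgroup V \<longleftrightarrow> 0 \<in> V \<and> (\<forall>a\<in>V. \<forall>b\<in>V. a - b \<in> V) \<and> (\<forall>a\<in>V. \<forall>b. \<bar>b\<bar> \<le> \<bar>a\<bar> \<longrightarrow> b \<in> V)"

lemma cs_zero: "convex_subgroup V \<Longrightarrow> 0 \<in> V"
  and cs_diff: "convex_subgroup V \<Longrightarrow> a \<in> V \<Longrightarrow> b \<in> V \<Longrightarrow> a - b \<in> V"
  and cs_convex: "convex_subgroup V \<Longrightarrow> a \<in> V \<Longrightarrow> \<bar>b\<bar> \<le> \<bar>a\<bar> \<Longrightarrow> b \<in> V"
  unfolding convex_subgroup_def by blast+

lemma cs_uminus: "convex_subgroup V \<Longrightarrow> a \<in> V \<Longrightarrow> - a \<in> V"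
  using cs_convex[of V a "- a"] by simp

lemma cs_minus_commute: "convex_subgroup V \<Longrightarrow> a - b \<in> V \<Longrightarrow> b - a \<in> V"
  using cs_convex[of V "a - b" "b - a"] by (simp add: abs_minus_commute)

lemma cs_add: "convex_subgroup V \<Longrightarrow> a \<in> V \<Longrightarrow> b \<in> V \<Longrightarrow> a + b \<in> V"
  using cs_diff[of V a "- b"] cs_uminus[of V b] by simp

lemma cs_nat: "convex_subgroup V \<Longrightarrow> a \<in> V \<Longrightarrow> of_nat n * a \<in> V"
  by (induction n) (auto simp: cs_zero cs_add algebra_simps)

text \<open>
  Comparison when differences in the convex subgroup \<open>V\<close> are neglected: the order of
  the quotient by \<open>V\<close>.
\<close>
definition less_mod :: "'a::linordered_field set \<Rightarrow> 'a \<Rightarrow> 'a \<Rightarrow> bool" where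
  "less_mod V a b \<longleftrightarrow> a < b \<and> b - a \<notin> V"

text \<open>
  Comparison of archimedean classes of positive elements.
\<close>
definition arch :: "'a::linordered_field \<Rightarrow> 'a \<Rightarrow> bool" where
  "arch a b \<longleftrightarrow> (\<forall>n::nat. of_nat n * a < b)"

abbreviation (input) sim :: "'a::linordered_field \<Rightarrow> 'a \<Rightarrow> bool" where
  "sim a b \<equiv> \<not> arch a b \<and> \<not> arch b a"

lemma transp_less_mod: "convex_subgroup V \<Longrightarrow> transp (less_mod V)"
proof (rule transpI)
  fix a b c assume V: "convex_subgroup V" and "less_mod V a b" "less_mod V b c"
  then have *: "a < b" "b < c" "b - a \<notin> V" by (auto simp: less_mod_def)
  then have "c - a \<notin> V" using cs_convex[OF V, of "c - a" "b - a"] by fastforce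
  with * show "less_mod V a c" by (simp add: less_mod_def)
qed

lemma not_less_mod_bound:
  assumes "convex_subgroup V" "\<not> less_mod V a b"
  shows "\<exists>v\<in>V. 0 \<le> v \<and> b \<le> a + v"
proof (cases "b \<le> a")
  case True
  then show ?thesis using cs_zero[OF assms(1)] by auto
next
  case False
  then show ?thesis using assms(2) by (intro bexI[of _ "b - a"]) (auto simp: less_mod_def)
qed

lemma less_mod_not_le:
  assumes "convex_subgroup V" "less_mod V a b" "v \<in> V" "0 \<le> v"
  shows "a + v < b"
proof (rule ccontr)
  assume "\<not> a + v < b"
  then have "\<bar>b - a\<bar> \<le> \<bar>v\<bar>" using assms(2) by (auto simp: less_mod_def)
  then show False using cs_convex[OF assms(1,3)] assms(2) by (auto simp: less_mod_def)
qed

text \<open>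
  With this as hypothesis, \<open>ot_le_inter\<close> and \<open>ot_lt_inter\<close> bound the types
  of sumsets.
\<close>
lemma less_mod_plus:
  assumes V: "convex_subgroup V" and "less_mod V (a' + b') (a + b)"
  shows "less_mod V a' a \<or> less_mod V b' b"
proof (rule ccontr)
  assume "\<not> ?thesis"
  then obtain v w where "v \<in> V" "0 \<le> v" "a \<le> a' + v" "w \<in> V" "0 \<le> w" "b \<le> b' + w"
    using not_less_mod_bound[OF V] by meson
  moreover have "a' + b' + (v + w) < a + b"
    by (rule less_mod_not_le[OF assms]) (use calculation cs_add[OF V] in auto)
  ultimately show False by linarith
qed

lemma less_mod_perturb:
  assumes V: "convex_subgroup V" and "less_mod V a' a" "a - b \<in> V" "a' - b' \<in> V"
  shows "less_mod V b' b"
proof -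
  have "\<not> b \<le> b'"
  proof
    assume "b \<le> b'"
    have "\<bar>(a - b) - (a' - b')\<bar> \<in> V"
      using cs_convex[OF V cs_diff[OF V assms(3,4)]] by simp
    from less_mod_not_le[OF V assms(2) this] have "a' + \<bar>(a - b) - (a' - b')\<bar> < a" by simp
    with \<open>b \<le> b'\<close> show False by linarith
  qed
  moreover have "b - b' \<notin> V"
  proof
    assume "b - b' \<in> V"
    then have "(b - b') + ((a - b) - (a' - b')) \<in> V" using cs_add[OF V] cs_diff[OF V assms(3,4)] by blast
    then show False using assms(2) by (simp add: less_mod_def)
  qed
  ultimately show ?thesis by (simp add: less_mod_def)
qed

lemma less_mod_irrefl: "\<not> less_mod V a a"
  by (simp add: less_mod_def)

lemma transp_arch: "transp arch"
proof (rule transpI)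
  fix a b c :: 'a assume *: "arch a b" "arch b c"
  show "arch a c" unfolding arch_def
  proof
    fix n :: nat
    have "of_nat n * a < b" "of_nat 1 * b < c" using * unfolding arch_def by blast+
    then show "of_nat n * a < c" by simp
  qed
qed

lemma not_arch_iff: "\<not> arch a b \<longleftrightarrow> (\<exists>n::nat. b \<le> of_nat n * a)"
  by (auto simp: arch_def not_less)

inductive_set fsums :: "'a::linordered_field set \<Rightarrow> 'a set" for C where
  zero: "0 \<in> fsums C"
| add: "h \<in> C \<Longrightarrow> y \<in> fsums C \<Longrightarrow> h + y \<in> fsums C"

lemma fsums_mono: "C \<subseteq> D \<Longrightarrow> fsums C \<subseteq> fsums D"
proof
  fix y assume "C \<subseteq> D" "y \<in> fsums C"
  from this(2,1) show "y \<in> fsums D" by induction (auto intro: fsums.intros)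
qed

lemma fsums_incl: "h \<in> C \<Longrightarrow> h \<in> fsums C"
  using fsums.add[OF _ fsums.zero] by simp

lemma fsums_plus: "a \<in> fsums C \<Longrightarrow> b \<in> fsums C \<Longrightarrow> a + b \<in> fsums C"
  by (induction rule: fsums.induct) (auto intro: fsums.intros simp: add.assoc)

lemma fsums_empty [simp]: "fsums {} = {0}"
proof -
  have "y = 0" if "y \<in> fsums {}" for y :: 'a using that by induction auto
  then show ?thesis using fsums.zero by auto
qed

lemma fsums_nonneg: "y \<in> fsums C \<Longrightarrow> (\<And>h. h \<in> C \<Longrightarrow> 0 < h) \<Longrightarrow> 0 \<le> y"
  by (induction rule: fsums.induct) (auto intro: add_nonneg_nonneg less_imp_le)

lemma fsums_subgroup: "convex_subgroup V \<Longrightarrow> C \<subseteq> V \<Longrightarrow> y \<in> fsums C \<Longrightarrow> y \<in> V"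
  by (rotate_tac 2, induction rule: fsums.induct) (auto intro: cs_zero cs_add)

lemma fsums_Un: "y \<in> fsums (A \<union> B) \<Longrightarrow> \<exists>a\<in>fsums A. \<exists>b\<in>fsums B. y = a + b"
proof (induction rule: fsums.induct)
  case zero
  show ?case using fsums.zero by force
next
  case (add h y)
  then obtain a b where ab: "a \<in> fsums A" "b \<in> fsums B" "y = a + b" by blast
  from add.hyps(1) consider "h \<in> A" | "h \<in> B" by blast
  then show ?case
  proof cases
    case 1
    then have "h + a \<in> fsums A" using ab by (auto intro: fsums.add)
    then show ?thesis using ab by (metis add.assoc)
  next
    case 2
    then have "h + b \<in> fsums B" using ab by (auto intro: fsums.add)
    then show ?thesis using ab by (metis add.left_commute)
  qed
qed

text \<open>
  The largest summand determines the magnitude of a sum, so the archimedean classes of sums are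
  those of the summands.
\<close>
lemma fsums_lead:
  assumes "y \<in> fsums C" "\<And>h. h \<in> C \<Longrightarrow> 0 < h" "y \<noteq> 0"
  shows "\<exists>h\<in>C. h \<le> y \<and> (\<exists>n::nat. y \<le> of_nat n * h)"
  using assms
proof (induction rule: fsums.induct)
  case (add h y)
  show ?case
  proof (cases "y = 0")
    case True
    then show ?thesis using add.hyps by (intro bexI[of _ h]) (auto intro: exI[of _ "1::nat"])
  next
    case False
    with add.IH add.prems obtain h' n where h': "h' \<in> C" "h' \<le> y" "y \<le> of_nat n * h'" by blast
    have pos: "0 < h" "0 < h'" "0 \<le> y"
      using add.hyps add.prems(1) h'(1) fsums_nonneg[OF add.hyps(2)] by blast+
    show ?thesis
    proof (cases "h \<le> h'")
      case True
      have "h + y \<le> of_nat (Suc n) * h'" using True h' by (simp add: algebra_simps)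
      then show ?thesis using h' pos by (intro bexI[of _ h']) (auto intro: exI[of _ "Suc n"])
    next
      case False
      then have "of_nat n * h' \<le> of_nat n * h" by (intro mult_left_mono) auto
      then have "h + y \<le> of_nat (Suc n) * h" using h' by (simp add: algebra_simps)
      then show ?thesis using add.hyps pos by (intro bexI[of _ h]) (auto intro: exI[of _ "Suc n"])
    qed
  qed
qed simp

lemma sumset_choice:
  obtains p q where "\<And>y. y \<in> {a + b |a b. a \<in> A \<and> b \<in> B} \<Longrightarrow> p y \<in> A"
    "\<And>y. y \<in> {a + b |a b. a \<in> A \<and> b \<in> B} \<Longrightarrow> q y \<in> B"
    "\<And>y. y \<in> {a + b |a b. a \<in> A \<and> b \<in> B} \<Longrightarrow> y = p y + (q y :: 'a::plus)"
proof -
  have "\<forall>y\<in>{a + b |a b. a \<in> A \<and> b \<in> B}. \<exists>p. fst p \<in> A \<and> snd p \<in> B \<and> y = fst p + snd p" by force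
  from bchoice[OF this] obtain r where
    "\<forall>y\<in>{a + b |a b. a \<in> A \<and> b \<in> B}. fst (r y) \<in> A \<and> snd (r y) \<in> B \<and> y = fst (r y) + snd (r y)" ..
  then show ?thesis using that[of "\<lambda>y. fst (r y)" "\<lambda>y. snd (r y)"] by blast
qed

lemma ot_le_sumset:
  assumes V: "convex_subgroup V" and "ot_le (less_mod V) d1 A" "ot_le (less_mod V) d2 B"
  shows "ot_le (less_mod V) (d1 + d2) {a + b |a b. a \<in> A \<and> b \<in> B}"
proof -
  obtain p q where pq: "\<And>y. y \<in> {a + b |a b. a \<in> A \<and> b \<in> B} \<Longrightarrow> p y \<in> A"
    "\<And>y. y \<in> {a + b |a b. a \<in> A \<and> b \<in> B} \<Longrightarrow> q y \<in> B"
    "\<And>y. y \<in> {a + b |a b. a \<in> A \<and> b \<in> B} \<Longrightarrow> y = p y + q y"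
    by (rule sumset_choice[of A B]) (rule that)
  show ?thesis
  proof (rule ot_le_inter)
    show "ot_le (\<lambda>y z. less_mod V (p y) (p z)) d1 {a + b |a b. a \<in> A \<and> b \<in> B}"
      by (rule ot_le_pullback[OF assms(2), of _ p]) (fact pq(1))
    show "ot_le (\<lambda>y z. less_mod V (q y) (q z)) d2 {a + b |a b. a \<in> A \<and> b \<in> B}"
      by (rule ot_le_pullback[OF assms(3), of _ q]) (fact pq(2))
    show "less_mod V (p y) (p z) \<or> less_mod V (q y) (q z)"
      if "y \<in> {a + b |a b. a \<in> A \<and> b \<in> B}" "z \<in> {a + b |a b. a \<in> A \<and> b \<in> B}" "less_mod V y z" for y z
      using less_mod_plus[OF V, of "p y" "q y" "p z" "q z"] pq(3)[OF that(1)] pq(3)[OF that(2)] that(3) by simp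
  qed
qed

lemma ot_lt_sumset:
  assumes V: "convex_subgroup V" and "ot_lt (less_mod V) (\<omega> \<beta>) A" "ot_lt (less_mod V) (\<omega> \<beta>) B"
  shows "ot_lt (less_mod V) (\<omega> \<beta>) {a + b |a b. a \<in> A \<and> b \<in> B}"
proof -
  obtain p q where pq: "\<And>y. y \<in> {a + b |a b. a \<in> A \<and> b \<in> B} \<Longrightarrow> p y \<in> A"
    "\<And>y. y \<in> {a + b |a b. a \<in> A \<and> b \<in> B} \<Longrightarrow> q y \<in> B"
    "\<And>y. y \<in> {a + b |a b. a \<in> A \<and> b \<in> B} \<Longrightarrow> y = p y + q y"
    by (rule sumset_choice[of A B]) (rule that)
  show ?thesis
  proof (rule ot_lt_inter)
    show "ot_lt (\<lambda>y z. less_mod V (p y) (p z)) (\<omega> \<beta>) {a + b |a b. a \<in> A \<and> b \<in> B}"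
      by (rule ot_lt_pullback[OF assms(2), of _ p]) (fact pq(1))
    show "ot_lt (\<lambda>y z. less_mod V (q y) (q z)) (\<omega> \<beta>) {a + b |a b. a \<in> A \<and> b \<in> B}"
      by (rule ot_lt_pullback[OF assms(3), of _ q]) (fact pq(2))
    show "less_mod V (p y) (p z) \<or> less_mod V (q y) (q z)"
      if "y \<in> {a + b |a b. a \<in> A \<and> b \<in> B}" "z \<in> {a + b |a b. a \<in> A \<and> b \<in> B}" "less_mod V y z" for y z
      using less_mod_plus[OF V, of "p y" "q y" "p z" "q z"] pq(3)[OF that(1)] pq(3)[OF that(2)] that(3) by simp
  qed
qed

lemma ot_le_singleton: "\<not> R a a \<Longrightarrow> ot_le R d {a}"
proof -
  assume a: "\<not> R a a"
  show ?thesis unfolding ot_le_iff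
  proof
    fix z assume "z \<in> {a}"
    with a have "{y \<in> {a}. R y z} = {}" by auto
    then show "ot_lt R d {y \<in> {a}. R y z}" by (simp only: ot_lt_empty)
  qed
qed

lemma ot_lt_singleton: "\<not> R a a \<Longrightarrow> 0 < d \<Longrightarrow> ot_lt R d {a}"
  by (rule ot_le_imp_lt[OF ot_le_singleton])

lemma ot_le_minimal:
  assumes "transp R" "ot_le R d A" "X \<subseteq> A" "X \<noteq> {}"
  shows "\<exists>m\<in>X. \<forall>y\<in>X. \<not> R y m"
proof -
  obtain \<rho> where \<rho>: "\<forall>a\<in>A. \<forall>b\<in>A. R a b \<longrightarrow> \<rho> a < (\<rho> b :: ord)"
    using ot_le_rank[OF assms(1,2)] by blast
  define m where "m = (LEAST r. r \<in> \<rho> ` X)"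
  have "m \<in> \<rho> ` X" unfolding m_def using assms(4) by (metis LeastI ex_in_conv imageI)
  then obtain x where x: "x \<in> X" "m = \<rho> x" by blast
  have "m \<le> \<rho> y" if "y \<in> X" for y unfolding m_def by (rule Least_le) (use that in auto)
  then have "\<not> R y x" if "y \<in> X" for y
    using that x \<rho> assms(3) leD by blast
  then show ?thesis using x by blast
qed

primrec msum :: "'a::linordered_field set \<Rightarrow> nat \<Rightarrow> 'a set" where
  "msum X 0 = {0}"
| "msum X (Suc m) = {h + y |h y. h \<in> X \<and> y \<in> msum X m}"

lemma ot_lt_msum:
  assumes "convex_subgroup V" "ot_lt (less_mod V) (\<omega> \<beta>) X"
  shows "ot_lt (less_mod V) (\<omega> \<beta>) (msum X m)"
proof (induction m)
  case 0
  show ?case by (simp add: ot_lt_singleton less_mod_irrefl)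
next
  case (Suc m)
  from ot_lt_sumset[OF assms(1,2) Suc] show ?case by simp
qed

text \<open>
  A sum below \<open>z\<close>, where \<open>z\<close> has the magnitude of \<open>h \<in>
  C\<close>, consists of a bounded number of summands in the archimedean class of \<open>h\<close>
  and a sum of elements of smaller classes. The former belongs to a finite sumset of the class,
  whose type modulo \<open>V\<close> stays below \<open>\<omega>\<^bsup>\<omega>
  \<beta>\<^esup>\<close>. The smaller classes are covered by finitely many sets to which the
  induction on the type of the archimedean classes applies.
\<close>
lemma ot_le_sums:
  assumes V: "convex_subgroup V"
  shows "(\<And>h. h \<in> C \<Longrightarrow> 0 < h) \<Longrightarrow> C \<inter> V = {} \<Longrightarrow> ot_le arch \<delta> C \<Longrightarrow>
    (\<And>h. h \<in> C \<Longrightarrow> ot_lt (less_mod V) (\<omega> \<beta>) {c \<in> C. sim c h}) \<Longrightarrow>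
    ot_le (less_mod V) (\<omega> (\<beta> + \<delta>)) (fsums C)"
proof (induction \<delta> arbitrary: C rule: less_induct)
  case (less \<delta>)
  show ?case unfolding ot_le_iff
  proof
    fix z assume z: "z \<in> fsums C"
    show "ot_lt (less_mod V) (\<omega> (\<beta> + \<delta>)) {y \<in> fsums C. less_mod V y z}"
    proof (cases "z = 0")
      case True
      have eq: "{y \<in> fsums C. less_mod V y z} = {}"
        using True fsums_nonneg[of _ C] less.prems(1) by (force simp: less_mod_def)
      show ?thesis unfolding eq by (rule ot_lt_empty)
    next
      case False
      obtain h k where h: "h \<in> C" "h \<le> z" "z \<le> of_nat k * h"
        using fsums_lead[OF z less.prems(1) False] by blast
      have hpos: "0 < h" using less.prems(1) h by blast
      define X where "X = {c \<in> C. sim c h}"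
      define Y where "Y = {c \<in> C. arch c h}"
      have X: "ot_lt (less_mod V) (\<omega> \<beta>) X" unfolding X_def by (rule less.prems(4)[OF h(1)])
      have "\<not> arch h h" unfolding arch_def by (auto intro: exI[of _ "1::nat"])
      then have "h \<in> X" using h(1) by (simp add: X_def)
      then obtain hm where hm: "hm \<in> X" "\<forall>y\<in>X. \<not> less_mod V y hm"
        using ot_le_minimal[OF transp_less_mod[OF V] ot_lt_imp_le[OF X] order_refl] by blast
      have hmV: "hm \<notin> V" "0 < hm" "\<not> arch hm h" using hm(1) less.prems(1,2) by (auto simp: X_def)
      \<comment> \<open>No element of the class is smaller than \<open>hm\<close> modulo \<open>V\<close>, and half of \<open>hm\<close> is not in \<open>V\<close>.\<close>
      have half: "hm \<le> 2 * c" if "c \<in> X" for c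
      proof (rule ccontr)
        assume "\<not> hm \<le> 2 * c"
        then have c: "2 * c < hm" by simp
        have "0 < c" using that less.prems(1) by (auto simp: X_def)
        with c have "c < hm" by linarith
        with hm(2) that have "hm - c \<in> V" by (auto simp: less_mod_def)
        from cs_nat[OF V this, of 2] have "2 * (hm - c) \<in> V" by simp
        moreover have "\<bar>hm\<bar> \<le> \<bar>2 * (hm - c)\<bar>" using c \<open>c < hm\<close> hmV(2) by simp
        ultimately show False using cs_convex[OF V] hmV(1) by blast
      qed
      from hmV(3) obtain n :: nat where n: "h \<le> of_nat n * hm" by (auto simp: arch_def not_less)
      have split: "\<exists>m. \<exists>a\<in>msum X m. \<exists>b\<in>fsums Y. y = a + b"
        if "y \<in> fsums C" "y \<le> of_nat k * h" for y
        using that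
      proof (induction rule: fsums.induct)
        case zero
        show ?case by (intro exI[of _ 0]) (auto intro: fsums.zero)
      next
        case (add c y)
        have "0 \<le> y" "0 < c" using fsums_nonneg[OF add.hyps(2)] less.prems(1) add.hyps(1) by blast+
        with add.prems have le: "y \<le> of_nat k * h" "c \<le> of_nat k * h" by linarith+
        with add.IH obtain m a b where ab: "a \<in> msum X m" "b \<in> fsums Y" "y = a + b" by blast
        have "\<not> arch h c" using le(2) by (auto simp: arch_def not_less)
        then consider "c \<in> X" | "c \<in> Y" using add.hyps(1) unfolding X_def Y_def by blast
        then show ?case
        proof cases
          case 1
          then have "c + a \<in> msum X (Suc m)" using ab by auto
          then show ?thesis using ab by (metis add.assoc)
        next
          case 2
          then have "c + b \<in> fsums Y" using ab by (auto intro: fsums.add)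
          then show ?thesis using ab by (metis add.left_commute)
        qed
      qed
      have msum_ge: "of_nat m * hm \<le> 2 * a" if "a \<in> msum X m" for m a
        using that
      proof (induction m arbitrary: a)
        case (Suc m)
        then obtain c y where "c \<in> X" "y \<in> msum X m" "a = c + y" by auto
        with Suc.IH[of y] half[of c] show ?case by (simp add: algebra_simps)
      qed simp
      \<comment> \<open>By \<open>half\<close>, a sum of \<open>m\<close> elements of the class is at least \<open>m * hm / 2\<close>; it is below \<open>z \<le> k * h \<le> k * n * hm\<close>.\<close>
      define M where "M = 2 * (k * n)"
      have cover: "{y \<in> fsums C. less_mod V y z} \<subseteq> (\<Union>m\<in>{..M}. {a + b |a b. a \<in> msum X m \<and> b \<in> fsums Y})"
      proof
        fix y assume "y \<in> {y \<in> fsums C. less_mod V y z}"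
        then have y: "y \<in> fsums C" "y < z" by (auto simp: less_mod_def)
        with h split obtain m a b where ab: "a \<in> msum X m" "b \<in> fsums Y" "y = a + b"
          by (meson less_le_trans less_imp_le)
        have "0 \<le> b" by (rule fsums_nonneg[OF ab(2)]) (use less.prems(1) in \<open>auto simp: Y_def\<close>)
        then have "a < z" using ab y by simp
        have "of_nat k * h \<le> of_nat k * (of_nat n * hm)" by (rule mult_left_mono) (use n in auto)
        then have "of_nat m * hm \<le> of_nat M * hm"
          using msum_ge[OF ab(1)] \<open>a < z\<close> h(3) by (simp add: M_def algebra_simps)
        then have "m \<le> M" using hmV(2) by simp
        then show "y \<in> (\<Union>m\<in>{..M}. {a + b |a b. a \<in> msum X m \<and> b \<in> fsums Y})" using ab by blast
      qed
      obtain \<B> where \<B>: "finite \<B>" "Y \<subseteq> \<Union>\<B>" "\<forall>B\<in>\<B>. \<exists>d'<\<delta>. ot_le arch d' B"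
        using ot_leD[OF less.prems(3) h(1)] unfolding Y_def by blast
      from \<B>(1,3) have "\<exists>d<\<omega> (\<beta> + \<delta>). ot_le (less_mod V) d (fsums (C \<inter> \<Union>\<B>))"
      proof (induction \<B> rule: finite_induct)
        case empty
        have "ot_le (less_mod V) 0 {0}" by (rule ot_le_singleton) (simp add: less_mod_irrefl)
        then show ?case by (intro exI[of _ 0]) simp
      next
        case (insert B \<B>)
        then obtain d where d: "d < \<omega> (\<beta> + \<delta>)" "ot_le (less_mod V) d (fsums (C \<inter> \<Union>\<B>))" by auto
        from insert.prems obtain d' where d': "d' < \<delta>" "ot_le arch d' B" by auto
        have "ot_le (less_mod V) (\<omega> (\<beta> + d')) (fsums (C \<inter> B))"
        proof (rule less.IH[OF d'(1)])
          show "ot_le arch d' (C \<inter> B)" by (rule ot_le_subset[OF d'(2)]) auto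
          show "ot_lt (less_mod V) (\<omega> \<beta>) {c \<in> C \<inter> B. sim c h}" if "h \<in> C \<inter> B" for h
            by (rule ot_lt_subset[OF less.prems(4)[of h]]) (use that in auto)
        qed (use less.prems in auto)
        from ot_le_sumset[OF V this d(2)]
        have "ot_le (less_mod V) (\<omega> (\<beta> + d') + d) (fsums (C \<inter> \<Union>(insert B \<B>)))"
        proof (rule ot_le_subset)
          have "C \<inter> \<Union>(insert B \<B>) = (C \<inter> B) \<union> (C \<inter> \<Union>\<B>)" by auto
          then show "fsums (C \<inter> \<Union>(insert B \<B>)) \<subseteq> {a + b |a b. a \<in> fsums (C \<inter> B) \<and> b \<in> fsums (C \<inter> \<Union>\<B>)}"
            using fsums_Un by fastforce
        qed
        moreover have "\<omega> (\<beta> + d') + d < \<omega> (\<beta> + \<delta>)"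
          by (rule plus_less_omega) (use d d' in \<open>simp_all add: add_strict_left_mono\<close>)
        ultimately show ?case by blast
      qed
      then obtain d where d: "d < \<omega> (\<beta> + \<delta>)" "ot_le (less_mod V) d (fsums (C \<inter> \<Union>\<B>))" by blast
      have "ot_le (less_mod V) d (fsums Y)"
        by (rule ot_le_subset[OF d(2)], rule fsums_mono) (use \<B>(2) in \<open>auto simp: Y_def\<close>)
      then have sY: "ot_lt (less_mod V) (\<omega> (\<beta> + \<delta>)) (fsums Y)" by (rule ot_le_imp_lt[OF _ d(1)])
      have "\<omega> \<beta> \<le> \<omega> (\<beta> + \<delta>)" using add_left_mono[of 0 \<delta> \<beta>] by simp
      then have sX: "ot_lt (less_mod V) (\<omega> (\<beta> + \<delta>)) (msum X m)" for m
        by (rule ot_lt_mono[OF ot_lt_msum[OF V X]])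
      have "ot_lt (less_mod V) (\<omega> (\<beta> + \<delta>)) (\<Union>m\<in>{..M}. {a + b |a b. a \<in> msum X m \<and> b \<in> fsums Y})"
        by (intro ot_lt_UN ot_lt_sumset V sX sY) simp
      then show ?thesis by (rule ot_lt_subset[OF _ cover])
    qed
  qed
qed

text \<open>
  Let \<open>W\<close> be a coarser precision, at which no element of \<open>C\<close> is
  negligible. Up to \<open>W\<close>, a sum near \<open>z\<close> is composed of a first summand and
  a remainder in finitely many ways, by Dickson's lemma for the ranks of both parts; the remainder
  is smaller than \<open>z\<close> modulo \<open>W\<close>. So, by induction on the rank of
  \<open>z\<close>, a \<open>W\<close>-window of sums is no more complicated than
  \<open>W\<close>-windows of summands.
\<close>
lemma ot_lt_sums_window:
  assumes V: "convex_subgroup V" and W: "convex_subgroup W"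
    and pos: "\<And>h. h \<in> C \<Longrightarrow> 0 < h" and CW: "C \<inter> W = {}"
    and wo: "ot_le (less_mod W) d0 (fsums C)"
    and window: "\<And>h. h \<in> C \<Longrightarrow> ot_lt (less_mod V) (\<omega> \<beta>) {c \<in> C. c - h \<in> W}"
  shows "ot_lt (less_mod V) (\<omega> \<beta>) {y \<in> fsums C. y - z \<in> W}"
proof -
  obtain \<rho> where \<rho>: "\<forall>a\<in>fsums C. \<forall>b\<in>fsums C. less_mod W a b \<longrightarrow> \<rho> a < (\<rho> b :: ord)"
    using ot_le_rank[OF transp_less_mod[OF W] wo] by blast
  have main: "ot_lt (less_mod V) (\<omega> \<beta>) {y \<in> fsums C. y - z \<in> W}" if "z \<in> fsums C" for z
    using that
  proof (induction "\<rho> z" arbitrary: z rule: less_induct)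
    case less
    define T where "T = {p. fst p \<in> C \<and> snd p \<in> fsums C \<and> fst p + snd p - z \<in> W}"
    obtain F where F: "F \<subseteq> T" "finite F"
        "\<forall>p\<in>T. \<exists>q\<in>F. \<rho> (fst q) \<le> \<rho> (fst p) \<and> \<rho> (snd q) \<le> \<rho> (snd p)"
      using dickson_pair[of T "\<lambda>p. \<rho> (fst p)" "\<lambda>p. \<rho> (snd p)"] by blast
    have sub: "{y \<in> fsums C. y - z \<in> W} \<subseteq> {0} \<union> (\<Union>q\<in>F. {a + b |a b.
        a \<in> {c \<in> C. c - fst q \<in> W} \<and> b \<in> {y \<in> fsums C. y - snd q \<in> W}})"
    proof
      fix y assume y: "y \<in> {y \<in> fsums C. y - z \<in> W}"
      then have "y \<in> fsums C" by simp
      then show "y \<in> {0} \<union> (\<Union>q\<in>F. {a + b |a b.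
        a \<in> {c \<in> C. c - fst q \<in> W} \<and> b \<in> {y \<in> fsums C. y - snd q \<in> W}})"
      proof cases
        case (add h y')
        then have "(h, y') \<in> T" using y by (simp add: T_def)
        then obtain q where q: "q \<in> F" "\<rho> (fst q) \<le> \<rho> h" "\<rho> (snd q) \<le> \<rho> y'" using F(3) by force
        then have qT: "fst q \<in> C" "snd q \<in> fsums C" "fst q + snd q - z \<in> W" using F(1) by (auto simp: T_def)
        have n1: "\<not> less_mod W h (fst q)" using \<rho> q(2) add(2) qT(1) fsums_incl by (metis leD)
        have n2: "\<not> less_mod W y' (snd q)" using \<rho> q(3) add(3) qT(2) by (metis leD)
        have d: "(h + y' - z) - (fst q + snd q - z) \<in> W" using cs_diff[OF W] y add qT by blast
        have "h - fst q \<in> W"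
        proof -
          obtain v where v: "v \<in> W" "0 \<le> v" "snd q \<le> y' + v" using not_less_mod_bound[OF W n2] by blast
          obtain v' where v': "v' \<in> W" "0 \<le> v'" "fst q \<le> h + v'" using not_less_mod_bound[OF W n1] by blast
          let ?D = "(h + y' - z) - (fst q + snd q - z)"
          have "\<bar>?D\<bar> + v + v' \<in> W" using cs_add[OF W] v v' d cs_convex[OF W d, of "\<bar>?D\<bar>"] by simp
          then show ?thesis
            by (rule cs_convex[OF W]) (use v v' in linarith)
        qed
        moreover have "y' - snd q \<in> W"
          using cs_diff[OF W d calculation] by (simp add: algebra_simps)
        ultimately show ?thesis using q add by blast
      qed simp
    qed
    have "ot_lt (less_mod V) (\<omega> \<beta>) {0}" by (rule ot_lt_singleton) (auto simp: less_mod_irrefl)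
    moreover have "ot_lt (less_mod V) (\<omega> \<beta>) (\<Union>q\<in>F. {a + b |a b.
        a \<in> {c \<in> C. c - fst q \<in> W} \<and> b \<in> {y \<in> fsums C. y - snd q \<in> W}})"
    proof (intro ot_lt_UN F(2) ot_lt_sumset V)
      fix q assume "q \<in> F"
      then have qT: "fst q \<in> C" "snd q \<in> fsums C" "fst q + snd q - z \<in> W" using F(1) by (auto simp: T_def)
      show "ot_lt (less_mod V) (\<omega> \<beta>) {c \<in> C. c - fst q \<in> W}" by (rule window[OF qT(1)])
      have "less_mod W (snd q) z"
      proof -
        have "fst q \<notin> W" "0 < fst q" using CW pos qT(1) by auto
        moreover have "z - snd q \<in> W \<Longrightarrow> fst q \<in> W"
          using cs_add[OF W qT(3), of "z - snd q"] by simp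
        moreover have "z \<le> snd q \<Longrightarrow> fst q \<in> W"
          by (rule cs_convex[OF W qT(3)]) (use \<open>0 < fst q\<close> in auto)
        ultimately show ?thesis unfolding less_mod_def using not_le by blast
      qed
      then have "\<rho> (snd q) < \<rho> z" using \<rho> qT(2) less.prems by blast
      then show "ot_lt (less_mod V) (\<omega> \<beta>) {y \<in> fsums C. y - snd q \<in> W}" using less.hyps qT(2) by blast
    qed
    ultimately show ?case by (intro ot_lt_subset[OF ot_lt_Un sub])
  qed
  show ?thesis
  proof (cases "{y \<in> fsums C. y - z \<in> W} = {}")
    case False
    then obtain y0 where y0: "y0 \<in> fsums C" "y0 - z \<in> W" by blast
    have "{y \<in> fsums C. y - z \<in> W} \<subseteq> {y \<in> fsums C. y - y0 \<in> W}"
      using cs_diff[OF W _ y0(2)] by fastforce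
    then show ?thesis by (rule ot_lt_subset[OF main[OF y0(1)]])
  next
    case True
    show ?thesis unfolding True by (rule ot_lt_empty)
  qed
qed

text \<open>
  A sum is split into the summands beyond \<open>W\<close>, treated with windows, those between
  \<open>V\<close> and \<open>W\<close>, whose archimedean classes are counted by \<open>a\<close>,
  and a negligible rest in \<open>V\<close>.
\<close>
lemma ot_lt_sums_two_scales:
  assumes V: "convex_subgroup V" and W: "convex_subgroup W" and VW: "V \<subseteq> W"
    and pos: "\<And>h. h \<in> C \<Longrightarrow> 0 < h"
    and wo: "ot_le (less_mod W) d0 (fsums (C - W))"
    and cls: "\<And>h. h \<in> C \<Longrightarrow> h \<notin> V \<Longrightarrow> ot_lt (less_mod V) (\<omega> \<beta>) {c \<in> C. sim c h \<and> c - h \<in> W}"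
    and arch: "ot_le arch a (C \<inter> W - V)"
  shows "ot_lt (less_mod V) (\<omega> (\<beta> + a + \<omega> 0)) {f \<in> fsums C. f - z \<in> W}"
proof -
  let ?b = "\<beta> + a + \<omega> 0"
  have lt: "\<beta> + a < ?b" using add_strict_left_mono[OF zero_less_omega, of "\<beta> + a" 0] by simp
  moreover have "\<beta> \<le> \<beta> + a" using add_left_mono[of 0 a \<beta>] by simp
  ultimately have le: "\<omega> \<beta> \<le> \<omega> ?b" by simp
  have big: "ot_lt (less_mod V) (\<omega> ?b) {y \<in> fsums (C - W). y - z \<in> W}"
  proof (rule ot_lt_mono[OF _ le], rule ot_lt_sums_window[OF V W _ _ wo])
    fix h assume h: "h \<in> C - W"
    have "{c \<in> C - W. c - h \<in> W} \<subseteq> {c \<in> C. sim c h \<and> c - h \<in> W}"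
    proof
      fix c assume c: "c \<in> {c \<in> C - W. c - h \<in> W}"
      have half: "a \<le> 2 * b" if "a \<in> C - W" "b \<in> C" "b - a \<in> W" for a b
      proof (rule ccontr)
        assume "\<not> a \<le> 2 * b"
        moreover have "0 < a" "0 < b" using pos that by blast+
        ultimately have "\<bar>a\<bar> \<le> \<bar>of_nat 2 * (b - a)\<bar>" by (simp add: abs_if)
        then have "a \<in> W" using cs_convex[OF W cs_nat[OF W that(3)]] by blast
        then show False using that by simp
      qed
      have "h \<le> 2 * c" "c \<le> 2 * h" using half h c cs_minus_commute[OF W] by auto
      then have "sim c h" unfolding arch_def by (metis leD of_nat_numeral)
      then show "c \<in> {c \<in> C. sim c h \<and> c - h \<in> W}" using c by simp
    qed
    then show "ot_lt (less_mod V) (\<omega> \<beta>) {c \<in> C - W. c - h \<in> W}"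
      by (rule ot_lt_subset[OF cls[of h], rotated 2]) (use h VW in auto)
  qed (use pos in auto)
  have "ot_le (less_mod V) (\<omega> (\<beta> + a)) (fsums (C \<inter> W - V))"
  proof (rule ot_le_sums[OF V _ _ arch])
    fix h assume h: "h \<in> C \<inter> W - V"
    show "ot_lt (less_mod V) (\<omega> \<beta>) {c \<in> C \<inter> W - V. sim c h}"
      by (rule ot_lt_subset[OF cls[of h]]) (use h cs_diff[OF W] in auto)
  qed (use pos in auto)
  then have mid: "ot_lt (less_mod V) (\<omega> ?b) (fsums (C \<inter> W - V))"
    by (rule ot_le_imp_lt) (use lt in simp)
  have "\<forall>f\<in>fsums C. \<exists>b\<in>fsums (C - W). \<exists>m\<in>fsums (C \<inter> W - V). f - (b + m) \<in> V"
  proof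
    fix f assume f: "f \<in> fsums C"
    have eq: "C = (C - W) \<union> ((C \<inter> W - V) \<union> (C \<inter> V))" using VW by blast
    from f obtain b r where 1: "b \<in> fsums (C - W)" "r \<in> fsums ((C \<inter> W - V) \<union> (C \<inter> V))" "f = b + r"
      using fsums_Un eq by metis
    from fsums_Un[OF 1(2)] obtain m v where 2: "m \<in> fsums (C \<inter> W - V)" "v \<in> fsums (C \<inter> V)" "r = m + v" by blast
    have "v \<in> V" by (rule fsums_subgroup[OF V _ 2(2)]) auto
    then show "\<exists>b\<in>fsums (C - W). \<exists>m\<in>fsums (C \<inter> W - V). f - (b + m) \<in> V"
      using 1 2 by (intro bexI[of _ b] bexI[of _ m]) auto
  qed
  then have "\<exists>b m. \<forall>f\<in>fsums C. b f \<in> fsums (C - W) \<and> m f \<in> fsums (C \<inter> W - V) \<and> f - (b f + m f) \<in> V"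
    by metis
  then obtain b m where bm: "\<And>f. f \<in> fsums C \<Longrightarrow> b f \<in> fsums (C - W)"
     "\<And>f. f \<in> fsums C \<Longrightarrow> m f \<in> fsums (C \<inter> W - V)" "\<And>f. f \<in> fsums C \<Longrightarrow> f - (b f + m f) \<in> V" by blast
  have mW: "m f \<in> W" if "f \<in> fsums C" for f
    by (rule fsums_subgroup[OF W _ bm(2)[OF that]]) auto
  let ?A = "{f \<in> fsums C. f - z \<in> W}"
  show ?thesis
  proof (rule ot_lt_inter)
    show "ot_lt (\<lambda>f g. less_mod V (b f) (b g)) (\<omega> ?b) ?A"
    proof (rule ot_lt_pullback[OF big, of _ b])
      fix f assume f: "f \<in> ?A"
      then have "(f - z) - (f - (b f + m f)) - m f \<in> W" using bm(3) mW VW cs_diff[OF W] by blast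
      then show "b f \<in> {y \<in> fsums (C - W). y - z \<in> W}" using bm(1) f by simp
    qed
    show "ot_lt (\<lambda>f g. less_mod V (m f) (m g)) (\<omega> ?b) ?A"
      by (rule ot_lt_pullback[OF mid, of _ m]) (use bm(2) in auto)
    show "less_mod V (b f) (b g) \<or> less_mod V (m f) (m g)" if "f \<in> ?A" "g \<in> ?A" "less_mod V f g" for f g
      by (rule less_mod_plus[OF V], rule less_mod_perturb[OF V that(3)]) (use bm(3) that in auto)
  qed
qed

text \<open>
  A crude bound, used only to have some rank for the well-founded inductions above.
\<close>
lemma ot_le_sums_wellorder:
  assumes W: "convex_subgroup W" and pos: "\<And>h. h \<in> C \<Longrightarrow> 0 < h" and "ot_le (<) d C"
  shows "ot_le (less_mod W) (\<omega> (d + \<omega> 0 + d)) (fsums (C - W))"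
proof -
  have "d + 0 < d + \<omega> 0" by (rule add_strict_left_mono) simp
  then have lt: "d < \<omega> (d + \<omega> 0)"
    using le_omega[of d] by (metis add.right_neutral omega_less_iff order_le_less_trans)
  show ?thesis
  proof (rule ot_le_sums[OF W])
    show "ot_le arch d (C - W)"
    proof (rule ot_le_pullback[OF assms(3), of _ "\<lambda>x. x"])
      fix a b assume "arch a b"
      then have "of_nat 1 * a < b" unfolding arch_def by blast
      then show "a < b" by simp
    qed auto
    show "ot_lt (less_mod W) (\<omega> (d + \<omega> 0)) {c \<in> C - W. sim c h}" for h
      by (rule ot_le_imp_lt[OF _ lt], rule ot_le_pullback[OF assms(3), of _ "\<lambda>x. x"]) (auto simp: less_mod_def)
  qed (use pos in auto)
qed

section \<open>Skolem functions in an ordered field with logarithms\<close>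

definition bigO :: "'a::linordered_field \<Rightarrow> 'a set" where
  "bigO e = {r. \<exists>n::nat. \<bar>r\<bar> \<le> of_nat n * e}"

text \<open>
  Allowing all powers of \<open>u\<close> makes this a convex subgroup that absorbs factors
  polynomial in \<open>u\<close>: a window of width \<open>u\<close> at precision \<open>e\<close>.
\<close>
definition window :: "'a::linordered_field \<Rightarrow> 'a \<Rightarrow> 'a set" where
  "window e u = {r. \<exists>n::nat. \<bar>r\<bar> \<le> e * u ^ n}"

lemma bigOI: "\<bar>r\<bar> \<le> of_nat n * e \<Longrightarrow> r \<in> bigO e"
  by (auto simp: bigO_def)

lemma windowI: "\<bar>r\<bar> \<le> e * u ^ n \<Longrightarrow> r \<in> window e u"
  by (auto simp: window_def)

lemma convex_subgroup_bigO:
  assumes "0 < e" shows "convex_subgroup (bigO e)"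
  unfolding convex_subgroup_def
proof (intro conjI ballI allI impI)
  show "0 \<in> bigO e" by (rule bigOI[of _ 0]) simp
  fix a assume "a \<in> bigO e"
  then obtain n where n: "\<bar>a\<bar> \<le> of_nat n * e" by (auto simp: bigO_def)
  { fix b assume "b \<in> bigO e"
    then obtain m where m: "\<bar>b\<bar> \<le> of_nat m * e" by (auto simp: bigO_def)
    have "\<bar>a - b\<bar> \<le> of_nat (n + m) * e"
      using n m abs_triangle_ineq4[of a b] by (simp add: algebra_simps)
    then show "a - b \<in> bigO e" by (rule bigOI) }
  fix b assume "\<bar>b\<bar> \<le> \<bar>a\<bar>"
  then show "b \<in> bigO e" using n by (intro bigOI[of _ n]) simp
qed

lemma convex_subgroup_window:
  assumes "0 < e" "2 \<le> u" shows "convex_subgroup (window e u)"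
  unfolding convex_subgroup_def
proof (intro conjI ballI allI impI)
  show "0 \<in> window e u" using assms by (intro windowI[of _ _ _ 0]) simp
  fix a assume "a \<in> window e u"
  then obtain n where n: "\<bar>a\<bar> \<le> e * u ^ n" by (auto simp: window_def)
  { fix b assume "b \<in> window e u"
    then obtain m where m: "\<bar>b\<bar> \<le> e * u ^ m" by (auto simp: window_def)
    have p: "u ^ n \<le> u ^ (n + m)" "u ^ m \<le> u ^ (n + m)" using assms by (auto intro: power_increasing)
    have "2 * u ^ (n + m) \<le> u * u ^ (n + m)" by (rule mult_right_mono) (use assms in auto)
    with p have "u ^ n + u ^ m \<le> u ^ Suc (n + m)" by simp
    then have "e * (u ^ n + u ^ m) \<le> e * u ^ Suc (n + m)" using assms by (intro mult_left_mono) auto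
    then have "\<bar>a - b\<bar> \<le> e * u ^ Suc (n + m)"
      using n m abs_triangle_ineq4[of a b] by (simp add: algebra_simps)
    then show "a - b \<in> window e u" by (rule windowI) }
  fix b assume "\<bar>b\<bar> \<le> \<bar>a\<bar>"
  then show "b \<in> window e u" using n by (intro windowI[of _ _ _ n]) simp
qed

lemma of_nat_le_power2:
  assumes "2 \<le> (u::'a::linordered_field)" shows "of_nat n \<le> u ^ n"
proof -
  have "(of_nat n :: 'a) \<le> of_nat (2 ^ n)" by (intro of_nat_mono less_imp_le less_exp)
  also have "\<dots> \<le> u ^ n" using power_mono[OF assms, of n] by simp
  finally show ?thesis .
qed

lemma bigO_subset_window:
  assumes "0 < e" "2 \<le> u" shows "bigO e \<subseteq> window e u"
proof
  fix r assume "r \<in> bigO e"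
  then obtain n where n: "\<bar>r\<bar> \<le> of_nat n * e" by (auto simp: bigO_def)
  have "of_nat n * e \<le> e * u ^ n" using of_nat_le_power2[OF assms(2), of n] assms(1) by (simp add: mult.commute)
  then show "r \<in> window e u" using n by (intro windowI[of _ _ _ n]) simp
qed

lemma bigO_mono: "e \<le> e' \<Longrightarrow> bigO e \<subseteq> bigO e'"
proof
  fix r assume "e \<le> e'" "r \<in> bigO e"
  then obtain n where n: "\<bar>r\<bar> \<le> of_nat n * e" by (auto simp: bigO_def)
  also have "\<dots> \<le> of_nat n * e'" using \<open>e \<le> e'\<close> by (intro mult_left_mono) auto
  finally show "r \<in> bigO e'" by (rule bigOI)
qed

lemma bigO_mult:
  assumes "v \<in> bigO (e / k)" "0 < k" "\<bar>b\<bar> \<le> of_nat m * k" "0 < e"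
  shows "b * v \<in> bigO e"
proof -
  obtain n where n: "\<bar>v\<bar> \<le> of_nat n * (e / k)" using assms(1) by (auto simp: bigO_def)
  have "\<bar>b * v\<bar> \<le> (of_nat m * k) * (of_nat n * (e / k))"
    unfolding abs_mult by (rule mult_mono[OF assms(3) n]) (use assms in auto)
  also have "\<dots> = of_nat (m * n) * e" using assms(2) by simp
  finally show ?thesis by (rule bigOI)
qed

lemma window_mult:
  assumes "v \<in> window (e / k) u" "0 < k" "\<bar>b\<bar> \<le> of_nat m * k" "0 < e" "2 \<le> u"
  shows "b * v \<in> window e u"
proof -
  obtain n where n: "\<bar>v\<bar> \<le> (e / k) * u ^ n" using assms(1) by (auto simp: window_def)
  have "\<bar>b * v\<bar> \<le> (of_nat m * k) * ((e / k) * u ^ n)"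
    unfolding abs_mult by (rule mult_mono[OF assms(3) n]) (use assms in auto)
  also have "\<dots> = e * (of_nat m * u ^ n)" using assms(2) by simp
  also have "\<dots> \<le> e * (u ^ m * u ^ n)"
    by (intro mult_left_mono mult_right_mono of_nat_le_power2) (use assms in auto)
  also have "\<dots> = e * u ^ (m + n)" by (simp add: power_add)
  finally show ?thesis by (rule windowI)
qed

inductive_set fprods :: "'a::linordered_field set \<Rightarrow> 'a set" for C where
  one: "1 \<in> fprods C"
| mult: "h \<in> C \<Longrightarrow> y \<in> fprods C \<Longrightarrow> h * y \<in> fprods C"

lemma fprods_times: "a \<in> fprods C \<Longrightarrow> b \<in> fprods C \<Longrightarrow> a * b \<in> fprods C"
  by (induction rule: fprods.induct) (auto intro: fprods.intros simp: mult.assoc)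

lemma fprods_incl: "h \<in> C \<Longrightarrow> h \<in> fprods C"
  using fprods.mult[OF _ fprods.one] by simp

lemma fsums_times:
  assumes mult: "\<And>a b. a \<in> C \<Longrightarrow> b \<in> C \<Longrightarrow> a * b \<in> C" and "y \<in> fsums C" "z \<in> fsums C"
  shows "y * z \<in> fsums C"
proof -
  have "h * z \<in> fsums C" if "h \<in> C" for h
    using assms(3)
  proof induction
    case (add c z)
    then show ?case using mult[OF that] by (auto intro: fsums.intros simp: distrib_left)
  qed (simp add: fsums.zero)
  with assms(2) show ?thesis
    by (induction rule: fsums.induct) (auto intro: fsums.zero fsums_plus simp: distrib_right)
qed

text \<open>
  The properties of the Skolem functions on which the upper bound rests. \<open>L\<close> is the
  logarithm and \<open>pw\<close> the power function. The inequality \<open>L_diff\<close> is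
  \<open>ln (g / f) \<le> g / f - 1\<close>, the constant in \<open>L_bounded\<close> comes from
  \<open>exp 1 \<le> 3\<close>, and \<open>gap\<close> says that no quotient of Skolem functions
  grows, however slowly, without exceeding every power of \<open>ln x\<close>.
\<close>
locale exp_field =
  fixes Sk :: "'a::linordered_field set" and L :: "'a \<Rightarrow> 'a" and pw :: "'a \<Rightarrow> 'a \<Rightarrow> 'a" and x :: 'a
  assumes Sk_one: "1 \<in> Sk" and Sk_x: "x \<in> Sk"
    and Sk_add: "f \<in> Sk \<Longrightarrow> g \<in> Sk \<Longrightarrow> f + g \<in> Sk"
    and Sk_mult: "f \<in> Sk \<Longrightarrow> g \<in> Sk \<Longrightarrow> f * g \<in> Sk"
    and Sk_pw: "f \<in> Sk \<Longrightarrow> g \<in> Sk \<Longrightarrow> pw f g \<in> Sk"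
    and Sk_induct [consumes 1, case_names one x add mult pw]:
      "f \<in> Sk \<Longrightarrow> P 1 \<Longrightarrow> P x \<Longrightarrow>
       (\<And>f g. f \<in> Sk \<Longrightarrow> g \<in> Sk \<Longrightarrow> P f \<Longrightarrow> P g \<Longrightarrow> P (f + g)) \<Longrightarrow>
       (\<And>f g. f \<in> Sk \<Longrightarrow> g \<in> Sk \<Longrightarrow> P f \<Longrightarrow> P g \<Longrightarrow> P (f * g)) \<Longrightarrow>
       (\<And>f g. f \<in> Sk \<Longrightarrow> g \<in> Sk \<Longrightarrow> P f \<Longrightarrow> P g \<Longrightarrow> P (pw f g)) \<Longrightarrow> P f"
    and Sk_pos: "f \<in> Sk \<Longrightarrow> 0 < f"
    and discrete: "f \<in> Sk \<Longrightarrow> g \<in> Sk \<Longrightarrow> f < g \<Longrightarrow> f + 1 \<le> g"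
    and L_mult: "f \<in> Sk \<Longrightarrow> g \<in> Sk \<Longrightarrow> L (f * g) = L f + L g"
    and L_pw: "f \<in> Sk \<Longrightarrow> g \<in> Sk \<Longrightarrow> L (pw f g) = g * L f"
    and L_diff: "f \<in> Sk \<Longrightarrow> g \<in> Sk \<Longrightarrow> L g - L f \<le> (g - f) / f"
    and L_bounded: "f \<in> Sk \<Longrightarrow> g \<in> Sk \<Longrightarrow> L g - L f \<le> of_nat n \<Longrightarrow> g \<le> of_nat (3 ^ n) * f"
    and L_x: "of_nat n < L x"
    and gap: "f \<in> Sk \<Longrightarrow> g \<in> Sk \<Longrightarrow> g \<le> f * L x ^ n \<Longrightarrow> \<exists>m::nat. g \<le> of_nat m * f"
    and pw_nat: "f \<in> Sk \<Longrightarrow> pw f (of_nat (Suc n)) = f ^ Suc n"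
begin

abbreviation t where "t \<equiv> L x"

lemma L_diff_lower: "f \<in> Sk \<Longrightarrow> g \<in> Sk \<Longrightarrow> (g - f) / g \<le> L g - L f"
  using L_diff[of g f] by (simp add: diff_divide_distrib)

lemma L_one [simp]: "L 1 = 0"
  using L_mult[OF Sk_one Sk_one] by simp

lemma L_strict_mono: "f \<in> Sk \<Longrightarrow> g \<in> Sk \<Longrightarrow> f < g \<Longrightarrow> L f < L g"
proof -
  assume fg: "f \<in> Sk" "g \<in> Sk" "f < g"
  then have "0 < (g - f) / g" using Sk_pos[of g] by (intro divide_pos_pos) auto
  then show ?thesis using L_diff_lower[OF fg(1,2)] by linarith
qed

lemma L_less_iff: "f \<in> Sk \<Longrightarrow> g \<in> Sk \<Longrightarrow> L f < L g \<longleftrightarrow> f < g"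
  using L_strict_mono[of f g] L_strict_mono[of g f] by (cases f g rule: linorder_cases) auto

lemma L_le_iff: "f \<in> Sk \<Longrightarrow> g \<in> Sk \<Longrightarrow> L f \<le> L g \<longleftrightarrow> f \<le> g"
  using L_less_iff[of g f] not_less by blast

lemma L_inj: "f \<in> Sk \<Longrightarrow> g \<in> Sk \<Longrightarrow> L f = L g \<Longrightarrow> f = g"
  using L_less_iff[of f g] L_less_iff[of g f] by (cases f g rule: linorder_cases) auto

lemma Sk_ge_one: "f \<in> Sk \<Longrightarrow> 1 \<le> f"
proof (rule ccontr)
  assume f: "f \<in> Sk" "\<not> 1 \<le> f"
  then have "f + 1 \<le> 1" using discrete[OF _ Sk_one] by simp
  then show False using Sk_pos[OF f(1)] by simp
qed

lemma Sk_two: "2 \<in> Sk"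
  using Sk_add[OF Sk_one Sk_one] by simp

lemma Sk_ge_two: "f \<in> Sk \<Longrightarrow> f \<noteq> 1 \<Longrightarrow> 2 \<le> f"
  using discrete[OF Sk_one, of f] Sk_ge_one[of f] by fastforce

lemma L_nonneg: "f \<in> Sk \<Longrightarrow> 0 \<le> L f"
  using L_le_iff[OF Sk_one, of f] Sk_ge_one by simp

lemma L_le: "f \<in> Sk \<Longrightarrow> L f \<le> f - 1"
  using L_diff[OF Sk_one, of f] by simp

lemma L_two: "1 \<le> 2 * L 2"
  using L_diff_lower[OF Sk_one Sk_two] by simp

lemma L_ge: "f \<in> Sk \<Longrightarrow> f \<noteq> 1 \<Longrightarrow> 1 \<le> 2 * L f"
  using L_le_iff[OF Sk_two, of f] Sk_ge_two[of f] L_two by linarith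

lemma L_pos: "f \<in> Sk \<Longrightarrow> f \<noteq> 1 \<Longrightarrow> 0 < L f"
  using L_ge[of f] by linarith

lemma x_infinite: "of_nat n < x"
  using L_x[of n] L_le[OF Sk_x] by linarith

lemma t_ge_two: "2 \<le> t" using L_x[of 2] by simp

lemma t_le_x: "t \<le> x" using L_le[OF Sk_x] by simp

lemma Sk_power: "f \<in> Sk \<Longrightarrow> f ^ n \<in> Sk"
  by (induction n) (auto intro: Sk_one Sk_mult)

lemma L_power: "f \<in> Sk \<Longrightarrow> L (f ^ n) = of_nat n * L f"
  by (induction n) (auto simp: L_mult Sk_power algebra_simps)

lemma Sk_of_nat: "of_nat (Suc n) \<in> Sk"
proof (induction n)
  case (Suc n)
  from Sk_add[OF Sk_one Suc] show ?case by simp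
qed (simp add: Sk_one)

text \<open>
  Discreteness leaves no room between consecutive integers.
\<close>
lemma Sk_finite: "f \<in> Sk \<Longrightarrow> f \<le> of_nat n \<Longrightarrow> \<exists>m. f = of_nat (Suc m)"
proof (induction n)
  case 0
  then show ?case using Sk_pos[of f] by simp
next
  case (Suc n)
  show ?case
  proof (cases "f \<le> of_nat n")
    case False
    show ?thesis
    proof (cases n)
      case 0
      then show ?thesis using Sk_ge_one[OF Suc.prems(1)] Suc.prems(2) by (intro exI[of _ 0]) simp
    next
      case (Suc k)
      have "of_nat n + 1 \<le> f" using discrete[OF Sk_of_nat[of k] Suc.prems(1)] False Suc by simp
      then show ?thesis using Suc.prems(2) by (intro exI[of _ n]) simp
    qed
  qed (use Suc in blast)
qed

text \<open>
  The widths of the windows: \<open>ln x, x, x\<^sup>x, \<dots>\<close>. Up to squares, the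
  logarithm steps down in this tower (\<open>L_tower_le\<close>).
\<close>
fun tower :: "nat \<Rightarrow> 'a" where
  "tower 0 = t"
| "tower (Suc 0) = x"
| "tower (Suc (Suc i)) = pw x (tower (Suc i))"

lemma tower_Sk: "tower (Suc i) \<in> Sk"
  by (induction i) (auto intro: Sk_x Sk_pw)

lemma L_tower: "L (tower (Suc (Suc i))) = tower (Suc i) * t"
  by (simp add: L_pw Sk_x tower_Sk)

lemma x_le_tower: "x \<le> tower (Suc i)"
proof (induction i)
  case (Suc i)
  have "1 * t \<le> tower (Suc i) * t"
    by (rule mult_right_mono) (use Sk_ge_one[OF tower_Sk[of i]] t_ge_two in auto)
  then have "L x \<le> L (tower (Suc (Suc i)))" by (simp add: L_tower del: tower.simps)
  then show ?case using L_le_iff[OF Sk_x tower_Sk] by blast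
qed simp

lemma tower_mono_Suc: "tower i \<le> tower (Suc i)"
proof (cases i)
  case 0
  then show ?thesis using t_le_x by simp
next
  case (Suc k)
  have "L (tower (Suc k)) \<le> tower (Suc k)" using L_le[OF tower_Sk[of k]] by simp
  also have "tower (Suc k) * 1 \<le> tower (Suc k) * t"
    by (rule mult_left_mono) (use Sk_ge_one[OF tower_Sk[of k]] t_ge_two in auto)
  finally have "L (tower (Suc k)) \<le> L (tower (Suc (Suc k)))" by (simp add: L_tower del: tower.simps)
  then show ?thesis using L_le_iff[OF tower_Sk tower_Sk] Suc by blast
qed

lemma tower_mono: "i \<le> j \<Longrightarrow> tower i \<le> tower j"
  by (rule lift_Suc_mono_le[of tower]) (rule tower_mono_Suc)

lemma tower_ge_two: "2 \<le> tower i"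
  using tower_mono[of 0 i] t_ge_two by simp

lemma t_le_tower: "t \<le> tower i"
  using tower_mono[of 0 i] by simp

lemma L_tower_le: "L (tower (Suc i)) \<le> tower i ^ 2"
proof (cases i)
  case 0
  have "t * 1 \<le> t * t" by (rule mult_left_mono) (use t_ge_two in auto)
  then show ?thesis using 0 by (simp add: power2_eq_square)
next
  case (Suc k)
  have "tower (Suc k) * t \<le> tower (Suc k) * tower (Suc k)"
    by (rule mult_left_mono[OF t_le_tower]) (use tower_ge_two[of "Suc k"] in simp)
  then show ?thesis using Suc L_tower[of k] by (simp add: power2_eq_square del: tower.simps)
qed

lemma le_tower_if_L_le:
  assumes "f \<in> Sk" "L f \<le> tower (Suc i) ^ m"
  shows "f \<le> tower (Suc (Suc (Suc i)))"
proof -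
  let ?u = "tower (Suc i)"
  have u: "1 \<le> ?u" using Sk_ge_one[OF tower_Sk] .
  have "L (?u ^ m) \<le> of_nat m * ?u"
    using L_le[OF tower_Sk[of i]] by (simp add: L_power tower_Sk mult_left_mono del: tower.simps)
  also have "\<dots> \<le> t * ?u" by (rule mult_right_mono) (use L_x[of m] u in auto)
  also have "\<dots> = L (tower (Suc (Suc i)))" by (simp add: L_tower del: tower.simps)
  finally have "?u ^ m \<le> tower (Suc (Suc i))" using L_le_iff[OF Sk_power[OF tower_Sk] tower_Sk] by blast
  with assms(2) have "L f \<le> tower (Suc (Suc i)) * 1" by simp
  also have "\<dots> \<le> tower (Suc (Suc i)) * t"
    by (rule mult_left_mono) (use Sk_ge_one[OF tower_Sk[of "Suc i"]] t_ge_two in auto)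
  also have "\<dots> = L (tower (Suc (Suc (Suc i))))" by (simp add: L_tower del: tower.simps)
  finally show ?thesis using L_le_iff[OF assms(1) tower_Sk] by blast
qed

end

section \<open>Powers with exponents from a set of bounded type\<close>

context exp_field
begin

text \<open>
  Only the exponents are restricted; iterating this closure exhausts the Skolem functions.
\<close>
inductive_set closure :: "'a set \<Rightarrow> 'a set" for G where
  one: "1 \<in> closure G"
| x: "x \<in> closure G"
| add: "f \<in> closure G \<Longrightarrow> g \<in> closure G \<Longrightarrow> f + g \<in> closure G"
| mult: "f \<in> closure G \<Longrightarrow> g \<in> closure G \<Longrightarrow> f * g \<in> closure G"
| pw: "f \<in> closure G \<Longrightarrow> q \<in> G \<Longrightarrow> pw f q \<in> closure G"

definition ratios :: "'a set" where
  "ratios = {a / b |a b. a \<in> Sk \<and> b \<in> Sk}"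

lemma ratios_pos: "e \<in> ratios \<Longrightarrow> 0 < e"
  using Sk_pos by (auto simp: ratios_def)

lemma ratios_mult: "e \<in> ratios \<Longrightarrow> f \<in> Sk \<Longrightarrow> e * f \<in> ratios"
proof -
  assume "e \<in> ratios" "f \<in> Sk"
  then obtain a b where "e = a / b" "a \<in> Sk" "b \<in> Sk" by (auto simp: ratios_def)
  then have "e * f = (a * f) / b" "a * f \<in> Sk" using \<open>f \<in> Sk\<close> Sk_mult by auto
  then show ?thesis using \<open>b \<in> Sk\<close> unfolding ratios_def by blast
qed

lemma ratios_div: "e \<in> ratios \<Longrightarrow> f \<in> Sk \<Longrightarrow> e / f \<in> ratios"
proof -
  assume "e \<in> ratios" "f \<in> Sk"
  then obtain a b where "e = a / b" "a \<in> Sk" "b \<in> Sk" by (auto simp: ratios_def)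
  then have "e / f = a / (b * f)" "b * f \<in> Sk" using \<open>f \<in> Sk\<close> Sk_mult by auto
  then show ?thesis using \<open>a \<in> Sk\<close> unfolding ratios_def by blast
qed

lemma ratios_one: "1 \<in> ratios"
  unfolding ratios_def using Sk_one by (auto intro!: exI[of _ "1::'a"])

text \<open>
  The bound that is carried through the induction: in all windows of width \<open>u\<close>, at all
  precisions \<open>e\<close> and around all centres \<open>z\<close>, the type of \<open>A\<close>
  modulo \<open>O(e)\<close> is at most \<open>\<omega>\<^sup>d\<close>. The uniformity in
  \<open>e\<close> and \<open>z\<close> is needed because multiplication by \<open>q\<close> and
  taking logarithms rescale the precision.
\<close>
definition locally :: "'a \<Rightarrow> ord \<Rightarrow> 'a set \<Rightarrow> bool" where
  "locally u d A \<longleftrightarrow> (\<forall>z. \<forall>e\<in>ratios. ot_le (less_mod (bigO e)) d {a \<in> A. a - z \<in> window e u})"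

lemma locallyD: "locally u d A \<Longrightarrow> e \<in> ratios \<Longrightarrow> ot_le (less_mod (bigO e)) d {a \<in> A. a - z \<in> window e u}"
  by (simp add: locally_def)

lemma locally_subset: "locally u d B \<Longrightarrow> A \<subseteq> B \<Longrightarrow> locally u d A"
  unfolding locally_def
proof (intro allI ballI)
  fix z e assume *: "\<forall>z. \<forall>e\<in>ratios. ot_le (less_mod (bigO e)) d {a \<in> B. a - z \<in> window e u}" "A \<subseteq> B" "e \<in> ratios"
  show "ot_le (less_mod (bigO e)) d {a \<in> A. a - z \<in> window e u}"
    by (rule ot_le_subset[of _ _ "{a \<in> B. a - z \<in> window e u}"]) (use * in auto)
qed

lemma locally_mono: "locally u d A \<Longrightarrow> d \<le> d' \<Longrightarrow> locally u d' A"
  unfolding locally_def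
proof (intro allI ballI)
  fix z e assume *: "\<forall>z. \<forall>e\<in>ratios. ot_le (less_mod (bigO e)) d {a \<in> A. a - z \<in> window e u}" "d \<le> d'" "e \<in> ratios"
  show "ot_le (less_mod (bigO e)) d' {a \<in> A. a - z \<in> window e u}"
    by (rule ot_le_mono[of _ d]) (use * in auto)
qed

text \<open>
  For functions of the same magnitude \<open>f\<close>, precision \<open>e * f\<close> corresponds
  to precision \<open>e\<close> for the logarithms. The following lemmas are the two directions of
  this correspondence, for the order and for the size of differences.
\<close>
lemma less_mod_L:
  assumes Sk: "f \<in> Sk" "g \<in> Sk" and "less_mod (bigO (e * f)) f g" "0 < e" "g \<le> of_nat n * f"
  shows "less_mod (bigO e) (L f) (L g)"
proof -
  have pos: "0 < f" "0 < g" using Sk Sk_pos by auto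
  have "f < g" "g - f \<notin> bigO (e * f)" using assms(3) by (auto simp: less_mod_def)
  have "L g - L f \<notin> bigO e"
  proof
    assume "L g - L f \<in> bigO e"
    then obtain m where "\<bar>L g - L f\<bar> \<le> of_nat m * e" by (auto simp: bigO_def)
    with L_diff_lower[OF Sk] have "(g - f) / g \<le> of_nat m * e" by linarith
    then have "g - f \<le> of_nat m * e * g" using pos by (simp add: field_simps)
    also have "\<dots> \<le> of_nat m * e * (of_nat n * f)" by (rule mult_left_mono) (use assms in auto)
    finally have "g - f \<in> bigO (e * f)" using \<open>f < g\<close> by (intro bigOI[of _ "m * n"]) (simp add: algebra_simps)
    then show False using \<open>g - f \<notin> bigO (e * f)\<close> by simp
  qed
  moreover have "L f < L g" using L_strict_mono[OF Sk \<open>f < g\<close>] .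
  ultimately show ?thesis by (simp add: less_mod_def)
qed

lemma less_mod_exp:
  assumes Sk: "f \<in> Sk" "g \<in> Sk" and "less_mod (bigO e) (L f) (L g)" "0 < e"
  shows "less_mod (bigO (e * f)) f g"
proof -
  have pos: "0 < f" "0 < g" using Sk Sk_pos by auto
  have "L f < L g" "L g - L f \<notin> bigO e" using assms(3) by (auto simp: less_mod_def)
  then have fg: "f < g" using L_less_iff[OF Sk] by simp
  have "g - f \<notin> bigO (e * f)"
  proof
    assume "g - f \<in> bigO (e * f)"
    then obtain m where "\<bar>g - f\<bar> \<le> of_nat m * (e * f)" by (auto simp: bigO_def)
    then have "(g - f) / f \<le> of_nat m * e" using pos fg by (simp add: field_simps)
    with L_diff[OF Sk] have "L g - L f \<le> of_nat m * e" by linarith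
    then have "L g - L f \<in> bigO e" using \<open>L f < L g\<close> by (intro bigOI[of _ m]) simp
    then show False using \<open>L g - L f \<notin> bigO e\<close> by simp
  qed
  then show ?thesis using fg by (simp add: less_mod_def)
qed

lemma abs_L_diff_le:
  assumes "f \<in> Sk" "g \<in> Sk" "f \<le> of_nat n * g"
  shows "\<bar>L f - L g\<bar> \<le> of_nat (Suc n) * (\<bar>f - g\<bar> / f)"
proof -
  have pos: "0 < f" "0 < g" using assms Sk_pos by auto
  show ?thesis
  proof (cases "f \<le> g")
    case True
    then have "\<bar>L f - L g\<bar> = L g - L f" using L_le_iff assms(1,2) by fastforce
    also have "\<dots> \<le> (g - f) / f" using L_diff assms by blast
    also have "\<dots> = of_nat 1 * (\<bar>f - g\<bar> / f)" using True by simp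
    also have "\<dots> \<le> of_nat (Suc n) * (\<bar>f - g\<bar> / f)" using pos by (intro mult_right_mono) auto
    finally show ?thesis .
  next
    case False
    then have "\<bar>L f - L g\<bar> = L f - L g" using L_le_iff[OF assms(2,1)] by (simp add: abs_if)
    also have "\<dots> \<le> (f - g) / g" using L_diff assms by blast
    also have "\<dots> \<le> of_nat n * ((f - g) / f)"
    proof -
      have "f * (f - g) \<le> of_nat n * g * (f - g)" using False assms(3) by (intro mult_right_mono) auto
      then show ?thesis using pos by (simp add: field_simps)
    qed
    also have "\<dots> \<le> of_nat (Suc n) * (\<bar>f - g\<bar> / f)"
      using pos False by (intro mult_mono) auto
    finally show ?thesis .
  qed
qed

lemma abs_diff_le_L:
  assumes "f \<in> Sk" "g \<in> Sk" "f \<le> of_nat n * g"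
  shows "\<bar>f - g\<bar> \<le> of_nat (Suc n) * g * \<bar>L f - L g\<bar>"
proof -
  have pos: "0 < f" "0 < g" using assms Sk_pos by auto
  show ?thesis
  proof (cases "f \<le> g")
    case True
    have "(g - f) / g \<le> L g - L f" using L_diff_lower[OF assms(1,2)] .
    then have "g - f \<le> g * (L g - L f)" using pos by (simp add: field_simps)
    moreover have "L f \<le> L g" using True L_le_iff assms(1,2) by blast
    ultimately have "\<bar>f - g\<bar> \<le> 1 * g * \<bar>L f - L g\<bar>" using True by simp
    also have "\<dots> \<le> of_nat (Suc n) * g * \<bar>L f - L g\<bar>" using pos by (intro mult_right_mono) auto
    finally show ?thesis .
  next
    case False
    have "(f - g) / f \<le> L f - L g" using L_diff_lower[OF assms(2,1)] .
    then have "f - g \<le> f * (L f - L g)" using pos by (simp add: field_simps)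
    moreover have "L g \<le> L f" using False L_le_iff[OF assms(2,1)] by simp
    ultimately have "\<bar>f - g\<bar> \<le> f * \<bar>L f - L g\<bar>" using False by simp
    also have "\<dots> \<le> of_nat (Suc n) * g * \<bar>L f - L g\<bar>"
      using assms(3) pos by (intro mult_right_mono) (auto simp: algebra_simps)
    finally show ?thesis .
  qed
qed

lemma bigO_L: "f \<in> Sk \<Longrightarrow> g \<in> Sk \<Longrightarrow> L g - L f \<in> bigO 1 \<Longrightarrow> \<exists>n::nat. g \<le> of_nat n * f"
proof -
  assume *: "f \<in> Sk" "g \<in> Sk" "L g - L f \<in> bigO 1"
  then obtain n :: nat where "\<bar>L g - L f\<bar> \<le> of_nat n" by (auto simp: bigO_def)
  then have "L g - L f \<le> of_nat n" by linarith
  from L_bounded[OF *(1,2) this] show ?thesis by blast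
qed

lemma ot_le_fsums_wellorder:
  fixes C :: "'a set"
  assumes pos: "\<And>h. h \<in> C \<Longrightarrow> 0 < h" and "ot_le (<) d C"
  shows "\<exists>d'. ot_le (<) d' (fsums C)"
proof -
  have "convex_subgroup {0::'a}" by (auto simp: convex_subgroup_def)
  then have "ot_le (less_mod {0}) (\<omega> (d + \<omega> 0 + d)) (fsums (C - {0}))"
    by (rule ot_le_sums_wellorder) (use pos assms(2) in auto)
  moreover have "C - {0} = C" using pos by force
  moreover have "less_mod {0::'a} = (<)" by (auto simp: less_mod_def fun_eq_iff)
  ultimately show ?thesis by auto
qed

end

locale exp_closure = exp_field +
  fixes G :: "'a set" and \<gamma> :: ord
  assumes G_Sk: "G \<subseteq> Sk" and G_one: "1 \<in> G" and G_mult: "p \<in> G \<Longrightarrow> q \<in> G \<Longrightarrow> p * q \<in> G"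
    and G_order: "ot_le (<) \<gamma> G"
begin

lemma G_pos: "q \<in> G \<Longrightarrow> 0 < q"
  using G_Sk Sk_pos by blast

abbreviation S where "S \<equiv> closure G"

lemma S_Sk: "f \<in> S \<Longrightarrow> f \<in> Sk"
  by (induction rule: closure.induct) (use G_Sk in \<open>auto intro: Sk_one Sk_x Sk_add Sk_mult Sk_pw\<close>)

definition S_logs where "S_logs = L ` (S - {1})"

definition infinite_elem where "infinite_elem q \<longleftrightarrow> (\<forall>n::nat. of_nat n < q)"

text \<open>
  Finite exponents are excluded: a power with integer exponent is an iterated product, while
  \<open>p\<close> has a logarithm of smaller magnitude than \<open>pw p q\<close> when
  \<open>q\<close> is infinite.
\<close>
definition factors where
  "factors = insert x {pw p q |p q. p \<in> S \<and> p \<noteq> 1 \<and> q \<in> G \<and> infinite_elem q}"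

lemma factors_S: "factors \<subseteq> S - {1}"
proof
  fix d assume "d \<in> factors"
  then consider "d = x" | p q where "d = pw p q" "p \<in> S" "p \<noteq> 1" "q \<in> G" "infinite_elem q"
    unfolding factors_def by blast
  then show "d \<in> S - {1}"
  proof cases
    case 1
    then show ?thesis using x_infinite[of 1] by (auto intro: closure.x)
  next
    case 2
    have "0 < q * L p" using L_pos[OF S_Sk[OF 2(2)] 2(3)] Sk_pos[of q] G_Sk 2(4) by auto
    then have "L (pw p q) \<noteq> 0" using L_pw[OF S_Sk[OF 2(2)]] G_Sk 2(4) by force
    then show ?thesis using 2 L_one by (auto intro: closure.pw)
  qed
qed

lemma S_subset: "f \<in> S \<Longrightarrow> f \<in> fsums (fprods factors)"
proof (induction rule: closure.induct)
  case one
  show ?case by (intro fsums_incl fprods.one)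
next
  case x
  show ?case by (intro fsums_incl fprods_incl) (simp add: factors_def)
next
  case (add f g)
  then show ?case by (intro fsums_plus)
next
  case (mult f g)
  then show ?case by (intro fsums_times fprods_times)
next
  case (pw f q)
  have fS: "f \<in> Sk" "q \<in> Sk" using S_Sk pw G_Sk by auto
  consider "f = 1" | "f \<noteq> 1" "infinite_elem q" | n :: nat where "q \<le> of_nat n"
    unfolding infinite_elem_def by (meson not_less)
  then show ?case
  proof cases
    case 1
    then have "L (pw f q) = L 1" using fS by (simp add: L_pw)
    then have "pw f q = 1" using L_inj[OF Sk_pw[OF fS] Sk_one] by simp
    then show ?thesis by (auto intro: fsums_incl fprods.one)
  next
    case 2
    then show ?thesis using pw by (intro fsums_incl fprods_incl) (auto simp: factors_def)
  next
    case 3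
    then obtain m where m: "q = of_nat (Suc m)" using Sk_finite fS by blast
    have "f ^ Suc k \<in> fsums (fprods factors)" for k
      by (induction k) (use pw.IH in \<open>auto intro: fsums_times fprods_times\<close>)
    then show ?thesis unfolding m using pw_nat[OF fS(1), of m] by simp
  qed
qed

text \<open>
  Products \<open>q * l\<close> in a window around \<open>h\<close> are covered by finitely many
  boxes \<open>q\<^sub>0 \<le> q\<close>, \<open>l\<^sub>0 \<le> l\<close> whose corners lie in the
  window themselves, by Dickson's lemma. In such a box \<open>q\<close> is bounded by a constant
  multiple of \<open>q\<^sub>0\<close>, so \<open>l\<close> stays in a window around
  \<open>l\<^sub>0\<close> at precision \<open>e / q\<^sub>0\<close>, and \<open>q * l\<close>
  increases beyond \<open>O(e)\<close> only if \<open>q\<close> increases or \<open>l\<close>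
  increases beyond \<open>O(e / q\<^sub>0)\<close>.
\<close>
lemma two_scale_products:
  assumes u: "2 \<le> u" and A: "\<And>l. l \<in> A \<Longrightarrow> 0 < l" "ot_le (<) d A" "locally u (\<omega> \<beta>) A"
    and D: "D \<subseteq> insert t {q * l |q l. q \<in> G \<and> l \<in> A}" and e: "e \<in> ratios" and h: "0 < h"
  shows "ot_lt (less_mod (bigO e)) (\<omega> (\<beta> + \<gamma> + \<omega> 0)) {c \<in> D. sim c h \<and> c - h \<in> window e u}"
proof -
  have epos: "0 < e" using ratios_pos[OF e] .
  have V: "convex_subgroup (bigO e)" and W: "convex_subgroup (window e u)"
    using convex_subgroup_bigO convex_subgroup_window epos u by auto
  obtain \<rho> where \<rho>: "\<forall>a\<in>G. \<forall>b\<in>G. a < b \<longrightarrow> \<rho> a < (\<rho> b :: ord)"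
    using ot_le_rank[OF _ G_order] by (auto simp: transp_on_less)
  obtain \<sigma> where \<sigma>: "\<forall>a\<in>A. \<forall>b\<in>A. a < b \<longrightarrow> \<sigma> a < (\<sigma> b :: ord)"
    using ot_le_rank[OF _ A(2)] by (auto simp: transp_on_less)
  define T where "T = {p. fst p \<in> G \<and> snd p \<in> A \<and> sim (fst p * snd p) h \<and> fst p * snd p - h \<in> window e u}"
  obtain F where F: "F \<subseteq> T" "finite F"
      "\<forall>p\<in>T. \<exists>q\<in>F. \<rho> (fst q) \<le> \<rho> (fst p) \<and> \<sigma> (snd q) \<le> \<sigma> (snd p)"
    using dickson_pair[of T "\<lambda>p. \<rho> (fst p)" "\<lambda>p. \<sigma> (snd p)"] by blast
  define box where "box p = {q * l |q l. (q, l) \<in> T \<and> fst p \<le> q \<and> snd p \<le> l}" for p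
  have box: "ot_le (less_mod (bigO e)) (\<gamma> + \<omega> \<beta>) (box p)" if p: "p \<in> F" for p
  proof -
    obtain q0 l0 where p_eq: "p = (q0, l0)" by (cases p)
    have T0: "q0 \<in> G" "l0 \<in> A" "sim (q0 * l0) h" "q0 * l0 - h \<in> window e u"
      using p F(1) by (auto simp: T_def p_eq)
    have pos0: "0 < q0" "0 < l0" using T0(1,2) G_pos A(1) by auto
    from T0(3) obtain n2 :: nat where n2: "h \<le> of_nat n2 * (q0 * l0)" by (auto simp: not_arch_iff)
    have eq: "e / q0 \<in> ratios" using ratios_div[OF e] T0(1) G_Sk by blast
    have "\<forall>y\<in>box p. \<exists>r. (fst r, snd r) \<in> T \<and> q0 \<le> fst r \<and> l0 \<le> snd r \<and> y = fst r * snd r"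
      by (force simp: box_def p_eq)
    from bchoice[OF this] obtain r where
      "\<forall>y\<in>box p. (fst (r y), snd (r y)) \<in> T \<and> q0 \<le> fst (r y) \<and> l0 \<le> snd (r y) \<and> y = fst (r y) * snd (r y)" ..
    then obtain q l where ql: "\<And>y. y \<in> box p \<Longrightarrow> (q y, l y) \<in> T \<and> q0 \<le> q y \<and> l0 \<le> l y \<and> y = q y * l y"
      using that[of "\<lambda>y. fst (r y)" "\<lambda>y. snd (r y)"] by blast
    have qlT: "q y \<in> G" "l y \<in> A" "sim (q y * l y) h" "q y * l y - h \<in> window e u" if "y \<in> box p" for y
      using ql[OF that] by (auto simp: T_def)
    have qbound: "\<exists>n. \<bar>q y\<bar> \<le> of_nat n * q0" if y: "y \<in> box p" for y
    proof -
      have posy: "0 < q y" "0 < l y" using qlT[OF y] G_pos A(1) by auto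
      from qlT(3)[OF y] obtain n1 :: nat where n1: "q y * l y \<le> of_nat n1 * h" by (auto simp: not_arch_iff)
      have "q y * l0 \<le> q y * l y" using ql[OF y] posy by (intro mult_left_mono) auto
      also have "\<dots> \<le> of_nat n1 * (of_nat n2 * (q0 * l0))"
        using n1 n2 by (rule order_trans[OF _ mult_left_mono]) auto
      finally have "q y * l0 \<le> (of_nat (n1 * n2) * q0) * l0" by (simp add: algebra_simps)
      then have "q y \<le> of_nat (n1 * n2) * q0" using pos0 by simp
      then show ?thesis using posy by (intro exI[of _ "n1 * n2"]) simp
    qed
    have lwin: "l y - l0 \<in> window (e / q0) u" if y: "y \<in> box p" for y
    proof -
      have posy: "0 < l y" using qlT[OF y] A(1) by auto
      have "(q y * l y - h) - (q0 * l0 - h) \<in> window e u" using cs_diff[OF W qlT(4)[OF y] T0(4)] .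
      then obtain n where n: "\<bar>q y * l y - q0 * l0\<bar> \<le> e * u ^ n" by (auto simp: window_def)
      have "q0 * l y \<le> q y * l y" using ql[OF y] posy by (intro mult_right_mono) auto
      then have "q0 * (l y - l0) \<le> e * u ^ n" using n by (simp add: algebra_simps)
      then have "l y - l0 \<le> e / q0 * u ^ n" using pos0 by (simp add: field_simps)
      then show ?thesis using ql[OF y] by (intro windowI[of _ _ _ n]) simp
    qed
    show ?thesis
    proof (rule ot_le_inter)
      show "ot_le (\<lambda>y z. q y < q z) \<gamma> (box p)"
        by (rule ot_le_pullback[OF G_order, of _ q]) (use qlT in auto)
      show "ot_le (\<lambda>y z. less_mod (bigO (e / q0)) (l y) (l z)) (\<omega> \<beta>) (box p)"
        by (rule ot_le_pullback[OF locallyD[OF A(3) eq, of l0], of _ l]) (use qlT lwin in auto)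
      fix y z assume yz: "y \<in> box p" "z \<in> box p" "less_mod (bigO e) y z"
      show "q y < q z \<or> less_mod (bigO (e / q0)) (l y) (l z)"
      proof (rule ccontr)
        assume neg: "\<not> ?thesis"
        have V0: "convex_subgroup (bigO (e / q0))" using epos pos0 by (intro convex_subgroup_bigO) auto
        obtain v where v: "v \<in> bigO (e / q0)" "0 \<le> v" "l z \<le> l y + v"
          using not_less_mod_bound[OF V0] neg by blast
        obtain n where n: "\<bar>q y\<bar> \<le> of_nat n * q0" using qbound[OF yz(1)] by blast
        have posy: "0 < q y" "0 < l z" using G_pos[OF qlT(1)[OF yz(1)]] A(1)[OF qlT(2)[OF yz(2)]] by auto
        have "z = q z * l z" using ql yz by blast
        also have "\<dots> \<le> q y * l z" using neg posy by (intro mult_right_mono) auto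
        also have "\<dots> \<le> q y * (l y + v)" using v posy by (intro mult_left_mono) auto
        also have "\<dots> = y + q y * v" using ql[OF yz(1)] by (simp add: algebra_simps)
        finally have "z \<le> y + q y * v" .
        moreover have "q y * v \<in> bigO e" by (rule bigO_mult[OF v(1) pos0(1) n epos])
        ultimately show False using less_mod_not_le[OF V yz(3), of "q y * v"] posy v by auto
      qed
    qed
  qed
  have lt: "\<gamma> + \<omega> \<beta> < \<omega> (\<beta> + \<gamma> + \<omega> 0)"
  proof (rule plus_less_omega)
    have 0: "0 < \<omega> 0" by simp
    have "\<beta> + \<gamma> + 0 < \<beta> + \<gamma> + \<omega> 0" by (rule add_strict_left_mono[OF 0])
    moreover have "0 + \<gamma> \<le> \<beta> + \<gamma>" "\<beta> + 0 \<le> \<beta> + \<gamma>" by (rule add_right_mono add_left_mono, simp)+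
    ultimately have "\<gamma> < \<beta> + \<gamma> + \<omega> 0" "\<beta> < \<beta> + \<gamma> + \<omega> 0" by (simp_all add: order_le_less_trans)
    then show "\<gamma> < \<omega> (\<beta> + \<gamma> + \<omega> 0)" "\<omega> \<beta> < \<omega> (\<beta> + \<gamma> + \<omega> 0)"
      using le_omega[of \<gamma>] by (auto intro: order_le_less_trans)
  qed
  have "ot_lt (less_mod (bigO e)) (\<omega> (\<beta> + \<gamma> + \<omega> 0)) ({t} \<union> (\<Union>p\<in>F. box p))"
    by (intro ot_lt_Un ot_lt_UN F(2) ot_le_imp_lt[OF box lt] ot_lt_singleton less_mod_irrefl zero_less_omega)
  then show ?thesis
  proof (rule ot_lt_subset, intro subsetI)
    fix c assume c: "c \<in> {c \<in> D. sim c h \<and> c - h \<in> window e u}"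
    show "c \<in> {t} \<union> (\<Union>p\<in>F. box p)"
    proof (cases "c = t")
      case False
      then obtain q l where ql: "c = q * l" "q \<in> G" "l \<in> A" using c D by blast
      then have T: "(q, l) \<in> T" using c by (simp add: T_def)
      then obtain p where p: "p \<in> F" "\<rho> (fst p) \<le> \<rho> q" "\<sigma> (snd p) \<le> \<sigma> l" using F(3) by force
      then have "fst p \<in> G" "snd p \<in> A" using F(1) by (auto simp: T_def)
      then have "fst p \<le> q" "snd p \<le> l" using p ql \<rho> \<sigma> by (meson leD not_le)+
      then have "c \<in> box p" using T ql unfolding box_def by blast
      then show ?thesis using p by blast
    qed simp
  qed
qed

text \<open>
  From logarithms of bases to logarithms of products of factors. The elements of \<open>D\<close>
  are logarithms of factors, and their finite sums are logarithms of products.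
\<close>
lemma locally_log_products:
  assumes u: "2 \<le> u" and A: "\<And>l. l \<in> A \<Longrightarrow> 0 < l" "ot_le (<) d A" "locally u (\<omega> \<beta>) A"
    and D: "D \<subseteq> insert t {q * l |q l. q \<in> G \<and> l \<in> A}" and arch: "ot_le arch \<delta> D"
  shows "locally u (\<omega> (\<beta> + \<gamma> + \<omega> 0 + \<delta> + \<omega> 0)) (fsums D)" "\<exists>d. ot_le (<) d (fsums D)"
proof -
  have pos: "0 < c" if cD: "c \<in> D" for c
  proof (cases "c = t")
    case True
    then show ?thesis using t_ge_two by simp
  next
    case False
    then obtain q l where "c = q * l" "q \<in> G" "l \<in> A" using cD D by blast
    then show ?thesis using A(1) G_pos by simp
  qed
  have "ot_le (<) (\<gamma> + d) (D - {t})"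
  proof -
    have "\<forall>y\<in>D - {t}. \<exists>r. fst r \<in> G \<and> snd r \<in> A \<and> y = fst r * snd r" using D by force
    from bchoice[OF this] obtain r where
      r: "\<And>y. y \<in> D - {t} \<Longrightarrow> fst (r y) \<in> G \<and> snd (r y) \<in> A \<and> y = fst (r y) * snd (r y)" by blast
    show ?thesis
    proof (rule ot_le_inter)
      show "ot_le (\<lambda>y z. fst (r y) < fst (r z)) \<gamma> (D - {t})"
        by (rule ot_le_pullback[OF G_order, of _ "\<lambda>y. fst (r y)"]) (use r in auto)
      show "ot_le (\<lambda>y z. snd (r y) < snd (r z)) d (D - {t})"
        by (rule ot_le_pullback[OF A(2), of _ "\<lambda>y. snd (r y)"]) (use r in auto)
      fix y z assume yz: "y \<in> D - {t}" "z \<in> D - {t}" "y < z"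
      show "fst (r y) < fst (r z) \<or> snd (r y) < snd (r z)"
      proof (rule ccontr)
        assume neg: "\<not> ?thesis"
        have "0 < fst (r z)" "0 < snd (r z)" "0 < fst (r y)" using r yz A(1) G_pos by blast+
        with neg have "fst (r z) * snd (r z) \<le> fst (r y) * snd (r y)" by (intro mult_mono) auto
        then show False using r[OF yz(1)] r[OF yz(2)] yz(3) by simp
      qed
    qed
  qed
  then have "ot_lt (<) (\<gamma> + d + \<omega> 0) (D - {t})"
    by (rule ot_le_imp_lt) (use add_strict_left_mono[OF zero_less_omega, of "\<gamma> + d" 0] in simp)
  moreover have "ot_lt (<) (\<gamma> + d + \<omega> 0) {t}"
    by (rule ot_lt_singleton) (use add_le_less_mono[OF zero_le_ord zero_less_omega, of "\<gamma> + d" 0] in simp_all)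
  ultimately have "ot_lt (<) (\<gamma> + d + \<omega> 0) ((D - {t}) \<union> {t})" by (rule ot_lt_Un)
  then have "ot_lt (<) (\<gamma> + d + \<omega> 0) D" by (rule ot_lt_subset) auto
  then have wo: "ot_le (<) (\<gamma> + d + \<omega> 0) D" by (rule ot_lt_imp_le)
  then show "\<exists>d. ot_le (<) d (fsums D)" using ot_le_fsums_wellorder[OF pos] by blast
  show "locally u (\<omega> (\<beta> + \<gamma> + \<omega> 0 + \<delta> + \<omega> 0)) (fsums D)"
    unfolding locally_def
  proof (intro allI ballI)
    fix z e assume e: "e \<in> ratios"
    have epos: "0 < e" using ratios_pos[OF e] .
    have W: "convex_subgroup (window e u)" using convex_subgroup_window epos u by auto
    have "ot_lt (less_mod (bigO e)) (\<omega> (\<beta> + \<gamma> + \<omega> 0 + \<delta> + \<omega> 0)) {f \<in> fsums D. f - z \<in> window e u}"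
    proof (rule ot_lt_sums_two_scales[OF convex_subgroup_bigO[OF epos] W bigO_subset_window[OF epos u]])
      show "ot_le (less_mod (window e u)) (\<omega> (\<gamma> + d + \<omega> 0 + \<omega> 0 + (\<gamma> + d + \<omega> 0))) (fsums (D - window e u))"
        by (rule ot_le_sums_wellorder[OF W _ wo]) (rule pos)
      show "ot_le arch \<delta> (D \<inter> window e u - bigO e)" by (rule ot_le_subset[OF arch]) auto
      show "ot_lt (less_mod (bigO e)) (\<omega> (\<beta> + \<gamma> + \<omega> 0)) {c \<in> D. sim c h \<and> c - h \<in> window e u}" if "h \<in> D" for h
        by (rule two_scale_products[OF u A D e pos[OF that]])
    qed (rule pos)
    then show "ot_le (less_mod (bigO e)) (\<omega> (\<beta> + \<gamma> + \<omega> 0 + \<delta> + \<omega> 0)) {f \<in> fsums D. f - z \<in> window e u}"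
      by (rule ot_lt_imp_le)
  qed
qed

lemma bigO_subset: "e \<le> of_nat n * e' \<Longrightarrow> bigO e \<subseteq> bigO e'"
proof
  fix r assume "e \<le> of_nat n * e'" "r \<in> bigO e"
  then obtain m where "\<bar>r\<bar> \<le> of_nat m * e" by (auto simp: bigO_def)
  also have "\<dots> \<le> of_nat m * (of_nat n * e')" using \<open>e \<le> of_nat n * e'\<close> by (intro mult_left_mono) auto
  finally show "r \<in> bigO e'" by (intro bigOI[of _ "m * n"]) (simp add: mult.assoc)
qed

lemma less_mod_antimono: "V \<subseteq> W \<Longrightarrow> less_mod W a b \<Longrightarrow> less_mod V a b"
  by (auto simp: less_mod_def)

lemma ot_le_trivial: "(\<And>y z. y \<in> A \<Longrightarrow> z \<in> A \<Longrightarrow> \<not> R y z) \<Longrightarrow> ot_le R d A"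
  unfolding ot_le_iff
proof
  fix z assume *: "\<And>y z. y \<in> A \<Longrightarrow> z \<in> A \<Longrightarrow> \<not> R y z" "z \<in> A"
  then have eq: "{y \<in> A. R y z} = {}" by blast
  show "ot_lt R d {y \<in> A. R y z}" unfolding eq by (rule ot_lt_empty)
qed

text \<open>
  From logarithms of products to sums of products. Summands of the same magnitude are compared
  through their logarithms; \<open>a\<close> counts the magnitudes between the precision and the
  width of the window.
\<close>
lemma ot_lt_window_sums:
  assumes u: "2 \<le> u" and C: "C \<subseteq> Sk" and loc: "locally u (\<omega> \<beta>) (L ` C)" and wo: "ot_le (<) d (L ` C)"
    and e: "e \<in> ratios" and arch: "ot_le arch a (C \<inter> window e u - bigO e)"
  shows "ot_lt (less_mod (bigO e)) (\<omega> (\<beta> + \<omega> 0 + a + \<omega> 0)) {f \<in> fsums C. f - z \<in> window e u}"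
proof -
  have epos: "0 < e" using ratios_pos[OF e] .
  have V: "convex_subgroup (bigO e)" and W: "convex_subgroup (window e u)"
    using convex_subgroup_bigO convex_subgroup_window epos u by auto
  have pos: "0 < h" if "h \<in> C" for h using that C Sk_pos by blast
  have woC: "ot_le (<) d C"
    by (rule ot_le_pullback[OF wo, of _ L]) (use C L_strict_mono in blast)+
  show ?thesis
  proof (rule ot_lt_sums_two_scales[OF V W bigO_subset_window[OF epos u] _ _ _ arch])
    show "ot_le (less_mod (window e u)) (\<omega> (d + \<omega> 0 + d)) (fsums (C - window e u))"
      by (rule ot_le_sums_wellorder[OF W _ woC]) (rule pos)
    fix h assume h: "h \<in> C" "h \<notin> bigO e"
    have hS: "h \<in> Sk" "0 < h" using h C pos by auto
    have W': "convex_subgroup (window (e / h) u)" using convex_subgroup_window[of "e / h" u] epos u hS by simp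
    have "ot_le (less_mod (bigO e)) (\<omega> \<beta>) {c \<in> C. sim c h \<and> c - h \<in> window e u}"
    proof (rule ot_le_pullback[OF locallyD[OF loc ratios_div[OF e hS(1)], of "L h"], of _ L])
      fix c assume c: "c \<in> {c \<in> C. sim c h \<and> c - h \<in> window e u}"
      then have cS: "c \<in> Sk" using C by auto
      from c obtain m :: nat where m: "h \<le> of_nat m * c" by (auto simp: not_arch_iff)
      from c obtain n where n: "\<bar>c - h\<bar> \<le> e * u ^ n" by (auto simp: window_def)
      have "\<bar>\<bar>h - c\<bar> / h\<bar> \<le> (e / h) * u ^ n"
        using n hS by (simp add: abs_minus_commute divide_right_mono)
      then have "of_nat (Suc m) * (\<bar>h - c\<bar> / h) \<in> window (e / h) u"
        by (intro cs_nat[OF W'] windowI[of _ _ _ n])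
      then have "L c - L h \<in> window (e / h) u"
        by (rule cs_convex[OF W'])
          (use abs_L_diff_le[OF hS(1) cS m] hS in \<open>simp add: abs_minus_commute abs_mult\<close>)
      then show "L c \<in> {a \<in> L ` C. a - L h \<in> window (e / h) u}" using c by blast
    next
      fix c c' assume c: "c \<in> {c \<in> C. sim c h \<and> c - h \<in> window e u}" "c' \<in> {c \<in> C. sim c h \<and> c - h \<in> window e u}"
        and "less_mod (bigO e) c' c"
      then obtain n m :: nat where nm: "c' \<le> of_nat n * h" "h \<le> of_nat m * c'" by (auto simp: not_arch_iff)
      from c obtain k :: nat where k: "c \<le> of_nat k * h" by (auto simp: not_arch_iff)
      have cS: "c \<in> Sk" "c' \<in> Sk" using c C by auto
      have "bigO (e / h * c') \<subseteq> bigO e"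
      proof (rule bigO_subset[of _ n])
        have "e / h * c' \<le> e / h * (of_nat n * h)" using nm(1) epos hS by (intro mult_left_mono) auto
        then show "e / h * c' \<le> of_nat n * e" using hS by (simp add: mult.commute)
      qed
      then have "less_mod (bigO (e / h * c')) c' c" using less_mod_antimono \<open>less_mod (bigO e) c' c\<close> by blast
      moreover have "c \<le> of_nat (k * m) * c'"
      proof -
        have "of_nat k * h \<le> of_nat k * (of_nat m * c')" using nm(2) by (intro mult_left_mono) auto
        then show ?thesis using k by (simp add: mult.assoc)
      qed
      ultimately show "less_mod (bigO (e / h)) (L c') (L c)"
        by (intro less_mod_L[OF cS(2,1), of "e / h" "k * m"]) (use epos hS in simp_all)
    qed
    then show "ot_lt (less_mod (bigO e)) (\<omega> (\<beta> + \<omega> 0)) {c \<in> C. sim c h \<and> c - h \<in> window e u}"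
      by (rule ot_le_imp_lt) (use add_strict_left_mono[OF zero_less_omega, of \<beta> 0] in simp)
  qed (rule pos)
qed

text \<open>
  Here the tower descends: a magnitude between \<open>e\<close> and \<open>e * u\<^sup>n\<close> is
  determined by a logarithm in a window whose width is the preceding tower function, at precision
  \<open>1\<close>.
\<close>
lemma arch_classes_window:
  assumes C: "C \<subseteq> Sk" and loc: "locally (tower i) a (L ` C)" and e: "e \<in> ratios"
  shows "ot_le arch a (C \<inter> window e (tower (Suc i)) - bigO e)"
proof -
  obtain p q where pq: "p \<in> Sk" "q \<in> Sk" "e = p / q" using e by (auto simp: ratios_def)
  have pos: "0 < p" "0 < q" using pq Sk_pos by auto
  have u: "tower (Suc i) \<in> Sk" by (rule tower_Sk)
  show ?thesis
  proof (rule ot_le_pullback[OF locallyD[OF loc ratios_one, of "L p - L q"], of _ L])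
    fix h assume h: "h \<in> C \<inter> window e (tower (Suc i)) - bigO e"
    then have hS: "h \<in> Sk" "0 < h" using C Sk_pos by auto
    from h obtain n where "\<bar>h\<bar> \<le> e * tower (Suc i) ^ n" by (auto simp: window_def)
    then have n: "h \<le> e * tower (Suc i) ^ n" by simp
    have "p * tower (Suc i) ^ n \<in> Sk" using pq u by (intro Sk_mult Sk_power)
    moreover have "h * q \<le> p * tower (Suc i) ^ n" using n pos by (simp add: pq(3) field_simps)
    ultimately have "L (h * q) \<le> L (p * tower (Suc i) ^ n)" using L_le_iff Sk_mult[OF hS(1) pq(2)] by blast
    then have "L h + L q \<le> L p + of_nat n * L (tower (Suc i))"
      using hS pq u by (simp add: L_mult L_power Sk_power)
    also have "of_nat n * L (tower (Suc i)) \<le> tower i ^ n * tower i ^ 2"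
      by (rule mult_mono[OF of_nat_le_power2 L_tower_le]) (use tower_ge_two[of i] L_nonneg[OF u] in auto)
    finally have "L h - (L p - L q) \<le> tower i ^ n * tower i ^ 2" by simp
    then have le: "L h - (L p - L q) \<le> tower i ^ (n + 2)" by (simp only: power_add)
    have "\<not> \<bar>h\<bar> \<le> of_nat 1 * e" using h bigOI by blast
    then have "p \<le> h * q" using hS pos by (simp add: pq(3) field_simps)
    then have "L p \<le> L h + L q" using L_le_iff[OF pq(1) Sk_mult[OF hS(1) pq(2)]] L_mult[OF hS(1) pq(2)] by simp
    with le have "L h - (L p - L q) \<in> window 1 (tower i)" by (intro windowI[of _ _ _ "n + 2"]) simp
    then show "L h \<in> {a \<in> L ` C. a - (L p - L q) \<in> window 1 (tower i)}" using h by blast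
  next
    fix h h' assume h: "h \<in> C \<inter> window e (tower (Suc i)) - bigO e" "h' \<in> C \<inter> window e (tower (Suc i)) - bigO e"
      and a: "arch h' h"
    have S: "h \<in> Sk" "h' \<in> Sk" using h C by auto
    from a have "of_nat 1 * h' < h" unfolding arch_def by blast
    then have "L h' < L h" using L_strict_mono[OF S(2,1)] by simp
    moreover have "L h - L h' \<notin> bigO 1"
      using bigO_L[OF S(2,1)] a by (auto simp: arch_def not_less[symmetric])
    ultimately show "less_mod (bigO 1) (L h') (L h)" by (simp add: less_mod_def)
  qed
qed

text \<open>
  For the width \<open>ln x\<close> the gap leaves a single magnitude.
\<close>
lemma arch_classes_gap:
  assumes C: "C \<subseteq> Sk" and e: "e \<in> ratios"
  shows "ot_le arch a (C \<inter> window e (tower 0) - bigO e)"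
proof (rule ot_le_trivial)
  fix y z assume y: "y \<in> C \<inter> window e (tower 0) - bigO e" and z: "z \<in> C \<inter> window e (tower 0) - bigO e"
  have S: "y \<in> Sk" "z \<in> Sk" using C y z by auto
  have epos: "0 < e" using ratios_pos[OF e] .
  have "\<not> \<bar>y\<bar> \<le> of_nat 1 * e" using y bigOI by blast
  then have ey: "e \<le> y" using Sk_pos[OF S(1)] by simp
  from z obtain n where "\<bar>z\<bar> \<le> e * t ^ n" by (auto simp: window_def)
  then have "z \<le> e * t ^ n" by simp
  also have "\<dots> \<le> y * t ^ n" using ey t_ge_two by (intro mult_right_mono) auto
  finally show "\<not> arch y z" using gap[OF S] by (auto simp: not_arch_iff)
qed

text \<open>
  From sums back to logarithms, which closes the circle. Up to \<open>O(1)\<close>, the logarithm of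
  a sum is the logarithm of its largest summand, so coarse precisions are covered by the bound for
  products. For finer precisions the coarse classes are refined: functions in one class have the
  same magnitude \<open>f\<^sub>1\<close>, and their logarithms at precision \<open>e\<close>
  correspond to the functions themselves at precision \<open>e * f\<^sub>1\<close>.
\<close>
lemma locally_logs:
  assumes u: "2 \<le> u" and C: "C \<subseteq> Sk" and B: "B \<subseteq> Sk" "B \<subseteq> fsums C"
    and loc: "locally u (\<omega> \<beta>) (L ` C)" and le: "\<beta> \<le> \<beta>'"
    and window: "\<And>e z. e \<in> ratios \<Longrightarrow> ot_lt (less_mod (bigO e)) (\<omega> \<beta>') {f \<in> fsums C. f - z \<in> window e u}"
  shows "locally u (\<omega> (\<beta>' + \<omega> 0)) (L ` B)"
  unfolding locally_def
proof (intro allI ballI)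
  fix z e assume e: "e \<in> ratios"
  have epos: "0 < e" using ratios_pos[OF e] .
  have "\<beta>' + 0 < \<beta>' + \<omega> 0" by (rule add_strict_left_mono) simp
  then have lt: "\<beta>' < \<beta>' + \<omega> 0" by simp
  have V1: "convex_subgroup (bigO 1 :: 'a set)" by (rule convex_subgroup_bigO) simp
  have "\<exists>f\<in>B. \<exists>h\<in>C. l = L f \<and> l - L h \<in> bigO 1" if "l \<in> L ` B" for l
  proof -
    from that obtain f where f: "f \<in> B" "l = L f" by blast
    then have fS: "f \<in> Sk" "0 < f" using B Sk_pos by auto
    obtain h n where h: "h \<in> C" "h \<le> f" "f \<le> of_nat n * h"
      using fsums_lead[of f C] f B C Sk_pos fS by blast
    then have hS: "h \<in> Sk" "0 < h" using C Sk_pos by auto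
    have "L f - L h \<le> (f - h) / h" by (rule L_diff[OF hS(1) fS(1)])
    also have "\<dots> \<le> of_nat n" using h hS by (simp add: field_simps)
    finally have "L f - L h \<in> bigO 1"
      using L_le_iff[OF hS(1) fS(1)] h by (intro bigOI[of _ n]) auto
    then show ?thesis using f h by blast
  qed
  then obtain f h where fh: "\<And>l. l \<in> L ` B \<Longrightarrow> f l \<in> B" "\<And>l. l \<in> L ` B \<Longrightarrow> h l \<in> C"
    "\<And>l. l \<in> L ` B \<Longrightarrow> l = L (f l)" "\<And>l. l \<in> L ` B \<Longrightarrow> l - L (h l) \<in> bigO 1"
    by metis
  \<comment> \<open>precisions that are at least of order \<open>1\<close>\<close>
  have coarse: "ot_le (less_mod (bigO e')) (\<omega> \<beta>) {l \<in> L ` B. l - z \<in> window e' u}"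
    if e': "e' \<in> ratios" "1 \<le> of_nat k * e'" for e' and k :: nat
  proof -
    have e'pos: "0 < e'" using ratios_pos[OF e'(1)] .
    have V: "convex_subgroup (bigO e')" and W: "convex_subgroup (window e' u)"
      using convex_subgroup_bigO convex_subgroup_window e'pos u by auto
    have sub: "bigO 1 \<subseteq> bigO e'" "bigO e' \<subseteq> window e' u"
      using bigO_subset[OF e'(2)] bigO_subset_window[OF e'pos u] by auto
    show ?thesis
    proof (rule ot_le_pullback[OF locallyD[OF loc e'(1), of z], of _ "\<lambda>l. L (h l)"])
      fix l assume l: "l \<in> {l \<in> L ` B. l - z \<in> window e' u}"
      then have "l - z \<in> window e' u" "l - L (h l) \<in> window e' u" using fh(4)[of l] sub by blast+
      then have "(l - z) - (l - L (h l)) \<in> window e' u" by (rule cs_diff[OF W])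
      then show "L (h l) \<in> {a \<in> L ` C. a - z \<in> window e' u}" using fh(2)[of l] l by simp
    next
      fix l l' assume l: "l \<in> {l \<in> L ` B. l - z \<in> window e' u}" "l' \<in> {l \<in> L ` B. l - z \<in> window e' u}"
        "less_mod (bigO e') l' l"
      show "less_mod (bigO e') (L (h l')) (L (h l))"
        by (rule less_mod_perturb[OF V l(3)]) (use fh(4)[of l] fh(4)[of l'] l sub in auto)
    qed
  qed
  show "ot_le (less_mod (bigO e)) (\<omega> (\<beta>' + \<omega> 0)) {l \<in> L ` B. l - z \<in> window e u}"
  proof (cases "1 \<le> e")
    case True
    have "\<omega> \<beta> \<le> \<omega> (\<beta>' + \<omega> 0)" using le lt by simp
    then show ?thesis using ot_le_mono[OF coarse[OF e, of 1]] True by simp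
  next
    case False
    let ?A = "{l \<in> L ` B. l - z \<in> window e u}"
    have W: "convex_subgroup (window e u)" using convex_subgroup_window epos u by auto
    have "window e u \<subseteq> window 1 u"
    proof
      fix r assume "r \<in> window e u"
      then obtain n where "\<bar>r\<bar> \<le> e * u ^ n" by (auto simp: window_def)
      also have "\<dots> \<le> 1 * u ^ n" using False u by (intro mult_right_mono) auto
      finally show "r \<in> window 1 u" by (rule windowI)
    qed
    then have 1: "ot_le (less_mod (bigO 1)) (\<omega> \<beta>) ?A"
      using ot_le_subset[OF coarse[OF ratios_one, of 1]] by (auto simp: subset_iff)
    have sub: "bigO e \<subseteq> bigO 1" using False by (intro bigO_mono) simp
    have "ot_le (less_mod (bigO e)) (\<omega> \<beta>' + \<omega> 0 + \<omega> \<beta>) ?A"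
    proof (rule ot_le_lex[OF 1])
      fix l1 assume l1: "l1 \<in> ?A"
      define f1 where "f1 = f l1"
      from l1 have "l1 \<in> L ` B" by simp
      from fh(1,3)[OF this] B(1) have f1: "f1 \<in> Sk" "l1 = L f1" by (auto simp: f1_def)
      have f1pos: "0 < f1" using Sk_pos f1(1) .
      let ?X = "{y \<in> ?A. \<not> less_mod (bigO 1) y l1 \<and> \<not> less_mod (bigO 1) l1 y}"
      have X: "f l \<in> Sk" "l = L (f l)" "0 < f l" "l - l1 \<in> bigO 1" "l - l1 \<in> window e u"
        "\<exists>n::nat. f l \<le> of_nat n * f1" "\<exists>n::nat. f1 \<le> of_nat n * f l" if l: "l \<in> ?X" for l
      proof -
        from l have lB: "l \<in> L ` B" by simp
        from fh(1,3)[OF lB] B(1) show fS: "f l \<in> Sk" "l = L (f l)" by auto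
        then show "0 < f l" using Sk_pos by simp
        show O: "l - l1 \<in> bigO 1"
        proof (cases "l < l1")
          case True
          with l have "l1 - l \<in> bigO 1" by (auto simp: less_mod_def)
          then show ?thesis by (rule cs_minus_commute[OF V1])
        next
          case False
          then show ?thesis using l cs_zero[OF V1] by (cases "l = l1") (auto simp: less_mod_def)
        qed
        have "(l - z) - (l1 - z) \<in> window e u" by (rule cs_diff[OF W]) (use l l1 in auto)
        then show "l - l1 \<in> window e u" by simp
        show "\<exists>n::nat. f l \<le> of_nat n * f1"
          using bigO_L[OF f1(1) fS(1)] O fS(2) f1(2) by simp
        show "\<exists>n::nat. f1 \<le> of_nat n * f l"
          using bigO_L[OF fS(1) f1(1)] cs_minus_commute[OF V1 O] fS(2) f1(2) by simp
      qed
      have e1: "e * f1 \<in> ratios" by (rule ratios_mult[OF e f1(1)])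
      have W1: "convex_subgroup (window (e * f1) u)" using convex_subgroup_window[of "e * f1" u] epos f1pos u by simp
      show "ot_le (less_mod (bigO e)) (\<omega> \<beta>') ?X"
      proof (rule ot_le_pullback[OF ot_lt_imp_le[OF window[OF e1, of f1]], of _ f])
        fix l assume l: "l \<in> ?X"
        note Xl = X[OF l]
        from Xl(6) obtain n :: nat where n: "f l \<le> of_nat n * f1" by blast
        have "(of_nat (Suc n) * f1) * (l - l1) \<in> window (e * f1) u"
          by (rule window_mult[of _ _ f1 _ _ "Suc n"]) (use Xl(5) f1pos epos u in auto)
        then have "f l - f1 \<in> window (e * f1) u"
        proof (rule cs_convex[OF W1])
          show "\<bar>f l - f1\<bar> \<le> \<bar>(of_nat (Suc n) * f1) * (l - l1)\<bar>"
            using abs_diff_le_L[OF Xl(1) f1(1) n] Xl(2) f1 f1pos by (simp add: abs_mult)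
        qed
        then show "f l \<in> {g \<in> fsums C. g - f1 \<in> window (e * f1) u}" using fh(1) B(2) l by auto
      next
        fix l l' assume l: "l \<in> ?X" "l' \<in> ?X" "less_mod (bigO e) l' l"
        have "less_mod (bigO e) (L (f l')) (L (f l))" using X(2)[OF l(1)] X(2)[OF l(2)] l(3) by simp
        from less_mod_exp[OF X(1)[OF l(2)] X(1)[OF l(1)] this epos]
        have 2: "less_mod (bigO (e * f l')) (f l') (f l)" .
        from X(7)[OF l(2)] obtain n :: nat where n: "f1 \<le> of_nat n * f l'" by blast
        have "e * f1 \<le> of_nat n * (e * f l')" using mult_left_mono[OF n, of e] epos by (simp add: algebra_simps)
        from less_mod_antimono[OF bigO_subset[OF this] 2] show "less_mod (bigO (e * f1)) (f l') (f l)" .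
      qed
    next
      fix y z assume "less_mod (bigO e) y z"
      then show "\<not> less_mod (bigO 1) z y" by (auto simp: less_mod_def)
    qed
    moreover have "\<omega> \<beta>' + \<omega> 0 + \<omega> \<beta> < \<omega> (\<beta>' + \<omega> 0)"
      by (intro plus_less_omega) (use lt le in \<open>auto intro: order_le_less_trans[OF zero_le_ord]\<close>)
    ultimately show ?thesis using ot_le_mono less_imp_le by blast
  qed
qed

text \<open>
  Distinct values differ by at least \<open>1\<close>, so the logarithms of values bounded by
  \<open>u\<close> differ by at least \<open>1 / u\<close>, and one window at precision \<open>1 /
  (x * u)\<close> shows the plain order of the logarithms.
\<close>
lemma locally_wellorder:
  assumes A: "A \<subseteq> S_logs" and bound: "\<And>f. f \<in> S \<Longrightarrow> f \<le> tower (Suc I)" and loc: "locally (tower (Suc I)) d A"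
  shows "ot_le (<) d A"
proof -
  let ?u = "tower (Suc I)"
  \<comment> \<open>The factor \<open>x\<close> ensures that differences of size \<open>1 / ?u\<close> are not in \<open>O(e)\<close>.\<close>
  define e where "e = 1 / (x * ?u)"
  have u: "?u \<in> Sk" "0 < ?u" "0 < x" "x \<le> ?u" using tower_Sk[of I] Sk_pos Sk_x x_le_tower by auto
  have e: "e \<in> ratios" unfolding e_def using ratios_div[OF ratios_one Sk_mult[OF Sk_x u(1)]] .
  show ?thesis
  proof (rule ot_le_pullback[OF locallyD[OF loc e, of 0], of _ "\<lambda>y. y"])
    fix a assume a: "a \<in> A"
    then obtain f where f: "f \<in> S" "f \<noteq> 1" "a = L f" using A by (auto simp: S_logs_def)
    have "0 \<le> a" "a \<le> ?u" using f L_nonneg[OF S_Sk] L_le[OF S_Sk, of f] bound[of f] by auto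
    moreover have "?u \<le> e * ?u ^ 3"
    proof -
      have "e * ?u ^ 3 = ?u * (?u / x)" using u by (simp add: e_def field_simps power3_eq_cube)
      moreover have "?u * 1 \<le> ?u * (?u / x)" using u by (intro mult_left_mono) auto
      ultimately show ?thesis by simp
    qed
    ultimately have "a - 0 \<in> window e ?u" by (intro windowI[of _ _ _ 3]) simp
    then show "a \<in> {a \<in> A. a - 0 \<in> window e ?u}" using a by simp
  next
    fix a a' assume aa: "a \<in> A" "a' \<in> A" "a' < a"
    then have "a \<in> L ` S" "a' \<in> L ` S" using A by (auto simp: S_logs_def)
    then obtain f g where f: "f \<in> S" "a = L f" and g: "g \<in> S" "a' = L g" by blast
    have S: "f \<in> Sk" "g \<in> Sk" using f g S_Sk by auto
    then have "g < f" using aa f g L_less_iff by simp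
    then have "g + 1 \<le> f" using discrete S by blast
    have fpos: "0 < f" using Sk_pos S by simp
    have "1 / ?u \<le> 1 / f" using bound[OF f(1)] fpos by (intro divide_left_mono) (auto simp: u)
    also have "\<dots> \<le> (f - g) / f" using \<open>g + 1 \<le> f\<close> fpos by (intro divide_right_mono) auto
    also have "\<dots> \<le> a - a'" using L_diff_lower[OF S(2,1)] f g by simp
    finally have low: "1 / ?u \<le> a - a'" .
    have "a - a' \<notin> bigO e"
    proof
      assume "a - a' \<in> bigO e"
      then obtain n where "\<bar>a - a'\<bar> \<le> of_nat n * e" by (auto simp: bigO_def)
      with low have "1 / ?u \<le> of_nat n * e" by simp
      then have "x \<le> of_nat n" using u by (simp add: e_def field_simps)
      then show False using x_infinite[of n] by simp
    qed
    then show "less_mod (bigO e) a' a" using aa by (simp add: less_mod_def)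
  qed
qed

definition has_level :: "'a \<Rightarrow> bool" where
  "has_level a \<longleftrightarrow> (\<exists>l\<in>G \<union> (\<lambda>q. q * t) ` G. \<exists>n::nat. a \<le> of_nat n * l \<and> l \<le> of_nat n * a)"

lemma level_pos: "l \<in> G \<union> (\<lambda>q. q * t) ` G \<Longrightarrow> 0 < l"
  using G_pos t_ge_two by auto

lemma has_level_cong:
  assumes "has_level a" "b \<le> of_nat m * a" "a \<le> of_nat m * b"
  shows "has_level b"
proof -
  from assms(1) obtain l n where l: "l \<in> G \<union> (\<lambda>q. q * t) ` G" "a \<le> of_nat n * l" "l \<le> of_nat n * a"
    unfolding has_level_def by blast
  have "b \<le> of_nat m * (of_nat n * l)" using assms(2) l(2) by (rule order_trans[OF _ mult_left_mono]) auto
  moreover have "l \<le> of_nat n * (of_nat m * b)" using l(3) assms(3) by (rule order_trans[OF _ mult_left_mono]) auto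
  ultimately show ?thesis using l(1) unfolding has_level_def
    by (intro bexI[of _ l] exI[of _ "m * n"]) (auto simp: algebra_simps)
qed

lemma has_level_mult:
  assumes "has_level a" "q \<in> G" shows "has_level (q * a)"
proof -
  from assms(1) obtain l n where l: "l \<in> G \<union> (\<lambda>q. q * t) ` G" "a \<le> of_nat n * l" "l \<le> of_nat n * a"
    unfolding has_level_def by blast
  have q: "0 < q" using G_pos assms(2) .
  have "q * l \<in> G \<union> (\<lambda>q. q * t) ` G" using l(1) G_mult[OF assms(2)] by (force simp: mult.assoc[symmetric])
  moreover have "q * a \<le> of_nat n * (q * l)" "q * l \<le> of_nat n * (q * a)"
    using mult_left_mono[OF l(2), of q] mult_left_mono[OF l(3), of q] q by (simp_all add: algebra_simps)
  ultimately show ?thesis unfolding has_level_def by blast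
qed

text \<open>
  The archimedean class of \<open>L f\<close>: sums and products have the class of the larger
  logarithm, and powers multiply it by an element of \<open>G\<close>, starting with \<open>L x =
  t\<close>. The element \<open>1 \<in> G\<close> is the class of the logarithm of integers.
\<close>
lemma S_has_level: "f \<in> S \<Longrightarrow> f \<noteq> 1 \<Longrightarrow> has_level (L f)"
proof (induction rule: closure.induct)
  case x
  have "t \<in> G \<union> (\<lambda>q. q * t) ` G" using G_one by force
  then show ?case unfolding has_level_def by (intro bexI[of _ t] exI[of _ 1]) auto
next
  case (add f g)
  have main: "has_level (L (f + g))" if "g \<le> f" "f \<in> S" "g \<in> S" "f \<noteq> 1 \<Longrightarrow> has_level (L f)" for f g
  proof -
    have S: "f \<in> Sk" "g \<in> Sk" "f + g \<in> Sk" "0 < g" using that S_Sk Sk_add Sk_pos by auto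
    show ?thesis
    proof (cases "f = 1")
      case True
      then have "g = 1" using Sk_ge_one[OF S(2)] that(1) by simp
      have "L 2 \<le> 1" using L_le[OF Sk_two] by simp
      moreover have "f + g = 2" using True \<open>g = 1\<close> by simp
      ultimately show ?thesis using L_two G_one unfolding has_level_def
        by (intro bexI[of _ 1] exI[of _ 2]) auto
    next
      case False
      have "L f \<le> L (f + g)" using L_le_iff[OF S(1,3)] S(4) by simp
      moreover have "L (f + g) \<le> L (2 * f)" using L_le_iff[OF S(3) Sk_mult[OF Sk_two S(1)]] that(1) by simp
      then have "L (f + g) \<le> 3 * L f"
        using L_mult[OF Sk_two S(1)] L_le[OF Sk_two] L_ge[OF S(1) False] by simp
      moreover have "0 \<le> L (f + g)" using L_nonneg[OF S(3)] .
      ultimately show ?thesis using has_level_cong[OF that(4)[OF False], of "L (f + g)" 3] by simp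
    qed
  qed
  show ?case
    using main[of g f] main[of f g] add by (cases "g \<le> f") (auto simp: add.commute)
next
  case (mult f g)
  have main: "has_level (L (f * g))" if "L g \<le> L f" "f \<in> S" "g \<in> S" "has_level (L f)" for f g
  proof -
    have S: "f \<in> Sk" "g \<in> Sk" using that S_Sk by auto
    have "0 \<le> L f" "0 \<le> L g" using L_nonneg S by auto
    then show ?thesis using has_level_cong[OF that(4), of "L (f * g)" 2] that(1) L_mult[OF S] by simp
  qed
  consider "f = 1" | "g = 1" | "f \<noteq> 1" "g \<noteq> 1" "L g \<le> L f" | "f \<noteq> 1" "g \<noteq> 1" "L f \<le> L g" by linarith
  then show ?case
    by cases (use mult main[of g f] main[of f g] in \<open>auto simp: mult.commute\<close>)
next
  case (pw f q)
  have S: "f \<in> Sk" "q \<in> Sk" using pw S_Sk G_Sk by auto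
  have "f \<noteq> 1"
  proof
    assume "f = 1"
    then have "L (pw f q) = L 1" using L_pw[OF S] by simp
    then show False using L_inj[OF Sk_pw[OF S] Sk_one] pw.prems by simp
  qed
  then show ?case using has_level_mult pw L_pw[OF S] by simp
qed simp

lemma S_logs_arch: "\<exists>\<delta>. ot_le arch \<delta> S_logs"
proof -
  let ?\<Lambda> = "G \<union> (\<lambda>q. q * t) ` G"
  have lt: "\<gamma> < \<gamma> + \<omega> 0" using add_strict_left_mono[OF zero_less_omega, of \<gamma> 0] by simp
  have arch_less: "a < b" if "arch a b" for a b :: 'a
  proof -
    from that have "of_nat 1 * a < b" unfolding arch_def by blast
    then show ?thesis by simp
  qed
  have 1: "ot_le arch \<gamma> G"
    by (rule ot_le_pullback[OF G_order, of _ "\<lambda>a. a"]) (auto dest: arch_less)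
  have 2: "ot_le arch \<gamma> ((\<lambda>q. q * t) ` G)"
  proof (rule ot_le_pullback[OF G_order, of _ "\<lambda>a. a / t"])
    fix a b :: 'a assume "arch a b"
    then show "a / t < b / t" using arch_less t_ge_two by (intro divide_strict_right_mono) auto
  qed (use t_ge_two in auto)
  have "ot_lt arch (\<gamma> + \<omega> 0) ?\<Lambda>"
    by (rule ot_lt_Un[OF ot_le_imp_lt[OF 1 lt] ot_le_imp_lt[OF 2 lt]])
  then have \<Lambda>: "ot_le arch (\<gamma> + \<omega> 0) ?\<Lambda>" by (rule ot_lt_imp_le)
  have "\<forall>a\<in>S_logs. \<exists>l\<in>?\<Lambda>. \<exists>n::nat. a \<le> of_nat n * l \<and> l \<le> of_nat n * a"
    using S_has_level unfolding S_logs_def has_level_def by blast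
  then obtain l where l: "\<And>a. a \<in> S_logs \<Longrightarrow> l a \<in> ?\<Lambda> \<and> (\<exists>n::nat. a \<le> of_nat n * l a \<and> l a \<le> of_nat n * a)"
    by metis
  have "ot_le arch (\<gamma> + \<omega> 0) S_logs"
  proof (rule ot_le_pullback[OF \<Lambda>, of _ l])
    fix a b assume ab: "a \<in> S_logs" "b \<in> S_logs" "arch b a"
    obtain n :: nat where n: "a \<le> of_nat n * l a" using l ab by blast
    obtain m :: nat where m: "l b \<le> of_nat m * b" using l ab by blast
    have lpos: "0 < l a" "0 < l b" using l ab level_pos by blast+
    show "arch (l b) (l a)" unfolding arch_def
    proof
      fix k :: nat
      have "of_nat n * (of_nat k * l b) \<le> of_nat n * (of_nat k * (of_nat m * b))"
        by (intro mult_left_mono m) auto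
      also have "\<dots> = of_nat (n * k * m) * b" by (simp add: mult.assoc)
      also have "\<dots> < a" using ab(3) unfolding arch_def by blast
      also note n
      finally have "of_nat n * (of_nat k * l b) < of_nat n * l a" .
      then show "of_nat k * l b < l a" by (rule mult_left_less_imp_less) simp
    qed
  qed (use l in blast)
  then show ?thesis by blast
qed

lemma fsums_smaller:
  assumes "y \<in> fsums C" "\<And>h. h \<in> C \<Longrightarrow> 0 < h"
  shows "y \<in> fsums {h \<in> C. h \<le> y}"
  using assms(1)
proof induction
  case (add h y)
  have pos: "0 < h" "0 \<le> y" using assms(2) add.hyps fsums_nonneg[OF add.hyps(2)] by blast+
  then have "{c \<in> C. c \<le> y} \<subseteq> {c \<in> C. c \<le> h + y}" by auto
  then have "y \<in> fsums {c \<in> C. c \<le> h + y}" using add.IH fsums_mono by blast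
  moreover have "h \<in> {c \<in> C. c \<le> h + y}" using pos add.hyps by auto
  ultimately show ?case by (rule fsums.add[rotated])
qed (rule fsums.zero)

lemma fprods_mono: "C \<subseteq> D \<Longrightarrow> fprods C \<subseteq> fprods D"
proof
  fix y assume "C \<subseteq> D" "y \<in> fprods C"
  from this(2,1) show "y \<in> fprods D" by induction (auto intro: fprods.intros)
qed

lemma fprods_ge_one: "y \<in> fprods C \<Longrightarrow> (\<And>h. h \<in> C \<Longrightarrow> 1 \<le> h) \<Longrightarrow> 1 \<le> y"
proof (induction rule: fprods.induct)
  case (mult h y)
  then have "1 * 1 \<le> h * y" by (intro mult_mono) (auto intro: order_trans[OF zero_le_one])
  then show ?case by simp
qed simp

lemma fprods_smaller:
  assumes "y \<in> fprods C" "\<And>h. h \<in> C \<Longrightarrow> 1 \<le> h"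
  shows "y \<in> fprods {h \<in> C. h \<le> y}"
  using assms(1)
proof induction
  case (mult h y)
  have pos: "1 \<le> h" "1 \<le> y" using assms(2) mult.hyps fprods_ge_one[OF mult.hyps(2)] by blast+
  then have le: "h \<le> h * y" "y \<le> h * y"
    using mult_left_mono[of 1 y h] mult_right_mono[of 1 h y] by auto
  then have "{c \<in> C. c \<le> y} \<subseteq> {c \<in> C. c \<le> h * y}" by auto
  then have "y \<in> fprods {c \<in> C. c \<le> h * y}" using mult.IH fprods_mono by blast
  moreover have "h \<in> {c \<in> C. c \<le> h * y}" using le mult.hyps by auto
  ultimately show ?case by (rule fprods.mult[rotated])
qed (rule fprods.one)

lemma fprods_Sk: "y \<in> fprods C \<Longrightarrow> C \<subseteq> Sk \<Longrightarrow> y \<in> Sk"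
  by (induction rule: fprods.induct) (auto intro: Sk_one Sk_mult)

lemma L_fprods: "y \<in> fprods C \<Longrightarrow> C \<subseteq> Sk \<Longrightarrow> L y \<in> fsums (L ` C)"
proof (induction rule: fprods.induct)
  case (mult h y)
  then have "L (h * y) = L h + L y" using fprods_Sk by (intro L_mult) auto
  then show ?case using mult by (auto intro: fsums.add)
qed (simp add: fsums.zero)

text \<open>
  The main induction, on the rank \<open>r\<close> of the archimedean class of \<open>L f\<close>.
  The logarithms of rank below \<open>r\<close> (\<open>below r\<close>) are known for all widths at
  once; they contain the logarithms of the bases of those factors that can occur in a function of
  rank \<open>r\<close>, because infinite exponents raise the rank. Passing through products and
  sums yields the logarithms of rank at most \<open>r\<close> (\<open>upto r\<close>). For width
  \<open>tower i\<close> this step uses the bound for products at width \<open>tower (i - 1)\<close>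
  to count magnitudes; as that bound grows with \<open>r\<close>, it is replaced by \<open>acoef
  i\<close>, a bound for all \<open>r \<le> \<omega> \<delta>\<close>. Each step adds the constant
  \<open>c (acoef i)\<close> to the exponent, and the choice of \<open>\<beta> i r\<close> as a
  power of \<open>\<omega>\<close> with exponent growing in \<open>r\<close> absorbs it.
\<close>
theorem closure_order_type:
  assumes bound: "\<And>f. f \<in> S \<Longrightarrow> f \<le> tower (Suc I)"
  shows "\<exists>d. ot_le (<) d S"
proof -
  obtain \<delta> where \<delta>: "ot_le arch \<delta> S_logs" using S_logs_arch by blast
  obtain \<rho> where \<rho>: "\<And>a. a \<in> S_logs \<Longrightarrow> \<rho> a < \<omega> \<delta>"
     "\<And>a b. a \<in> S_logs \<Longrightarrow> b \<in> S_logs \<Longrightarrow> arch a b \<Longrightarrow> \<rho> a < \<rho> b"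
     "\<And>a b. a \<in> S_logs \<Longrightarrow> b \<in> S_logs \<Longrightarrow> {y \<in> S_logs. arch y a} \<subseteq> {y \<in> S_logs. arch y b} \<Longrightarrow> \<rho> a \<le> \<rho> b"
    using ot_le_rank[OF transp_arch \<delta>] by blast
  have \<rho>_mono: "\<rho> a \<le> \<rho> b" if "a \<in> S_logs" "b \<in> S_logs" "a \<le> b" for a b
    by (rule \<rho>(3)[OF that(1,2)]) (use that(3) in \<open>auto simp: arch_def intro: less_le_trans\<close>)
  \<comment> \<open>\<open>k\<close> is the increment of the exponent from bases to products, \<open>c a\<close> the one from bases to logarithms of sums when \<open>a\<close> bounds the number of magnitudes.\<close>
  define k where "k = \<gamma> + \<omega> 0 + \<delta> + \<omega> 0"
  define c where "c a = k + \<omega> 0 + a + \<omega> 0 + \<omega> 0" for a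
  \<comment> \<open>The gap allows the value \<open>0\<close> for the first width.\<close>
  define acoef where "acoef = rec_nat 0 (\<lambda>_ a. \<omega> (\<omega> (c a + \<omega> \<delta>) + k))"
  have acoef_Suc: "acoef (Suc j) = \<omega> (\<omega> (c (acoef j) + \<omega> \<delta>) + k)" for j by (simp add: acoef_def)
  define \<beta> where "\<beta> i r = \<omega> (c (acoef i) + r)" for i r
  define below where "below r = {l \<in> S_logs. \<rho> l < r}" for r
  define upto where "upto r = {l \<in> S_logs. \<rho> l \<le> r}" for r
  have main: "locally (tower i) (\<omega> (\<beta> i r + c (acoef i))) (upto r)" if "r \<le> \<omega> \<delta>" for r i
    using that
  proof (induction r arbitrary: i rule: less_induct)
    case (less r)
    have A_loc: "locally (tower i) (\<omega> (\<beta> i r)) (below r)" for i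
      unfolding locally_def
    proof (intro allI ballI)
      fix z e assume e: "e \<in> ratios"
      show "ot_le (less_mod (bigO e)) (\<omega> (\<beta> i r)) {a \<in> below r. a - z \<in> window e (tower i)}"
        unfolding ot_le_iff[of _ _ "{a \<in> below r. a - z \<in> window e (tower i)}"]
      proof
        fix y assume y: "y \<in> {a \<in> below r. a - z \<in> window e (tower i)}"
        define r' where "r' = \<rho> y"
        have r': "r' < r" "y \<in> S_logs" using y by (auto simp: r'_def below_def)
        have cc: "c (acoef i) + r' < c (acoef i) + r" using r'(1) by (rule add_strict_left_mono)
        have "\<omega> (\<beta> i r' + c (acoef i)) \<le> \<omega> (\<beta> i r)"
          unfolding \<beta>_def omega_le_iff
        proof (rule less_imp_le, rule plus_less_omega)
          show "\<omega> (c (acoef i) + r') < \<omega> (c (acoef i) + r)" using cc by simp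
          have "0 < r" using r'(1) zero_le_ord[of r'] by (rule order_le_less_trans[rotated])
          then have "c (acoef i) + 0 < c (acoef i) + r" by (rule add_strict_left_mono)
          then have "\<omega> (c (acoef i)) < \<omega> (c (acoef i) + r)" by simp
          then show "c (acoef i) < \<omega> (c (acoef i) + r)" by (rule order_le_less_trans[OF le_omega])
        qed
        then have "ot_le (less_mod (bigO e)) (\<omega> (\<beta> i r)) {a \<in> upto r'. a - z \<in> window e (tower i)}"
          using locallyD[OF less.IH[OF r'(1)] e] less.prems r'(1) ot_le_mono by fastforce
        then have "ot_lt (less_mod (bigO e)) (\<omega> (\<beta> i r)) {x \<in> {a \<in> upto r'. a - z \<in> window e (tower i)}. less_mod (bigO e) x y}"
          unfolding ot_le_iff[of _ _ "{a \<in> upto r'. a - z \<in> window e (tower i)}"]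
          using y r'(2) by (simp add: upto_def r'_def)
        then show "ot_lt (less_mod (bigO e)) (\<omega> (\<beta> i r)) {x \<in> {a \<in> below r. a - z \<in> window e (tower i)}. less_mod (bigO e) x y}"
          by (rule ot_lt_subset)
            (use \<rho>_mono[OF _ r'(2)] in \<open>auto simp: less_mod_def upto_def below_def r'_def\<close>)
      qed
    qed
    have A_pos: "0 < l" if "l \<in> below r" for l
      using that L_pos S_Sk by (auto simp: below_def S_logs_def)
    have A_wo: "ot_le (<) (\<omega> (\<beta> (Suc I) r)) (below r)"
      by (rule locally_wellorder[OF _ bound A_loc]) (auto simp: below_def)
    define D where "D = {d \<in> factors. \<rho> (L d) \<le> r}"
    have D: "D \<subseteq> S - {1}" "D \<subseteq> Sk" using factors_S S_Sk by (auto simp: D_def)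
    have LD: "L ` D \<subseteq> S_logs" using D by (auto simp: S_logs_def)
    have LD_sub: "L ` D \<subseteq> insert t {q * l |q l. q \<in> G \<and> l \<in> below r}"
    proof
      fix y assume "y \<in> L ` D"
      then obtain d where d: "d \<in> factors" "\<rho> (L d) \<le> r" "y = L d" "L d \<in> S_logs"
        using LD by (auto simp: D_def)
      then consider "d = x" | p q where "d = pw p q" "p \<in> S" "p \<noteq> 1" "q \<in> G" "infinite_elem q"
        unfolding factors_def by blast
      then show "y \<in> insert t {q * l |q l. q \<in> G \<and> l \<in> below r}"
      proof cases
        case 2
        have eq: "L d = q * L p" using 2 S_Sk G_Sk L_pw by auto
        have p: "L p \<in> S_logs" "0 < L p" using 2 L_pos S_Sk by (auto simp: S_logs_def)
        have "arch (L p) (L d)" unfolding arch_def eq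
        proof
          fix n :: nat
          show "of_nat n * L p < q * L p"
            by (rule mult_strict_right_mono) (use 2 p in \<open>auto simp: infinite_elem_def\<close>)
        qed
        then have "\<rho> (L p) < \<rho> (L d)" using \<rho>(2) p d by blast
        then have "L p \<in> below r" using p d by (simp add: below_def)
        then show ?thesis using 2 d eq by blast
      qed (use d in simp)
    qed
    have LD_arch: "ot_le arch \<delta> (L ` D)" by (rule ot_le_subset[OF \<delta> LD])
    define C where "C = fprods D"
    have C: "C \<subseteq> Sk" using fprods_Sk D by (auto simp: C_def)
    have LC: "L ` C \<subseteq> fsums (L ` D)" using L_fprods D by (auto simp: C_def)
    have LC_loc: "locally (tower j) (\<omega> (\<beta> j r + k)) (L ` C)" for j
      using locally_subset[OF locally_log_products(1)[OF tower_ge_two A_pos A_wo A_loc LD_sub LD_arch] LC]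
      by (simp add: k_def add.assoc)
    obtain d0 where d0: "ot_le (<) d0 (L ` C)"
      using locally_log_products(2)[OF tower_ge_two A_pos A_wo A_loc LD_sub LD_arch] ot_le_subset[OF _ LC] by blast
    have arch: "ot_le arch (acoef i) (C \<inter> window e (tower i) - bigO e)" if e: "e \<in> ratios" for e
    proof (cases i)
      case 0
      then show ?thesis using arch_classes_gap[OF C e] by simp
    next
      case (Suc j)
      have "\<beta> j r \<le> \<omega> (c (acoef j) + \<omega> \<delta>)"
        unfolding \<beta>_def omega_le_iff using less.prems by (rule add_left_mono)
      then have "\<omega> (\<beta> j r + k) \<le> acoef (Suc j)" unfolding acoef_Suc omega_le_iff by (rule add_right_mono)
      then show ?thesis
        using arch_classes_window[OF C locally_mono[OF LC_loc[of j]] e] Suc by blast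
    qed
    have window: "ot_lt (less_mod (bigO e)) (\<omega> (\<beta> i r + k + \<omega> 0 + acoef i + \<omega> 0)) {f \<in> fsums C. f - z \<in> window e (tower i)}"
      if "e \<in> ratios" for e z
      by (rule ot_lt_window_sums[OF tower_ge_two C LC_loc d0 that arch[OF that]])
    define B where "B = {f \<in> S. f \<noteq> 1 \<and> \<rho> (L f) \<le> r}"
    have B: "B \<subseteq> Sk" "L ` B = upto r" using S_Sk by (auto simp: B_def upto_def S_logs_def)
    have "B \<subseteq> fsums C"
    proof
      fix f assume f: "f \<in> B"
      then have fS: "f \<in> S" "f \<noteq> 1" "\<rho> (L f) \<le> r" "f \<in> Sk" "L f \<in> S_logs"
        using B by (auto simp: B_def S_logs_def)
      have fac: "1 \<le> d" if "d \<in> factors" for d using that factors_S S_Sk Sk_ge_one by blast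
      have facpos: "0 < h" if "h \<in> fprods factors" for h
        using fprods_ge_one[OF that fac] by simp
      have "f \<in> fsums {h \<in> fprods factors. h \<le> f}"
        by (rule fsums_smaller[OF S_subset[OF fS(1)] facpos])
      moreover have "{h \<in> fprods factors. h \<le> f} \<subseteq> C"
      proof
        fix h assume h: "h \<in> {h \<in> fprods factors. h \<le> f}"
        then have "h \<in> fprods {d \<in> factors. d \<le> h}" using fprods_smaller fac by blast
        moreover have "{d \<in> factors. d \<le> h} \<subseteq> D"
        proof
          fix d assume d: "d \<in> {d \<in> factors. d \<le> h}"
          then have dS: "d \<in> Sk" "L d \<in> S_logs" using factors_S S_Sk by (auto simp: S_logs_def)
          have "L d \<le> L f" using L_le_iff[OF dS(1) fS(4)] d h by auto
          then show "d \<in> D" using \<rho>_mono[OF dS(2) fS(5)] fS(3) d by (auto simp: D_def)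
        qed
        ultimately show "h \<in> C" using fprods_mono unfolding C_def by blast
      qed
      ultimately show "f \<in> fsums C" using fsums_mono by blast
    qed
    have "\<beta> i r + k + 0 \<le> \<beta> i r + k + (\<omega> 0 + acoef i + \<omega> 0)" by (rule add_left_mono) simp
    then have "locally (tower i) (\<omega> (\<beta> i r + k + \<omega> 0 + acoef i + \<omega> 0 + \<omega> 0)) (L ` B)"
      by (intro locally_logs[OF tower_ge_two C B(1) \<open>B \<subseteq> fsums C\<close> LC_loc _ window]) (simp add: add.assoc)
    then show ?case unfolding B(2) c_def by (simp add: add.assoc)
  qed
  have "S_logs = upto (\<omega> \<delta>)" using \<rho>(1) by (auto simp: upto_def less_imp_le)
  then have "ot_le (<) (\<omega> (\<beta> (Suc I) (\<omega> \<delta>) + c (acoef (Suc I)))) S_logs"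
    using locally_wellorder[OF _ bound main[OF order_refl, of "Suc I"]] by simp
  then obtain d where d: "ot_le (<) d S_logs" by blast
  have "ot_le (<) d (S - {1})"
    by (rule ot_le_pullback[OF d, of _ L]) (use L_strict_mono S_Sk in \<open>auto simp: S_logs_def\<close>)
  then have "ot_lt (<) (d + \<omega> 0) (S - {1})"
    by (rule ot_le_imp_lt) (use add_strict_left_mono[OF zero_less_omega, of d 0] in simp)
  moreover have "ot_lt (<) (d + \<omega> 0) {1::'a}"
    by (rule ot_lt_singleton, simp) (use add_le_less_mono[OF zero_le_ord zero_less_omega, of d 0] in simp_all)
  ultimately have "ot_lt (<) (d + \<omega> 0) ((S - {1}) \<union> {1})" by (rule ot_lt_Un)
  then have "ot_lt (<) (d + \<omega> 0) S" by (rule ot_lt_subset) auto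
  then have "ot_le (<) (d + \<omega> 0) S" by (rule ot_lt_imp_le)
  then show ?thesis by blast
qed

end

section \<open>Stages of the construction and the rank of the Skolem functions\<close>

context exp_field
begin

primrec stage :: "nat \<Rightarrow> 'a set" where
  "stage 0 = range (\<lambda>n. of_nat (Suc n))"
| "stage (Suc N) = closure (stage N)"

text \<open>
  Two levels of the tower suffice for one closure step; what matters is that some level does.
\<close>
lemma closure_bound:
  assumes G: "G \<subseteq> Sk" "\<And>q. q \<in> G \<Longrightarrow> q \<le> tower (Suc I)" and f: "f \<in> closure G"
  shows "f \<in> Sk \<and> f \<le> tower (Suc (Suc (Suc I)))"
proof -
  let ?u = "tower (Suc I)"
  have u: "1 \<le> ?u" "2 \<le> ?u" using tower_ge_two[of "Suc I"] by linarith+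
  have "f \<in> Sk \<and> (\<exists>m. L f \<le> ?u ^ m)"
    using f
  proof (induction rule: closure.induct)
    case one
    show ?case using Sk_one by (auto intro: exI[of _ 0])
  next
    case x
    show ?case using Sk_x t_le_tower[of "Suc I"] by (auto intro!: exI[of _ 1])
  next
    case (add f g)
    then obtain m n where *: "L f \<le> ?u ^ m" "L g \<le> ?u ^ n" by blast
    have S: "f \<in> Sk" "g \<in> Sk" "f + g \<in> Sk" "f * g \<in> Sk" "2 * (f * g) \<in> Sk"
      using add Sk_add Sk_mult Sk_two by auto
    have "0 \<le> (f - 1) * (g - 1)" using Sk_ge_one S by (intro mult_nonneg_nonneg) auto
    moreover have "1 * 1 \<le> f * g" using Sk_ge_one S Sk_pos by (intro mult_mono) (auto intro: less_imp_le)
    ultimately have "f + g \<le> 2 * (f * g)" by (simp add: algebra_simps)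
    then have "L (f + g) \<le> L 2 + (L f + L g)"
      using L_le_iff[OF S(3,5)] L_mult[OF Sk_two S(4)] L_mult[OF S(1,2)] by simp
    also have "\<dots> \<le> ?u ^ (m + n) + (?u ^ (m + n) + ?u ^ (m + n))"
    proof (intro add_mono)
      have "1 \<le> ?u ^ (m + n)" using u by (intro one_le_power)
      then show "L 2 \<le> ?u ^ (m + n)" using L_le[OF Sk_two] by simp
      show "L f \<le> ?u ^ (m + n)" using *(1) power_increasing[OF le_add1 u(1), of m n] by linarith
      show "L g \<le> ?u ^ (m + n)" using *(2) power_increasing[OF le_add2 u(1), of n m] by linarith
    qed
    also have "\<dots> \<le> ?u ^ 2 * ?u ^ (m + n)"
    proof -
      have "2 * 2 \<le> ?u * ?u" using u by (intro mult_mono) auto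
      then have "3 * ?u ^ (m + n) \<le> (?u * ?u) * ?u ^ (m + n)" using u by (intro mult_right_mono) auto
      then show ?thesis by (simp add: power2_eq_square)
    qed
    finally have "L (f + g) \<le> ?u ^ (2 + (m + n))" by (simp only: power_add)
    then show ?case using S by blast
  next
    case (mult f g)
    then obtain m n where *: "L f \<le> ?u ^ m" "L g \<le> ?u ^ n" by blast
    have S: "f \<in> Sk" "g \<in> Sk" "f * g \<in> Sk" using mult Sk_mult by auto
    have "L (f * g) \<le> ?u ^ (m + n) + ?u ^ (m + n)"
      using * power_increasing[OF le_add1 u(1), of m n] power_increasing[OF le_add2 u(1), of n m]
      by (simp add: L_mult[OF S(1,2)])
    also have "\<dots> \<le> ?u * ?u ^ (m + n)" using mult_right_mono[OF u(2), of "?u ^ (m + n)"] u by simp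
    finally have "L (f * g) \<le> ?u ^ Suc (m + n)" by simp
    then show ?case using S by blast
  next
    case (pw f q)
    then obtain m where *: "L f \<le> ?u ^ m" by blast
    have S: "f \<in> Sk" "q \<in> Sk" "pw f q \<in> Sk" "0 < q" using pw G Sk_pw Sk_pos by auto
    have "q * L f \<le> ?u * ?u ^ m" by (rule mult_mono[OF G(2)[OF pw.hyps(2)] *]) (use u L_nonneg[OF S(1)] in auto)
    then have "L (pw f q) \<le> ?u ^ Suc m" by (simp add: L_pw[OF S(1,2)])
    then show ?case using S by blast
  qed
  then show ?thesis using le_tower_if_L_le by blast
qed

lemma ot_lt_finite: "finite A \<Longrightarrow> (\<And>a. \<not> R a a) \<Longrightarrow> 0 < d \<Longrightarrow> ot_lt R d A"
proof -
  assume *: "finite A" "\<And>a. \<not> R a a" "0 < d"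
  have "ot_lt R d (\<Union>a\<in>A. {a})" by (intro ot_lt_UN * ot_lt_singleton)
  then show ?thesis by simp
qed

lemma stage_order:
  "stage N \<subseteq> Sk \<and> 1 \<in> stage N \<and> (\<forall>p\<in>stage N. \<forall>q\<in>stage N. p * q \<in> stage N) \<and>
   (\<exists>\<gamma>. ot_le (<) \<gamma> (stage N)) \<and> (\<exists>I. \<forall>f\<in>stage N. f \<le> tower (Suc I))"
proof (induction N)
  case 0
  have h3: "p * q \<in> stage 0" if "p \<in> stage 0" "q \<in> stage 0" for p q
  proof -
    from that obtain m n where "p = of_nat (Suc m)" "q = of_nat (Suc n)" by auto
    then have "p * q = of_nat (Suc (m + n + m * n))" by (simp add: algebra_simps)
    then show ?thesis unfolding stage.simps by (rule range_eqI)
  qed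
  have h4: "ot_le (<) (\<omega> 0) (stage 0)"
    unfolding ot_le_iff
  proof
    fix z assume "z \<in> stage 0"
    then obtain n where n: "z = of_nat (Suc n)" by auto
    have "{y \<in> stage 0. y < z} \<subseteq> (\<lambda>n. of_nat (Suc n)) ` {..n}"
    proof
      fix y assume y: "y \<in> {y \<in> stage 0. y < z}"
      then obtain m where m: "y = of_nat (Suc m)" by auto
      with y n have "(of_nat (Suc m) :: 'a) < of_nat (Suc n)" by simp
      then have "Suc m < Suc n" by (simp only: of_nat_less_iff)
      then show "y \<in> (\<lambda>n. of_nat (Suc n)) ` {..n}" using m by auto
    qed
    then have "finite {y \<in> stage 0. y < z}" by (rule finite_subset) simp
    then show "ot_lt (<) (\<omega> 0) {y \<in> stage 0. y < z}" by (rule ot_lt_finite) auto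
  qed
  have h5: "f \<le> tower (Suc 0)" if f: "f \<in> stage 0" for f
  proof -
    from f obtain n where "f = of_nat (Suc n)" by auto
    then show ?thesis using x_infinite[of "Suc n"] by simp
  qed
  show ?case
  proof (intro conjI)
    show "stage 0 \<subseteq> Sk" using Sk_of_nat by auto
    show "1 \<in> stage 0" by (auto intro!: range_eqI[of _ _ 0])
    show "\<forall>p\<in>stage 0. \<forall>q\<in>stage 0. p * q \<in> stage 0" using h3 by blast
    show "\<exists>\<gamma>. ot_le (<) \<gamma> (stage 0)" using h4 by (rule exI)
    show "\<exists>I. \<forall>f\<in>stage 0. f \<le> tower (Suc I)" using h5 by blast
  qed
next
  case (Suc N)
  then obtain \<gamma> I where *: "ot_le (<) \<gamma> (stage N)" "\<forall>f\<in>stage N. f \<le> tower (Suc I)"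
    "stage N \<subseteq> Sk" "1 \<in> stage N" "\<forall>p\<in>stage N. \<forall>q\<in>stage N. p * q \<in> stage N" by blast
  interpret exp_closure Sk L pw x "stage N" \<gamma> by unfold_locales (use * in auto)
  have bound: "f \<in> Sk \<and> f \<le> tower (Suc (Suc (Suc I)))" if "f \<in> closure (stage N)" for f
    using closure_bound[OF *(3) _ that] *(2) by blast
  then obtain d where "ot_le (<) d (closure (stage N))" using closure_order_type[of "Suc (Suc I)"] by auto
  then have ex: "\<exists>\<gamma>. ot_le (<) \<gamma> (stage (Suc N))" by auto
  show ?case
  proof (intro conjI)
    show "stage (Suc N) \<subseteq> Sk" using bound by auto
    show "1 \<in> stage (Suc N)" by (simp add: closure.one)
    show "\<forall>p\<in>stage (Suc N). \<forall>q\<in>stage (Suc N). p * q \<in> stage (Suc N)" by (simp add: closure.mult)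
    show "\<exists>\<gamma>. ot_le (<) \<gamma> (stage (Suc N))" by (rule ex)
    show "\<exists>I. \<forall>f\<in>stage (Suc N). f \<le> tower (Suc I)"
      unfolding stage.simps using bound by blast
  qed
qed

text \<open>
  If \<open>pw f g\<close> with \<open>f \<noteq> 1\<close> is below a power of one tower function,
  then \<open>g\<close> is below a power of the preceding one, because \<open>g \<le> 2 * L (pw f
  g)\<close>. At the bottom of the tower the gap leaves the positive integers.
\<close>
lemma below_tower_stage: "f \<in> Sk \<Longrightarrow> f \<le> tower N ^ m \<Longrightarrow> f \<in> stage N"
proof (induction N arbitrary: f m)
  case 0
  then have "f \<le> 1 * t ^ m" by simp
  from gap[OF Sk_one 0(1) this] Sk_finite[OF 0(1)] show ?case by auto
next
  case (Suc N)
  from Suc.prems show ?case unfolding stage.simps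
  proof (induction f arbitrary: m rule: Sk_induct)
    case (add f g)
    have "f \<le> f + g" "g \<le> f + g" using Sk_pos add.hyps less_imp_le by auto
    then have "f \<le> tower (Suc N) ^ m" "g \<le> tower (Suc N) ^ m" using add.prems by auto
    then show ?case using add.IH by (intro closure.add)
  next
    case (mult f g)
    have "f * 1 \<le> f * g" "1 * g \<le> f * g"
      using Sk_pos Sk_ge_one mult.hyps by (auto intro!: mult_left_mono mult_right_mono less_imp_le)
    then have "f \<le> tower (Suc N) ^ m" "g \<le> tower (Suc N) ^ m" using mult.prems by auto
    then show ?case using mult.IH by (intro closure.mult)
  next
    case (pw f g)
    show ?case
    proof (cases "f = 1")
      case True
      have "L (pw f g) = L 1" using L_pw[OF pw.hyps] True by simp
      then have "pw f g = 1" using L_inj[OF Sk_pw[OF pw.hyps] Sk_one] by simp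
      then show ?thesis by (simp add: closure.one)
    next
      case False
      have pos: "1 \<le> g" "0 < L f" "1 \<le> 2 * L f" using Sk_ge_one L_pos L_ge pw.hyps False by auto
      have S: "pw f g \<in> Sk" using Sk_pw pw.hyps by blast
      have "1 * L f \<le> g * L f" using pos by (intro mult_right_mono) auto
      then have "f \<le> pw f g" using L_le_iff[OF pw.hyps(1) S] L_pw[OF pw.hyps] by simp
      then have fin: "f \<in> closure (stage N)" using pw.IH(1) pw.prems order_trans by blast
      have "g * 1 \<le> g * (2 * L f)" using pos by (intro mult_left_mono) auto
      also have "\<dots> = 2 * L (pw f g)" using L_pw[OF pw.hyps] by simp
      also have "\<dots> \<le> 2 * L (tower (Suc N) ^ m)"
        using L_le_iff[OF S Sk_power[OF tower_Sk]] pw.prems by simp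
      also have "\<dots> = of_nat (2 * m) * L (tower (Suc N))" by (simp add: L_power tower_Sk del: tower.simps)
      also have "\<dots> \<le> tower N ^ (2 * m) * tower N ^ 2"
        by (rule mult_mono[OF of_nat_le_power2 L_tower_le]) (use tower_ge_two[of N] L_nonneg[OF tower_Sk] in auto)
      finally have "g \<le> tower N ^ (2 * m + 2)" by (simp only: power_add mult_1_right)
      then have "g \<in> stage N" using Suc.IH pw.hyps by blast
      then show ?thesis using fin by (rule closure.pw[rotated])
    qed
  qed (auto intro: closure.intros)
qed

lemma Sk_cofinal: "f \<in> Sk \<Longrightarrow> \<exists>I. f \<le> tower (Suc I)"
proof -
  have step: "\<exists>K. h \<le> tower (Suc K)"
    if "f \<in> Sk" "g \<in> Sk" "h \<in> Sk" "L h \<le> f * g \<or> L h \<le> f + g"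
      "f \<le> tower (Suc I)" "g \<le> tower (Suc J)" for f g h I J
  proof -
    let ?u = "tower (Suc (I + J))"
    have le: "f \<le> ?u" "g \<le> ?u" using that(5,6) tower_mono[of "Suc I" "Suc (I + J)"] tower_mono[of "Suc J" "Suc (I + J)"]
      by (auto simp del: tower.simps)
    have pos: "0 < f" "0 < g" using that Sk_pos by auto
    have "f * g \<le> ?u * ?u" using le pos by (intro mult_mono) auto
    moreover have "?u + ?u \<le> ?u * ?u" using mult_right_mono[OF tower_ge_two[of "Suc (I + J)"], of ?u] tower_ge_two[of "Suc (I + J)"]
      by (simp del: tower.simps)
    ultimately have "L h \<le> ?u ^ 2" using that(4) le unfolding power2_eq_square by linarith
    from le_tower_if_L_le[OF that(3) this] show ?thesis by blast
  qed
  assume "f \<in> Sk"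
  then show ?thesis
  proof (induction rule: Sk_induct)
    case one
    show ?case using tower_ge_two[of "Suc 0"] by (intro exI[of _ 0]) simp
  next
    case x
    show ?case by (intro exI[of _ 0]) simp
  next
    case (add f g)
    then show ?case using step[of f g "f + g"] L_le[of "f + g"] Sk_add by fastforce
  next
    case (mult f g)
    then show ?case using step[of f g "f * g"] L_le[of "f * g"] Sk_mult by fastforce
  next
    case (pw f g)
    have "g * L f \<le> g * f" using L_le[OF pw.hyps(1)] Sk_pos[OF pw.hyps(2)] by (intro mult_left_mono) auto
    then show ?case using step[of f g "pw f g"] pw Sk_pw L_pw by (auto simp: mult.commute)
  qed
qed

text \<open>
  Each initial segment lies in one stage, and the residual rank glues the bounds of the stages
  together.
\<close>
theorem Sk_rank: "\<exists>\<rho>::'a \<Rightarrow> ord. \<forall>f\<in>Sk. \<forall>g\<in>Sk. f < g \<longrightarrow> \<rho> f < \<rho> g"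
proof -
  have rk: "\<exists>\<theta>. True \<and> ranked (<) \<theta> {y \<in> Sk. y < z}" if z: "z \<in> Sk" for z
  proof -
    obtain I where I: "z \<le> tower (Suc I)" using Sk_cofinal[OF z] by blast
    have sub: "{y \<in> Sk. y < z} \<subseteq> stage (Suc I)"
    proof
      fix y assume y: "y \<in> {y \<in> Sk. y < z}"
      then have "y \<le> tower (Suc I) ^ 1" using I by (simp del: tower.simps)
      then show "y \<in> stage (Suc I)" using below_tower_stage y by blast
    qed
    obtain d where "ot_le (<) d (stage (Suc I))" using stage_order by blast
    then have "ot_le (<) d {y \<in> Sk. y < z}" using sub by (rule ot_le_subset)
    from ot_le_rank[OF transp_on_less this] have "ranked (<) (\<omega> d) {y \<in> Sk. y < z}"
      unfolding ranked_def by blast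
    then show ?thesis by blast
  qed
  show ?thesis using ranked_residual[OF transp_on_less rk] by blast
qed

end

section \<open>Germs and absolutely convergent exponential series\<close>

instantiation germ :: "{comm_ring_1, real_vector, ordered_ab_group_add}"
begin

lift_definition uminus_germ :: "germ \<Rightarrow> germ" is "\<lambda>f x. - f x"
  by (erule eventually_mono) simp

lift_definition minus_germ :: "germ \<Rightarrow> germ \<Rightarrow> germ" is "\<lambda>f g x. f x - g x"
  by (erule (1) eventually_elim2) simp

lift_definition scaleR_germ :: "real \<Rightarrow> germ \<Rightarrow> germ" is "\<lambda>r f x. r * f x"
  by (erule eventually_mono) simp

instance
proof
  fix a b c :: germ and r s :: real
  show "a + b + c = a + (b + c)" "a + b = b + a" "0 + a = a" "- a + a = 0" "a - b = a + - b"
    "a * b * c = a * (b * c)" "a * b = b * a" "1 * a = a" "(a + b) * c = a * c + b * c"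
    "r *\<^sub>R (a + b) = r *\<^sub>R a + r *\<^sub>R b" "(r + s) *\<^sub>R a = r *\<^sub>R a + s *\<^sub>R a"
    "r *\<^sub>R s *\<^sub>R a = (r * s) *\<^sub>R a" "1 *\<^sub>R a = a"
    by (transfer, simp add: algebra_simps)+
  show "(0::germ) \<noteq> 1" by transfer simp
  show "a \<le> b \<Longrightarrow> c + a \<le> c + b"
    unfolding less_eq_germ_def by (transfer, auto elim: eventually_mono)
qed

end

abbreviation germ_of :: "(real \<Rightarrow> real) \<Rightarrow> germ" where "germ_of \<equiv> abs_germ"

lemma germ_of_eq_iff: "germ_of f = germ_of g \<longleftrightarrow> (\<forall>\<^sub>F x in at_top. f x = g x)"
  by (rule germ.abs_eq_iff)

lemma germ_of_less_iff: "germ_of f < germ_of g \<longleftrightarrow> (\<forall>\<^sub>F x in at_top. f x < g x)"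
  by (rule less_germ.abs_eq)

lemma germ_of_rep: "germ_of (rep_germ a) = a"
  by (rule Quotient3_abs_rep[OF Quotient3_germ])

lemma germ_of_simps:
  "germ_of f + germ_of g = germ_of (\<lambda>x. f x + g x)" "germ_of f - germ_of g = germ_of (\<lambda>x. f x - g x)"
  "germ_of f * germ_of g = germ_of (\<lambda>x. f x * g x)" "- germ_of f = germ_of (\<lambda>x. - f x)" "r *\<^sub>R germ_of f = germ_of (\<lambda>x. r * f x)"
  by (simp_all add: plus_germ.abs_eq minus_germ.abs_eq times_germ.abs_eq uminus_germ.abs_eq scaleR_germ.abs_eq)

lemma germ_of_zero: "0 = germ_of (\<lambda>_. 0)" and germ_of_one: "1 = germ_of (\<lambda>_. 1)"
  by (simp_all add: zero_germ_def one_germ_def)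

text \<open>
  A linear choice of representatives. It turns the map from exponents to exponential functions into
  a homomorphism for every single argument, not only eventually, so that infinite families of
  exponents can be evaluated at a common point.
\<close>
definition section_of :: "germ \<Rightarrow> real \<Rightarrow> real" where
  "section_of a x = construct (extend_basis {}) (\<lambda>b. rep_germ b x) a"

lemma linear_section: "linear (\<lambda>a. section_of a x)"
  unfolding section_of_def by (rule real_vector.linear_construct) (simp add: real_vector.independent_extend_basis real_vector.independent_empty)

lemma section_simps [simp]:
  "section_of (a + b) x = section_of a x + section_of b x"
  "section_of (a - b) x = section_of a x - section_of b x"
  "section_of (- a) x = - section_of a x"
  "section_of 0 x = 0"
  "section_of (r *\<^sub>R a) x = r * section_of a x"
  using linear_add[OF linear_section] linear_diff[OF linear_section] linear_neg[OF linear_section]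
    linear_0[OF linear_section] linear_scale[OF linear_section] by auto

lemma germ_of_section: "germ_of (section_of a) = a"
proof -
  have "a \<in> span (extend_basis ({} :: germ set))"
    by (simp add: real_vector.span_extend_basis real_vector.independent_empty)
  then show ?thesis
  proof (induction rule: real_vector.span_induct)
    case base
    show ?case unfolding real_vector.subspace_def
    proof (intro conjI ballI allI)
      have "section_of 0 = (\<lambda>_. 0)" by (rule ext) simp
      then have "germ_of (section_of 0) = 0" by (simp only: germ_of_zero[symmetric])
      then show "0 \<in> Collect (\<lambda>a. germ_of (section_of a) = a)" by simp
      fix a b :: germ and c :: real
      assume a: "a \<in> Collect (\<lambda>a. germ_of (section_of a) = a)"
      have "section_of (c *\<^sub>R a) = (\<lambda>x. c * section_of a x)" by (rule ext) simp
      then have "germ_of (section_of (c *\<^sub>R a)) = c *\<^sub>R germ_of (section_of a)" by (simp only: germ_of_simps)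
      then show "c *\<^sub>R a \<in> Collect (\<lambda>a. germ_of (section_of a) = a)" using a by simp
      assume b: "b \<in> Collect (\<lambda>a. germ_of (section_of a) = a)"
      have "section_of (a + b) = (\<lambda>x. section_of a x + section_of b x)" by (rule ext) simp
      then have "germ_of (section_of (a + b)) = germ_of (section_of a) + germ_of (section_of b)" by (simp only: germ_of_simps)
      then show "a + b \<in> Collect (\<lambda>a. germ_of (section_of a) = a)" using a b by simp
    qed
  next
    case (step b)
    have "section_of b = rep_germ b"
      unfolding section_of_def
      by (rule ext, rule real_vector.construct_basis)
        (use step real_vector.independent_extend_basis real_vector.independent_empty in auto)
    then show ?case by (simp add: germ_of_rep)
  qed
qed

lemma section_germ_of: "\<forall>\<^sub>F x in at_top. section_of (germ_of f) x = f x"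
  using germ_of_section[of "germ_of f"] by (simp add: germ_of_eq_iff)

lemma germ_less_iff: "a < b \<longleftrightarrow> (\<forall>\<^sub>F x in at_top. section_of a x < section_of b x)"
  by (metis germ_of_section germ_of_less_iff)

definition E :: "germ \<Rightarrow> real \<Rightarrow> real" where
  "E a x = exp (section_of a x)"

lemma E_pos [simp]: "0 < E a x" and E_nonneg [simp]: "0 \<le> E a x"
  and E_add: "E (a + b) x = E a x * E b x" and E_diff: "E (a - b) x = E a x / E b x"
  and E_zero [simp]: "E 0 x = 1" and E_minus: "E (- a) x = inverse (E a x)"
  by (simp_all add: E_def exp_add exp_diff exp_minus)

lemma E_word_le:
  assumes "0 < \<rho>" "\<And>g. g \<in># w \<Longrightarrow> E g x \<le> \<rho>"
  shows "E (\<Sum>\<^sub># w) x \<le> \<rho> ^ size w"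
  using assms(2)
proof (induction w)
  case (add g w)
  then have "E g x * E (\<Sum>\<^sub># w) x \<le> \<rho> * \<rho> ^ size w" by (intro mult_mono) (use assms(1) in auto)
  then show ?case by (simp add: E_add)
qed simp

text \<open>
  \<open>f\<close> is the sum of a family \<open>c\<^sub>i * exp (h\<^sub>i +
  \<Sum>w\<^sub>i)\<close>, where the multiset \<open>w\<^sub>i\<close> is a word in exponents from
  \<open>G\<close>. These are going to be negative, and the family converges absolutely at every
  point at which \<open>exp g \<le> \<rho>\<close> for all \<open>g \<in> G\<close>, hence
  eventually. \<open>N\<close> bounds the majorizing sum. Families, rather than power series with
  collected coefficients, make products and infinite sums immediate; only the leading term requires
  collecting.
\<close>
definition fam :: "germ set \<Rightarrow> (germ \<times> germ multiset) set \<Rightarrow> real \<Rightarrow> real \<Rightarrow> (real \<Rightarrow> real) \<Rightarrow> bool" where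
  "fam G A \<rho> N f \<longleftrightarrow> (\<exists>c h w N'. (\<forall>i::nat. c i \<noteq> 0 \<longrightarrow> (h i, w i) \<in> A) \<and> N' \<le> N \<and>
     ((\<lambda>i. \<bar>c i\<bar> * \<rho> ^ size (w i)) has_sum N') UNIV \<and>
     (\<forall>x. (\<forall>g\<in>G. E g x \<le> \<rho>) \<longrightarrow> ((\<lambda>i. c i * E (h i + \<Sum>\<^sub># (w i)) x) has_sum f x) UNIV))"

lemma fam_pairI:
  fixes c :: "nat \<times> nat \<Rightarrow> real"
  assumes "\<And>p. c p \<noteq> 0 \<Longrightarrow> (h p, w p) \<in> A" "N' \<le> N"
    "((\<lambda>p. \<bar>c p\<bar> * \<rho> ^ size (w p)) has_sum N') UNIV"
    "\<And>x. (\<And>g. g \<in> G \<Longrightarrow> E g x \<le> \<rho>) \<Longrightarrow> ((\<lambda>p. c p * E (h p + \<Sum>\<^sub># (w p)) x) has_sum f x) UNIV"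
  shows "fam G A \<rho> N f"
proof -
  have bij: "bij_betw prod_decode UNIV UNIV" by (rule bij_prod_decode)
  show ?thesis unfolding fam_def
  proof (intro exI conjI allI impI)
    show "(h (prod_decode i), w (prod_decode i)) \<in> A" if "c (prod_decode i) \<noteq> 0" for i
      using assms(1) that by blast
    show "((\<lambda>i. \<bar>c (prod_decode i)\<bar> * \<rho> ^ size (w (prod_decode i))) has_sum N') UNIV"
      using has_sum_reindex_bij_betw[OF bij, of "\<lambda>p. \<bar>c p\<bar> * \<rho> ^ size (w p)"] assms(3) by simp
    show "((\<lambda>i. c (prod_decode i) * E (h (prod_decode i) + \<Sum>\<^sub># (w (prod_decode i))) x) has_sum f x) UNIV"
      if "\<forall>g\<in>G. E g x \<le> \<rho>" for x
      using has_sum_reindex_bij_betw[OF bij, of "\<lambda>p. c p * E (h p + \<Sum>\<^sub># (w p)) x"] assms(4) that by simp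
  qed (rule assms(2))
qed

lemma has_sum_mult_pairs:
  fixes a b :: "nat \<Rightarrow> real"
  assumes "(a has_sum s) UNIV" "(b has_sum t) UNIV"
  shows "((\<lambda>p. a (fst p) * b (snd p)) has_sum (s * t)) UNIV"
proof -
  have abs: "(\<lambda>i. \<bar>a i\<bar>) summable_on UNIV" "(\<lambda>i. \<bar>b i\<bar>) summable_on UNIV"
    using assms summable_on_iff_abs_summable_on_real by (auto simp: summable_on_def)
  then obtain t' where t': "((\<lambda>i. \<bar>b i\<bar>) has_sum t') UNIV" by (auto simp: summable_on_def)
  have "(\<lambda>p. \<bar>a (fst p)\<bar> * \<bar>b (snd p)\<bar>) summable_on (SIGMA i:UNIV. UNIV)"
  proof (rule summable_on_SigmaI)
    show "((\<lambda>j. \<bar>a (fst (i, j))\<bar> * \<bar>b (snd (i, j))\<bar>) has_sum (\<bar>a i\<bar> * t')) UNIV" for i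
      using has_sum_cmult_right[OF t'] by simp
    show "(\<lambda>i. \<bar>a i\<bar> * t') summable_on UNIV" using abs(1) by (rule summable_on_cmult_left)
  qed simp
  then have "(\<lambda>p. norm (a (fst p) * b (snd p))) summable_on (SIGMA i:UNIV. UNIV)"
    by (simp add: abs_mult)
  then have summ: "(\<lambda>p. a (fst p) * b (snd p)) summable_on (SIGMA i:UNIV. UNIV)"
    by (rule abs_summable_summable)
  have "((\<lambda>p. a (fst p) * b (snd p)) has_sum (s * t)) (SIGMA i:UNIV. UNIV)"
  proof (rule has_sum_SigmaI)
    show "((\<lambda>j. a (fst (i, j)) * b (snd (i, j))) has_sum (a i * t)) UNIV" for i
      using has_sum_cmult_right[OF assms(2)] by simp
    show "((\<lambda>i. a i * t) has_sum (s * t)) UNIV" by (rule has_sum_cmult_left[OF assms(1)])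
  qed (rule summ)
  then show ?thesis by simp
qed

lemma fam_mult:
  assumes "fam G A \<rho> N f" "fam G B \<rho> M g"
    and C: "\<And>h w k v. (h, w) \<in> A \<Longrightarrow> (k, v) \<in> B \<Longrightarrow> (h + k, w + v) \<in> C" and "0 < \<rho>"
  shows "fam G C \<rho> (N * M) (\<lambda>x. f x * g x)"
proof -
  from assms(1) obtain c h w N' where f: "\<And>i. c i \<noteq> 0 \<Longrightarrow> (h i, w i) \<in> A" "N' \<le> N"
     "((\<lambda>i::nat. \<bar>c i\<bar> * \<rho> ^ size (w i)) has_sum N') UNIV"
     "\<And>x. (\<forall>g\<in>G. E g x \<le> \<rho>) \<Longrightarrow> ((\<lambda>i. c i * E (h i + \<Sum>\<^sub># (w i)) x) has_sum f x) UNIV"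
    unfolding fam_def by blast
  from assms(2) obtain d k v M' where g: "\<And>i. d i \<noteq> 0 \<Longrightarrow> (k i, v i) \<in> B" "M' \<le> M"
     "((\<lambda>i::nat. \<bar>d i\<bar> * \<rho> ^ size (v i)) has_sum M') UNIV"
     "\<And>x. (\<forall>g\<in>G. E g x \<le> \<rho>) \<Longrightarrow> ((\<lambda>i. d i * E (k i + \<Sum>\<^sub># (v i)) x) has_sum g x) UNIV"
    unfolding fam_def by blast
  have nn: "0 \<le> N'" "0 \<le> M'"
    using has_sum_nonneg[OF f(3)] has_sum_nonneg[OF g(3)] assms(4) by auto
  show ?thesis
  proof (rule fam_pairI[where c = "\<lambda>p. c (fst p) * d (snd p)" and h = "\<lambda>p. h (fst p) + k (snd p)"
        and w = "\<lambda>p. w (fst p) + v (snd p)" and N' = "N' * M'"])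
    show "c (fst p) * d (snd p) \<noteq> 0 \<Longrightarrow> (h (fst p) + k (snd p), w (fst p) + v (snd p)) \<in> C" for p
      using C f(1) g(1) by auto
    show "N' * M' \<le> N * M" using f(2) g(2) nn by (intro mult_mono) auto
    show "((\<lambda>p. \<bar>c (fst p) * d (snd p)\<bar> * \<rho> ^ size (w (fst p) + v (snd p))) has_sum (N' * M')) UNIV"
      using has_sum_mult_pairs[OF f(3) g(3)] by (simp add: abs_mult power_add mult_ac)
    fix x assume "\<And>g. g \<in> G \<Longrightarrow> E g x \<le> \<rho>"
    then have "\<forall>g\<in>G. E g x \<le> \<rho>" by blast
    from has_sum_mult_pairs[OF f(4)[OF this] g(4)[OF this]]
    show "((\<lambda>p. c (fst p) * d (snd p) * E (h (fst p) + k (snd p) + \<Sum>\<^sub># (w (fst p) + v (snd p))) x) has_sum f x * g x) UNIV"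
      by (simp add: E_add mult_ac)
  qed
qed

lemma fam_suminf:
  assumes fam: "\<And>k. fam G A \<rho> (N k) (f k)" and N: "N summable_on UNIV" and fin: "finite (fst ` A)"
    and A: "\<And>h w. (h, w) \<in> A \<Longrightarrow> set_mset w \<subseteq> G" and \<rho>: "0 < \<rho>"
  shows "fam G A \<rho> (infsum N UNIV) (\<lambda>x. infsum (\<lambda>k::nat. f k x) UNIV)"
proof -
  define P where "P k c h w n \<longleftrightarrow> (\<forall>i::nat. c i \<noteq> 0 \<longrightarrow> (h i, w i) \<in> A) \<and> n \<le> N k \<and>
     ((\<lambda>i. \<bar>c i\<bar> * \<rho> ^ size (w i)) has_sum n) UNIV \<and>
     (\<forall>x. (\<forall>g\<in>G. E g x \<le> \<rho>) \<longrightarrow> ((\<lambda>i. c i * E (h i + \<Sum>\<^sub># (w i)) x) has_sum f k x) UNIV)" for k c h w n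
  have "\<forall>k. \<exists>c h w n. P k c h w n" using fam by (simp add: fam_def P_def)
  from choice[OF this] obtain c where "\<forall>k. \<exists>h w n. P k (c k) h w n" ..
  from choice[OF this] obtain h where "\<forall>k. \<exists>w n. P k (c k) (h k) w n" ..
  from choice[OF this] obtain w where "\<forall>k. \<exists>n. P k (c k) (h k) (w k) n" ..
  from choice[OF this] obtain N' where "\<forall>k. P k (c k) (h k) (w k) (N' k)" ..
  then have *: "\<And>k i::nat. c k i \<noteq> 0 \<Longrightarrow> (h k i, w k i) \<in> A" "\<And>k. N' k \<le> N k"
     "\<And>k. ((\<lambda>i. \<bar>c k i\<bar> * \<rho> ^ size (w k i)) has_sum N' k) UNIV"
     "\<And>k x. (\<forall>g\<in>G. E g x \<le> \<rho>) \<Longrightarrow> ((\<lambda>i. c k i * E (h k i + \<Sum>\<^sub># (w k i)) x) has_sum f k x) UNIV"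
    unfolding P_def by blast+
  have nn: "0 \<le> N' k" for k using has_sum_nonneg[OF *(3)[of k]] \<rho> by auto
  have N': "N' summable_on UNIV" by (rule summable_on_comparison_test[OF N]) (use * nn in auto)
  have summ: "(\<lambda>p. \<bar>c (fst p) (snd p)\<bar> * \<rho> ^ size (w (fst p) (snd p))) summable_on (SIGMA k:UNIV. UNIV)"
  proof (rule summable_on_SigmaI)
    show "((\<lambda>i. \<bar>c (fst (k, i)) (snd (k, i))\<bar> * \<rho> ^ size (w (fst (k, i)) (snd (k, i)))) has_sum N' k) UNIV" for k
      using *(3) by simp
    show "N' summable_on UNIV" by (rule N')
  qed (use \<rho> in auto)
  show ?thesis
  proof (rule fam_pairI[where c = "\<lambda>p. c (fst p) (snd p)" and h = "\<lambda>p. h (fst p) (snd p)"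
        and w = "\<lambda>p. w (fst p) (snd p)" and N' = "infsum N' UNIV"])
    show "c (fst p) (snd p) \<noteq> 0 \<Longrightarrow> (h (fst p) (snd p), w (fst p) (snd p)) \<in> A" for p
      using *(1) .
    show "infsum N' UNIV \<le> infsum N UNIV" by (rule infsum_mono[OF N' N]) (rule *(2))
    have "((\<lambda>p. \<bar>c (fst p) (snd p)\<bar> * \<rho> ^ size (w (fst p) (snd p))) has_sum (infsum N' UNIV)) (SIGMA k:UNIV. UNIV)"
    proof (rule has_sum_SigmaI)
      show "((\<lambda>i. \<bar>c (fst (k, i)) (snd (k, i))\<bar> * \<rho> ^ size (w (fst (k, i)) (snd (k, i)))) has_sum N' k) UNIV" for k
        using *(3) by simp
    qed (rule has_sum_infsum[OF N'] summ)+
    then show "((\<lambda>p. \<bar>c (fst p) (snd p)\<bar> * \<rho> ^ size (w (fst p) (snd p))) has_sum (infsum N' UNIV)) UNIV"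
      by simp
  next
    fix x assume x: "\<And>g. g \<in> G \<Longrightarrow> E g x \<le> \<rho>"
    define M where "M = (\<Sum>a\<in>fst ` A. E a x)"
    let ?t = "\<lambda>p. c (fst p) (snd p) * E (h (fst p) (snd p) + \<Sum>\<^sub># (w (fst p) (snd p))) x"
    have abs: "(\<lambda>p. norm (?t p)) summable_on UNIV"
    proof (rule summable_on_comparison_test)
      show "(\<lambda>p. M * (\<bar>c (fst p) (snd p)\<bar> * \<rho> ^ size (w (fst p) (snd p)))) summable_on UNIV"
        using summable_on_cmult_right[OF summ] by simp
      fix p :: "nat \<times> nat"
      show "norm (?t p) \<le> M * (\<bar>c (fst p) (snd p)\<bar> * \<rho> ^ size (w (fst p) (snd p)))"
      proof (cases "c (fst p) (snd p) = 0")
        case False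
        note hw = *(1)[OF this]
        have "E (h (fst p) (snd p)) x \<le> M" unfolding M_def
          by (rule member_le_sum) (use hw fin in force)+
        moreover have "E (\<Sum>\<^sub># (w (fst p) (snd p))) x \<le> \<rho> ^ size (w (fst p) (snd p))"
          by (rule E_word_le[OF \<rho>]) (use A[OF hw] x in blast)
        ultimately have "E (h (fst p) (snd p)) x * E (\<Sum>\<^sub># (w (fst p) (snd p))) x \<le> M * \<rho> ^ size (w (fst p) (snd p))"
          by (intro mult_mono) (auto intro: order_trans[OF E_nonneg])
        then have "\<bar>c (fst p) (snd p)\<bar> * (E (h (fst p) (snd p)) x * E (\<Sum>\<^sub># (w (fst p) (snd p))) x)
            \<le> \<bar>c (fst p) (snd p)\<bar> * (M * \<rho> ^ size (w (fst p) (snd p)))" by (intro mult_left_mono) auto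
        then show ?thesis by (simp add: abs_mult E_add mult_ac)
      qed simp
    qed simp
    have "?t summable_on (SIGMA k:UNIV. UNIV)" using abs_summable_summable[OF abs] by simp
    then have S: "(?t has_sum infsum ?t UNIV) (SIGMA k:UNIV. UNIV)" by simp
    have "((\<lambda>k. f k x) has_sum infsum ?t UNIV) UNIV"
      by (rule has_sum_SigmaD[OF S]) (use *(4) x in simp)
    then have "infsum ?t UNIV = infsum (\<lambda>k. f k x) UNIV" by (simp add: infsumI)
    then show "(?t has_sum infsum (\<lambda>k. f k x) UNIV) UNIV" using S by simp
  qed
qed

lemma fam_mono:
  assumes "fam G A \<rho> N f" "G \<subseteq> G'" "A \<subseteq> A'" "0 < \<rho>'" "\<rho>' \<le> \<rho>" "N \<le> M"
  shows "fam G' A' \<rho>' M f"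
proof -
  from assms(1) obtain c h w N' where f: "\<And>i. c i \<noteq> 0 \<Longrightarrow> (h i, w i) \<in> A" "N' \<le> N"
     "((\<lambda>i::nat. \<bar>c i\<bar> * \<rho> ^ size (w i)) has_sum N') UNIV"
     "\<And>x. (\<forall>g\<in>G. E g x \<le> \<rho>) \<Longrightarrow> ((\<lambda>i. c i * E (h i + \<Sum>\<^sub># (w i)) x) has_sum f x) UNIV"
    unfolding fam_def by blast
  have le: "\<bar>c i\<bar> * \<rho>' ^ size (w i) \<le> \<bar>c i\<bar> * \<rho> ^ size (w i)" for i
    using assms(4,5) by (intro mult_left_mono power_mono) auto
  have sm: "(\<lambda>i. \<bar>c i\<bar> * \<rho> ^ size (w i)) summable_on UNIV" using f(3) by (auto simp: summable_on_def)
  have sm': "(\<lambda>i. \<bar>c i\<bar> * \<rho>' ^ size (w i)) summable_on UNIV"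
    by (rule summable_on_comparison_test[OF sm le]) (use assms(4) in auto)
  show ?thesis unfolding fam_def
  proof (intro exI conjI allI impI)
    show "(h i, w i) \<in> A'" if "c i \<noteq> 0" for i using f(1)[OF that] assms(3) by blast
    show "((\<lambda>i. \<bar>c i\<bar> * \<rho>' ^ size (w i)) has_sum infsum (\<lambda>i. \<bar>c i\<bar> * \<rho>' ^ size (w i)) UNIV) UNIV"
      by (rule has_sum_infsum[OF sm'])
    have "infsum (\<lambda>i. \<bar>c i\<bar> * \<rho>' ^ size (w i)) UNIV \<le> N'"
      using infsum_mono[OF sm' sm le] infsumI[OF f(3)] by simp
    then show "infsum (\<lambda>i. \<bar>c i\<bar> * \<rho>' ^ size (w i)) UNIV \<le> M" using f(2) assms(6) by linarith
    show "((\<lambda>i. c i * E (h i + \<Sum>\<^sub># (w i)) x) has_sum f x) UNIV" if "\<forall>g\<in>G'. E g x \<le> \<rho>'" for x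
      by (rule f(4)) (use that assms(2,5) in \<open>auto intro: order_trans\<close>)
  qed
qed

lemma fam_zero: "0 \<le> N \<Longrightarrow> fam G A \<rho> N (\<lambda>_. 0)"
  unfolding fam_def by (intro exI[of _ "\<lambda>_. 0"] exI[of _ 0]) simp

lemma fam_single:
  assumes "(\<theta>, w) \<in> A"
  shows "fam G A \<rho> (\<bar>r\<bar> * \<rho> ^ size w) (\<lambda>x. r * E (\<theta> + \<Sum>\<^sub># w) x)"
  unfolding fam_def
proof (intro exI conjI allI impI)
  let ?c = "\<lambda>i::nat. if i = 0 then r else 0"
  have *: "(f has_sum f 0) UNIV" if "\<And>i. i \<noteq> 0 \<Longrightarrow> f i = 0" for f :: "nat \<Rightarrow> real"
    using has_sum_cong_neutral[of "{0}" UNIV f f "f 0"] has_sum_finiteI[of "{0}" "f 0" f] that by auto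
  show "(\<theta>, w) \<in> A" by (rule assms)
  show "((\<lambda>i. \<bar>?c i\<bar> * \<rho> ^ size w) has_sum (\<bar>r\<bar> * \<rho> ^ size w)) UNIV"
    using *[of "\<lambda>i. \<bar>?c i\<bar> * \<rho> ^ size w"] by simp
  show "((\<lambda>i. ?c i * E (\<theta> + \<Sum>\<^sub># w) x) has_sum (r * E (\<theta> + \<Sum>\<^sub># w) x)) UNIV" for x
    using *[of "\<lambda>i. ?c i * E (\<theta> + \<Sum>\<^sub># w) x"] by simp
qed simp

lemma fam_add:
  assumes "fam G A \<rho> N f" "fam G A \<rho> M g" "finite (fst ` A)"
    "\<And>h w. (h, w) \<in> A \<Longrightarrow> set_mset w \<subseteq> G" "0 < \<rho>"
  shows "fam G A \<rho> (N + M) (\<lambda>x. f x + g x)"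
proof -
  let ?N = "\<lambda>k::nat. if k = 0 then N else if k = 1 then M else 0"
  let ?f = "\<lambda>k::nat. if k = 0 then f else if k = 1 then g else (\<lambda>_. 0)"
  have sum2: "(s has_sum (s 0 + s 1)) UNIV" if "\<And>i. i > 1 \<Longrightarrow> s i = 0" for s :: "nat \<Rightarrow> real"
    using has_sum_cong_neutral[of "{0, 1}" UNIV s s "s 0 + s 1"] has_sum_finiteI[of "{0, 1}" "s 0 + s 1" s] that by auto
  have 1: "(?N has_sum (N + M)) UNIV" using sum2[of ?N] by simp
  have 2: "((\<lambda>k. ?f k x) has_sum (f x + g x)) UNIV" for x using sum2[of "\<lambda>k. ?f k x"] by simp
  have "fam G A \<rho> (infsum ?N UNIV) (\<lambda>x. infsum (\<lambda>k. ?f k x) UNIV)"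
  proof (rule fam_suminf)
    show "fam G A \<rho> (?N k) (?f k)" for k using assms(1,2) fam_zero by auto
    show "?N summable_on UNIV" using 1 by (auto simp: summable_on_def)
  qed (use assms in auto)
  then show ?thesis using infsumI[OF 1] infsumI[OF 2] by simp
qed

definition lnln :: germ where "lnln = germ_of (\<lambda>x. ln (ln x))"

text \<open>
  The group is linearly ordered, and \<open>ln (ln x)\<close> is its smallest positive element. This
  bounds the rate at which exponentials of its negative elements tend to zero.
\<close>
definition good :: "germ set \<Rightarrow> bool" where
  "good \<Gamma> \<longleftrightarrow> 0 \<in> \<Gamma> \<and> (\<forall>a\<in>\<Gamma>. \<forall>b\<in>\<Gamma>. a - b \<in> \<Gamma>) \<and> lnln \<in> \<Gamma> \<and> (\<forall>a\<in>\<Gamma>. a = 0 \<or> lnln \<le> a \<or> lnln \<le> - a)"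

lemma goodD:
  assumes "good \<Gamma>"
  shows "0 \<in> \<Gamma>" "a \<in> \<Gamma> \<Longrightarrow> b \<in> \<Gamma> \<Longrightarrow> a - b \<in> \<Gamma>" "lnln \<in> \<Gamma>" "a \<in> \<Gamma> \<Longrightarrow> - a \<in> \<Gamma>"
    "a \<in> \<Gamma> \<Longrightarrow> b \<in> \<Gamma> \<Longrightarrow> a + b \<in> \<Gamma>" "a \<in> \<Gamma> \<Longrightarrow> a = 0 \<or> lnln \<le> a \<or> lnln \<le> - a"
proof -
  have G: "0 \<in> \<Gamma>" "\<And>a b. a \<in> \<Gamma> \<Longrightarrow> b \<in> \<Gamma> \<Longrightarrow> a - b \<in> \<Gamma>" "lnln \<in> \<Gamma>"
    "\<And>a. a \<in> \<Gamma> \<Longrightarrow> a = 0 \<or> lnln \<le> a \<or> lnln \<le> - a"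
    using assms by (auto simp: good_def)
  show "0 \<in> \<Gamma>" "lnln \<in> \<Gamma>" "a \<in> \<Gamma> \<Longrightarrow> b \<in> \<Gamma> \<Longrightarrow> a - b \<in> \<Gamma>"
    "a \<in> \<Gamma> \<Longrightarrow> a = 0 \<or> lnln \<le> a \<or> lnln \<le> - a" using G by blast+
  have neg: "a \<in> \<Gamma> \<Longrightarrow> - a \<in> \<Gamma>" for a using G(2)[OF G(1), of a] by simp
  then show "a \<in> \<Gamma> \<Longrightarrow> - a \<in> \<Gamma>" .
  show "a \<in> \<Gamma> \<Longrightarrow> b \<in> \<Gamma> \<Longrightarrow> a + b \<in> \<Gamma>" using G(2)[of a "- b"] neg[of b] by simp
qed

lemma eventually_ln_ln_ge: "\<forall>\<^sub>F x in at_top. K \<le> ln (ln (x::real))"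
proof -
  have "filterlim (\<lambda>x::real. ln (ln x)) at_top at_top"
    by (rule filterlim_compose[OF ln_at_top ln_at_top])
  then show ?thesis by (simp add: filterlim_at_top)
qed

lemma lnln_pos: "0 < lnln"
  unfolding lnln_def germ_of_zero germ_of_less_iff
  using eventually_ln_ln_ge[of 1] by eventually_elim simp

lemma good_pos: "good \<Gamma> \<Longrightarrow> a \<in> \<Gamma> \<Longrightarrow> 0 < a \<Longrightarrow> lnln \<le> a"
proof -
  assume *: "good \<Gamma>" "a \<in> \<Gamma>" "0 < a"
  have "\<not> lnln \<le> - a"
  proof
    assume "lnln \<le> - a"
    then have "lnln + a \<le> 0" using add_right_mono[of lnln "- a" a] by simp
    moreover have "0 < lnln + a" using lnln_pos *(3) by (rule add_pos_pos)
    ultimately show False by (simp add: less_le_not_le)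
  qed
  then show ?thesis using goodD(6)[OF *(1,2)] *(3) by auto
qed

lemma good_linear: "good \<Gamma> \<Longrightarrow> a \<in> \<Gamma> \<Longrightarrow> b \<in> \<Gamma> \<Longrightarrow> a < b \<or> a = b \<or> b < a"
proof -
  assume *: "good \<Gamma>" "a \<in> \<Gamma>" "b \<in> \<Gamma>"
  from goodD(6)[OF *(1) goodD(2)[OF *]] consider "a - b = 0" | "lnln \<le> a - b" | "lnln \<le> b - a" by auto
  then show ?thesis
  proof cases
    case 2
    then have "0 < a - b" using lnln_pos by (rule less_le_trans[rotated])
    then show ?thesis by simp
  next
    case 3
    then have "0 < b - a" using lnln_pos by (rule less_le_trans[rotated])
    then show ?thesis by simp
  qed simp
qed

lemma E_ge_ln: "lnln \<le> a \<Longrightarrow> \<forall>\<^sub>F x in at_top. ln x \<le> E a x"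
proof -
  assume "lnln \<le> a"
  then consider "lnln = a" | "lnln < a" by fastforce
  then have "\<forall>\<^sub>F x in at_top. section_of lnln x \<le> section_of a x"
    by cases (auto simp: germ_less_iff elim: eventually_mono)
  moreover have "\<forall>\<^sub>F x in at_top. section_of lnln x = ln (ln x)" unfolding lnln_def by (rule section_germ_of)
  moreover have "\<forall>\<^sub>F x::real in at_top. 1 < x" by (rule eventually_gt_at_top)
  ultimately show ?thesis
  proof eventually_elim
    case (elim x)
    have "ln x = exp (ln (ln x))" using elim(3) by simp
    also have "\<dots> \<le> E a x" unfolding E_def exp_le_cancel_iff using elim by simp
    finally show ?case .
  qed
qed

lemma E_tendsto_0:
  assumes "good \<Gamma>" "a \<in> \<Gamma>" "a < 0"
  shows "(E a \<longlongrightarrow> 0) at_top"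
proof (rule tendsto_sandwich[of "\<lambda>_. 0" _ _ "\<lambda>x. inverse (ln x)"])
  have "lnln \<le> - a" using good_pos[OF assms(1) goodD(4)[OF assms(1,2)]] assms(3) by simp
  from E_ge_ln[OF this] show "\<forall>\<^sub>F x in at_top. E a x \<le> inverse (ln x)"
    using eventually_gt_at_top[of 1]
  proof eventually_elim
    case (elim x)
    then have "ln x \<le> inverse (E a x)" by (simp add: E_minus)
    then have "inverse (inverse (E a x)) \<le> inverse (ln x)"
      using elim(2) by (intro le_imp_inverse_le) auto
    then show ?case by simp
  qed
  show "((\<lambda>x::real. inverse (ln x)) \<longlongrightarrow> 0) at_top"
    by (rule tendsto_inverse_0_at_top[OF ln_at_top])
qed auto

lemma eventually_E_le:
  assumes "good \<Gamma>" "finite G" "G \<subseteq> \<Gamma>" "\<And>g. g \<in> G \<Longrightarrow> g < 0" "0 < \<rho>"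
  shows "\<forall>\<^sub>F x in at_top. \<forall>g\<in>G. E g x \<le> \<rho>"
proof (rule eventually_ball_finite[OF assms(2)], rule ballI)
  fix g assume g: "g \<in> G"
  then have "(E g \<longlongrightarrow> 0) at_top" using E_tendsto_0[OF assms(1)] assms(3,4) by blast
  then have "\<forall>\<^sub>F x in at_top. E g x < \<rho>" using assms(5) by (rule order_tendstoD)
  then show "\<forall>\<^sub>F x in at_top. E g x \<le> \<rho>" by (rule eventually_mono) simp
qed

text \<open>
  Dickson's lemma for words over a finite alphabet: it shows that among the exponents that occur in
  a family there are finitely many from which all others arise by adding negative elements.
\<close>
lemma dickson_mset:
  assumes "finite H" "finite G" "\<And>i. i \<in> T \<Longrightarrow> h i \<in> H \<and> set_mset (w i) \<subseteq> G"
  shows "\<exists>F\<subseteq>T. finite F \<and> (\<forall>i\<in>T. \<exists>k\<in>F. h k = h i \<and> w k \<subseteq># w i)"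
proof -
  have "\<forall>T'\<subseteq>T. \<exists>F\<subseteq>T'. finite F \<and> (\<forall>i\<in>T'. \<exists>k\<in>F. h k = h i \<and> (\<forall>g\<in>G'. count (w k) g \<le> count (w i) g))"
    if "finite G'" for G'
    using that
  proof induction
    case empty
    show ?case
    proof (intro allI impI)
      fix T' assume T': "T' \<subseteq> T"
      then have "finite (h ` T')" using assms(1,3) finite_subset[of "h ` T'" H] by blast
      then have "\<exists>F\<subseteq>T'. finite F \<and> h ` T' = h ` F"
        by (rule finite_subset_image) simp
      then obtain F where F: "F \<subseteq> T'" "finite F" "h ` T' = h ` F" by blast
      then have "\<forall>i\<in>T'. \<exists>k\<in>F. h k = h i" by (metis image_iff)
      then show "\<exists>F\<subseteq>T'. finite F \<and> (\<forall>i\<in>T'. \<exists>k\<in>F. h k = h i \<and> (\<forall>g\<in>{}. count (w k) g \<le> count (w i) g))"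
        using F by auto
    qed
  next
    case (insert g G')
    show ?case
    proof (intro allI impI)
      fix T' assume T': "T' \<subseteq> T"
      have "\<exists>F\<subseteq>T'. finite F \<and> (\<forall>i\<in>T'. \<exists>k\<in>F. count (w k) g \<le> count (w i) g \<and>
          (h k = h i \<and> (\<forall>g\<in>G'. count (w k) g \<le> count (w i) g)))"
        by (rule dickson) (use insert.IH T' in blast)
      then show "\<exists>F\<subseteq>T'. finite F \<and> (\<forall>i\<in>T'. \<exists>k\<in>F. h k = h i \<and> (\<forall>g\<in>insert g G'. count (w k) g \<le> count (w i) g))"
        by (simp add: conj_ac)
    qed
  qed
  then have "\<exists>F\<subseteq>T. finite F \<and> (\<forall>i\<in>T. \<exists>k\<in>F. h k = h i \<and> (\<forall>g\<in>G. count (w k) g \<le> count (w i) g))"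
    using assms(2) by simp
  then obtain F where F: "F \<subseteq> T" "finite F"
    "\<forall>i\<in>T. \<exists>k\<in>F. h k = h i \<and> (\<forall>g\<in>G. count (w k) g \<le> count (w i) g)" by (elim exE conjE)
  have sub: "w k \<subseteq># w i" if "k \<in> F" "\<forall>g\<in>G. count (w k) g \<le> count (w i) g" for k i
    unfolding subseteq_mset_def
  proof
    fix g
    show "count (w k) g \<le> count (w i) g"
    proof (cases "g \<in> G")
      case False
      then have "g \<notin># w k" using assms(3)[of k] F(1) that(1) by blast
      then show ?thesis by (simp add: not_in_iff)
    qed (use that in blast)
  qed
  show ?thesis
  proof (rule exI[of _ F], intro conjI ballI)
    fix i assume "i \<in> T"
    from bspec[OF F(3) this] obtain k where "k \<in> F" "h k = h i" "\<forall>g\<in>G. count (w k) g \<le> count (w i) g" by blast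
    then show "\<exists>k\<in>F. h k = h i \<and> w k \<subseteq># w i" using sub[of k i] by auto
  qed (fact F(1) F(2))+
qed

definition ser_rep where
  "ser_rep \<Gamma> P H G \<rho> N f \<longleftrightarrow> finite H \<and> H \<subseteq> \<Gamma> \<and> finite G \<and> G \<subseteq> \<Gamma> \<and> (\<forall>g\<in>G. g < 0) \<and> 0 < \<rho> \<and>
     fam G {(h, w). h \<in> H \<and> set_mset w \<subseteq> G \<and> P (h + \<Sum>\<^sub># w)} \<rho> N f"

text \<open>
  The predicate \<open>P\<close> restricts the exponents that occur with nonzero coefficient. The
  cases of interest are \<open>0 < e\<close> (purely infinite series), \<open>e < 0\<close> (small
  series) and no restriction.
\<close>
definition ser :: "germ set \<Rightarrow> (germ \<Rightarrow> bool) \<Rightarrow> germ set" where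
  "ser \<Gamma> P = {germ_of f |f H G \<rho> N. ser_rep \<Gamma> P H G \<rho> N f}"

lemma serI:
  assumes "finite H" "H \<subseteq> \<Gamma>" "finite G" "G \<subseteq> \<Gamma>" "\<And>g. g \<in> G \<Longrightarrow> g < 0" "0 < \<rho>"
    "fam G {(h, w). h \<in> H \<and> set_mset w \<subseteq> G \<and> P (h + \<Sum>\<^sub># w)} \<rho> N f"
  shows "germ_of f \<in> ser \<Gamma> P"
proof -
  have "ser_rep \<Gamma> P H G \<rho> N f" unfolding ser_rep_def by (intro conjI ballI assms)
  then show ?thesis unfolding ser_def by blast
qed

lemma serE:
  assumes "a \<in> ser \<Gamma> P"
  obtains f H G \<rho> N where "a = germ_of f" "finite H" "H \<subseteq> \<Gamma>" "finite G" "G \<subseteq> \<Gamma>" "\<And>g. g \<in> G \<Longrightarrow> g < 0" "0 < \<rho>"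
    "fam G {(h, w). h \<in> H \<and> set_mset w \<subseteq> G \<and> P (h + \<Sum>\<^sub># w)} \<rho> N f"
proof -
  from assms obtain f H G \<rho> N where r: "a = germ_of f" "ser_rep \<Gamma> P H G \<rho> N f" unfolding ser_def by blast
  from r(2)[unfolded ser_rep_def] show ?thesis by (elim conjE) (rule that[OF r(1)], simp_all)
qed

lemma sum_mset_good: "good \<Gamma> \<Longrightarrow> set_mset w \<subseteq> \<Gamma> \<Longrightarrow> \<Sum>\<^sub># w \<in> \<Gamma>"
  by (induction w) (auto simp: goodD)

lemma ser_mono: "\<Gamma> \<subseteq> \<Gamma>' \<Longrightarrow> (\<And>e. P e \<Longrightarrow> P' e) \<Longrightarrow> ser \<Gamma> P \<subseteq> ser \<Gamma>' P'"
proof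
  fix a assume *: "\<Gamma> \<subseteq> \<Gamma>'" "\<And>e. P e \<Longrightarrow> P' e" "a \<in> ser \<Gamma> P"
  from *(3) obtain f H G \<rho> N where a: "a = germ_of f" "finite H" "H \<subseteq> \<Gamma>" "finite G" "G \<subseteq> \<Gamma>" "\<And>g. g \<in> G \<Longrightarrow> g < 0" "0 < \<rho>"
    "fam G {(h, w). h \<in> H \<and> set_mset w \<subseteq> G \<and> P (h + \<Sum>\<^sub># w)} \<rho> N f" by (rule serE) (rule that)
  have "fam G {(h, w). h \<in> H \<and> set_mset w \<subseteq> G \<and> P' (h + \<Sum>\<^sub># w)} \<rho> N f"
    by (rule fam_mono[OF a(8)]) (use *(2) a(7) in auto)
  then show "a \<in> ser \<Gamma>' P'" unfolding a(1) by (intro serI[of H _ G]) (use a(2-7) *(1) in auto)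
qed

lemma ser_add:
  assumes "a \<in> ser \<Gamma> P" "b \<in> ser \<Gamma> P" shows "a + b \<in> ser \<Gamma> P"
proof -
  from assms(1) obtain f H G \<rho> N where a: "a = germ_of f" "finite H" "H \<subseteq> \<Gamma>" "finite G" "G \<subseteq> \<Gamma>" "\<And>g. g \<in> G \<Longrightarrow> g < 0" "0 < \<rho>"
    "fam G {(h, w). h \<in> H \<and> set_mset w \<subseteq> G \<and> P (h + \<Sum>\<^sub># w)} \<rho> N f" by (rule serE) (rule that)
  from assms(2) obtain f' H' G' \<rho>' N' where b: "b = germ_of f'" "finite H'" "H' \<subseteq> \<Gamma>" "finite G'" "G' \<subseteq> \<Gamma>" "\<And>g. g \<in> G' \<Longrightarrow> g < 0" "0 < \<rho>'"
    "fam G' {(h, w). h \<in> H' \<and> set_mset w \<subseteq> G' \<and> P (h + \<Sum>\<^sub># w)} \<rho>' N' f'" by (rule serE) (rule that)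
  define A where "A = {(h, w). h \<in> H \<union> H' \<and> set_mset w \<subseteq> G \<union> G' \<and> P (h + \<Sum>\<^sub># w)}"
  have "fst ` A \<subseteq> H \<union> H'" by (auto simp: A_def)
  then have fin: "finite (fst ` A)" by (rule finite_subset) (use a(2) b(2) in simp)
  have "fam (G \<union> G') A (min \<rho> \<rho>') (N + N') (\<lambda>x. f x + f' x)"
  proof (rule fam_add[OF _ _ fin])
    show "fam (G \<union> G') A (min \<rho> \<rho>') N f" by (rule fam_mono[OF a(8)]) (use a(7) b(7) in \<open>auto simp: A_def\<close>)
    show "fam (G \<union> G') A (min \<rho> \<rho>') N' f'" by (rule fam_mono[OF b(8)]) (use a(7) b(7) in \<open>auto simp: A_def\<close>)
  qed (use a(7) b(7) in \<open>auto simp: A_def\<close>)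
  then have "germ_of (\<lambda>x. f x + f' x) \<in> ser \<Gamma> P"
    unfolding A_def by (intro serI[of "H \<union> H'" _ "G \<union> G'"]) (use a(2-7) b(2-7) in auto)
  then show ?thesis using a(1) b(1) by (simp add: germ_of_simps)
qed

lemma ser_mult:
  assumes "a \<in> ser \<Gamma> P" "b \<in> ser \<Gamma> Q" "good \<Gamma>" "\<And>d e. P d \<Longrightarrow> Q e \<Longrightarrow> R (d + e)"
  shows "a * b \<in> ser \<Gamma> R"
proof -
  from assms(1) obtain f H G \<rho> N where a: "a = germ_of f" "finite H" "H \<subseteq> \<Gamma>" "finite G" "G \<subseteq> \<Gamma>" "\<And>g. g \<in> G \<Longrightarrow> g < 0" "0 < \<rho>"
    "fam G {(h, w). h \<in> H \<and> set_mset w \<subseteq> G \<and> P (h + \<Sum>\<^sub># w)} \<rho> N f" by (rule serE) (rule that)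
  from assms(2) obtain f' H' G' \<rho>' N' where b: "b = germ_of f'" "finite H'" "H' \<subseteq> \<Gamma>" "finite G'" "G' \<subseteq> \<Gamma>" "\<And>g. g \<in> G' \<Longrightarrow> g < 0" "0 < \<rho>'"
    "fam G' {(h, w). h \<in> H' \<and> set_mset w \<subseteq> G' \<and> Q (h + \<Sum>\<^sub># w)} \<rho>' N' f'" by (rule serE) (rule that)
  let ?H = "(\<lambda>(h, k). h + k) ` (H \<times> H')"
  let ?\<rho> = "min \<rho> \<rho>'"
  have A: "fam (G \<union> G') {(h, w). h \<in> H \<and> set_mset w \<subseteq> G \<union> G' \<and> P (h + \<Sum>\<^sub># w)} ?\<rho> N f"
    by (rule fam_mono[OF a(8)]) (use a(7) b(7) in auto)
  have B: "fam (G \<union> G') {(h, w). h \<in> H' \<and> set_mset w \<subseteq> G \<union> G' \<and> Q (h + \<Sum>\<^sub># w)} ?\<rho> N' f'"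
    by (rule fam_mono[OF b(8)]) (use a(7) b(7) in auto)
  have "fam (G \<union> G') {(h, w). h \<in> ?H \<and> set_mset w \<subseteq> G \<union> G' \<and> R (h + \<Sum>\<^sub># w)} ?\<rho> (N * N') (\<lambda>x. f x * f' x)"
  proof (rule fam_mult[OF A B])
    fix h w k v
    assume hw: "(h, w) \<in> {(h, w). h \<in> H \<and> set_mset w \<subseteq> G \<union> G' \<and> P (h + \<Sum>\<^sub># w)}"
      and kv: "(k, v) \<in> {(h, w). h \<in> H' \<and> set_mset w \<subseteq> G \<union> G' \<and> Q (h + \<Sum>\<^sub># w)}"
    have "R ((h + \<Sum>\<^sub># w) + (k + \<Sum>\<^sub># v))" using assms(4) hw kv by auto
    then have "R (h + k + \<Sum>\<^sub># (w + v))" by (simp add: algebra_simps)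
    then show "(h + k, w + v) \<in> {(h, w). h \<in> ?H \<and> set_mset w \<subseteq> G \<union> G' \<and> R (h + \<Sum>\<^sub># w)}"
      using hw kv by (auto simp: image_iff)
  qed (use a(7) b(7) in auto)
  then have "germ_of (\<lambda>x. f x * f' x) \<in> ser \<Gamma> R"
  proof (rule serI[rotated 6])
    show "?H \<subseteq> \<Gamma>" using a(3) b(3) goodD(5)[OF assms(3)] by auto
  qed (use a(2-7) b(2-7) in auto)
  then show ?thesis using a(1) b(1) by (simp add: germ_of_simps)
qed

lemma ser_monomial:
  assumes "\<theta> \<in> \<Gamma>" "P \<theta>" shows "germ_of (\<lambda>x. r * E \<theta> x) \<in> ser \<Gamma> P"
proof (rule serI[of "{\<theta>}" _ "{}" 1])
  show "fam {} {(h, w). h \<in> {\<theta>} \<and> set_mset w \<subseteq> {} \<and> P (h + \<Sum>\<^sub># w)} 1 (\<bar>r\<bar> * 1 ^ size {#}) (\<lambda>x. r * E \<theta> x)"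
    using fam_single[of \<theta> "{#}" _ "{}" 1 r] assms(2) by simp
qed (use assms in auto)

section \<open>Leading terms of series\<close>

abbreviation small :: "germ set \<Rightarrow> germ set" where
  "small \<Gamma> \<equiv> ser \<Gamma> (\<lambda>e. e < 0)"

lemma sum_mset_neg:
  assumes "w \<noteq> {#}" "\<And>g. g \<in># w \<Longrightarrow> g < (0::germ)" shows "\<Sum>\<^sub># w < 0"
  using assms
proof (induction w)
  case (add g w)
  show ?case
  proof (cases "w = {#}")
    case False
    then have "\<Sum>\<^sub># w < 0" "g < 0" using add by auto
    then have "g + \<Sum>\<^sub># w < 0" by (rule add_neg_neg[rotated])
    then show ?thesis by simp
  qed (use add in auto)
qed simp

lemma fam_bound_summable:
  assumes sm: "(\<lambda>i::nat. \<bar>c i\<bar> * \<rho> ^ size (w i)) summable_on UNIV" and "finite H" "0 < \<rho>"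
    and nz: "\<And>i. c i \<noteq> 0 \<Longrightarrow> h i \<in> H \<and> set_mset (w i) \<subseteq> G" and x: "\<forall>g\<in>G. E g x \<le> \<rho>"
  shows "(\<lambda>i. c i * E (h i + \<Sum>\<^sub># (w i)) x) summable_on UNIV"
proof -
  define M where "M = (\<Sum>a\<in>H. E a x)"
  have abs: "(\<lambda>i. norm (c i * E (h i + \<Sum>\<^sub># (w i)) x)) summable_on UNIV"
  proof (rule summable_on_comparison_test)
    show "(\<lambda>i. M * (\<bar>c i\<bar> * \<rho> ^ size (w i))) summable_on UNIV" by (rule summable_on_cmult_right[OF sm])
    show "norm (c i * E (h i + \<Sum>\<^sub># (w i)) x) \<le> M * (\<bar>c i\<bar> * \<rho> ^ size (w i))" for i
    proof (cases "c i = 0")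
      case False
      note hw = nz[OF this]
      have "E (h i) x \<le> M" unfolding M_def by (rule member_le_sum) (use hw assms(2) in auto)
      moreover have "E (\<Sum>\<^sub># (w i)) x \<le> \<rho> ^ size (w i)" by (rule E_word_le[OF assms(3)]) (use hw x in blast)
      ultimately have "E (h i) x * E (\<Sum>\<^sub># (w i)) x \<le> M * \<rho> ^ size (w i)"
        by (intro mult_mono) (auto intro: order_trans[OF E_nonneg])
      then have "\<bar>c i\<bar> * (E (h i) x * E (\<Sum>\<^sub># (w i)) x) \<le> \<bar>c i\<bar> * (M * \<rho> ^ size (w i))"
        by (intro mult_left_mono) auto
      then show ?thesis by (simp add: abs_mult E_add mult_ac)
    qed simp
  qed simp
  show ?thesis by (rule abs_summable_summable[OF abs])
qed

text \<open>
  If all exponents that occur are below \<open>\<theta>\<close>, the series is \<open>exp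
  \<theta>\<close> times a series in nonempty words over an enlarged alphabet \<open>G'\<close>: by
  Dickson's lemma, each exponent is one of finitely many \<open>e\<^sub>k < \<theta>\<close> plus a
  word over \<open>G\<close>, and the differences \<open>e\<^sub>k - \<theta>\<close> are the new
  letters.
\<close>
lemma truncation:
  assumes \<Gamma>: "good \<Gamma>" and HG: "finite H" "H \<subseteq> \<Gamma>" "finite G" "G \<subseteq> \<Gamma>" "\<And>g. g \<in> G \<Longrightarrow> g < 0" "0 < \<rho>"
    and sm: "(\<lambda>i::nat. \<bar>c i\<bar> * \<rho> ^ size (w i)) summable_on UNIV"
    and nz: "\<And>i. c i \<noteq> 0 \<Longrightarrow> h i \<in> H \<and> set_mset (w i) \<subseteq> G"
    and \<theta>: "\<theta> \<in> \<Gamma>" "\<And>i. c i \<noteq> 0 \<Longrightarrow> h i + \<Sum>\<^sub># (w i) < \<theta>"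
  obtains G' N r where "finite G'" "G \<subseteq> G'" "G' \<subseteq> \<Gamma>" "\<And>g. g \<in> G' \<Longrightarrow> g < 0"
    "fam G' {(h, w). h = 0 \<and> w \<noteq> {#} \<and> set_mset w \<subseteq> G'} \<rho> N r"
    "\<And>x. E \<theta> x * r x = infsum (\<lambda>i. c i * E (h i + \<Sum>\<^sub># (w i)) x) UNIV"
proof -
  define T where "T = {i. c i \<noteq> 0}"
  define e where "e i = h i + \<Sum>\<^sub># (w i)" for i
  have "\<exists>F\<subseteq>T. finite F \<and> (\<forall>i\<in>T. \<exists>k\<in>F. h k = h i \<and> w k \<subseteq># w i)"
    by (rule dickson_mset[OF HG(1,3)]) (use nz in \<open>auto simp: T_def\<close>)
  then obtain F where F: "F \<subseteq> T" "finite F" "\<forall>i\<in>T. \<exists>k\<in>F. h k = h i \<and> w k \<subseteq># w i" by (elim exE conjE)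
  then have "\<forall>i\<in>T. \<exists>k. k \<in> F \<and> h k = h i \<and> w k \<subseteq># w i" by blast
  from bchoice[OF this] obtain \<kappa> where \<kappa>: "\<forall>i\<in>T. \<kappa> i \<in> F \<and> h (\<kappa> i) = h i \<and> w (\<kappa> i) \<subseteq># w i" ..
  define G' where "G' = G \<union> (\<lambda>k. e k - \<theta>) ` F"
  define v where "v i = add_mset (e (\<kappa> i) - \<theta>) (w i - w (\<kappa> i))" for i
  have eG: "e k \<in> \<Gamma>" "e k - \<theta> < 0" if "k \<in> F" for k
  proof -
    have ck: "c k \<noteq> 0" using that F(1) by (auto simp: T_def)
    from nz[OF ck] HG have "h k \<in> \<Gamma>" "set_mset (w k) \<subseteq> \<Gamma>" by auto
    then show "e k \<in> \<Gamma>" unfolding e_def using goodD(5)[OF \<Gamma>] sum_mset_good[OF \<Gamma>] by blast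
    show "e k - \<theta> < 0" using \<theta>(2)[OF ck] by (simp add: e_def)
  qed
  have v: "0 + \<Sum>\<^sub># (v i) = e i - \<theta>" "set_mset (v i) \<subseteq> G'"
    "\<rho> ^ size (v i) = \<rho> ^ size (w i) * (\<rho> / \<rho> ^ size (w (\<kappa> i)))" if "c i \<noteq> 0" for i
  proof -
    have k: "\<kappa> i \<in> F" "h (\<kappa> i) = h i" "w (\<kappa> i) \<subseteq># w i" using \<kappa> that by (auto simp: T_def)
    then obtain u where u: "w i = w (\<kappa> i) + u" by (auto simp: mset_subset_eq_exists_conv)
    show "0 + \<Sum>\<^sub># (v i) = e i - \<theta>" by (simp add: v_def e_def u k(2) algebra_simps)
    show "set_mset (v i) \<subseteq> G'" using nz[OF that] k(1) by (auto simp: v_def G'_def dest: in_diffD)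
    show "\<rho> ^ size (v i) = \<rho> ^ size (w i) * (\<rho> / \<rho> ^ size (w (\<kappa> i)))"
      using HG(6) by (simp add: v_def u power_add)
  qed
  define D where "D = (\<Sum>k\<in>F. \<rho> / \<rho> ^ size (w k))"
  have D: "\<bar>c i\<bar> * \<rho> ^ size (v i) \<le> D * (\<bar>c i\<bar> * \<rho> ^ size (w i))" for i
  proof (cases "c i = 0")
    case False
    have "\<rho> / \<rho> ^ size (w (\<kappa> i)) \<le> D" unfolding D_def
      by (rule member_le_sum[of "\<kappa> i" F "\<lambda>k. \<rho> / \<rho> ^ size (w k)"]) (use \<kappa> False F HG(6) in \<open>auto simp: T_def\<close>)
    then have "\<rho> ^ size (v i) \<le> \<rho> ^ size (w i) * D"
      unfolding v(3)[OF False] using HG(6) by (intro mult_left_mono) auto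
    then have "\<bar>c i\<bar> * \<rho> ^ size (v i) \<le> \<bar>c i\<bar> * (\<rho> ^ size (w i) * D)" by (intro mult_left_mono) auto
    then show ?thesis by (simp add: mult_ac)
  qed simp
  have sm': "(\<lambda>i. \<bar>c i\<bar> * \<rho> ^ size (v i)) summable_on UNIV"
    by (rule summable_on_comparison_test[OF summable_on_cmult_right[OF sm] D]) (use HG(6) in auto)
  define r where "r x = infsum (\<lambda>i. c i * E (0 + \<Sum>\<^sub># (v i)) x) UNIV" for x
  have fin: "finite G'" using HG F by (auto simp: G'_def)
  have G'\<Gamma>: "G' \<subseteq> \<Gamma>" using HG(4) eG(1) goodD(2)[OF \<Gamma> _ \<theta>(1)] by (auto simp: G'_def)
  have G'neg: "g < 0" if "g \<in> G'" for g using that HG(5) eG(2) by (auto simp: G'_def)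
  have "fam G' {(h, w). h = 0 \<and> w \<noteq> {#} \<and> set_mset w \<subseteq> G'} \<rho> (infsum (\<lambda>i. \<bar>c i\<bar> * \<rho> ^ size (v i)) UNIV) r"
    unfolding fam_def
  proof (intro exI conjI allI impI)
    show "(0, v i) \<in> {(h, w). h = 0 \<and> w \<noteq> {#} \<and> set_mset w \<subseteq> G'}" if "c i \<noteq> 0" for i
      using v(2)[OF that] by (auto simp: v_def)
    show "((\<lambda>i. \<bar>c i\<bar> * \<rho> ^ size (v i)) has_sum infsum (\<lambda>i. \<bar>c i\<bar> * \<rho> ^ size (v i)) UNIV) UNIV"
      by (rule has_sum_infsum[OF sm'])
    fix x assume x: "\<forall>g\<in>G'. E g x \<le> \<rho>"
    have "(\<lambda>i. c i * E (0 + \<Sum>\<^sub># (v i)) x) summable_on UNIV"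
      by (rule fam_bound_summable[OF sm', of "{0}" "\<lambda>_. 0" G']) (use v(2) x HG(6) in auto)
    then show "((\<lambda>i. c i * E (0 + \<Sum>\<^sub># (v i)) x) has_sum r x) UNIV" unfolding r_def by (rule has_sum_infsum)
  qed simp
  moreover have "E \<theta> x * r x = infsum (\<lambda>i. c i * E (h i + \<Sum>\<^sub># (w i)) x) UNIV" for x
  proof -
    have "E \<theta> x * r x = infsum (\<lambda>i. E \<theta> x * (c i * E (0 + \<Sum>\<^sub># (v i)) x)) UNIV"
      unfolding r_def by (rule infsum_cmult_right'[symmetric])
    also have "\<dots> = infsum (\<lambda>i. c i * E (h i + \<Sum>\<^sub># (w i)) x) UNIV"
    proof (rule infsum_cong)
      fix i
      show "E \<theta> x * (c i * E (0 + \<Sum>\<^sub># (v i)) x) = c i * E (h i + \<Sum>\<^sub># (w i)) x"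
      proof (cases "c i = 0")
        case False
        have "E \<theta> x * E (e i - \<theta>) x = E (e i) x" by (simp add: E_diff less_imp_neq[OF E_pos, symmetric])
        then show ?thesis using v(1)[OF False] by (simp add: e_def mult_ac)
      qed simp
    qed
    finally show ?thesis .
  qed
  ultimately show ?thesis using that[OF fin _ G'\<Gamma> G'neg] by (auto simp: G'_def)
qed

lemma small_of_words:
  assumes "good \<Gamma>" "finite G" "G \<subseteq> \<Gamma>" "\<And>g. g \<in> G \<Longrightarrow> g < 0" "0 < \<rho>"
    "fam G {(h, w). h = 0 \<and> w \<noteq> {#} \<and> set_mset w \<subseteq> G} \<rho> N r"
  shows "germ_of r \<in> small \<Gamma>"
proof -
  have neg: "\<Sum>\<^sub># w < 0" if "w \<noteq> {#}" "set_mset w \<subseteq> G" for w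
    by (rule sum_mset_neg[OF that(1)]) (use that(2) assms(4) in blast)
  have "fam G {(h, w). h \<in> {0} \<and> set_mset w \<subseteq> G \<and> h + \<Sum>\<^sub># w < 0} \<rho> N r"
    by (rule fam_mono[OF assms(6)]) (use neg assms(5) in auto)
  then show ?thesis
    by (intro serI[of "{0}" _ G]) (use assms(2-5) goodD(1)[OF assms(1)] in auto)
qed

text \<open>
  In this form, every term of a small series has a factor that tends to zero.
\<close>
lemma small_words:
  assumes "good \<Gamma>" "a \<in> small \<Gamma>"
  obtains r G \<rho> N where "a = germ_of r" "finite G" "G \<subseteq> \<Gamma>" "\<And>g. g \<in> G \<Longrightarrow> g < 0" "0 < \<rho>"
    "fam G {(h, w). h = 0 \<and> w \<noteq> {#} \<and> set_mset w \<subseteq> G} \<rho> N r"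
proof -
  from assms(2) obtain f H G \<rho> N where a: "a = germ_of f" "finite H" "H \<subseteq> \<Gamma>" "finite G" "G \<subseteq> \<Gamma>" "\<And>g. g \<in> G \<Longrightarrow> g < 0" "0 < \<rho>"
    "fam G {(h, w). h \<in> H \<and> set_mset w \<subseteq> G \<and> h + \<Sum>\<^sub># w < 0} \<rho> N f" by (rule serE) (rule that)
  from a(8) obtain c h w N' where f: "\<And>i. c i \<noteq> 0 \<Longrightarrow> (h i, w i) \<in> {(h, w). h \<in> H \<and> set_mset w \<subseteq> G \<and> h + \<Sum>\<^sub># w < 0}"
     "((\<lambda>i::nat. \<bar>c i\<bar> * \<rho> ^ size (w i)) has_sum N') UNIV"
     "\<And>x. (\<forall>g\<in>G. E g x \<le> \<rho>) \<Longrightarrow> ((\<lambda>i. c i * E (h i + \<Sum>\<^sub># (w i)) x) has_sum f x) UNIV"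
    unfolding fam_def by blast
  have sm: "(\<lambda>i. \<bar>c i\<bar> * \<rho> ^ size (w i)) summable_on UNIV" using f(2) by (auto simp: summable_on_def)
  obtain G' M r where r: "finite G'" "G \<subseteq> G'" "G' \<subseteq> \<Gamma>" "\<And>g. g \<in> G' \<Longrightarrow> g < 0"
    "fam G' {(h, w). h = 0 \<and> w \<noteq> {#} \<and> set_mset w \<subseteq> G'} \<rho> M r"
    "\<And>x. E 0 x * r x = infsum (\<lambda>i. c i * E (h i + \<Sum>\<^sub># (w i)) x) UNIV"
    by (rule truncation[OF assms(1) a(2-7) sm _ goodD(1)[OF assms(1)]]) (use f(1) that in auto)
  have ev: "\<forall>\<^sub>F x in at_top. \<forall>g\<in>G. E g x \<le> \<rho>"
    by (rule eventually_E_le[OF assms(1) a(4,5)]) (use a(6,7) in auto)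
  have "germ_of f = germ_of r" unfolding germ_of_eq_iff
    using ev
  proof eventually_elim
    case (elim x)
    then show ?case using infsumI[OF f(3)[OF elim]] r(6)[of x] by simp
  qed
  with that[OF _ r(1,3,4) a(7) r(5)] a(1) show ?thesis by simp
qed

lemma small_tendsto_0:
  assumes "good \<Gamma>" "germ_of f \<in> small \<Gamma>" shows "(f \<longlongrightarrow> 0) at_top"
proof -
  from assms obtain r G \<rho> N where r: "germ_of f = germ_of r" "finite G" "G \<subseteq> \<Gamma>" "\<And>g. g \<in> G \<Longrightarrow> g < 0" "0 < \<rho>"
    "fam G {(h, w). h = 0 \<and> w \<noteq> {#} \<and> set_mset w \<subseteq> G} \<rho> N r" by (rule small_words) (rule that)
  from r(6) obtain c h w N' where c: "\<And>i. c i \<noteq> 0 \<Longrightarrow> (h i, w i) \<in> {(h, w). h = 0 \<and> w \<noteq> {#} \<and> set_mset w \<subseteq> G}"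
     "((\<lambda>i::nat. \<bar>c i\<bar> * \<rho> ^ size (w i)) has_sum N') UNIV"
     "\<And>x. (\<forall>g\<in>G. E g x \<le> \<rho>) \<Longrightarrow> ((\<lambda>i. c i * E (h i + \<Sum>\<^sub># (w i)) x) has_sum r x) UNIV"
    unfolding fam_def by blast
  have ev: "\<forall>\<^sub>F x in at_top. \<forall>g\<in>G. E g x \<le> \<rho>"
    by (rule eventually_E_le[OF assms(1) r(2,3)]) (use r(4,5) in auto)
  have "\<forall>\<^sub>F x in at_top. norm (r x) \<le> (\<Sum>g\<in>G. E g x) / \<rho> * N'"
    using ev
  proof eventually_elim
    case (elim x)
    let ?M = "\<Sum>g\<in>G. E g x"
    have le: "\<bar>c i * E (h i + \<Sum>\<^sub># (w i)) x\<bar> \<le> ?M / \<rho> * (\<bar>c i\<bar> * \<rho> ^ size (w i))" for i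
    proof (cases "c i = 0")
      case False
      note ci = c(1)[OF False]
      then obtain g u where gu: "w i = add_mset g u" using multiset_cases[of "w i"] by auto
      then have g: "g \<in> G" "set_mset u \<subseteq> G" "h i = 0" using ci by auto
      have "E g x \<le> ?M" by (rule member_le_sum) (use g r(2) in auto)
      moreover have "E (\<Sum>\<^sub># u) x \<le> \<rho> ^ size u" by (rule E_word_le[OF r(5)]) (use g elim in auto)
      ultimately have "E g x * E (\<Sum>\<^sub># u) x \<le> ?M * \<rho> ^ size u"
        by (intro mult_mono) (auto intro: order_trans[OF E_nonneg])
      also have "\<dots> = ?M / \<rho> * \<rho> ^ size (w i)" using r(5) by (simp add: gu)
      finally have "\<bar>c i\<bar> * (E g x * E (\<Sum>\<^sub># u) x) \<le> \<bar>c i\<bar> * (?M / \<rho> * \<rho> ^ size (w i))"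
        by (intro mult_left_mono) auto
      then show ?thesis using r(5) by (simp add: gu g(3) E_add abs_mult mult_ac)
    qed simp
    have bd: "((\<lambda>i. ?M / \<rho> * (\<bar>c i\<bar> * \<rho> ^ size (w i))) has_sum (?M / \<rho> * N')) UNIV"
      by (rule has_sum_cmult_right[OF c(2)])
    have "r x \<le> ?M / \<rho> * N'"
      by (rule has_sum_mono[OF c(3)[OF elim] bd]) (use le in \<open>simp add: abs_le_iff\<close>)
    moreover have "- (?M / \<rho> * N') \<le> r x"
    proof (rule has_sum_mono[OF _ c(3)[OF elim]])
      show "((\<lambda>i. - (?M / \<rho> * (\<bar>c i\<bar> * \<rho> ^ size (w i)))) has_sum - (?M / \<rho> * N')) UNIV"
        unfolding has_sum_uminus using bd by simp
      show "- (?M / \<rho> * (\<bar>c i\<bar> * \<rho> ^ size (w i))) \<le> c i * E (h i + \<Sum>\<^sub># (w i)) x" for i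
        using le[of i] by (simp only: abs_le_iff minus_le_iff)
    qed
    ultimately show ?case by (simp add: abs_le_iff)
  qed
  moreover have "((\<lambda>x. (\<Sum>g\<in>G. E g x) / \<rho> * N') \<longlongrightarrow> 0) at_top"
  proof -
    have "((\<lambda>x. \<Sum>g\<in>G. E g x) \<longlongrightarrow> (\<Sum>g\<in>G. 0)) at_top"
      by (rule tendsto_sum, rule E_tendsto_0[OF assms(1)]) (use r(3,4) in auto)
    then have "((\<lambda>x. (\<Sum>g\<in>G. E g x) * (inverse \<rho> * N')) \<longlongrightarrow> 0) at_top"
      using tendsto_mult_left_zero by fastforce
    then show ?thesis by (simp add: divide_inverse mult_ac)
  qed
  ultimately have "(r \<longlongrightarrow> 0) at_top" by (rule Lim_null_comparison)
  moreover have "\<forall>\<^sub>F x in at_top. f x = r x" using r(1) by (simp add: germ_of_eq_iff)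
  ultimately show ?thesis using tendsto_cong by blast
qed

text \<open>
  Cancellation: terms with the same exponent may be collected, by absolute convergence.
\<close>
lemma infsum_grouped_zero:
  fixes u :: "nat \<Rightarrow> real"
  assumes u: "u summable_on UNIV" and z: "\<And>\<gamma>. \<gamma> \<in> S \<Longrightarrow> infsum u {i. e i = \<gamma>} = 0"
  shows "infsum u {i. e i \<in> S} = 0"
proof -
  have bij: "bij_betw snd (Sigma S (\<lambda>\<gamma>. {i. e i = \<gamma>})) {i. e i \<in> S}"
    by (rule bij_betwI[where g = "\<lambda>i. (e i, i)"]) auto
  have "u summable_on {i. e i \<in> S}" by (rule summable_on_subset_banach[OF u]) simp
  then have "(\<lambda>p. u (snd p)) summable_on Sigma S (\<lambda>\<gamma>. {i. e i = \<gamma>})"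
    using summable_on_reindex_bij_betw[OF bij, of u] by simp
  then have "(\<lambda>(\<gamma>, i). u i) summable_on Sigma S (\<lambda>\<gamma>. {i. e i = \<gamma>})"
    by (simp add: case_prod_unfold)
  from infsum_Sigma'_banach[OF this]
  have "infsum (\<lambda>p. u (snd p)) (Sigma S (\<lambda>\<gamma>. {i. e i = \<gamma>})) = infsum (\<lambda>\<gamma>. infsum u {i. e i = \<gamma>}) S"
    by (simp add: case_prod_unfold)
  also have "\<dots> = 0" by (rule infsum_0) (rule z)
  finally show ?thesis using infsum_reindex_bij_betw[OF bij, of u] by simp
qed

lemma infsum_restrict:
  fixes c :: "nat \<Rightarrow> real"
  shows "infsum (\<lambda>i. (if Q i then c i else 0) * d i) UNIV = infsum (\<lambda>i. c i * d i) {i. Q i}"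
  by (rule infsum_cong_neutral) auto

lemma infsum_trichotomy:
  assumes \<Gamma>: "good \<Gamma>" and HG: "finite H" "H \<subseteq> \<Gamma>" "G \<subseteq> \<Gamma>" "0 < \<rho>"
    and sm: "(\<lambda>i::nat. \<bar>c i\<bar> * \<rho> ^ size (w i)) summable_on UNIV"
    and nz: "\<And>i. c i \<noteq> 0 \<Longrightarrow> h i \<in> H \<and> set_mset (w i) \<subseteq> G"
    and \<theta>: "\<theta> \<in> \<Gamma>" and x: "\<forall>g\<in>G. E g x \<le> \<rho>"
  shows "infsum (\<lambda>i. c i * E (h i + \<Sum>\<^sub># (w i)) x) UNIV =
    infsum (\<lambda>i. c i * E (h i + \<Sum>\<^sub># (w i)) x) {i. \<theta> < h i + \<Sum>\<^sub># (w i)} +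
    infsum c {i. h i + \<Sum>\<^sub># (w i) = \<theta>} * E \<theta> x +
    infsum (\<lambda>i. c i * E (h i + \<Sum>\<^sub># (w i)) x) {i. h i + \<Sum>\<^sub># (w i) < \<theta>}"
    (is "infsum ?u UNIV = infsum ?u ?A1 + infsum c ?A2 * _ + infsum ?u ?A3")
proof -
  have u: "?u summable_on UNIV" by (rule fam_bound_summable[OF sm HG(1,4) nz x])
  have sub: "?u summable_on A" for A by (rule summable_on_subset_banach[OF u]) simp
  have \<Gamma>e: "h i + \<Sum>\<^sub># (w i) \<in> \<Gamma>" if "c i \<noteq> 0" for i
    using nz[OF that] HG goodD(5)[OF \<Gamma>] sum_mset_good[OF \<Gamma>, of "w i"] by blast
  have "infsum ?u UNIV = infsum ?u (?A1 \<union> ?A2 \<union> ?A3)"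
  proof (rule infsum_cong_neutral)
    fix i assume "i \<in> UNIV - (?A1 \<union> ?A2 \<union> ?A3)"
    then have "c i = 0" using good_linear[OF \<Gamma> \<Gamma>e \<theta>, of i] by auto
    then show "?u i = 0" by simp
  qed auto
  also have "\<dots> = infsum ?u (?A1 \<union> ?A2) + infsum ?u ?A3"
    by (rule infsum_Un_disjoint) (use sub in \<open>auto dest: less_asym\<close>)
  also have "infsum ?u (?A1 \<union> ?A2) = infsum ?u ?A1 + infsum ?u ?A2"
    by (rule infsum_Un_disjoint) (use sub in auto)
  also have "infsum ?u ?A2 = infsum (\<lambda>i. c i * E \<theta> x) ?A2" by (rule infsum_cong) simp
  also have "\<dots> = infsum c ?A2 * E \<theta> x" by (rule infsum_cmult_left')
  finally show ?thesis .
qed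

text \<open>
  Among the exponents whose collected coefficient does not vanish, Dickson's lemma provides a
  largest one, \<open>\<theta>\<close>. The terms with larger exponents cancel, those with exponent
  \<open>\<theta>\<close> give the constant \<open>C\<close>, and the others are small relative to
  \<open>exp \<theta>\<close> by truncation.
\<close>
lemma leading:
  assumes \<Gamma>: "good \<Gamma>" and "a \<in> ser \<Gamma> P" "a \<noteq> 0"
  obtains \<theta> C r where "\<theta> \<in> \<Gamma>" "P \<theta>" "C \<noteq> 0" "germ_of r \<in> small \<Gamma>" "a = germ_of (\<lambda>x. E \<theta> x * (C + r x))"
proof -
  from assms(2) obtain f H G \<rho> N where a: "a = germ_of f" "finite H" "H \<subseteq> \<Gamma>" "finite G" "G \<subseteq> \<Gamma>" "\<And>g. g \<in> G \<Longrightarrow> g < 0" "0 < \<rho>"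
    "fam G {(h, w). h \<in> H \<and> set_mset w \<subseteq> G \<and> P (h + \<Sum>\<^sub># w)} \<rho> N f" by (rule serE) (rule that)
  from a(8) obtain c h w N' where f: "\<And>i. c i \<noteq> 0 \<Longrightarrow> (h i, w i) \<in> {(h, w). h \<in> H \<and> set_mset w \<subseteq> G \<and> P (h + \<Sum>\<^sub># w)}"
     "((\<lambda>i::nat. \<bar>c i\<bar> * \<rho> ^ size (w i)) has_sum N') UNIV"
     "\<And>x. (\<forall>g\<in>G. E g x \<le> \<rho>) \<Longrightarrow> ((\<lambda>i. c i * E (h i + \<Sum>\<^sub># (w i)) x) has_sum f x) UNIV"
    unfolding fam_def by blast
  have sm: "(\<lambda>i. \<bar>c i\<bar> * \<rho> ^ size (w i)) summable_on UNIV" using f(2) by (auto simp: summable_on_def)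
  have nz: "h i \<in> H \<and> set_mset (w i) \<subseteq> G" if "c i \<noteq> 0" for i using f(1)[OF that] by auto
  have ev: "\<forall>\<^sub>F x in at_top. \<forall>g\<in>G. E g x \<le> \<rho>"
    by (rule eventually_E_le[OF assms(1) a(4,5)]) (use a(6,7) in auto)
  define e where "e i = h i + \<Sum>\<^sub># (w i)" for i
  have e\<Gamma>: "e i \<in> \<Gamma>" if "c i \<noteq> 0" for i
    unfolding e_def using nz[OF that] a(3,5) goodD(5)[OF \<Gamma>] sum_mset_good[OF \<Gamma>, of "w i"] by blast
  define Cc where "Cc \<gamma> = infsum c {i. e i = \<gamma>}" for \<gamma>
  have usum: "(\<lambda>i. c i * E (e i) x) summable_on UNIV" if "\<forall>g\<in>G. E g x \<le> \<rho>" for x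
    unfolding e_def by (rule fam_bound_summable[OF sm a(2,7) nz that])
  have grp: "infsum (\<lambda>i. c i * E (e i) x) {i. e i = \<gamma>} = Cc \<gamma> * E \<gamma> x" for x \<gamma>
  proof -
    have "infsum (\<lambda>i. c i * E (e i) x) {i. e i = \<gamma>} = infsum (\<lambda>i. c i * E \<gamma> x) {i. e i = \<gamma>}"
      by (rule infsum_cong) simp
    also have "\<dots> = Cc \<gamma> * E \<gamma> x" unfolding Cc_def by (rule infsum_cmult_left')
    finally show ?thesis .
  qed
  define T where "T = {i. c i \<noteq> 0 \<and> Cc (e i) \<noteq> 0}"
  have "\<exists>F\<subseteq>T. finite F \<and> (\<forall>i\<in>T. \<exists>k\<in>F. h k = h i \<and> w k \<subseteq># w i)"
    by (rule dickson_mset[OF a(2,4)]) (use nz in \<open>auto simp: T_def\<close>)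
  then obtain F where F: "F \<subseteq> T" "finite F" "\<forall>i\<in>T. \<exists>k\<in>F. h k = h i \<and> w k \<subseteq># w i" by (elim exE conjE)
  have dom: "\<exists>k\<in>F. e i \<le> e k" if "i \<in> T" for i
  proof -
    from F(3) that obtain k where k: "k \<in> F" "h k = h i" "w k \<subseteq># w i" by blast
    then obtain u where u: "w i = w k + u" by (auto simp: mset_subset_eq_exists_conv)
    have "g < 0" if "g \<in># u" for g using nz[of i] \<open>i \<in> T\<close> a(6) that by (auto simp: T_def u)
    then have "\<Sum>\<^sub># u \<le> 0" using sum_mset_neg[of u] by (cases "u = {#}") (auto intro: less_imp_le)
    then have "e k + \<Sum>\<^sub># u \<le> e k + 0" by (rule add_left_mono)
    moreover have "e i = e k + \<Sum>\<^sub># u" by (simp add: e_def u k(2) add.assoc)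
    ultimately show ?thesis using k(1) by (intro bexI[of _ k]) simp_all
  qed
  have F0: "F \<noteq> {}"
  proof
    assume "F = {}"
    then have T0: "T = {}" using dom by blast
    have C0: "Cc (e i) = 0" for i
    proof (rule ccontr)
      assume ne: "Cc (e i) \<noteq> 0"
      have "c j = 0" if "e j = e i" for j
      proof (rule ccontr)
        assume "c j \<noteq> 0"
        then have "j \<in> T" using ne that by (simp add: T_def)
        then show False using T0 by simp
      qed
      then have "Cc (e i) = 0" unfolding Cc_def by (intro infsum_0) auto
      then show False using ne by simp
    qed
    have "f x = 0" if "\<forall>g\<in>G. E g x \<le> \<rho>" for x
    proof -
      have "infsum (\<lambda>i. c i * E (e i) x) {i. e i \<in> range e} = 0"
        by (rule infsum_grouped_zero[OF usum[OF that]]) (use grp C0 in auto)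
      then show ?thesis using infsumI[OF f(3)[OF that]] by (simp add: e_def)
    qed
    then have "germ_of f = germ_of (\<lambda>_. 0)" unfolding germ_of_eq_iff using ev by (auto elim: eventually_mono)
    then show False using assms(3) a(1) by (simp add: germ_of_zero)
  qed
  have "\<exists>m\<in>F. \<forall>k\<in>F. e k \<le> e m" using F(2) F0 F(1)
  proof (induction F rule: finite_ne_induct)
    case (insert k F)
    then obtain m where m: "m \<in> F" "\<forall>k\<in>F. e k \<le> e m" by auto
    have "e k \<in> \<Gamma>" "e m \<in> \<Gamma>" using insert m(1) e\<Gamma> by (auto simp: T_def)
    from good_linear[OF \<Gamma> this] consider "e k \<le> e m" | "e m \<le> e k" by (auto intro: less_imp_le)
    then show ?case
    proof cases
      case 1
      then show ?thesis using m by auto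
    next
      case 2
      then show ?thesis using m by (intro bexI[of _ k]) (auto intro: order_trans)
    qed
  qed auto
  then obtain m where m: "m \<in> F" "\<And>k. k \<in> F \<Longrightarrow> e k \<le> e m" by blast
  define \<theta> where "\<theta> = e m"
  have mT: "c m \<noteq> 0" "Cc \<theta> \<noteq> 0" using m(1) F(1) by (auto simp: T_def \<theta>_def)
  have \<theta>: "\<theta> \<in> \<Gamma>" "P \<theta>" using e\<Gamma>[OF mT(1)] f(1)[OF mT(1)] by (auto simp: \<theta>_def e_def)
  have top: "e i \<le> \<theta>" if "i \<in> T" for i using dom[OF that] m(2) by (auto simp: \<theta>_def intro: order_trans)
  have high: "Cc \<gamma> = 0" if "\<theta> < \<gamma>" for \<gamma>
  proof (rule ccontr)
    assume ne: "Cc \<gamma> \<noteq> 0"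
    have "c j = 0" if "e j = \<gamma>" for j
    proof (rule ccontr)
      assume "c j \<noteq> 0"
      then have "j \<in> T" using ne that by (simp add: T_def)
      from top[OF this] show False using \<open>\<theta> < \<gamma>\<close> that by (simp add: less_le_not_le)
    qed
    then have "Cc \<gamma> = 0" unfolding Cc_def by (intro infsum_0) auto
    then show False using ne by simp
  qed
  define d where "d i = (if e i < \<theta> then c i else 0)" for i
  have dsm: "(\<lambda>i. \<bar>d i\<bar> * \<rho> ^ size (w i)) summable_on UNIV"
    by (rule summable_on_comparison_test[OF sm]) (use a(7) in \<open>auto simp: d_def\<close>)
  obtain G' M r where r: "finite G'" "G \<subseteq> G'" "G' \<subseteq> \<Gamma>" "\<And>g. g \<in> G' \<Longrightarrow> g < 0"
    "fam G' {(h, w). h = 0 \<and> w \<noteq> {#} \<and> set_mset w \<subseteq> G'} \<rho> M r"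
    "\<And>x. E \<theta> x * r x = infsum (\<lambda>i. d i * E (h i + \<Sum>\<^sub># (w i)) x) UNIV"
    by (rule truncation[OF \<Gamma> a(2-7) dsm _ \<theta>(1)]) (use nz that in \<open>auto simp: d_def e_def split: if_splits\<close>)
  have "germ_of r \<in> small \<Gamma>" by (rule small_of_words[OF \<Gamma> r(1,3) _ a(7) r(5)]) (rule r(4))
  moreover have "germ_of f = germ_of (\<lambda>x. E \<theta> x * (Cc \<theta> + r x))" unfolding germ_of_eq_iff
    using ev
  proof eventually_elim
    case (elim x)
    have "f x = infsum (\<lambda>i. c i * E (e i) x) UNIV" using infsumI[OF f(3)[OF elim]] by (simp add: e_def)
    also have "\<dots> = infsum (\<lambda>i. c i * E (e i) x) {i. \<theta> < e i} + Cc \<theta> * E \<theta> x + infsum (\<lambda>i. c i * E (e i) x) {i. e i < \<theta>}"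
      unfolding Cc_def e_def by (rule infsum_trichotomy[OF \<Gamma> a(2,3,5,7) sm nz \<theta>(1) elim])
    also have "infsum (\<lambda>i. c i * E (e i) x) {i. \<theta> < e i} = 0"
      using infsum_grouped_zero[OF usum[OF elim], of "{\<gamma>. \<theta> < \<gamma>}" e] grp high by simp
    also have "infsum (\<lambda>i. c i * E (e i) x) {i. e i < \<theta>} = E \<theta> x * r x"
      unfolding r(6) d_def using infsum_restrict[of "\<lambda>i. e i < \<theta>" c] by (simp add: e_def)
    finally show ?case by (simp add: algebra_simps)
  qed
  ultimately show ?thesis using that[OF \<theta> mT(2)] a(1) by simp
qed

lemma decomp:
  assumes \<Gamma>: "good \<Gamma>" and "a \<in> ser \<Gamma> (\<lambda>_. True)"
  obtains j C r where "j \<in> ser \<Gamma> (\<lambda>e. 0 < e)" "r \<in> small \<Gamma>" "a = j + germ_of (\<lambda>_. C) + r"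
proof -
  from assms(2) obtain f H G \<rho> N where a: "a = germ_of f" "finite H" "H \<subseteq> \<Gamma>" "finite G" "G \<subseteq> \<Gamma>" "\<And>g. g \<in> G \<Longrightarrow> g < 0" "0 < \<rho>"
    "fam G {(h, w). h \<in> H \<and> set_mset w \<subseteq> G \<and> True} \<rho> N f" by (rule serE) (rule that)
  from a(8) obtain c h w N' where f: "\<And>i. c i \<noteq> 0 \<Longrightarrow> (h i, w i) \<in> {(h, w). h \<in> H \<and> set_mset w \<subseteq> G \<and> True}"
     "((\<lambda>i::nat. \<bar>c i\<bar> * \<rho> ^ size (w i)) has_sum N') UNIV"
     "\<And>x. (\<forall>g\<in>G. E g x \<le> \<rho>) \<Longrightarrow> ((\<lambda>i. c i * E (h i + \<Sum>\<^sub># (w i)) x) has_sum f x) UNIV"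
    unfolding fam_def by blast
  have sm: "(\<lambda>i. \<bar>c i\<bar> * \<rho> ^ size (w i)) summable_on UNIV" using f(2) by (auto simp: summable_on_def)
  have nz: "h i \<in> H \<and> set_mset (w i) \<subseteq> G" if "c i \<noteq> 0" for i using f(1)[OF that] by auto
  have ev: "\<forall>\<^sub>F x in at_top. \<forall>g\<in>G. E g x \<le> \<rho>"
    by (rule eventually_E_le[OF assms(1) a(4,5)]) (use a(6,7) in auto)
  define e where "e i = h i + \<Sum>\<^sub># (w i)" for i
  have part: "germ_of (\<lambda>x. infsum (\<lambda>i. c i * E (e i) x) {i. P (e i)}) \<in> ser \<Gamma> P" for P
  proof (rule serI[OF a(2-7)])
    define d where "d i = (if P (e i) then c i else 0)" for i
    have dsm: "(\<lambda>i. \<bar>d i\<bar> * \<rho> ^ size (w i)) summable_on UNIV"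
      by (rule summable_on_comparison_test[OF sm]) (use a(7) in \<open>auto simp: d_def\<close>)
    show "fam G {(h, w). h \<in> H \<and> set_mset w \<subseteq> G \<and> P (h + \<Sum>\<^sub># w)} \<rho> (infsum (\<lambda>i. \<bar>d i\<bar> * \<rho> ^ size (w i)) UNIV)
      (\<lambda>x. infsum (\<lambda>i. c i * E (e i) x) {i. P (e i)})" unfolding fam_def
    proof (intro exI conjI allI impI)
      show "(h i, w i) \<in> {(h, w). h \<in> H \<and> set_mset w \<subseteq> G \<and> P (h + \<Sum>\<^sub># w)}" if "d i \<noteq> 0" for i
        using nz[of i] that by (auto simp: d_def e_def split: if_splits)
      show "((\<lambda>i. \<bar>d i\<bar> * \<rho> ^ size (w i)) has_sum infsum (\<lambda>i. \<bar>d i\<bar> * \<rho> ^ size (w i)) UNIV) UNIV"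
        by (rule has_sum_infsum[OF dsm])
      fix x assume x: "\<forall>g\<in>G. E g x \<le> \<rho>"
      have "(\<lambda>i. d i * E (h i + \<Sum>\<^sub># (w i)) x) summable_on UNIV"
        by (rule fam_bound_summable[OF dsm a(2,7) _ x]) (use nz in \<open>auto simp: d_def split: if_splits\<close>)
      from has_sum_infsum[OF this]
      show "((\<lambda>i. d i * E (h i + \<Sum>\<^sub># (w i)) x) has_sum infsum (\<lambda>i. c i * E (e i) x) {i. P (e i)}) UNIV"
        unfolding d_def infsum_restrict by (simp add: e_def)
    qed simp
  qed
  have "germ_of f = germ_of (\<lambda>x. infsum (\<lambda>i. c i * E (e i) x) {i. 0 < e i}) + germ_of (\<lambda>_. infsum c {i. e i = 0}) +
      germ_of (\<lambda>x. infsum (\<lambda>i. c i * E (e i) x) {i. e i < 0})" unfolding germ_of_simps germ_of_eq_iff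
    using ev
  proof eventually_elim
    case (elim x)
    have "f x = infsum (\<lambda>i. c i * E (e i) x) UNIV" using infsumI[OF f(3)[OF elim]] by (simp add: e_def)
    then show ?case using infsum_trichotomy[OF \<Gamma> a(2,3,5,7) sm nz goodD(1)[OF \<Gamma>] elim] by (simp add: e_def)
  qed
  with that[OF part part] a(1) show ?thesis by simp
qed

section \<open>Power series of small series, inverses and exponentials\<close>

text \<open>
  Since all words are nonempty, the majorizing sum can be made as small as desired.
\<close>
lemma fam_shrink:
  assumes "fam G A \<rho> N f" "\<And>h w. (h, w) \<in> A \<Longrightarrow> w \<noteq> {#}" "0 < \<rho>" "0 < t" "t \<le> 1"
  shows "fam G A (t * \<rho>) (t * N) f"
proof -
  from assms(1) obtain c h w N' where f: "\<And>i. c i \<noteq> 0 \<Longrightarrow> (h i, w i) \<in> A" "N' \<le> N"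
     "((\<lambda>i::nat. \<bar>c i\<bar> * \<rho> ^ size (w i)) has_sum N') UNIV"
     "\<And>x. (\<forall>g\<in>G. E g x \<le> \<rho>) \<Longrightarrow> ((\<lambda>i. c i * E (h i + \<Sum>\<^sub># (w i)) x) has_sum f x) UNIV"
    unfolding fam_def by blast
  have le: "\<bar>c i\<bar> * (t * \<rho>) ^ size (w i) \<le> t * (\<bar>c i\<bar> * \<rho> ^ size (w i))" for i
  proof (cases "c i = 0")
    case False
    then have "w i \<noteq> {#}" using f(1) assms(2) by blast
    then obtain n where n: "size (w i) = Suc n" by (cases "size (w i)") auto
    have "t ^ n * \<rho> ^ Suc n \<le> 1 * \<rho> ^ Suc n"
      by (rule mult_right_mono) (use assms in \<open>auto intro: power_le_one\<close>)
    then have "(\<bar>c i\<bar> * t) * (t ^ n * \<rho> ^ Suc n) \<le> (\<bar>c i\<bar> * t) * (1 * \<rho> ^ Suc n)"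
      using assms by (intro mult_left_mono) auto
    then show ?thesis by (simp add: n power_mult_distrib mult_ac)
  qed simp
  have sm: "(\<lambda>i. t * (\<bar>c i\<bar> * \<rho> ^ size (w i))) summable_on UNIV"
    by (rule summable_on_cmult_right) (use f(3) in \<open>auto simp: summable_on_def\<close>)
  have sm': "(\<lambda>i. \<bar>c i\<bar> * (t * \<rho>) ^ size (w i)) summable_on UNIV"
    by (rule summable_on_comparison_test[OF sm le]) (use assms in auto)
  show ?thesis unfolding fam_def
  proof (intro exI conjI allI impI)
    show "(h i, w i) \<in> A" if "c i \<noteq> 0" for i using f(1)[OF that] .
    show "((\<lambda>i. \<bar>c i\<bar> * (t * \<rho>) ^ size (w i)) has_sum infsum (\<lambda>i. \<bar>c i\<bar> * (t * \<rho>) ^ size (w i)) UNIV) UNIV"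
      by (rule has_sum_infsum[OF sm'])
    have "infsum (\<lambda>i. \<bar>c i\<bar> * (t * \<rho>) ^ size (w i)) UNIV \<le> t * N'"
      using infsum_mono[OF sm' sm le] infsumI[OF has_sum_cmult_right[OF f(3), of t]] by simp
    also have "\<dots> \<le> t * N" using f(2) assms(4) by simp
    finally show "infsum (\<lambda>i. \<bar>c i\<bar> * (t * \<rho>) ^ size (w i)) UNIV \<le> t * N" .
    have "t * \<rho> \<le> 1 * \<rho>" using assms by (intro mult_right_mono) auto
    then show "((\<lambda>i. c i * E (h i + \<Sum>\<^sub># (w i)) x) has_sum f x) UNIV" if "\<forall>g\<in>G. E g x \<le> t * \<rho>" for x
      by (intro f(4)) (use that in \<open>auto intro: order_trans\<close>)
  qed
qed

text \<open>
  A power series without constant term may be applied to a small series: after shrinking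
  \<open>\<rho>\<close>, the majorizing sum of the small series is inside the radius of convergence,
  so the family of all products of its terms converges absolutely.
\<close>
lemma small_compose:
  assumes \<Gamma>: "good \<Gamma>" and small: "germ_of r \<in> small \<Gamma>" and a0: "a 0 = 0" and s: "0 < s"
    and sm: "summable (\<lambda>k. \<bar>a k\<bar> * s ^ k)" and F: "\<And>z. \<bar>z\<bar> < s \<Longrightarrow> (\<lambda>k. a k * z ^ k) sums F z"
  shows "germ_of (\<lambda>x. F (r x)) \<in> small \<Gamma>"
proof -
  from \<Gamma> small obtain r' G \<rho> N where r: "germ_of r = germ_of r'" "finite G" "G \<subseteq> \<Gamma>" "\<And>g. g \<in> G \<Longrightarrow> g < 0" "0 < \<rho>"
    "fam G {(h, w). h = 0 \<and> w \<noteq> {#} \<and> set_mset w \<subseteq> G} \<rho> N r'" by (rule small_words) (rule that)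
  define A where "A = {(h::germ, w). h = 0 \<and> w \<noteq> {#} \<and> set_mset w \<subseteq> G}"
  \<comment> \<open>With \<open>t * N \<le> s\<close>, the majorizing sum lies within the radius of convergence.\<close>
  define t where "t = min 1 (s / (\<bar>N\<bar> + 1))"
  have t: "0 < t" "t \<le> 1" using s by (auto simp: t_def)
  have "t * N \<le> t * (\<bar>N\<bar> + 1)" using t by (intro mult_left_mono) auto
  also have "\<dots> \<le> s / (\<bar>N\<bar> + 1) * (\<bar>N\<bar> + 1)" by (intro mult_right_mono) (auto simp: t_def)
  finally have tN: "t * N \<le> s" by simp
  have "fam G A (t * \<rho>) (t * N) r'"
    by (rule fam_shrink) (use r(5,6) t in \<open>auto simp: A_def\<close>)
  then have fr: "fam G A (t * \<rho>) s r'" by (rule fam_mono) (use tN t r(5) in auto)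
  have pos: "0 < t * \<rho>" using t r(5) by simp
  have pw: "fam G A (t * \<rho>) (s ^ Suc k) (\<lambda>x. r' x ^ Suc k)" for k
  proof (induction k)
    case (Suc k)
    have "fam G A (t * \<rho>) (s * s ^ Suc k) (\<lambda>x. r' x * r' x ^ Suc k)"
      by (rule fam_mult[OF fr Suc]) (use pos in \<open>auto simp: A_def\<close>)
    then show ?case by simp
  qed (use fr in simp)
  have tm: "fam G A (t * \<rho>) (\<bar>a k\<bar> * s ^ k) (\<lambda>x. a k * r' x ^ k)" for k
  proof (cases k)
    case 0
    then show ?thesis using fam_zero[of 0 G A "t * \<rho>"] a0 by simp
  next
    case (Suc n)
    have "fam G {(0, {#})} (t * \<rho>) (\<bar>a k\<bar> * (t * \<rho>) ^ size {#}) (\<lambda>x. a k * E (0 + \<Sum>\<^sub># {#}) x)"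
      using fam_single[of 0 "{#}" "{(0, {#})}" G "t * \<rho>" "a k"] by simp
    from fam_mult[OF this pw[of n] _ pos, of A]
    show ?thesis unfolding Suc by (simp add: A_def)
  qed
  have sm': "(\<lambda>k. \<bar>a k\<bar> * s ^ k) summable_on UNIV"
    by (subst summable_on_UNIV_nonneg_real_iff) (use s sm in auto)
  have "fst ` A \<subseteq> {0}" by (auto simp: A_def)
  then have fin: "finite (fst ` A)" by (rule finite_subset) simp
  have F': "fam G A (t * \<rho>) (infsum (\<lambda>k. \<bar>a k\<bar> * s ^ k) UNIV) (\<lambda>x. infsum (\<lambda>k. a k * r' x ^ k) UNIV)"
    by (rule fam_suminf[OF tm sm' fin _ pos]) (auto simp: A_def)
  have "germ_of (\<lambda>x. infsum (\<lambda>k. a k * r' x ^ k) UNIV) \<in> small \<Gamma>"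
    by (rule small_of_words[OF \<Gamma> r(2,3) _ pos F'[unfolded A_def]]) (rule r(4))
  moreover have "germ_of (\<lambda>x. F (r x)) = germ_of (\<lambda>x. infsum (\<lambda>k. a k * r' x ^ k) UNIV)"
    unfolding germ_of_eq_iff
  proof -
    have "\<forall>\<^sub>F x in at_top. dist (r x) 0 < s"
      using small_tendsto_0[OF \<Gamma> small] s by (rule tendstoD)
    moreover have "\<forall>\<^sub>F x in at_top. r x = r' x" using r(1) by (simp add: germ_of_eq_iff)
    ultimately show "\<forall>\<^sub>F x in at_top. F (r x) = infsum (\<lambda>k. a k * r' x ^ k) UNIV"
    proof eventually_elim
      case (elim x)
      then have z: "\<bar>r' x\<bar> < s" by simp
      have "summable (\<lambda>k. norm (a k * r' x ^ k))"
        by (rule summable_comparison_test'[OF sm, of 0])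
          (use z in \<open>auto simp: abs_mult power_abs intro!: mult_left_mono power_mono\<close>)
      from infsumI[OF norm_summable_imp_has_sum[OF this F[OF z]]] show ?case using elim by simp
    qed
  qed
  ultimately show ?thesis by simp
qed

lemma small_exp: assumes "good \<Gamma>" "germ_of r \<in> small \<Gamma>" shows "germ_of (\<lambda>x. exp (r x) - 1) \<in> small \<Gamma>"
proof (rule small_compose[where F = "\<lambda>z. exp z - 1" and s = 1 and a = "\<lambda>k. if k = 0 then 0 else inverse (fact k)", OF assms])
  have "summable (\<lambda>k. inverse (fact k) * 1 ^ k :: real)" by (rule summable_exp)
  then show "summable (\<lambda>k. \<bar>if k = 0 then 0 else inverse (fact k :: real)\<bar> * 1 ^ k)"
    by (rule summable_comparison_test'[of _ 0]) auto
  fix z :: real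
  have "(\<lambda>k. z ^ k /\<^sub>R fact k - (if k = 0 then 1 else 0)) sums (exp z - 1)"
    by (rule sums_diff[OF exp_converges]) (rule sums_single)
  moreover have "z ^ k /\<^sub>R fact k - (if k = 0 then 1 else 0) = (if k = 0 then 0 else inverse (fact k)) * z ^ k" for k
    by simp
  ultimately show "(\<lambda>k. (if k = 0 then 0 else inverse (fact k)) * z ^ k) sums (exp z - 1)" by simp
qed auto

lemma small_inverse: assumes "good \<Gamma>" "germ_of r \<in> small \<Gamma>" shows "germ_of (\<lambda>x. inverse (1 + r x) - 1) \<in> small \<Gamma>"
proof (rule small_compose[where F = "\<lambda>z. inverse (1 + z) - 1" and s = "1/2" and a = "\<lambda>k. if k = 0 then 0 else (-1) ^ k", OF assms])
  have "summable (\<lambda>k. (1/2 :: real) ^ k)" by (rule summable_geometric) simp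
  then show "summable (\<lambda>k. \<bar>if k = 0 then 0 else (- 1 :: real) ^ k\<bar> * (1 / 2) ^ k)"
    by (rule summable_comparison_test'[of _ 0]) (auto simp: power_abs)
  fix z :: real assume z: "\<bar>z\<bar> < 1/2"
  have "(\<lambda>k. (- z) ^ k - (if k = 0 then 1 else 0)) sums (1 / (1 - (- z)) - 1)"
    by (rule sums_diff[OF geometric_sums]) (use z in \<open>auto intro: sums_single\<close>)
  moreover have "(- z) ^ k - (if k = 0 then 1 else 0) = (if k = 0 then 0 else (- 1) ^ k) * z ^ k" for k
    by (simp add: power_minus[of z])
  ultimately show "(\<lambda>k. (if k = 0 then 0 else (- 1) ^ k) * z ^ k) sums (inverse (1 + z) - 1)"
    by (simp add: inverse_eq_divide)
qed auto

lemma small_ln: assumes "good \<Gamma>" "germ_of r \<in> small \<Gamma>" shows "germ_of (\<lambda>x. ln (1 + r x)) \<in> small \<Gamma>"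
proof (rule small_compose[where F = "\<lambda>z. ln (1 + z)" and s = "1/2" and a = "\<lambda>k. - ((-1) ^ k) / of_nat k", OF assms])
  have "summable (\<lambda>k. (1/2 :: real) ^ k)" by (rule summable_geometric) simp
  then show "summable (\<lambda>k. \<bar>- ((- 1 :: real) ^ k) / of_nat k\<bar> * (1 / 2) ^ k)"
  proof (rule summable_comparison_test'[of _ 0])
    fix k :: nat
    have "\<bar>1 / real k\<bar> \<le> 1" by (cases "k = 0") auto
    then have "\<bar>1 / real k\<bar> * (1 / 2) ^ k \<le> 1 * (1 / 2) ^ k" by (rule mult_right_mono) simp
    then show "norm (\<bar>- ((- 1) ^ k) / real k\<bar> * (1 / 2) ^ k) \<le> (1 / 2) ^ k"
      by (simp add: abs_mult power_abs)
  qed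
  fix z :: real assume "\<bar>z\<bar> < 1/2"
  then have "(\<lambda>n. - ((- z) ^ n) / of_nat n) sums ln (1 + z)" by (intro ln_series') simp
  moreover have "(\<lambda>n. - ((- z) ^ n) / of_nat n) = (\<lambda>n. - ((- 1) ^ n) / of_nat n * z ^ n)"
    by (rule ext) (simp add: power_minus[of z])
  ultimately show "(\<lambda>k. - ((- 1) ^ k) / of_nat k * z ^ k) sums ln (1 + z)" by (simp only:)
qed auto

abbreviation full :: "germ set \<Rightarrow> germ set" where
  "full \<Gamma> \<equiv> ser \<Gamma> (\<lambda>_. True)"

lemma ser_full: "ser \<Gamma> P \<subseteq> full \<Gamma>"
  by (rule ser_mono) auto

lemma ser_scale: assumes "good \<Gamma>" "a \<in> ser \<Gamma> P" shows "r *\<^sub>R a \<in> ser \<Gamma> P"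
proof -
  have "germ_of (\<lambda>x. r * E 0 x) \<in> ser \<Gamma> (\<lambda>e. e = 0)" by (rule ser_monomial) (auto simp: goodD(1)[OF assms(1)])
  from ser_mult[OF this assms(2,1), of P] have "germ_of (\<lambda>x. r) * a \<in> ser \<Gamma> P" by simp
  then show ?thesis using germ_of_simps(3)[of "\<lambda>_. r" "rep_germ a"] germ_of_simps(5)[of r "rep_germ a"] by (simp add: germ_of_rep)
qed

lemma ser_uminus: assumes "good \<Gamma>" "a \<in> ser \<Gamma> P" shows "- a \<in> ser \<Gamma> P"
  using ser_scale[OF assms, of "- 1"] by simp

lemma ser_diff: assumes "good \<Gamma>" "a \<in> ser \<Gamma> P" "b \<in> ser \<Gamma> P" shows "a - b \<in> ser \<Gamma> P"
  using ser_add[OF assms(2) ser_uminus[OF assms(1,3)]] by simp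

lemma ser_zero: "0 \<in> ser \<Gamma> P"
  unfolding germ_of_zero by (rule serI[of "{}" _ "{}" 1 _ 0]) (auto intro: fam_zero)

lemma full_const: assumes "good \<Gamma>" shows "germ_of (\<lambda>_. r) \<in> full \<Gamma>"
  using ser_monomial[OF goodD(1)[OF assms], of "\<lambda>_. True" r] by simp

lemma full_mult: "good \<Gamma> \<Longrightarrow> a \<in> full \<Gamma> \<Longrightarrow> b \<in> full \<Gamma> \<Longrightarrow> a * b \<in> full \<Gamma>"
  by (rule ser_mult) auto

lift_definition germ_inverse :: "germ \<Rightarrow> germ" is "\<lambda>f x. inverse (f x)" by (erule eventually_mono) simp
lift_definition germ_exp :: "germ \<Rightarrow> germ" is "\<lambda>f x. exp (f x)" by (erule eventually_mono) simp
lift_definition germ_ln :: "germ \<Rightarrow> germ" is "\<lambda>f x. ln (f x)" by (erule eventually_mono) simp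

lemmas germ_of_fun_simps = germ_inverse.abs_eq germ_exp.abs_eq germ_ln.abs_eq

lemma germ_of_E: "germ_of (E \<theta>) = germ_exp \<theta>"
proof -
  have "germ_of (E \<theta>) = germ_exp (germ_of (section_of \<theta>))" unfolding germ_of_fun_simps by (simp add: E_def[abs_def])
  then show ?thesis by (simp only: germ_of_section)
qed

lemma eventually_sgn_leading:
  assumes "good \<Gamma>" "germ_of r \<in> small \<Gamma>" "C \<noteq> 0"
  shows "\<forall>\<^sub>F x in at_top. \<bar>C\<bar> / 2 < sgn C * (C + r x) \<and> sgn C * (C + r x) < 2 * \<bar>C\<bar>"
proof -
  have "\<forall>\<^sub>F x in at_top. dist (r x) 0 < \<bar>C\<bar> / 2"
    using small_tendsto_0[OF assms(1,2)] by (rule tendstoD) (use assms(3) in simp)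
  then show ?thesis
  proof eventually_elim
    case (elim x)
    then show ?case by (cases "0 < C") (auto simp: sgn_if abs_if split: if_splits)
  qed
qed

text \<open>
  Factor out the leading term and apply the geometric series.
\<close>
lemma full_inverse:
  assumes \<Gamma>: "good \<Gamma>" and "a \<in> full \<Gamma>" "a \<noteq> 0"
  shows "germ_inverse a \<in> full \<Gamma>" "a * germ_inverse a = 1"
proof -
  from \<Gamma> assms(2,3) obtain \<theta> C r where a: "\<theta> \<in> \<Gamma>" "C \<noteq> 0" "germ_of r \<in> small \<Gamma>" "a = germ_of (\<lambda>x. E \<theta> x * (C + r x))"
    by (rule leading)
  have "inverse C *\<^sub>R germ_of r \<in> small \<Gamma>" by (rule ser_scale[OF \<Gamma> a(3)])
  then have "germ_of (\<lambda>x. inverse C * r x) \<in> small \<Gamma>" by (simp add: germ_of_simps)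
  from small_inverse[OF \<Gamma> this] have sm: "germ_of (\<lambda>x. inverse (1 + inverse C * r x) - 1) \<in> full \<Gamma>"
    using ser_full by blast
  have "germ_of (\<lambda>x. inverse C * E (- \<theta>) x) * (germ_of (\<lambda>_. 1) + germ_of (\<lambda>x. inverse (1 + inverse C * r x) - 1)) \<in> full \<Gamma>"
    by (intro full_mult[OF \<Gamma>] ser_add sm full_const[OF \<Gamma>] ser_monomial goodD(4)[OF \<Gamma>] a(1)) simp
  moreover have "inverse (E \<theta> x * (C + r x)) = inverse C * E (- \<theta>) x * (1 + (inverse (1 + inverse C * r x) - 1))" for x
  proof -
    have "C + r x = C * (1 + inverse C * r x)" using a(2) by (simp add: algebra_simps)
    then show ?thesis by (simp add: E_minus)
  qed
  ultimately show "germ_inverse a \<in> full \<Gamma>" by (simp add: a(4) germ_of_fun_simps germ_of_simps)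
  show "a * germ_inverse a = 1" unfolding a(4) germ_of_fun_simps germ_of_simps germ_of_one germ_of_eq_iff
    using eventually_sgn_leading[OF \<Gamma> a(3,2)]
  proof eventually_elim
    case (elim x)
    then have "C + r x \<noteq> 0" using a(2) by auto
    moreover have "E \<theta> x \<noteq> 0" using E_pos[of \<theta> x] by linarith
    ultimately show ?case by (intro right_inverse) simp
  qed
qed

lemma full_cases:
  assumes \<Gamma>: "good \<Gamma>" and "a \<in> full \<Gamma>" "a \<noteq> 0"
  obtains \<theta> C r where "\<theta> \<in> \<Gamma>" "0 < C" "germ_of r \<in> small \<Gamma>" "0 < a" "a = germ_of (\<lambda>x. E \<theta> x * (C + r x))"
    "\<forall>\<^sub>F x in at_top. C / 2 < C + r x" "\<forall>\<^sub>F x in at_top. C + r x < 2 * C"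
  | "a < 0"
proof -
  from \<Gamma> assms(2,3) obtain \<theta> C r where a: "\<theta> \<in> \<Gamma>" "C \<noteq> 0" "germ_of r \<in> small \<Gamma>" "a = germ_of (\<lambda>x. E \<theta> x * (C + r x))"
    by (rule leading)
  note ev = eventually_sgn_leading[OF \<Gamma> a(3,2)]
  show ?thesis
  proof (cases "0 < C")
    case True
    have ev1: "\<forall>\<^sub>F x in at_top. C / 2 < C + r x" "\<forall>\<^sub>F x in at_top. C + r x < 2 * C"
      using ev True by (auto elim: eventually_mono)
    then have "0 < a" unfolding a(4) germ_of_zero germ_of_less_iff
      using True by (auto elim!: eventually_mono intro!: mult_pos_pos)
    then show ?thesis using that(1)[OF a(1) True a(3) _ a(4) ev1] by blast
  next
    case False
    then have C: "C < 0" using a(2) by simp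
    have "a < 0" unfolding a(4) germ_of_zero germ_of_less_iff
      using ev
    proof eventually_elim
      case (elim x)
      then have "C + r x < 0" using C by (simp add: sgn_if abs_if)
      then show ?case by (simp add: mult_pos_neg)
    qed
    then show ?thesis by (rule that(2))
  qed
qed

lemma full_linear:
  assumes "good \<Gamma>" "a \<in> full \<Gamma>" "b \<in> full \<Gamma>" shows "a < b \<or> a = b \<or> b < a"
proof (cases "a - b = 0")
  case False
  from assms(1) ser_diff[OF assms] this have "0 < a - b \<or> a - b < 0" by (rule full_cases) auto
  then show ?thesis by auto
qed simp

text \<open>
  The exponential of the purely infinite part is a monomial if that part is an exponent, and the
  exponential of the small part is given by the exponential series.
\<close>
lemma full_exp:
  assumes \<Gamma>: "good \<Gamma>" "ser \<Gamma> (\<lambda>e. 0 < e) \<subseteq> \<Gamma>" and "a \<in> full \<Gamma>"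
  shows "germ_exp a \<in> full \<Gamma>"
proof -
  from decomp[OF \<Gamma>(1) assms(3)] obtain j C r where
    a: "j \<in> ser \<Gamma> (\<lambda>e. 0 < e)" "r \<in> small \<Gamma>" "a = j + germ_of (\<lambda>_. C) + r" .
  define s where "s = rep_germ r"
  have s: "germ_of s = r" unfolding s_def by (rule germ_of_rep)
  have j: "j \<in> \<Gamma>" using a(1) \<Gamma>(2) by blast
  have "germ_of (\<lambda>x. exp (s x) - 1) \<in> full \<Gamma>"
    using small_exp[OF \<Gamma>(1), of s] a(2) s ser_full by auto
  then have "germ_of (\<lambda>x. exp C * E j x) * (germ_of (\<lambda>_. 1) + germ_of (\<lambda>x. exp (s x) - 1)) \<in> full \<Gamma>"
    by (intro full_mult[OF \<Gamma>(1)] ser_add full_const[OF \<Gamma>(1)] ser_monomial j) simp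
  moreover have "germ_exp a = germ_exp (germ_of (section_of j) + germ_of (\<lambda>_. C) + germ_of s)"
    by (simp add: a(3) s germ_of_section)
  ultimately show ?thesis by (simp add: germ_of_simps germ_of_fun_simps exp_add E_def mult_ac)
qed

section \<open>The field of series over the tower of exponent groups\<close>

lemma scaleR_germ_pos: "0 < r \<Longrightarrow> 0 < a \<Longrightarrow> 0 < r *\<^sub>R (a::germ)"
  by transfer (auto elim!: eventually_mono)

text \<open>
  The element \<open>ln (ln x)\<close> remains the smallest positive exponent after purely infinite
  series have been added: these are at least a multiple of \<open>ln x\<close>.
\<close>
lemma lnln_less_ln:
  assumes "0 < c" shows "K *\<^sub>R lnln < germ_of (\<lambda>x. c * ln x)"
proof -
  have "((\<lambda>x::real. ln (ln x) / ln x) \<longlongrightarrow> 0) at_top"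
    by (rule filterlim_compose[OF ln_x_over_x_tendsto_0 ln_at_top])
  then have "\<forall>\<^sub>F x::real in at_top. dist (ln (ln x) / ln x) 0 < c / (\<bar>K\<bar> + 1)"
    by (rule tendstoD) (use assms in simp)
  then show ?thesis unfolding lnln_def germ_of_simps germ_of_less_iff
    using eventually_gt_at_top[of 1]
  proof eventually_elim
    case (elim x)
    then have l: "0 < ln x" by simp
    then have "\<bar>ln (ln x)\<bar> / ln x < c / (\<bar>K\<bar> + 1)" using elim(1) by simp
    then have "\<bar>ln (ln x)\<bar> * (\<bar>K\<bar> + 1) < c * ln x" using l by (simp add: field_simps)
    moreover have "K * ln (ln x) \<le> \<bar>ln (ln x)\<bar> * (\<bar>K\<bar> + 1)"
    proof -
      have "K * ln (ln x) \<le> \<bar>K * ln (ln x)\<bar>" by simp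
      also have "\<dots> = \<bar>ln (ln x)\<bar> * \<bar>K\<bar>" by (simp add: abs_mult)
      also have "\<dots> \<le> \<bar>ln (ln x)\<bar> * (\<bar>K\<bar> + 1)" by (rule mult_left_mono) auto
      finally show ?thesis .
    qed
    ultimately show ?case by linarith
  qed
qed

lemma leading_large:
  assumes \<Gamma>: "good \<Gamma>" "\<theta> \<in> \<Gamma>" "0 < \<theta>" "C \<noteq> 0" "germ_of r \<in> small \<Gamma>" "a = germ_of (\<lambda>x. E \<theta> x * (C + r x))" "0 < a"
  shows "\<exists>c>0. germ_of (\<lambda>x. c * ln x) < a"
proof (intro exI conjI)
  show "0 < \<bar>C\<bar> / 2" using assms(4) by simp
  have pos: "\<forall>\<^sub>F x in at_top. 0 < E \<theta> x * (C + r x)" using assms(6,7) by (simp add: germ_of_zero germ_of_less_iff)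
  show "germ_of (\<lambda>x. \<bar>C\<bar> / 2 * ln x) < a" unfolding assms(6) germ_of_less_iff
    using pos eventually_sgn_leading[OF \<Gamma>(1) assms(5,4)] E_ge_ln[OF good_pos[OF \<Gamma>(1-3)]] eventually_gt_at_top[of 1]
  proof eventually_elim
    case (elim x)
    have "0 < C + r x" by (rule zero_less_mult_pos[OF elim(1) E_pos])
    moreover have "0 < sgn C * (C + r x)" using elim(2) assms(4) by (auto intro: less_trans[rotated])
    ultimately have "sgn C = 1" by (auto simp: sgn_if split: if_splits)
    then have "\<bar>C\<bar> / 2 < C + r x" using elim(2) by simp
    have "\<bar>C\<bar> / 2 * ln x < (C + r x) * ln x" by (rule mult_strict_right_mono) (use \<open>\<bar>C\<bar> / 2 < _\<close> elim(4) in auto)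
    also have "\<dots> \<le> (C + r x) * E \<theta> x" by (rule mult_left_mono) (use \<open>0 < C + r x\<close> elim(3) in auto)
    finally show ?case by (simp add: mult.commute)
  qed
qed

lemma purely_infinite_large:
  assumes "good \<Gamma>" "j \<in> ser \<Gamma> (\<lambda>e. 0 < e)" "0 < j"
  shows "K *\<^sub>R lnln < j"
proof -
  have "j \<noteq> 0" using assms(3) by auto
  from leading[OF assms(1,2) this] obtain \<theta> C r where a: "\<theta> \<in> \<Gamma>" "0 < \<theta>" "C \<noteq> 0" "germ_of r \<in> small \<Gamma>" "j = germ_of (\<lambda>x. E \<theta> x * (C + r x))" .
  from leading_large[OF assms(1) a assms(3)] obtain c where "0 < c" "germ_of (\<lambda>x. c * ln x) < j" by blast
  then show ?thesis using lnln_less_ln less_trans by blast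
qed

text \<open>
  One step in the construction of the exponents. The purely infinite series over
  \<open>\<Gamma>\<close> become exponents, so their exponentials exist over the new group.
\<close>
definition extend :: "germ set \<Rightarrow> germ set" where
  "extend \<Gamma> = {real_of_int k *\<^sub>R lnln + j |k j. j \<in> ser \<Gamma> (\<lambda>e. 0 < e)}"

lemma extendI: "j \<in> ser \<Gamma> (\<lambda>e. 0 < e) \<Longrightarrow> real_of_int k *\<^sub>R lnln + j \<in> extend \<Gamma>"
  unfolding extend_def by blast

lemma extendE:
  assumes "a \<in> extend \<Gamma>"
  obtains k :: int and j where "a = real_of_int k *\<^sub>R lnln + j" "j \<in> ser \<Gamma> (\<lambda>e. 0 < e)"
  using assms unfolding extend_def by blast

lemma int_multiple_lnln: "k = 0 \<or> lnln \<le> real_of_int k *\<^sub>R lnln \<or> lnln \<le> - (real_of_int k *\<^sub>R lnln)"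
proof -
  have pos: "lnln \<le> real_of_int k *\<^sub>R lnln" if "0 < k" for k
  proof (cases "k = 1")
    case False
    then have "0 < (real_of_int k - 1) *\<^sub>R lnln" using that lnln_pos by (intro scaleR_germ_pos) auto
    then show ?thesis by (simp add: scaleR_diff_left)
  qed simp
  show ?thesis
  proof (cases "0 < k")
    case False
    then show ?thesis using pos[of "- k"] by auto
  qed (use pos in blast)
qed

lemma good_extend: assumes "good \<Gamma>" shows "good (extend \<Gamma>)"
  unfolding good_def
proof (intro conjI ballI)
  show "0 \<in> extend \<Gamma>" using extendI[OF ser_zero, of 0 \<Gamma>] by simp
  show "lnln \<in> extend \<Gamma>" using extendI[OF ser_zero, of 1 \<Gamma>] by simp
  fix a assume "a \<in> extend \<Gamma>"
  then obtain k j where a: "a = real_of_int k *\<^sub>R lnln + j" "j \<in> ser \<Gamma> (\<lambda>e. 0 < e)" by (rule extendE)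
  {
    fix b assume "b \<in> extend \<Gamma>"
    then obtain l i where b: "b = real_of_int l *\<^sub>R lnln + i" "i \<in> ser \<Gamma> (\<lambda>e. 0 < e)" by (rule extendE)
    have "a - b = real_of_int (k - l) *\<^sub>R lnln + (j - i)"
      by (simp add: a(1) b(1) scaleR_diff_left)
    then show "a - b \<in> extend \<Gamma>" using extendI[OF ser_diff[OF assms a(2) b(2)], of "k - l"] by (simp only:)
  }
  show "a = 0 \<or> lnln \<le> a \<or> lnln \<le> - a"
  proof -
    have "j < 0 \<or> j = 0 \<or> 0 < j"
      using full_linear[OF assms] a(2) ser_zero ser_full by blast
    then consider "j < 0" | "j = 0" | "0 < j" by blast
    then show ?thesis
    proof cases
      case 1
      then have "(1 + real_of_int k) *\<^sub>R lnln < - j"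
        by (intro purely_infinite_large[OF assms ser_uminus[OF assms a(2)]]) simp
      then have "lnln < - a" unfolding a(1) by (simp add: scaleR_add_left algebra_simps less_diff_eq)
      then have "lnln \<le> - a" by (rule less_imp_le)
      then show ?thesis by blast
    next
      case 2
      then show ?thesis using int_multiple_lnln[of k] a(1) by auto
    next
      case 3
      then have "(1 - real_of_int k) *\<^sub>R lnln < j" by (intro purely_infinite_large[OF assms a(2)])
      then have "lnln < a" unfolding a(1) by (simp add: scaleR_diff_left algebra_simps diff_less_eq)
      then have "lnln \<le> a" by (rule less_imp_le)
      then show ?thesis by blast
    qed
  qed
qed

primrec exponent_stage :: "nat \<Rightarrow> germ set" where
  "exponent_stage 0 = range (\<lambda>k. real_of_int k *\<^sub>R lnln)"
| "exponent_stage (Suc n) = extend (exponent_stage n)"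

lemma good_exponent_stage: "good (exponent_stage n)"
proof (induction n)
  case 0
  show ?case unfolding good_def
  proof (intro conjI ballI)
    show "0 \<in> exponent_stage 0" by (auto intro!: image_eqI[of _ _ 0])
    show "lnln \<in> exponent_stage 0" by (auto intro!: image_eqI[of _ _ 1])
    fix a assume "a \<in> exponent_stage 0"
    then obtain k where a: "a = real_of_int k *\<^sub>R lnln" by auto
    {
      fix b assume "b \<in> exponent_stage 0"
      then obtain l where "b = real_of_int l *\<^sub>R lnln" by auto
      then have "a - b = real_of_int (k - l) *\<^sub>R lnln" by (simp add: a scaleR_diff_left)
      then show "a - b \<in> exponent_stage 0" by (simp only: exponent_stage.simps) (rule rangeI)
    }
    show "a = 0 \<or> lnln \<le> a \<or> lnln \<le> - a" using int_multiple_lnln[of k] a by auto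
  qed
qed (simp add: good_extend)

lemma exponent_stage_Suc: "exponent_stage n \<subseteq> exponent_stage (Suc n)"
proof (induction n)
  case 0
  show ?case
  proof
    fix a assume "a \<in> exponent_stage 0"
    then obtain k where "a = real_of_int k *\<^sub>R lnln" by auto
    then show "a \<in> exponent_stage (Suc 0)" using extendI[OF ser_zero, of k "exponent_stage 0"] by simp
  qed
next
  case (Suc n)
  have "ser (exponent_stage n) (\<lambda>e. 0 < e) \<subseteq> ser (exponent_stage (Suc n)) (\<lambda>e. 0 < e)" by (rule ser_mono[OF Suc])
  then show ?case by (auto simp: extend_def)
qed

lemma exponent_stage_mono: "m \<le> n \<Longrightarrow> exponent_stage m \<subseteq> exponent_stage n"
  using lift_Suc_mono_le[of exponent_stage m n] exponent_stage_Suc by blast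

text \<open>
  As a series involves finitely many letters, it belongs to some level of the tower, and the union
  contains all purely infinite series over itself.
\<close>
definition exponent_group :: "germ set" where "exponent_group = (\<Union>n. exponent_stage n)"

lemma finite_subset_exponent_group:
  assumes "finite S" "S \<subseteq> exponent_group" shows "\<exists>n. S \<subseteq> exponent_stage n"
  using assms
proof induction
  case (insert a S)
  then obtain n m where "S \<subseteq> exponent_stage n" "a \<in> exponent_stage m" by (auto simp: exponent_group_def)
  then have "insert a S \<subseteq> exponent_stage (max m n)"
    using exponent_stage_mono[of n "max m n"] exponent_stage_mono[of m "max m n"] by auto
  then show ?case by blast
qed simp

lemma good_exponent_group: "good exponent_group"
  unfolding good_def
proof (intro conjI ballI)
  have "exponent_stage 0 \<subseteq> exponent_group" unfolding exponent_group_def by (rule UN_upper) simp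
  then show "0 \<in> exponent_group" "lnln \<in> exponent_group" using goodD(1,3)[OF good_exponent_stage] by blast+
  fix a assume a: "a \<in> exponent_group"
  {
    fix b assume "b \<in> exponent_group"
    then obtain n where "{a, b} \<subseteq> exponent_stage n" using finite_subset_exponent_group[of "{a, b}"] a by auto
    then have "a - b \<in> exponent_stage n" using goodD(2)[OF good_exponent_stage] by simp
    then show "a - b \<in> exponent_group" by (auto simp: exponent_group_def)
  }
  from a obtain n where "a \<in> exponent_stage n" by (auto simp: exponent_group_def)
  then show "a = 0 \<or> lnln \<le> a \<or> lnln \<le> - a" by (rule goodD(6)[OF good_exponent_stage])
qed

lemma purely_infinite_exponent_group: "ser exponent_group (\<lambda>e. 0 < e) \<subseteq> exponent_group"
proof
  fix a assume "a \<in> ser exponent_group (\<lambda>e. 0 < e)"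
  then obtain f H G \<rho> N where a: "a = germ_of f" "finite H" "H \<subseteq> exponent_group" "finite G" "G \<subseteq> exponent_group" "\<And>g. g \<in> G \<Longrightarrow> g < 0" "0 < \<rho>"
    "fam G {(h, w). h \<in> H \<and> set_mset w \<subseteq> G \<and> 0 < h + \<Sum>\<^sub># w} \<rho> N f" by (rule serE) (rule that)
  obtain n where n: "H \<union> G \<subseteq> exponent_stage n" using finite_subset_exponent_group[of "H \<union> G"] a by auto
  have "a \<in> ser (exponent_stage n) (\<lambda>e. 0 < e)" unfolding a(1) by (rule serI[OF a(2) _ a(4) _ a(6) a(7) a(8)]) (use n in auto)
  from extendI[OF this, of 0] have "a \<in> exponent_stage (Suc n)" by simp
  then show "a \<in> exponent_group" unfolding exponent_group_def by blast
qed

abbreviation "series_field \<equiv> full exponent_group"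

text \<open>
  The leading exponent is positive, hence at least \<open>ln (ln x)\<close>, or it is at most
  \<open>0\<close>.
\<close>
lemma series_field_bounded_or_large:
  assumes "a \<in> series_field" "0 < a"
  shows "(\<exists>c>0. germ_of (\<lambda>x. c * ln x) < a) \<or> (\<exists>D s. germ_of s \<in> small exponent_group \<and> 0 \<le> D \<and> a = germ_of (\<lambda>x. D + s x))"
proof -
  have "a \<noteq> 0" using assms(2) by auto
  with good_exponent_group assms(1) show ?thesis
  proof (rule full_cases)
    fix \<theta> C r assume *: "\<theta> \<in> exponent_group" "0 < C" "germ_of r \<in> small exponent_group" "a = germ_of (\<lambda>x. E \<theta> x * (C + r x))"
    from good_linear[OF good_exponent_group *(1) goodD(1)[OF good_exponent_group]] consider "0 < \<theta>" | "\<theta> = 0" | "\<theta> < 0" by blast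
    then show ?thesis
    proof cases
      case 1
      show ?thesis by (rule disjI1, rule leading_large[OF good_exponent_group *(1) 1 _ *(3,4) assms(2)]) (use *(2) in simp)
    next
      case 2
      then show ?thesis using * by (intro disjI2 exI[of _ C] exI[of _ r]) simp
    next
      case 3
      have "germ_of (\<lambda>x. 1 * E \<theta> x) * germ_of r \<in> small exponent_group"
        by (rule ser_mult[OF ser_monomial[where P = "\<lambda>e. e < 0"] *(3) good_exponent_group]) (use *(1) 3 in \<open>auto intro: add_neg_neg\<close>)
      moreover have "germ_of (\<lambda>x. C * E \<theta> x) \<in> small exponent_group" by (rule ser_monomial) (use *(1) 3 in auto)
      ultimately have "germ_of (\<lambda>x. 1 * E \<theta> x) * germ_of r + germ_of (\<lambda>x. C * E \<theta> x) \<in> small exponent_group" by (intro ser_add)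
      then have "germ_of (\<lambda>x. E \<theta> x * (C + r x)) \<in> small exponent_group" by (simp add: germ_of_simps algebra_simps)
      then show ?thesis unfolding *(4)
        by (intro disjI2 exI[of _ 0] exI[of _ "\<lambda>x. E \<theta> x * (C + r x)"]) simp
    qed
  next
    assume "a < 0"
    then show ?thesis using assms(2) by (simp add: less_le_not_le)
  qed
qed

lemma ln_near_const:
  assumes "0 < D" "germ_of s \<in> small exponent_group" shows "germ_of (\<lambda>x. ln (D + s x)) \<in> series_field"
proof -
  have "inverse D *\<^sub>R germ_of s \<in> small exponent_group" by (rule ser_scale[OF good_exponent_group assms(2)])
  then have 1: "germ_of (\<lambda>x. inverse D * s x) \<in> small exponent_group" by (simp add: germ_of_simps)
  then have "germ_of (\<lambda>x. ln (1 + inverse D * s x)) \<in> series_field" using small_ln[OF good_exponent_group] ser_full by blast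
  then have "germ_of (\<lambda>_. ln D) + germ_of (\<lambda>x. ln (1 + inverse D * s x)) \<in> series_field"
    by (intro ser_add full_const good_exponent_group)
  moreover have "germ_of (\<lambda>x. ln (D + s x)) = germ_of (\<lambda>x. ln D + ln (1 + inverse D * s x))" unfolding germ_of_eq_iff
  proof -
    have "\<forall>\<^sub>F x in at_top. dist (inverse D * s x) 0 < 1"
      by (rule tendstoD[OF small_tendsto_0[OF good_exponent_group 1]]) simp
    then show "\<forall>\<^sub>F x in at_top. ln (D + s x) = ln D + ln (1 + inverse D * s x)"
    proof eventually_elim
      case (elim x)
      then have "0 < 1 + inverse D * s x" by (simp add: abs_less_iff)
      then have "ln D + ln (1 + inverse D * s x) = ln (D * (1 + inverse D * s x))"
        using assms(1) by (simp add: ln_mult)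
      also have "D * (1 + inverse D * s x) = D + s x" using assms(1) by (simp add: field_simps)
      finally show ?case by simp
    qed
  qed
  ultimately show ?thesis by (simp add: germ_of_simps)
qed

lemma germ_of_ln_exponent_group: "germ_of ln \<in> exponent_group"
proof -
  have "germ_of (\<lambda>x. 1 * E lnln x) \<in> ser exponent_group (\<lambda>e. 0 < e)"
    by (rule ser_monomial) (use goodD(3)[OF good_exponent_group] lnln_pos in auto)
  moreover have "germ_of (E lnln) = germ_of ln" unfolding germ_of_E lnln_def germ_of_fun_simps germ_of_eq_iff
    using eventually_gt_at_top[of 1] by eventually_elim simp
  ultimately show ?thesis using purely_infinite_exponent_group by auto
qed

lemma germ_of_ln_series_field: "germ_of ln \<in> series_field"
proof -
  have "germ_of (\<lambda>x. 1 * E lnln x) \<in> series_field"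
    by (rule ser_monomial) (use goodD(3)[OF good_exponent_group] in auto)
  moreover have "germ_of (E lnln) = germ_of ln" unfolding germ_of_E lnln_def germ_of_fun_simps germ_of_eq_iff
    using eventually_gt_at_top[of 1] by eventually_elim simp
  ultimately show ?thesis by simp
qed

lemma germ_id_germ_of: "germ_id = germ_of (\<lambda>x. x)"
  by (simp add: germ_id_def)

lemma germ_id_series_field: "germ_id \<in> series_field"
proof -
  have "germ_of (\<lambda>x. 1 * E (germ_of ln) x) \<in> series_field" by (rule ser_monomial) (use germ_of_ln_exponent_group in auto)
  moreover have "germ_of (E (germ_of ln)) = germ_id" unfolding germ_of_E germ_of_fun_simps germ_id_germ_of germ_of_eq_iff
    using eventually_gt_at_top[of 1] by eventually_elim simp
  ultimately show ?thesis by simp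
qed

lemma germ_ln_mult: "0 < a \<Longrightarrow> 0 < b \<Longrightarrow> germ_ln (a * b) = germ_ln a + germ_ln b"
  by transfer (erule (1) eventually_elim2, simp add: ln_mult)

lemma germ_powr_exp: "0 < a \<Longrightarrow> germ_powr a b = germ_exp (b * germ_ln a)"
  by transfer (erule eventually_mono, simp add: powr_def)

lemma germ_ln_exp: "germ_ln (germ_exp a) = a"
  by transfer simp

lemma germ_exp_pos: "0 < germ_exp a"
  by transfer simp

text \<open>
  The field is not closed under logarithms: that of \<open>ln x\<close> is the exponent \<open>ln
  (ln x)\<close>, which is not itself a series. The elements with logarithms in the field are
  nevertheless closed under the operations that generate the Skolem functions.
\<close>
definition loggable :: "germ set" where
  "loggable = {a \<in> series_field. 0 < a \<and> germ_ln a \<in> series_field}"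

lemma germ_mult_pos: "0 < a \<Longrightarrow> 0 < b \<Longrightarrow> 0 < a * (b::germ)"
  by transfer (erule (1) eventually_elim2, simp)

lemma germ_inverse_pos: "0 < a \<Longrightarrow> 0 < germ_inverse a"
  by transfer (erule eventually_mono, simp)

lemma loggable_mult: "a \<in> loggable \<Longrightarrow> b \<in> loggable \<Longrightarrow> a * b \<in> loggable"
  by (auto simp: loggable_def germ_ln_mult germ_mult_pos intro: full_mult ser_add good_exponent_group)

lemma loggable_powr: "a \<in> loggable \<Longrightarrow> b \<in> loggable \<Longrightarrow> germ_powr a b \<in> loggable"
  by (auto simp: loggable_def germ_powr_exp germ_ln_exp germ_exp_pos
      intro!: full_mult full_exp good_exponent_group purely_infinite_exponent_group)

text \<open>
  If \<open>b \<le> a\<close> then \<open>ln (a + b) = ln a + ln (1 + b / a)\<close>, where \<open>1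
  + b / a\<close> is a positive constant plus a small series.
\<close>
lemma loggable_add_le:
  assumes "a \<in> loggable" "b \<in> loggable" "b \<le> a" shows "a + b \<in> loggable"
proof -
  from assms have ab: "a \<in> series_field" "0 < a" "germ_ln a \<in> series_field" "b \<in> series_field" "0 < b" by (auto simp: loggable_def)
  then have "a \<noteq> 0" by auto
  note inv = full_inverse[OF good_exponent_group ab(1) this]
  define q where "q = b * germ_inverse a"
  have q: "q \<in> series_field" "0 < q" "a + b = a * (1 + q)"
    using full_mult[OF good_exponent_group ab(4) inv(1)] germ_mult_pos[OF ab(5) germ_inverse_pos[OF ab(2)]] inv(2)
    by (auto simp: q_def distrib_left mult.left_commute[of a b])
  have "\<forall>\<^sub>F x in at_top. section_of b x \<le> section_of a x"
    using assms(3) by (cases "a = b") (auto simp: germ_less_iff order.order_iff_strict elim: eventually_mono)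
  moreover have "\<forall>\<^sub>F x in at_top. 0 < section_of a x" using ab(2) by (simp add: germ_less_iff)
  ultimately have q1: "\<forall>\<^sub>F x in at_top. section_of b x * inverse (section_of a x) \<le> 1"
    by eventually_elim (simp add: field_simps)
  have "q = germ_of (section_of b) * germ_inverse (germ_of (section_of a))" by (simp add: q_def germ_of_section)
  then have qs: "q = germ_of (\<lambda>x. section_of b x * inverse (section_of a x))" by (simp add: germ_of_fun_simps germ_of_simps)
  have "\<not> (\<exists>c>0. germ_of (\<lambda>x. c * ln x) < q)"
  proof
    assume "\<exists>c>0. germ_of (\<lambda>x. c * ln x) < q"
    then obtain c where c: "0 < c" "\<forall>\<^sub>F x in at_top. c * ln x < section_of b x * inverse (section_of a x)"
      unfolding qs germ_of_less_iff by blast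
    have "\<forall>\<^sub>F x::real in at_top. 1 / c \<le> ln x" using ln_at_top by (simp add: filterlim_at_top)
    with c(2) q1 have "\<forall>\<^sub>F x::real in at_top. False"
    proof eventually_elim
      case (elim x)
      then show ?case using c(1) by (simp add: field_simps)
    qed
    then show False by simp
  qed
  with series_field_bounded_or_large[OF q(1,2)] obtain D s where D: "germ_of s \<in> small exponent_group" "0 \<le> D" "q = germ_of (\<lambda>x. D + s x)" by blast
  have "germ_of (\<lambda>x. ln ((1 + D) + s x)) \<in> series_field" using D by (intro ln_near_const) auto
  moreover have "germ_ln (1 + q) = germ_of (\<lambda>x. ln ((1 + D) + s x))"
    by (simp add: D(3) germ_of_one germ_of_simps germ_of_fun_simps add.assoc)
  ultimately have l: "germ_ln (1 + q) \<in> series_field" by simp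
  have "0 < 1 + q" using q(2) Sk_pos[OF Sk.one] by (simp add: add_pos_pos)
  then have "germ_ln (a + b) = germ_ln a + germ_ln (1 + q)" unfolding q(3) by (rule germ_ln_mult[OF ab(2)])
  then show ?thesis using ab l by (auto simp: loggable_def intro: ser_add add_pos_pos)
qed

lemma loggable_add: "a \<in> loggable \<Longrightarrow> b \<in> loggable \<Longrightarrow> a + b \<in> loggable"
proof -
  assume *: "a \<in> loggable" "b \<in> loggable"
  then have "b \<le> a \<or> a \<le> b" using full_linear[OF good_exponent_group, of a b] by (auto simp: loggable_def)
  then show ?thesis using loggable_add_le[OF *] loggable_add_le[OF *(2,1)] by (auto simp: add.commute)
qed

lemma Sk_loggable: "f \<in> Sk \<Longrightarrow> f \<in> loggable"
proof (induction rule: Sk.induct)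
  case one
  have "germ_ln 1 = germ_of (\<lambda>_. 0)" by (simp add: germ_of_one germ_of_fun_simps)
  then show ?case using full_const[OF good_exponent_group, of 1] full_const[OF good_exponent_group, of 0] Sk_pos[OF Sk.one]
    by (auto simp: loggable_def germ_of_one)
next
  case ident
  have "germ_ln germ_id = germ_of ln" by (simp add: germ_id_germ_of germ_of_fun_simps)
  then show ?case using germ_id_series_field germ_of_ln_series_field Sk_pos[OF Sk.ident] by (simp add: loggable_def)
qed (blast intro: loggable_add loggable_mult loggable_powr)+

text \<open>
  An unbounded \<open>q\<close> exceeds a multiple of \<open>ln x\<close>, so that \<open>ln
  q\<close> is unbounded; being in the field, \<open>ln q\<close> then also exceeds a multiple of
  \<open>ln x\<close>, which a power of \<open>ln x\<close> does not allow.
\<close>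
lemma loggable_gap:
  assumes "q \<in> loggable" "q \<le> germ_of ln ^ n" shows "\<exists>m::nat. q \<le> germ_of (\<lambda>_. of_nat m)"
proof -
  from assms have q: "q \<in> series_field" "0 < q" "germ_ln q \<in> series_field" by (auto simp: loggable_def)
  have bounded: "\<exists>m::nat. a \<le> germ_of (\<lambda>_. of_nat m)" if "germ_of s \<in> small exponent_group" "a = germ_of (\<lambda>x. D + s x)" for a s D
  proof -
    obtain m :: nat where m: "D + 1 \<le> m" using real_arch_simple by blast
    have "\<forall>\<^sub>F x in at_top. dist (s x) 0 < 1" by (rule tendstoD[OF small_tendsto_0[OF good_exponent_group that(1)]]) simp
    then have "\<forall>\<^sub>F x in at_top. D + s x < m" by eventually_elim (use m in \<open>simp add: abs_less_iff\<close>)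
    then have "a < germ_of (\<lambda>_. of_nat m)" by (simp add: that(2) germ_of_less_iff)
    then show ?thesis by (intro exI[of _ m]) simp
  qed
  show ?thesis
  proof (cases "\<exists>c>0. germ_of (\<lambda>x. c * ln x) < q")
    case False
    then show ?thesis using series_field_bounded_or_large[OF q(1,2)] bounded by blast
  next
    case True
    then obtain c where c: "0 < c" "germ_of (\<lambda>x. c * ln x) < q" by blast
    define f where "f = section_of q"
    have qf: "q = germ_of f" by (simp add: f_def germ_of_section)
    have cf: "\<forall>\<^sub>F x in at_top. c * ln x < f x" using c(2) by (simp add: qf germ_of_less_iff)
    have pow: "germ_of ln ^ n = germ_of (\<lambda>x. ln x ^ n)" by (induction n) (simp_all add: germ_of_one germ_of_simps)
    have fn: "\<forall>\<^sub>F x in at_top. f x \<le> ln x ^ n"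
      using assms(2) unfolding qf pow order.order_iff_strict germ_of_less_iff germ_of_eq_iff by (auto elim: eventually_mono)
    have large: "\<forall>\<^sub>F x in at_top. K < f x" for K
    proof -
      have "\<forall>\<^sub>F x::real in at_top. K / c \<le> ln x" using ln_at_top by (simp add: filterlim_at_top)
      with cf show ?thesis
      proof eventually_elim
        case (elim x)
        have "K \<le> c * ln x" using elim(2) c(1) by (simp add: field_simps)
        then show ?case using elim(1) by linarith
      qed
    qed
    have lq: "germ_ln q = germ_of (\<lambda>x. ln (f x))" by (simp add: qf germ_of_fun_simps)
    have "0 < germ_ln q" unfolding lq germ_of_zero germ_of_less_iff using large[of 1] by eventually_elim simp
    from series_field_bounded_or_large[OF q(3) this]
    consider d where "0 < d" "germ_of (\<lambda>x. d * ln x) < germ_ln q" | m :: nat where "germ_ln q \<le> germ_of (\<lambda>_. of_nat m)"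
      using bounded by blast
    then show ?thesis
    proof cases
      case (1 d)
      from 1(2) have "\<forall>\<^sub>F x in at_top. d * ln x < ln (f x)" by (simp add: lq germ_of_less_iff)
      moreover have "\<forall>\<^sub>F x in at_top. real n * ln (ln x) < d * ln x"
        using lnln_less_ln[OF 1(1), of "real n"] by (simp add: lnln_def germ_of_simps germ_of_less_iff)
      ultimately have "\<forall>\<^sub>F x::real in at_top. False"
        using fn large[of 1] eventually_gt_at_top[of 1]
      proof eventually_elim
        case (elim x)
        have "ln (f x) \<le> ln (ln x ^ n)" using elim by simp
        also have "\<dots> = real n * ln (ln x)" using elim(5) by (simp add: ln_realpow)
        finally show ?case using elim by linarith
      qed
      then show ?thesis by simp
    next
      case (2 m)
      have "\<forall>\<^sub>F x in at_top. ln (f x) \<le> real m"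
        using 2 unfolding lq order.order_iff_strict germ_of_less_iff germ_of_eq_iff by (auto elim: eventually_mono)
      with large[of 1] large[of "exp (real m)"] have "\<forall>\<^sub>F x::real in at_top. False"
      proof eventually_elim
        case (elim x)
        have "f x \<le> exp (real m)" using elim(1,3) by (metis exp_le_cancel_iff exp_ln less_trans zero_less_one)
        then show ?case using elim(2) by linarith
      qed
      then show ?thesis by simp
    qed
  qed
qed

section \<open>Skolem functions as elements of the field of series\<close>

typedef tseries = "series_field"
  by (rule exI[of _ 0]) (rule ser_zero)

setup_lifting type_definition_tseries

lemma germ_mult_left_mono: "a < b \<Longrightarrow> 0 < c \<Longrightarrow> c * a < c * (b::germ)"
  by transfer (erule (1) eventually_elim2, simp)

instantiation tseries :: linordered_field
begin

lift_definition zero_tseries :: tseries is 0 by (rule ser_zero)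
lift_definition one_tseries :: tseries is 1 unfolding germ_of_one by (rule full_const[OF good_exponent_group])
lift_definition plus_tseries :: "tseries \<Rightarrow> tseries \<Rightarrow> tseries" is "(+)" by (rule ser_add)
lift_definition minus_tseries :: "tseries \<Rightarrow> tseries \<Rightarrow> tseries" is "(-)" by (rule ser_diff[OF good_exponent_group])
lift_definition uminus_tseries :: "tseries \<Rightarrow> tseries" is uminus by (rule ser_uminus[OF good_exponent_group])
lift_definition times_tseries :: "tseries \<Rightarrow> tseries \<Rightarrow> tseries" is "(*)" by (rule full_mult[OF good_exponent_group])
lift_definition inverse_tseries :: "tseries \<Rightarrow> tseries" is "\<lambda>a. if a = 0 then 0 else germ_inverse a"
  by (auto intro: ser_zero full_inverse[OF good_exponent_group])
lift_definition less_eq_tseries :: "tseries \<Rightarrow> tseries \<Rightarrow> bool" is "(\<le>)" .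
lift_definition less_tseries :: "tseries \<Rightarrow> tseries \<Rightarrow> bool" is "(<)" .
definition divide_tseries :: "tseries \<Rightarrow> tseries \<Rightarrow> tseries" where "divide_tseries a b = a * inverse b"
definition abs_tseries :: "tseries \<Rightarrow> tseries" where "abs_tseries a = (if a < 0 then - a else a)"
definition sgn_tseries :: "tseries \<Rightarrow> tseries" where "sgn_tseries a = (if a = 0 then 0 else if 0 < a then 1 else - 1)"

instance
proof
  fix a b c :: tseries
  show "a + b + c = a + (b + c)" "a + b = b + a" "0 + a = a" "- a + a = 0" "a - b = a + - b"
    "a * b * c = a * (b * c)" "a * b = b * a" "1 * a = a" "(a + b) * c = a * c + b * c"
    "a + b - a = b" "a - b - c = a - (b + c)" "0 * a = 0" "a * 0 = 0"
    by (transfer, simp add: algebra_simps)+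
  show "(0::tseries) \<noteq> 1" by transfer simp
  show "(a < b) = (a \<le> b \<and> \<not> b \<le> a)" by transfer (rule less_le_not_le)
  show "a \<le> a" by transfer simp
  show "a \<le> b \<Longrightarrow> b \<le> c \<Longrightarrow> a \<le> c" by transfer (rule order_trans)
  show "a \<le> b \<Longrightarrow> b \<le> a \<Longrightarrow> a = b" by transfer (rule order_antisym)
  show "a \<le> b \<or> b \<le> a"
    by transfer (use full_linear[OF good_exponent_group] in \<open>auto simp: order.order_iff_strict\<close>)
  show "a \<le> b \<Longrightarrow> c + a \<le> c + b" by transfer (rule add_left_mono)
  show "a < b \<Longrightarrow> 0 < c \<Longrightarrow> c * a < c * b" by transfer (rule germ_mult_left_mono)
  show "\<bar>a\<bar> = (if a < 0 then - a else a)" by (rule abs_tseries_def)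
  show "sgn a = (if a = 0 then 0 else if 0 < a then 1 else - 1)" by (rule sgn_tseries_def)
  show "a div b = a * inverse b" by (rule divide_tseries_def)
  show "inverse (0::tseries) = 0" by transfer simp
  show "a \<noteq> 0 \<Longrightarrow> inverse a * a = 1"
    by transfer (simp add: full_inverse(2)[OF good_exponent_group] mult.commute)
qed

end

lemma Rep_of_nat: "Rep_tseries (of_nat n) = germ_of (\<lambda>_. of_nat n)"
  by (induction n) (simp_all add: zero_tseries.rep_eq one_tseries.rep_eq plus_tseries.rep_eq germ_of_zero germ_of_one germ_of_simps)

lemma Rep_power: "Rep_tseries (a ^ n) = Rep_tseries a ^ n"
  by (induction n) (simp_all add: one_tseries.rep_eq times_tseries.rep_eq)

lemma tseries_leI:
  assumes "Rep_tseries a = germ_of f" "Rep_tseries b = germ_of g" "\<forall>\<^sub>F x in at_top. f x \<le> g x"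
  shows "a \<le> b"
proof (rule ccontr)
  assume "\<not> a \<le> b"
  then have "b < a" by simp
  then have "\<forall>\<^sub>F x in at_top. g x < f x" by (simp add: less_tseries.rep_eq assms(1,2) germ_of_less_iff)
  with assms(3) have "\<forall>\<^sub>F x::real in at_top. False" by eventually_elim simp
  then show False by simp
qed

lemma tseries_leD:
  assumes "a \<le> b" "Rep_tseries a = germ_of f" "Rep_tseries b = germ_of g"
  shows "\<forall>\<^sub>F x in at_top. f x \<le> g x"
  using assms(1) unfolding less_eq_tseries.rep_eq assms(2,3) order.order_iff_strict germ_of_less_iff germ_of_eq_iff
  by (auto elim: eventually_mono)

definition SkT :: "tseries set" where "SkT = {a. Rep_tseries a \<in> Sk}"
definition lnT :: "tseries \<Rightarrow> tseries" where "lnT a = Abs_tseries (germ_ln (Rep_tseries a))"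
definition powT :: "tseries \<Rightarrow> tseries \<Rightarrow> tseries" where
  "powT a b = Abs_tseries (germ_powr (Rep_tseries a) (Rep_tseries b))"
definition idT :: tseries where "idT = Abs_tseries germ_id"

lemma Sk_series_field: "f \<in> Sk \<Longrightarrow> f \<in> series_field"
  using Sk_loggable by (simp add: loggable_def)

lemma Rep_Abs_Sk: "f \<in> Sk \<Longrightarrow> Rep_tseries (Abs_tseries f) = f"
  by (rule Abs_tseries_inverse[OF Sk_series_field])

lemma Abs_SkT: "f \<in> Sk \<Longrightarrow> Abs_tseries f \<in> SkT"
  by (simp add: SkT_def Rep_Abs_Sk)

lemma Rep_lnT: "a \<in> SkT \<Longrightarrow> Rep_tseries (lnT a) = germ_ln (Rep_tseries a)"
  unfolding lnT_def using Sk_loggable by (intro Abs_tseries_inverse) (auto simp: SkT_def loggable_def)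

lemma Rep_powT: "a \<in> SkT \<Longrightarrow> b \<in> SkT \<Longrightarrow> Rep_tseries (powT a b) = germ_powr (Rep_tseries a) (Rep_tseries b)"
  unfolding powT_def by (rule Rep_Abs_Sk) (auto simp: SkT_def intro: Sk.power)

lemma Rep_idT: "Rep_tseries idT = germ_id"
  unfolding idT_def by (rule Rep_Abs_Sk[OF Sk.ident])

lemma SkT_germ_of:
  assumes "a \<in> SkT"
  obtains f where "Rep_tseries a = germ_of f" "\<forall>\<^sub>F x in at_top. 0 < f x"
proof -
  have "0 < Rep_tseries a" using assms Sk_pos by (simp add: SkT_def)
  then have "\<forall>\<^sub>F x in at_top. 0 < section_of (Rep_tseries a) x" by (simp add: germ_less_iff)
  then show ?thesis using that[of "section_of (Rep_tseries a)"] germ_of_section[of "Rep_tseries a"] by simp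
qed

text \<open>
  The argument \<open>0\<close> is excluded because of \<open>0 powr 0 = 0\<close>.
\<close>
lemma Sk_integer_valued:
  "f \<in> Sk \<Longrightarrow> \<exists>F. f = germ_of F \<and> (\<forall>n::nat. 0 < n \<longrightarrow> (\<exists>m::nat. 0 < m \<and> F (real n) = real m))"
proof (induction rule: Sk.induct)
  case one
  show ?case by (intro exI[of _ "\<lambda>_. 1"]) (auto simp: germ_of_one intro!: exI[of _ 1])
next
  case ident
  show ?case by (intro exI[of _ "\<lambda>x. x"]) (auto simp: germ_id_germ_of)
next
  case (add f g)
  then obtain F G where F: "f = germ_of F" "\<And>n::nat. 0 < n \<Longrightarrow> \<exists>m::nat. 0 < m \<and> F (real n) = real m"
    and G: "g = germ_of G" "\<And>n::nat. 0 < n \<Longrightarrow> \<exists>m::nat. 0 < m \<and> G (real n) = real m" by blast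
  show ?case
  proof (intro exI[of _ "\<lambda>x. F x + G x"] conjI allI impI)
    show "f + g = germ_of (\<lambda>x. F x + G x)" by (simp add: F G germ_of_simps)
    fix n :: nat assume "0 < n"
    from F(2)[OF this] G(2)[OF this] obtain k m :: nat where "0 < k" "0 < m" "F n = k" "G n = m" by blast
    then show "\<exists>m::nat. 0 < m \<and> F (real n) + G (real n) = real m" by (intro exI[of _ "k + m"]) simp
  qed
next
  case (mult f g)
  then obtain F G where F: "f = germ_of F" "\<And>n::nat. 0 < n \<Longrightarrow> \<exists>m::nat. 0 < m \<and> F (real n) = real m"
    and G: "g = germ_of G" "\<And>n::nat. 0 < n \<Longrightarrow> \<exists>m::nat. 0 < m \<and> G (real n) = real m" by blast
  show ?case
  proof (intro exI[of _ "\<lambda>x. F x * G x"] conjI allI impI)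
    show "f * g = germ_of (\<lambda>x. F x * G x)" by (simp add: F G germ_of_simps)
    fix n :: nat assume "0 < n"
    from F(2)[OF this] G(2)[OF this] obtain k m :: nat where "0 < k" "0 < m" "F n = k" "G n = m" by blast
    then show "\<exists>m::nat. 0 < m \<and> F (real n) * G (real n) = real m" by (intro exI[of _ "k * m"]) simp
  qed
next
  case (power f g)
  then obtain F G where F: "f = germ_of F" "\<And>n::nat. 0 < n \<Longrightarrow> \<exists>m::nat. 0 < m \<and> F (real n) = real m"
    and G: "g = germ_of G" "\<And>n::nat. 0 < n \<Longrightarrow> \<exists>m::nat. 0 < m \<and> G (real n) = real m" by blast
  show ?case
  proof (intro exI[of _ "\<lambda>x. F x powr G x"] conjI allI impI)
    show "germ_powr f g = germ_of (\<lambda>x. F x powr G x)" by (simp add: F G germ_powr.abs_eq)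
    fix n :: nat assume "0 < n"
    from F(2)[OF this] G(2)[OF this] obtain k m :: nat where "0 < k" "0 < m" "F n = k" "G n = m" by blast
    then show "\<exists>m::nat. 0 < m \<and> F (real n) powr G (real n) = real m"
      by (intro exI[of _ "k ^ m"]) (simp add: powr_realpow)
  qed
qed

lemma Sk_discrete:
  assumes "f \<in> Sk" "g \<in> Sk" "f < g" shows "\<not> g < f + 1"
proof
  assume lt: "g < f + 1"
  obtain F G where F: "f = germ_of F" "\<And>n::nat. 0 < n \<Longrightarrow> \<exists>m::nat. 0 < m \<and> F (real n) = real m"
    and G: "g = germ_of G" "\<And>n::nat. 0 < n \<Longrightarrow> \<exists>m::nat. 0 < m \<and> G (real n) = real m"
    using Sk_integer_valued[OF assms(1)] Sk_integer_valued[OF assms(2)] by blast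
  have "\<forall>\<^sub>F x in at_top. F x < G x \<and> G x < F x + 1"
    using assms(3) lt by (simp add: F(1) G(1) germ_of_one germ_of_simps germ_of_less_iff eventually_conj_iff)
  then have "\<forall>\<^sub>F n in sequentially. F (real n) < G (real n) \<and> G (real n) < F (real n) + 1"
    using filterlim_real_sequentially by (rule eventually_compose_filterlim)
  moreover have "\<forall>\<^sub>F n::nat in sequentially. 0 < n" by (rule eventually_gt_at_top)
  ultimately have "\<forall>\<^sub>F n::nat in sequentially. False"
  proof eventually_elim
    case (elim n)
    from F(2)[OF elim(2)] G(2)[OF elim(2)] obtain k m :: nat where "F n = k" "G n = m" by blast
    then have "real k < real m" "real m < real (k + 1)" using elim(1) by auto
    then have "k < m" "m < k + 1" unfolding of_nat_less_iff .
    then show ?case by simp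
  qed
  then show False by simp
qed

lemma SkT_induct:
  assumes "a \<in> SkT" "P 1" "P idT"
    "\<And>f g. f \<in> SkT \<Longrightarrow> g \<in> SkT \<Longrightarrow> P f \<Longrightarrow> P g \<Longrightarrow> P (f + g)"
    "\<And>f g. f \<in> SkT \<Longrightarrow> g \<in> SkT \<Longrightarrow> P f \<Longrightarrow> P g \<Longrightarrow> P (f * g)"
    "\<And>f g. f \<in> SkT \<Longrightarrow> g \<in> SkT \<Longrightarrow> P f \<Longrightarrow> P g \<Longrightarrow> P (powT f g)"
  shows "P a"
proof -
  have "P (Abs_tseries f)" if "f \<in> Sk" for f
    using that
  proof (induction rule: Sk.induct)
    case one
    then show ?case using assms(2) by (simp add: one_tseries_def)
  next
    case ident
    then show ?case using assms(3) by (simp add: idT_def)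
  next
    case (add f g)
    have "Abs_tseries (f + g) = Abs_tseries f + Abs_tseries g"
      using add by (simp add: Rep_tseries_inject[symmetric] plus_tseries.rep_eq Rep_Abs_Sk Sk.add)
    then show ?case using assms(4)[of "Abs_tseries f" "Abs_tseries g"] add Abs_SkT by simp
  next
    case (mult f g)
    have "Abs_tseries (f * g) = Abs_tseries f * Abs_tseries g"
      using mult by (simp add: Rep_tseries_inject[symmetric] times_tseries.rep_eq Rep_Abs_Sk Sk.mult)
    then show ?case using assms(5)[of "Abs_tseries f" "Abs_tseries g"] mult Abs_SkT by simp
  next
    case (power f g)
    have "Abs_tseries (germ_powr f g) = powT (Abs_tseries f) (Abs_tseries g)"
      using power by (simp add: powT_def Rep_Abs_Sk)
    then show ?case using assms(6)[of "Abs_tseries f" "Abs_tseries g"] power Abs_SkT by simp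
  qed
  from this[of "Rep_tseries a"] show ?thesis using assms(1) by (simp add: SkT_def Rep_tseries_inverse)
qed

lemma SkT_closed:
  "1 \<in> SkT" "idT \<in> SkT" "a \<in> SkT \<Longrightarrow> b \<in> SkT \<Longrightarrow> a + b \<in> SkT"
  "a \<in> SkT \<Longrightarrow> b \<in> SkT \<Longrightarrow> a * b \<in> SkT" "a \<in> SkT \<Longrightarrow> b \<in> SkT \<Longrightarrow> powT a b \<in> SkT"
  using Rep_powT[of a b]
  by (auto simp: SkT_def one_tseries.rep_eq Rep_idT plus_tseries.rep_eq times_tseries.rep_eq intro: Sk.intros)

lemma SkT_pos: "a \<in> SkT \<Longrightarrow> 0 < a"
  using Sk_pos by (simp add: SkT_def less_tseries.rep_eq zero_tseries.rep_eq)

lemma Rep_diff_germ_of: "Rep_tseries a = germ_of f \<Longrightarrow> Rep_tseries b = germ_of g \<Longrightarrow> Rep_tseries (a - b) = germ_of (\<lambda>x. f x - g x)"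
  and Rep_mult_germ_of: "Rep_tseries a = germ_of f \<Longrightarrow> Rep_tseries b = germ_of g \<Longrightarrow> Rep_tseries (a * b) = germ_of (\<lambda>x. f x * g x)"
  and Rep_lnT_germ_of: "a \<in> SkT \<Longrightarrow> Rep_tseries a = germ_of f \<Longrightarrow> Rep_tseries (lnT a) = germ_of (\<lambda>x. ln (f x))"
  by (simp_all add: minus_tseries.rep_eq times_tseries.rep_eq germ_of_simps Rep_lnT germ_of_fun_simps)

lemma germ_of_power: "germ_of f ^ n = germ_of (\<lambda>x. f x ^ n)"
  by (induction n) (simp_all add: germ_of_one germ_of_simps)

lemma SkT_gap:
  assumes "f \<in> SkT" "g \<in> SkT" "g \<le> f * lnT idT ^ n"
  shows "\<exists>m::nat. g \<le> of_nat m * f"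
proof -
  from assms(1) obtain F where F: "Rep_tseries f = germ_of F" "\<forall>\<^sub>F x in at_top. 0 < F x" by (rule SkT_germ_of)
  from assms(2) obtain G where G: "Rep_tseries g = germ_of G" "\<forall>\<^sub>F x in at_top. 0 < G x" by (rule SkT_germ_of)
  have f0: "0 < f" "0 < g" using SkT_pos assms by auto
  have inv: "Rep_tseries (inverse f) = germ_of (\<lambda>x. inverse (F x))"
    using f0 F(1) by (auto simp: inverse_tseries.rep_eq germ_of_fun_simps zero_tseries.rep_eq[symmetric] Rep_tseries_inject)
  have q: "Rep_tseries (g / f) = germ_of (\<lambda>x. G x * inverse (F x))"
    unfolding divide_tseries_def by (rule Rep_mult_germ_of[OF G(1) inv])
  have "germ_ln (Rep_tseries (g / f)) = Rep_tseries (lnT g - lnT f)"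
    unfolding Rep_diff_germ_of[OF Rep_lnT_germ_of[OF assms(2) G(1)] Rep_lnT_germ_of[OF assms(1) F(1)]] q germ_of_fun_simps germ_of_eq_iff
    using F(2) G(2) by eventually_elim (simp add: ln_mult ln_inverse)
  then have ln: "germ_ln (Rep_tseries (g / f)) \<in> series_field" using Rep_tseries[of "lnT g - lnT f"] by simp
  have "0 < g / f" using f0 by simp
  then have "0 < Rep_tseries (g / f)" by (simp add: less_tseries.rep_eq zero_tseries.rep_eq)
  then have loggable: "Rep_tseries (g / f) \<in> loggable" using ln Rep_tseries[of "g / f"] by (simp add: loggable_def)
  have l: "Rep_tseries (lnT idT) = germ_of ln" using Rep_lnT_germ_of[OF SkT_closed(2), of "\<lambda>x. x"] by (simp add: Rep_idT germ_id_germ_of)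
  have "g / f \<le> lnT idT ^ n" using assms(3) f0 by (simp add: field_simps)
  then have "Rep_tseries (g / f) \<le> germ_of ln ^ n" by (simp add: less_eq_tseries.rep_eq Rep_power l)
  from loggable_gap[OF loggable this] obtain m where "Rep_tseries (g / f) \<le> germ_of (\<lambda>_. real m)" by blast
  then have "g / f \<le> of_nat m" by (simp add: less_eq_tseries.rep_eq Rep_of_nat)
  then show ?thesis using f0 by (auto simp: field_simps)
qed

lemma exp_field_SkT: "exp_field SkT lnT powT idT"
proof
  fix f g :: tseries
  show "1 \<in> SkT" "idT \<in> SkT" "f \<in> SkT \<Longrightarrow> g \<in> SkT \<Longrightarrow> f + g \<in> SkT"
    "f \<in> SkT \<Longrightarrow> g \<in> SkT \<Longrightarrow> f * g \<in> SkT" "f \<in> SkT \<Longrightarrow> g \<in> SkT \<Longrightarrow> powT f g \<in> SkT"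
    by (fact SkT_closed)+
  show "0 < f" if "f \<in> SkT" using that by (rule SkT_pos)
  fix n :: nat
  show "of_nat n < lnT idT"
    unfolding less_tseries.rep_eq Rep_of_nat Rep_lnT[OF SkT_closed(2)] Rep_idT germ_id_germ_of germ_of_fun_simps germ_of_less_iff
    using ln_at_top by (simp add: filterlim_at_top_dense)
  assume f: "f \<in> SkT"
  from f obtain F where F: "Rep_tseries f = germ_of F" "\<forall>\<^sub>F x in at_top. 0 < F x" by (rule SkT_germ_of)
  note fpos = SkT_pos[OF f]
  have one: "of_nat (Suc k) \<in> SkT" for k
  proof (induction k)
    case (Suc k)
    show ?case by (subst of_nat_Suc) (rule SkT_closed(3)[OF SkT_closed(1) Suc])
  qed (simp add: SkT_closed)
  show "powT f (of_nat (Suc n)) = f ^ Suc n"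
    unfolding Rep_tseries_inject[symmetric] Rep_powT[OF f one] Rep_power Rep_of_nat F(1) germ_of_power germ_powr.abs_eq germ_of_eq_iff
    using F(2) by eventually_elim (simp only: powr_realpow)
  assume g: "g \<in> SkT"
  from g obtain G where G: "Rep_tseries g = germ_of G" "\<forall>\<^sub>F x in at_top. 0 < G x" by (rule SkT_germ_of)
  show "f + 1 \<le> g" if "f < g"
  proof -
    have "\<not> Rep_tseries g < Rep_tseries f + 1"
      by (rule Sk_discrete) (use f g that in \<open>auto simp: SkT_def less_tseries.rep_eq\<close>)
    then have "\<not> g < f + 1" by (simp add: less_tseries.rep_eq plus_tseries.rep_eq one_tseries.rep_eq)
    then show ?thesis by simp
  qed
  have pos: "0 < Rep_tseries f" "0 < Rep_tseries g" using f g Sk_pos by (simp_all add: SkT_def)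
  show "lnT (f * g) = lnT f + lnT g"
    unfolding Rep_tseries_inject[symmetric] plus_tseries.rep_eq Rep_lnT[OF f] Rep_lnT[OF g]
      Rep_lnT[OF SkT_closed(4)[OF f g]] times_tseries.rep_eq by (rule germ_ln_mult[OF pos])
  show "lnT (powT f g) = g * lnT f"
    unfolding Rep_tseries_inject[symmetric] times_tseries.rep_eq Rep_lnT[OF f]
      Rep_lnT[OF SkT_closed(5)[OF f g]] Rep_powT[OF f g] germ_powr_exp[OF pos(1)] by (rule germ_ln_exp)
  have dl: "Rep_tseries (lnT g - lnT f) = germ_of (\<lambda>x. ln (G x) - ln (F x))"
    by (rule Rep_diff_germ_of[OF Rep_lnT_germ_of[OF g G(1)] Rep_lnT_germ_of[OF f F(1)]])
  have "(lnT g - lnT f) * f \<le> g - f"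
  proof (rule tseries_leI[OF Rep_mult_germ_of[OF dl F(1)] Rep_diff_germ_of[OF G(1) F(1)]])
    show "\<forall>\<^sub>F x in at_top. (ln (G x) - ln (F x)) * F x \<le> G x - F x"
      using F(2) G(2)
    proof eventually_elim
      case (elim x)
      have "ln (G x) - ln (F x) = ln (G x / F x)" using elim by (simp add: ln_div)
      also have "\<dots> \<le> G x / F x - 1" using elim by (intro ln_le_minus_one) simp
      finally show ?case using elim(1) by (simp add: field_simps)
    qed
  qed
  then show "lnT g - lnT f \<le> (g - f) / f" using fpos by (simp add: pos_le_divide_eq)
  show "g \<le> of_nat (3 ^ n) * f" if le: "lnT g - lnT f \<le> of_nat n"
  proof (rule tseries_leI[OF G(1) Rep_mult_germ_of[OF Rep_of_nat F(1)]])
    show "\<forall>\<^sub>F x in at_top. G x \<le> real (3 ^ n) * F x"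
      using tseries_leD[OF le dl Rep_of_nat] F(2) G(2)
    proof eventually_elim
      case (elim x)
      have "G x = exp (ln (G x))" using elim by simp
      also have "\<dots> \<le> exp (real n + ln (F x))" unfolding exp_le_cancel_iff using elim(1) by simp
      also have "\<dots> = exp 1 ^ n * F x" using elim(2) by (simp add: exp_add exp_of_nat_mult[symmetric])
      also have "\<dots> \<le> 3 ^ n * F x" using elim(2) by (intro mult_right_mono power_mono exp_le) auto
      finally show ?case by simp
    qed
  qed
  show "\<exists>m. g \<le> of_nat m * f" if "g \<le> f * lnT idT ^ n" by (rule SkT_gap[OF f g that])
next
  fix f :: tseries and P
  assume "f \<in> SkT" "P 1" "P idT"
       "\<And>f g. f \<in> SkT \<Longrightarrow> g \<in> SkT \<Longrightarrow> P f \<Longrightarrow> P g \<Longrightarrow> P (f + g)"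
       "\<And>f g. f \<in> SkT \<Longrightarrow> g \<in> SkT \<Longrightarrow> P f \<Longrightarrow> P g \<Longrightarrow> P (f * g)"
       "\<And>f g. f \<in> SkT \<Longrightarrow> g \<in> SkT \<Longrightarrow> P f \<Longrightarrow> P g \<Longrightarrow> P (powT f g)"
  then show "P f" by (rule SkT_induct)
qed

lemma Sk_rank: "\<exists>\<rho>::germ \<Rightarrow> ord. \<forall>f\<in>Sk. \<forall>g\<in>Sk. f < g \<longrightarrow> \<rho> f < \<rho> g"
proof -
  from exp_field.Sk_rank[OF exp_field_SkT] obtain \<rho> :: "tseries \<Rightarrow> ord"
    where \<rho>: "\<forall>f\<in>SkT. \<forall>g\<in>SkT. f < g \<longrightarrow> \<rho> f < \<rho> g" by blast
  show ?thesis
  proof (intro exI[of _ "\<lambda>f. \<rho> (Abs_tseries f)"] ballI impI)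
    fix f g assume "f \<in> Sk" "g \<in> Sk" "f < g"
    then show "\<rho> (Abs_tseries f) < \<rho> (Abs_tseries g)"
      using \<rho> Abs_SkT by (simp add: less_tseries.rep_eq Rep_Abs_Sk)
  qed
qed

lemma Sk_linear: "f \<in> Sk \<Longrightarrow> g \<in> Sk \<Longrightarrow> f < g \<or> f = g \<or> g < f"
  by (rule full_linear[OF good_exponent_group Sk_series_field Sk_series_field])

section \<open>The order type of the Skolem functions\<close>

lemma Field_Sk_order: "Field Sk_order = Sk"
  by (auto simp: Sk_order_def Field_def)

lemma Sk_order_iff: "(f, g) \<in> Sk_order \<longleftrightarrow> f \<in> Sk \<and> g \<in> Sk \<and> f \<le> g"
  by (simp add: Sk_order_def)

text \<open>
  A total relation with a strictly monotone rank is automatically transitive and antisymmetric.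
\<close>
lemma well_order_on_via_rank:
  fixes \<rho> :: "'a \<Rightarrow> 'b::wellorder"
  assumes "\<And>a b. (a, b) \<in> r \<Longrightarrow> a \<in> A \<and> b \<in> A" "\<And>a. a \<in> A \<Longrightarrow> (a, a) \<in> r"
    and tot: "\<And>a b. a \<in> A \<Longrightarrow> b \<in> A \<Longrightarrow> (a, b) \<in> r \<or> (b, a) \<in> r"
    and \<rho>: "\<And>a b. (a, b) \<in> r \<Longrightarrow> a \<noteq> b \<Longrightarrow> \<rho> a < \<rho> b"
  shows "well_order_on A r"
proof -
  have le: "\<rho> a \<le> \<rho> b" if "(a, b) \<in> r" for a b using \<rho>[OF that] by (cases "a = b") auto
  have anti: "a = b" if "(a, b) \<in> r" "(b, a) \<in> r" for a b
  proof (rule ccontr)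
    assume "a \<noteq> b"
    then show False using \<rho>[OF that(1)] le[OF that(2)] by simp
  qed
  have trans: "(a, c) \<in> r" if ab: "(a, b) \<in> r" and bc: "(b, c) \<in> r" for a b c
  proof (rule ccontr)
    assume n: "(a, c) \<notin> r"
    then have "(c, a) \<in> r" using tot assms(1) ab bc by blast
    then have "\<rho> c \<le> \<rho> a" by (rule le)
    then have "\<rho> a = \<rho> b" "\<rho> b = \<rho> c" using le[OF ab] le[OF bc] by auto
    then have "a = b" "b = c" using \<rho>[OF ab] \<rho>[OF bc] by auto
    then show False using n ab by simp
  qed
  have "r - Id \<subseteq> inv_image {(x, y). x < y} \<rho>"
  proof (rule subrelI)
    fix a b assume "(a, b) \<in> r - Id"
    then have "\<rho> a < \<rho> b" by (intro \<rho>) auto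
    then show "(a, b) \<in> inv_image {(x, y). x < y} \<rho>" by simp
  qed
  then have "wf (r - Id)" by (rule wf_subset[OF wf_inv_image[OF wf]])
  moreover have "linear_order_on A r"
    unfolding linear_order_on_def partial_order_on_def preorder_on_def refl_on_def total_on_def
  proof (intro conjI)
    show "trans r" using trans by (rule transI)
    show "antisym r" using anti by (rule antisymI)
    show "r \<subseteq> A \<times> A" by (rule subrelI) (simp add: assms(1))
    show "\<forall>x\<in>A. (x, x) \<in> r" using assms(2) by simp
    show "\<forall>x\<in>A. \<forall>y\<in>A. x \<noteq> y \<longrightarrow> (x, y) \<in> r \<or> (y, x) \<in> r" using tot by simp
  qed
  ultimately show ?thesis by (simp add: well_order_on_def)
qed

lemma Field_of_refl:
  assumes "\<And>a b. (a, b) \<in> r \<Longrightarrow> a \<in> A \<and> b \<in> A" "\<And>a. a \<in> A \<Longrightarrow> (a, a) \<in> r"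
  shows "Field r = A"
  using assms unfolding Field_def by blast

lemma Well_order_Sk_order: "Well_order Sk_order"
proof -
  obtain \<rho> :: "germ \<Rightarrow> ord" where \<rho>: "\<forall>f\<in>Sk. \<forall>g\<in>Sk. f < g \<longrightarrow> \<rho> f < \<rho> g" using Sk_rank by blast
  have "well_order_on Sk Sk_order"
    by (rule well_order_on_via_rank[where \<rho> = \<rho>])
      (use \<rho> Sk_linear in \<open>auto simp: Sk_order_iff order.order_iff_strict\<close>)
  then show ?thesis by (simp add: Field_Sk_order)
qed

text \<open>
  The library compares well-orders by initial segment embeddings. If \<open>s\<close> were
  isomorphic to a proper initial segment of \<open>r\<close>, then composing with \<open>f\<close>
  would give a strictly monotone map from \<open>r\<close> to itself that moves some element down,
  which is impossible in a well-order.
\<close>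
lemma ordLeq_if_strict_mono:
  assumes r: "Well_order r" and s: "Well_order s"
    and f: "\<And>a. a \<in> Field r \<Longrightarrow> f a \<in> Field s"
    and mono: "\<And>a b. (a, b) \<in> r \<Longrightarrow> a \<noteq> b \<Longrightarrow> (f a, f b) \<in> s \<and> f a \<noteq> f b"
  shows "r \<le>o s"
proof (rule ccontr)
  assume "\<not> r \<le>o s"
  then have "s <o r" using r s by (simp add: not_ordLeq_iff_ordLess)
  then obtain a where a: "a \<in> Field r" "s =o Restr r (underS r a)"
    using ordLess_iff_ordIso_Restr[OF r s] by blast
  from a(2) obtain e where e: "iso s (Restr r (underS r a)) e" unfolding ordIso_def by blast
  have bij: "bij_betw e (Field s) (Field (Restr r (underS r a)))"
    and emono: "\<And>b c. b \<in> Field s \<Longrightarrow> c \<in> Field s \<Longrightarrow> (b, c) \<in> s \<Longrightarrow> (e b, e c) \<in> Restr r (underS r a)"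
    using e unfolding iso_iff2 by auto
  define h where "h = (\<lambda>c. e (f c))"
  have hU: "h c \<in> underS r a" if "c \<in> Field r" for c
  proof -
    have "h c \<in> Field (Restr r (underS r a))" unfolding h_def using bij_betw_apply[OF bij f[OF that]] .
    then show ?thesis unfolding Field_def by auto
  qed
  have hmono: "(h b, h c) \<in> r \<and> h b \<noteq> h c" if "(b, c) \<in> r" "b \<noteq> c" for b c
  proof -
    have bc: "b \<in> Field r" "c \<in> Field r" using that(1) by (auto simp: Field_def)
    from mono[OF that] have m: "(f b, f c) \<in> s" "f b \<noteq> f c" by auto
    have "(h b, h c) \<in> r" unfolding h_def using emono[OF f[OF bc(1)] f[OF bc(2)] m(1)] by simp
    moreover have "h b \<noteq> h c"
      unfolding h_def using bij_betw_imp_inj_on[OF bij] f[OF bc(1)] f[OF bc(2)] m(2) by (auto dest: inj_onD)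
    ultimately show ?thesis by blast
  qed
  have "wf (r - Id)" using r by (simp add: well_order_on_def)
  then have no: "\<not> ((h c, c) \<in> r \<and> h c \<noteq> c)" for c
  proof (induction c rule: wf_induct_rule)
    case (less c)
    show ?case
    proof
      assume hc: "(h c, c) \<in> r \<and> h c \<noteq> c"
      then have "(h c, c) \<in> r - Id" by auto
      from less[OF this] hmono[of "h c" c] hc show False by blast
    qed
  qed
  from hU[OF a(1)] no[of a] show False by (auto simp: underS_def)
qed

definition finsupp :: "'a rel \<Rightarrow> ('a \<Rightarrow> nat) set" where
  "finsupp r = {f. finite {a. f a \<noteq> 0} \<and> {a. f a \<noteq> 0} \<subseteq> Field r}"

lemma omega_exp_iff:
  "(f, g) \<in> omega_exp r \<longleftrightarrow> f \<in> finsupp r \<and> g \<in> finsupp r \<and>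
    (f = g \<or> (\<exists>a \<in> Field r. f a < g a \<and> (\<forall>b. (a, b) \<in> r \<and> b \<noteq> a \<longrightarrow> f b = g b)))"
  by (simp add: omega_exp_def finsupp_def Let_def)

lemma Field_omega_exp: "Field (omega_exp r) = finsupp r"
  by (rule Field_of_refl) (auto simp: omega_exp_iff)

lemma powT_gap:
  assumes "a \<in> SkT" "b \<in> SkT" "a < b" shows "powT idT a * idT \<le> powT idT b"
proof -
  interpret exp_field SkT lnT powT idT by (rule exp_field_SkT)
  from assms(1) obtain F where F: "Rep_tseries a = germ_of F" "\<forall>\<^sub>F x in at_top. 0 < F x" by (rule SkT_germ_of)
  from assms(2) obtain G where G: "Rep_tseries b = germ_of G" "\<forall>\<^sub>F x in at_top. 0 < G x" by (rule SkT_germ_of)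
  have le: "a + 1 \<le> b" by (rule discrete[OF assms])
  have a1: "Rep_tseries (a + 1) = germ_of (\<lambda>x. F x + 1)" by (simp add: plus_tseries.rep_eq one_tseries.rep_eq F(1) germ_of_one germ_of_simps)
  have i: "Rep_tseries idT = germ_of (\<lambda>x. x)" by (simp add: Rep_idT germ_id_germ_of)
  have pa: "Rep_tseries (powT idT a) = germ_of (\<lambda>x. x powr F x)" "Rep_tseries (powT idT b) = germ_of (\<lambda>x. x powr G x)"
    by (simp_all add: Rep_powT SkT_closed assms(1,2) i F(1) G(1) germ_powr.abs_eq)
  show ?thesis
  proof (rule tseries_leI[OF Rep_mult_germ_of[OF pa(1) i] pa(2)])
    show "\<forall>\<^sub>F x in at_top. x powr F x * x \<le> x powr G x"
      using tseries_leD[OF le a1 G(1)] eventually_ge_at_top[of 1]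
    proof eventually_elim
      case (elim x)
      have "x powr F x * x = x powr (F x + 1)" using elim(2) by (simp add: powr_add)
      also have "\<dots> \<le> x powr G x" using elim by (intro powr_mono) auto
      finally show ?case .
    qed
  qed
qed

lemma of_nat_less_idT: "of_nat n < idT"
  unfolding less_tseries.rep_eq Rep_of_nat Rep_idT germ_id_germ_of germ_of_less_iff by (rule eventually_gt_at_top)

text \<open>
  The Cantor normal form with \<open>x\<close> in place of \<open>\<omega>\<close>. The summand
  \<open>1\<close> is there because \<open>0\<close> is not a Skolem function.
\<close>
definition normal_form_sum :: "(germ \<Rightarrow> nat) \<Rightarrow> tseries" where
  "normal_form_sum f = 1 + (\<Sum>a | f a \<noteq> 0. of_nat (f a) * powT idT (Abs_tseries a))"

lemma of_nat_mult_SkT: "a \<in> SkT \<Longrightarrow> 0 < n \<Longrightarrow> of_nat n * a \<in> SkT"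
proof (induction n)
  case (Suc n)
  then show ?case by (cases "n = 0") (auto simp: distrib_right SkT_closed)
qed simp

lemma normal_form_sum_SkT:
  assumes "f \<in> finsupp Sk_order" shows "normal_form_sum f \<in> SkT"
proof -
  have "finite {a. f a \<noteq> 0}" "{a. f a \<noteq> 0} \<subseteq> Sk" using assms by (auto simp: finsupp_def Field_Sk_order)
  moreover have "1 + (\<Sum>a\<in>S. of_nat (f a) * powT idT (Abs_tseries a)) \<in> SkT"
    if "finite S" "S \<subseteq> {a. f a \<noteq> 0}" "S \<subseteq> Sk" for S
    using that
  proof (induction S rule: finite_induct)
    case (insert a S)
    have IH: "1 + (\<Sum>a\<in>S. of_nat (f a) * powT idT (Abs_tseries a)) \<in> SkT" using insert by auto
    have "of_nat (f a) * powT idT (Abs_tseries a) \<in> SkT"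
      by (intro of_nat_mult_SkT SkT_closed(5) SkT_closed(2) Abs_SkT) (use insert in auto)
    from SkT_closed(3)[OF IH this]
    have "1 + (\<Sum>a\<in>S. of_nat (f a) * powT idT (Abs_tseries a)) + of_nat (f a) * powT idT (Abs_tseries a) \<in> SkT" .
    then show ?case using insert.hyps by (simp add: add_ac)
  qed (simp add: SkT_closed)
  ultimately show ?thesis unfolding normal_form_sum_def by blast
qed

text \<open>
  As \<open>b < a\<close> implies \<open>x\<^sup>b * x \<le> x\<^sup>a\<close>, and natural numbers
  are below \<open>x\<close>, all terms below the largest difference together are less than
  \<open>x\<^sup>a\<close>.
\<close>
lemma normal_form_sum_strict_mono:
  assumes "(f, g) \<in> omega_exp Sk_order" "f \<noteq> g" shows "normal_form_sum f < normal_form_sum g"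
proof -
  from assms obtain a where fg: "f \<in> finsupp Sk_order" "g \<in> finsupp Sk_order" "a \<in> Sk" "f a < g a"
    and above: "\<And>b. (a, b) \<in> Sk_order \<Longrightarrow> b \<noteq> a \<Longrightarrow> f b = g b"
    by (auto simp: omega_exp_iff Field_Sk_order)
  define S where "S = {b. f b \<noteq> 0} \<union> {b. g b \<noteq> 0}"
  define p where "p b = powT idT (Abs_tseries b)" for b
  have S: "finite S" "S \<subseteq> Sk" "a \<in> S" using fg by (auto simp: finsupp_def Field_Sk_order S_def)
  have p: "0 < p b" if "b \<in> Sk" for b
    unfolding p_def by (intro SkT_pos SkT_closed Abs_SkT that)
  have full_sum: "normal_form_sum k = 1 + (\<Sum>b\<in>S. of_nat (k b) * p b)" if "{b. k b \<noteq> 0} \<subseteq> S" for k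
  proof -
    have "(\<Sum>b | k b \<noteq> 0. of_nat (k b) * p b) = (\<Sum>b\<in>S. of_nat (k b) * p b)"
      by (rule sum.mono_neutral_left[OF S(1) that]) auto
    then show ?thesis unfolding normal_form_sum_def p_def by (simp only:)
  qed
  define low where "low = {b \<in> S. b < a}"
  define high where "high = {b \<in> S. a < b}"
  have split: "(\<Sum>b\<in>S. of_nat (k b) * p b) = (\<Sum>b\<in>high. of_nat (k b) * p b) + of_nat (k a) * p a + (\<Sum>b\<in>low. of_nat (k b) * p b)" for k
  proof -
    have "S = (high \<union> {a}) \<union> low" using Sk_linear S(2,3) by (auto simp: low_def high_def)
    moreover have "(high \<union> {a}) \<inter> low = {}" "high \<inter> {a} = {}" by (auto simp: low_def high_def dest: less_asym)
    moreover have "finite high" "finite low" using S(1) by (auto simp: low_def high_def)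
    ultimately show ?thesis by (simp add: sum.union_disjoint add_ac)
  qed
  have low: "(\<Sum>b\<in>low. of_nat (f b) * p b) < p a"
  proof -
    have "(\<Sum>b\<in>low. of_nat (f b) * p b) * idT = (\<Sum>b\<in>low. of_nat (f b) * (p b * idT))"
      by (simp add: sum_distrib_right mult.assoc)
    also have "\<dots> \<le> (\<Sum>b\<in>low. of_nat (f b) * p a)"
    proof (rule sum_mono)
      fix b assume "b \<in> low"
      then have b: "b \<in> Sk" "b < a" using S(2) by (auto simp: low_def)
      have "p b * idT \<le> p a" unfolding p_def
        by (rule powT_gap) (use b fg(3) Abs_SkT in \<open>auto simp: less_tseries.rep_eq Rep_Abs_Sk\<close>)
      then show "of_nat (f b) * (p b * idT) \<le> of_nat (f b) * p a" by (rule mult_left_mono) simp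
    qed
    also have "\<dots> = of_nat (\<Sum>b\<in>low. f b) * p a" by (simp add: sum_distrib_right)
    also have "\<dots> < idT * p a" by (rule mult_strict_right_mono[OF of_nat_less_idT p[OF fg(3)]])
    finally show ?thesis using of_nat_less_idT[of 0] by (simp add: mult.commute[of idT])
  qed
  have "(\<Sum>b\<in>high. of_nat (f b) * p b) = (\<Sum>b\<in>high. of_nat (g b) * p b)"
    by (rule sum.cong) (use above S(2) fg(3) in \<open>auto simp: high_def Sk_order_iff order.order_iff_strict\<close>)
  moreover have "0 \<le> (\<Sum>b\<in>low. of_nat (g b) * p b)"
  proof (rule sum_nonneg)
    fix b assume "b \<in> low"
    then have "b \<in> Sk" using S(2) by (auto simp: low_def)
    then show "0 \<le> of_nat (g b) * p b" using p by (intro mult_nonneg_nonneg) (auto intro: less_imp_le)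
  qed
  moreover have "of_nat (f a) * p a + p a \<le> of_nat (g a) * p a"
  proof -
    have "of_nat (f a) + 1 \<le> (of_nat (g a) :: tseries)"
      using fg(4) by (metis Suc_leI add.commute of_nat_Suc of_nat_le_iff)
    from mult_right_mono[OF this less_imp_le[OF p[OF fg(3)]]] show ?thesis by (simp add: distrib_right)
  qed
  ultimately have "(\<Sum>b\<in>S. of_nat (f b) * p b) < (\<Sum>b\<in>S. of_nat (g b) * p b)"
    unfolding split using low by simp
  then show ?thesis using full_sum[of f] full_sum[of g] by (auto simp: S_def)
qed

lemma omega_exp_total:
  assumes r: "Well_order r" and f: "f \<in> finsupp r" and g: "g \<in> finsupp r"
  shows "(f, g) \<in> omega_exp r \<or> (g, f) \<in> omega_exp r"
proof (cases "f = g")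
  case True
  then show ?thesis using f by (simp add: omega_exp_iff)
next
  case False
  define D where "D = {a. f a \<noteq> g a}"
  have "D \<subseteq> {a. f a \<noteq> 0} \<union> {a. g a \<noteq> 0}" by (auto simp: D_def)
  then have D: "finite D" "D \<subseteq> Field r" "D \<noteq> {}"
    using f g False finite_subset[of D "{a. f a \<noteq> 0} \<union> {a. g a \<noteq> 0}"] by (auto simp: finsupp_def D_def)
  have lin: "Linear_order r" using r by (simp add: well_order_on_def)
  have "\<exists>m\<in>D. \<forall>b\<in>D. (b, m) \<in> r" using D(1,3,2)
  proof (induction D rule: finite_ne_induct)
    case (singleton a)
    then show ?case using lin by (auto simp: order_on_defs refl_on_def)
  next
    case (insert a D)
    then obtain m where m: "m \<in> D" "\<forall>b\<in>D. (b, m) \<in> r" by auto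
    have aa: "a \<in> Field r" "m \<in> Field r" using insert m by auto
    have am: "(a, a) \<in> r" "(a, m) \<in> r \<or> (m, a) \<in> r"
      using lin aa by (cases "a = m"; auto simp: order_on_defs refl_on_def total_on_def)+
    have tr: "trans r" using lin by (simp add: order_on_defs)
    from am(2) show ?case
    proof
      assume "(a, m) \<in> r"
      then show ?thesis using m by (intro bexI[of _ m]) auto
    next
      assume "(m, a) \<in> r"
      then have "(b, a) \<in> r" if "b \<in> D" for b using m(2) that transD[OF tr] by blast
      then show ?thesis using am(1) by (intro bexI[of _ a]) auto
    qed
  qed
  then obtain m where m: "m \<in> D" "\<And>b. b \<in> D \<Longrightarrow> (b, m) \<in> r" by blast
  have above: "f b = g b" if "(m, b) \<in> r" "b \<noteq> m" for b
  proof (rule ccontr)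
    assume "f b \<noteq> g b"
    then have "(b, m) \<in> r" using m(2) by (simp add: D_def)
    then show False using that lin by (auto simp: order_on_defs dest: antisymD)
  qed
  have mF: "m \<in> Field r" using m(1) D(2) by blast
  have "f m < g m \<or> g m < f m" using m(1) by (auto simp: D_def)
  then show ?thesis
  proof
    assume lt: "f m < g m"
    show ?thesis unfolding omega_exp_iff using f g above
      by (intro disjI1 conjI disjI2 bexI[OF _ mF] allI impI lt) auto
  next
    assume lt: "g m < f m"
    show ?thesis unfolding omega_exp_iff using f g above
      by (intro disjI2 conjI disjI2 bexI[OF _ mF] allI impI lt) auto
  qed
qed

lemma Well_order_omega_exp_Sk: "Well_order (omega_exp Sk_order)"
proof -
  obtain \<rho> :: "germ \<Rightarrow> ord" where \<rho>: "\<forall>f\<in>Sk. \<forall>g\<in>Sk. f < g \<longrightarrow> \<rho> f < \<rho> g" using Sk_rank by blast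
  have "well_order_on (finsupp Sk_order) (omega_exp Sk_order)"
  proof (rule well_order_on_via_rank[where \<rho> = "\<lambda>f. \<rho> (Rep_tseries (normal_form_sum f))"])
    show "(f, g) \<in> omega_exp Sk_order \<or> (g, f) \<in> omega_exp Sk_order"
      if "f \<in> finsupp Sk_order" "g \<in> finsupp Sk_order" for f g
      by (rule omega_exp_total[OF Well_order_Sk_order that])
    show "\<rho> (Rep_tseries (normal_form_sum f)) < \<rho> (Rep_tseries (normal_form_sum g))"
      if "(f, g) \<in> omega_exp Sk_order" "f \<noteq> g" for f g
    proof -
      have "f \<in> finsupp Sk_order" "g \<in> finsupp Sk_order" using that(1) by (auto simp: omega_exp_iff)
      then have "Rep_tseries (normal_form_sum f) \<in> Sk" "Rep_tseries (normal_form_sum g) \<in> Sk"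
        using normal_form_sum_SkT by (auto simp: SkT_def)
      then show ?thesis using \<rho> normal_form_sum_strict_mono[OF that] by (simp add: less_tseries.rep_eq)
    qed
  qed (auto simp: omega_exp_iff)
  then show ?thesis by (simp add: Field_omega_exp)
qed

lemma omega_exp_Sk_order: "omega_exp Sk_order =o Sk_order"
  unfolding ordIso_iff_ordLeq
proof
  show "omega_exp Sk_order \<le>o Sk_order"
  proof (rule ordLeq_if_strict_mono[OF Well_order_omega_exp_Sk Well_order_Sk_order,
        where f = "\<lambda>f. Rep_tseries (normal_form_sum f)"])
    have Sk: "Rep_tseries (normal_form_sum f) \<in> Sk" if "f \<in> finsupp Sk_order" for f
      using normal_form_sum_SkT[OF that] by (simp add: SkT_def)
    then show "Rep_tseries (normal_form_sum f) \<in> Field Sk_order" if "f \<in> Field (omega_exp Sk_order)" for f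
      using that by (simp add: Field_omega_exp Field_Sk_order)
    show "(Rep_tseries (normal_form_sum f), Rep_tseries (normal_form_sum g)) \<in> Sk_order \<and>
      Rep_tseries (normal_form_sum f) \<noteq> Rep_tseries (normal_form_sum g)"
      if "(f, g) \<in> omega_exp Sk_order" "f \<noteq> g" for f g
      using normal_form_sum_strict_mono[OF that] that(1) Sk
      by (auto simp: Sk_order_iff omega_exp_iff less_tseries.rep_eq)
  qed
  show "Sk_order \<le>o omega_exp Sk_order"
  proof (rule ordLeq_if_strict_mono[OF Well_order_Sk_order Well_order_omega_exp_Sk,
        where f = "\<lambda>a b. if b = a then 1 else 0"])
    have F: "(\<lambda>b. if b = a then 1 else 0) \<in> finsupp Sk_order" if "a \<in> Sk" for a
      using that by (auto simp: finsupp_def Field_Sk_order)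
    then show "(\<lambda>b. if b = a then 1 else 0) \<in> Field (omega_exp Sk_order)" if "a \<in> Field Sk_order" for a
      using that by (simp add: Field_omega_exp Field_Sk_order)
    show "((\<lambda>c. if c = a then 1 else 0), (\<lambda>c. if c = b then 1 else 0)) \<in> omega_exp Sk_order \<and>
      (\<lambda>c. if c = a then 1 else 0 :: nat) \<noteq> (\<lambda>c. if c = b then 1 else 0)"
      if ab: "(a, b) \<in> Sk_order" "a \<noteq> b" for a b
    proof
      have Sk: "a \<in> Sk" "b \<in> Sk" "a < b" using ab by (auto simp: Sk_order_iff)
      show "((\<lambda>c. if c = a then 1 else 0), (\<lambda>c. if c = b then 1 else 0)) \<in> omega_exp Sk_order"
        unfolding omega_exp_iff
      proof (intro conjI F Sk disjI2 bexI[of _ b] allI impI)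
        show "(if c = a then 1 else 0) = (if c = b then 1 else (0::nat))" if "(b, c) \<in> Sk_order \<and> c \<noteq> b" for c
          using that Sk by (auto simp: Sk_order_iff order.order_iff_strict dest: less_asym)
      qed (use Sk in \<open>auto simp: Field_Sk_order\<close>)
      show "(\<lambda>c. if c = a then 1 else 0 :: nat) \<noteq> (\<lambda>c. if c = b then 1 else 0)"
        using ab(2) by (auto simp: fun_eq_iff)
    qed
  qed
qed

text \<open>
  Given \<open>\<phi>\<close>, which interprets normal forms over an order as elements of this
  order, ordinals in normal form are interpreted recursively.
\<close>
primrec realize :: "(('a \<Rightarrow> nat) \<Rightarrow> 'a) \<Rightarrow> ord \<Rightarrow> 'a" where
  "realize \<phi> (Ord M) = \<phi> (count (image_mset (realize \<phi>) M))"

lemma count_image_mset_inj_on: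
  assumes "inj_on f A" "set_mset M \<subseteq> A" "y \<in> A"
  shows "count (image_mset f M) (f y) = count M y"
proof -
  have "f -` {f y} \<inter> set_mset M = {y} \<inter> set_mset M" using assms by (auto dest: inj_onD)
  then show ?thesis by (cases "y \<in># M") (simp_all add: count_image_mset not_in_iff)
qed

text \<open>
  Over a linear order, the multiset extension compares multiplicities at the largest difference, as
  \<open>omega_exp\<close> does.
\<close>
lemma less_multiset_greatest_difference:
  fixes M N :: "'a::linorder multiset"
  assumes "M < N"
  shows "\<exists>z. count M z < count N z \<and> (\<forall>y>z. count M y = count N y)"
proof -
  define D where "D = {y. count M y \<noteq> count N y}"
  have "D \<subseteq> set_mset M \<union> set_mset N" by (auto simp: D_def not_in_iff[symmetric]) (metis not_in_iff)+
  then have "finite D" by (rule finite_subset) simp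
  moreover have "D \<noteq> {}"
  proof
    assume "D = {}"
    then have "M = N" by (intro multiset_eqI) (auto simp: D_def)
    then show False using assms by simp
  qed
  ultimately have z: "Max D \<in> D" "\<And>y. y \<in> D \<Longrightarrow> y \<le> Max D" by auto
  have "\<not> count N (Max D) < count M (Max D)"
  proof
    assume "count N (Max D) < count M (Max D)"
    then obtain x where "Max D < x" "count M x < count N x" using assms by (auto simp: less_multiset\<^sub>H\<^sub>O)
    moreover from this have "x \<in> D" by (simp add: D_def)
    ultimately show False using z(2)[of x] by simp
  qed
  then have "count M (Max D) < count N (Max D)" using z(1) by (auto simp: D_def)
  moreover have "count M y = count N y" if "Max D < y" for y
  proof (rule ccontr)
    assume "count M y \<noteq> count N y"
    then have "y \<in> D" by (simp add: D_def)
    from z(2)[OF this] show False using that by simp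
  qed
  ultimately show ?thesis by blast
qed

text \<open>
  By induction on the size, \<open>realize \<phi>\<close> is strictly monotone, in particular
  injective, on the exponents of two normal forms. It therefore preserves their multiplicities and
  the largest exponent at which these differ.
\<close>
lemma realize_strict_mono:
  assumes s: "Well_order s" and bij: "bij_betw \<phi> (finsupp s) (Field s)"
    and mono: "\<And>f g. (f, g) \<in> omega_exp s \<Longrightarrow> (\<phi> f, \<phi> g) \<in> s"
  shows realize_Field: "realize \<phi> a \<in> Field s"
    and "a < b \<Longrightarrow> (realize \<phi> a, realize \<phi> b) \<in> s \<and> realize \<phi> a \<noteq> realize \<phi> b"
proof -
  let ?i = "realize \<phi>"
  have cF: "count (image_mset ?i M) \<in> finsupp s" if "\<And>x. x \<in># M \<Longrightarrow> ?i x \<in> Field s" for M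
  proof -
    have "{a. count (image_mset ?i M) a \<noteq> 0} = ?i ` set_mset M"
      unfolding count_eq_zero_iff not_not by simp
    then show ?thesis using that by (auto simp: finsupp_def)
  qed
  have Field: "?i a \<in> Field s" for a
  proof (induction a)
    case (Ord M)
    have "count (image_mset ?i M) \<in> finsupp s" by (rule cF) (rule Ord)
    from bij_betw_apply[OF bij this] show ?case by simp
  qed
  then show "?i a \<in> Field s" .
  have anti: "b = c" if "(b, c) \<in> s" "(c, b) \<in> s" for b c
    using s that by (auto simp: order_on_defs dest: antisymD)
  have "\<forall>a b. size a < n \<longrightarrow> size b < n \<longrightarrow> a < b \<longrightarrow> (?i a, ?i b) \<in> s \<and> ?i a \<noteq> ?i b" for n
  proof (induction n)
    case (Suc n)
    show ?case
    proof (intro allI impI)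
      fix a b :: ord assume ab: "size a < Suc n" "size b < Suc n" "a < b"
      define M N where "M = exponents a" and "N = exponents b"
      define A where "A = set_mset M \<union> set_mset N"
      have eq: "a = Ord M" "b = Ord N" by (simp_all add: M_def N_def)
      have "size x < n" if "x \<in> A" for x
        using exponents_mem_size[of x a] exponents_mem_size[of x b] ab that by (auto simp: A_def M_def N_def)
      then have IH: "(?i x, ?i y) \<in> s \<and> ?i x \<noteq> ?i y" if "x \<in> A" "y \<in> A" "x < y" for x y
        using Suc that by blast
      have inj: "inj_on ?i A" by (rule linorder_inj_onI') (use IH in auto)
      have "M < N" using ab(3) by (simp add: less_ord_iff M_def N_def)
      from less_multiset_greatest_difference[OF this] obtain z
        where z: "count M z < count N z" "\<And>y. z < y \<Longrightarrow> count M y = count N y" by blast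
      have "z \<in># N" using z(1) by (simp flip: count_greater_zero_iff)
      then have zA: "z \<in> A" by (simp add: A_def)
      define f g where "f = count (image_mset ?i M)" and "g = count (image_mset ?i N)"
      have fi: "f (?i y) = count M y" "g (?i y) = count N y" if "y \<in> A" for y
        unfolding f_def g_def
        by (rule count_image_mset_inj_on[OF inj _ that], simp add: A_def)+
      have lt: "f (?i z) < g (?i z)" using z(1) fi[OF zA] by simp
      have above: "f c = g c" if c: "(?i z, c) \<in> s" "c \<noteq> ?i z" for c
      proof (cases "c \<in> ?i ` A")
        case True
        then obtain y where y: "y \<in> A" "c = ?i y" by blast
        have "\<not> y < z" using IH[OF y(1) zA] anti c y(2) by blast
        then have "z < y" using c(2) y(2) by (cases "y = z") auto
        then show ?thesis using fi[OF y(1)] z(2) y(2) by simp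
      next
        case False
        then have "c \<notin># image_mset ?i M" "c \<notin># image_mset ?i N" by (auto simp: A_def)
        then show ?thesis unfolding f_def g_def by (simp only: not_in_iff)
      qed
      have fg: "f \<in> finsupp s" "g \<in> finsupp s" unfolding f_def g_def using cF Field by auto
      have "(f, g) \<in> omega_exp s" unfolding omega_exp_iff using fg above
        by (intro conjI disjI2 bexI[OF _ Field[of z]] lt) auto
      moreover have "f \<noteq> g" using lt by auto
      ultimately show "(?i a, ?i b) \<in> s \<and> ?i a \<noteq> ?i b"
        using mono fg bij_betw_imp_inj_on[OF bij] unfolding eq by (auto simp: f_def g_def dest: inj_onD)
    qed
  qed simp
  from this[of "Suc (max (size a) (size b))"]
  show "a < b \<Longrightarrow> (?i a, ?i b) \<in> s \<and> ?i a \<noteq> ?i b" by (simp add: less_Suc_eq_le)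
qed

lemma Sk_order_least:
  assumes "Well_order s" "omega_exp s =o s" shows "Sk_order \<le>o s"
proof -
  from assms(2) obtain \<phi> where "iso (omega_exp s) s \<phi>" unfolding ordIso_def by blast
  then have bij: "bij_betw \<phi> (finsupp s) (Field s)"
    and mono: "\<And>f g. (f, g) \<in> omega_exp s \<Longrightarrow> (\<phi> f, \<phi> g) \<in> s"
    unfolding iso_iff2 by (auto simp: Field_omega_exp omega_exp_iff)
  note realize = realize_strict_mono[OF assms(1) bij mono]
  obtain \<rho> :: "germ \<Rightarrow> ord" where \<rho>: "\<forall>f\<in>Sk. \<forall>g\<in>Sk. f < g \<longrightarrow> \<rho> f < \<rho> g" using Sk_rank by blast
  show ?thesis
  proof (rule ordLeq_if_strict_mono[OF Well_order_Sk_order assms(1), where f = "\<lambda>f. realize \<phi> (\<rho> f)"])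
    show "realize \<phi> (\<rho> f) \<in> Field s" for f by (rule realize(1))
    show "(realize \<phi> (\<rho> f), realize \<phi> (\<rho> g)) \<in> s \<and> realize \<phi> (\<rho> f) \<noteq> realize \<phi> (\<rho> g)"
      if "(f, g) \<in> Sk_order" "f \<noteq> g" for f g
      by (rule realize(2)) (use that \<rho> in \<open>auto simp: Sk_order_iff order.order_iff_strict\<close>)
  qed
qed

theorem corollary26p2:
  shows "is_epsilon_0 Sk_order"
  unfolding is_epsilon_0_def
  using Well_order_Sk_order omega_exp_Sk_order Sk_order_least by blast

end
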